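(* Let $\mathbb{K}$ be an algebraically closed field of characteristic zero. Let $X\subset\mathbb{P}^n$ be a non-degenerate rational curve of degree $d$ and arithmetic genus $2$, with homogeneous coordinate ring $R(L)=\bigoplus_{k\geq0}L^k$, where $L\subset\mathbb{K}[x,y]_d$ is a linear subspace, and let $(\alpha:\beta)\in\mathbb{P}^1$. Assume further that $L$ is defined over a number field $F\subset\mathbb{K}$ with $[F:\mathbb{Q}]=\ell$. Then $\mathfrak{v}_{(\alpha:\beta)}$ is Khovanskii-finite with respect to $R(L)$ if and only if there exists an integer $k$ with $$1\leq k\leq\max\left\{2(d-n-1),\ \left(\left(96d^3\ell\right)^2+2\right)^2\right\}$$ such that $(\beta x-\alpha y)^{dk}\in L^k$.
   Context: A curve is an integral one-dimensional closed subscheme of projective space; it is non-degenerate if it is contained in no proper linear subspace. $\mathbb{K}[x,y]_d$ is the space of degree $d$ binary forms. $L$ is defined over $F$ if it has a basis consisting of forms with coefficients in $F$. For a linear subspace $L\subset\mathbb{K}[x,y]_d$, $R(L)=\bigoplus_{k\geq0}L^k$, where $L^k$ is the span of all products $\ell_1\cdots\ell_k$ with $\ell_i\in L$; it is a graded $\mathbb{K}$-algebra with $L^k$ in degree $k$. A non-degenerate rational curve $X\subset\mathbb{P}^n$ of degree $d$ has homogeneous coordinate ring $R(L)$, where $L\subset\mathbb{K}[x,y]_d$ is the $(n+1)$-dimensional space of pullbacks of linear forms on $\mathbb{P}^n$ under the normalization $\mathbb{P}^1\to X$. For $Q=(\alpha:\beta)\in\mathbb{P}^1$, $\mathfrak{v}_Q$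 is the valuation on $R(L)$ with values in $\mathbb{Z}^2$ (ordered lexicographically) given by $\mathfrak{v}_Q(f)=(k,\mathrm{ord}_Q(f))$ for $0\neq f\in L^k$, where $\mathrm{ord}_Q(f)$ is the highest power of $\beta x-\alpha y$ dividing $f$, and $\mathfrak{v}_Q(f)=\min_{f_k\neq0}\mathfrak{v}_Q(f_k)$ for $f=\sum_k f_k$ with $f_k\in L^k$. A valuation $\mathfrak{v}$ on a finitely generated graded $\mathbb{K}$-domain $S$ is Khovanskii-finite with respect to $S$ if it is homogeneous (i.e. $\mathfrak{v}(f)=\min_{f_k\ne 0}\mathfrak{v}(f_k)$ over the homogeneous parts $f_k$ of $f$), has full rank (the group generated by its values has rank equal to the Krull dimension of $S$), and its value semigroup $\mathfrak{v}(S\setminus\{0\})$ is finitely generated. *)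

theory Defs
  imports
    "HOL-Algebra.Embedded_Algebras"
    "HOL-Algebra.Algebraic_Closure_Type"
    "HOL-Computational_Algebra.Computational_Algebra"
    "HOL-Library.Poly_Mapping"
    "HOL-Library.Product_Plus"
    "HOL-Library.Product_Lexorder"
    "HOL-Library.Extended_Nat"
begin

section \<open>Krull dimension\<close>

definition krull_dim :: "('r, 'm) ring_scheme \<Rightarrow> enat" where
  "krull_dim R = Sup {enat m | m. \<exists>P. (\<forall>i\<le>m. primeideal (P i) R) \<and> (\<forall>i<m. P i \<subset> P (Suc i))}"


section \<open>Closed subschemes of projective space\<close>

text \<open>Polynomials in \<open>x\<^sub>0, x\<^sub>1, \<dots>\<close>; a monomial is its exponent vector.
  The homogeneous coordinate ring of projective $n$-space consists of the polynomials
  that involve only the variables with index at most \<open>n\<close>.\<close>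

type_synonym 'a mpoly = "(nat \<Rightarrow>\<^sub>0 nat) \<Rightarrow>\<^sub>0 'a"

definition mvar :: "nat \<Rightarrow> 'a::comm_ring_1 mpoly" where
  "mvar i = Poly_Mapping.single (Poly_Mapping.single i 1) 1"

definition mscale :: "'a::comm_ring_1 \<Rightarrow> 'a mpoly \<Rightarrow> 'a mpoly" where
  "mscale c p = Poly_Mapping.single 0 c * p"

definition polys :: "nat \<Rightarrow> 'a::comm_ring_1 mpoly set" where
  "polys n = {p. \<forall>m\<in>Poly_Mapping.keys p. Poly_Mapping.keys m \<subseteq> {..n}}"

definition polys_ring :: "nat \<Rightarrow> 'a::comm_ring_1 mpoly ring" where
  "polys_ring n = ring_of_type_algebra \<lparr>carrier := polys n\<rparr>"

definition mon_deg :: "(nat \<Rightarrow>\<^sub>0 nat) \<Rightarrow> nat" where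
  "mon_deg m = (\<Sum>i\<in>Poly_Mapping.keys m. Poly_Mapping.lookup m i)"

definition hom_polys :: "nat \<Rightarrow> nat \<Rightarrow> 'a::comm_ring_1 mpoly set" where
  "hom_polys n t = {p \<in> polys n. \<forall>m\<in>Poly_Mapping.keys p. mon_deg m = t}"

definition hom_part :: "nat \<Rightarrow> 'a::comm_ring_1 mpoly \<Rightarrow> 'a mpoly" where
  "hom_part t p = (\<Sum>m | m \<in> Poly_Mapping.keys p \<and> mon_deg m = t. Poly_Mapping.single m (Poly_Mapping.lookup p m))"

text \<open>The integral closed subschemes of projective $n$-space correspond to the homogeneous prime
  ideals that do not contain the irrelevant ideal; such a subscheme is represented by its ideal.\<close>

definition integral_subscheme :: "nat \<Rightarrow> 'a::field mpoly set \<Rightarrow> bool" where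
  "integral_subscheme n I \<longleftrightarrow>
     primeideal I (polys_ring n) \<and>
     (\<forall>p\<in>I. \<forall>t. hom_part t p \<in> I) \<and>
     (\<exists>i\<le>n. mvar i \<notin> I)"

text \<open>The dimension of the underlying topological space: the irreducible closed subsets of $V(I)$
  are the sets $V(P)$ for the relevant homogeneous prime ideals \<open>P\<close> containing \<open>I\<close>.\<close>

definition scheme_dim :: "nat \<Rightarrow> 'a::field mpoly set \<Rightarrow> enat" where
  "scheme_dim n I = Sup {enat m | m. \<exists>P. (\<forall>i\<le>m. integral_subscheme n (P i) \<and> I \<subseteq> P i) \<and>
                                        (\<forall>i<m. P i \<subset> P (Suc i))}"

definition projective_curve :: "nat \<Rightarrow> 'a::field mpoly set \<Rightarrow> bool" where
  "projective_curve n I \<longleftrightarrow> integral_subscheme n I \<and> scheme_dim n I = 1"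

text \<open>Every proper linear subspace lies in a hyperplane.\<close>

definition nondegenerate :: "nat \<Rightarrow> 'a::field mpoly set \<Rightarrow> bool" where
  "nondegenerate n I \<longleftrightarrow> (\<forall>l \<in> hom_polys n 1. l \<in> I \<longrightarrow> l = 0)"

global_interpretation mp: vector_space "mscale :: 'a::field \<Rightarrow> 'a mpoly \<Rightarrow> 'a mpoly"
  by unfold_locales
     (simp_all add: mscale_def algebra_simps single_add mult_single flip: mult.assoc)

text \<open>The Hilbert function of the homogeneous coordinate ring \<open>polys n / I\<close>.\<close>

definition hilbert_function :: "nat \<Rightarrow> 'a::field mpoly set \<Rightarrow> nat \<Rightarrow> int" where
  "hilbert_function n I t =
     int (mp.dim (hom_polys n t :: 'a mpoly set)) - int (mp.dim (I \<inter> hom_polys n t))"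

definition is_hilbert_polynomial :: "nat \<Rightarrow> 'a::field mpoly set \<Rightarrow> rat poly \<Rightarrow> bool" where
  "is_hilbert_polynomial n I P \<longleftrightarrow>
     eventually (\<lambda>t. of_int (hilbert_function n I t) = poly P (of_nat t)) sequentially"

definition has_degree :: "nat \<Rightarrow> 'a::field mpoly set \<Rightarrow> nat \<Rightarrow> bool" where
  "has_degree n I d \<longleftrightarrow>
     (\<exists>P. is_hilbert_polynomial n I P \<and> P \<noteq> 0 \<and>
          of_nat d = fact (Polynomial.degree P) * Polynomial.lead_coeff P)"

definition has_arithmetic_genus :: "nat \<Rightarrow> 'a::field mpoly set \<Rightarrow> int \<Rightarrow> bool" where
  "has_arithmetic_genus n I g \<longleftrightarrow>
     (\<exists>P. is_hilbert_polynomial n I P \<and>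
          of_int g = (-1) ^ Polynomial.degree P * (poly P 0 - 1))"


section \<open>Binary forms and rational curves\<close>

text \<open>$K[x,y]$ is represented as $K[x][y]$: the inner polynomial variable is \<open>x\<close>, the outer
  one is \<open>y\<close>.\<close>

definition xvar :: "'a::comm_ring_1 poly poly" where "xvar = [:[:0, 1:]:]"
definition yvar :: "'a::comm_ring_1 poly poly" where "yvar = [:0, 1:]"

definition bscale :: "'a::comm_ring_1 \<Rightarrow> 'a poly poly \<Rightarrow> 'a poly poly" where
  "bscale c = Polynomial.smult [:c:]"

definition bcoeff :: "'a::zero poly poly \<Rightarrow> nat \<Rightarrow> nat \<Rightarrow> 'a" where
  "bcoeff f i j = Polynomial.coeff (Polynomial.coeff f j) i"

definition binary_forms :: "nat \<Rightarrow> 'a::comm_ring_1 poly poly set" where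
  "binary_forms e = {f. \<forall>i j. bcoeff f i j \<noteq> 0 \<longrightarrow> i + j = e}"

definition beval :: "'a::comm_ring_1 poly poly \<Rightarrow> 'a \<Rightarrow> 'a \<Rightarrow> 'a" where
  "beval f a b = poly (poly f [:b:]) a"

definition substitute :: "(nat \<Rightarrow> 'a::comm_ring_1 poly poly) \<Rightarrow> 'a mpoly \<Rightarrow> 'a poly poly" where
  "substitute f p = (\<Sum>m\<in>Poly_Mapping.keys p. bscale (Poly_Mapping.lookup p m) (\<Prod>i\<in>Poly_Mapping.keys m. f i ^ Poly_Mapping.lookup m i))"

text \<open>The morphism from the projective line to projective $n$-space given by the forms
  $f_0, \dots, f_n$ of the same degree is the normalization of the integral curve with ideal \<open>I\<close>
  if it is dominant onto the curve and birational. Dominance says that \<open>I\<close> is the kernel of the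
  pullback; birationality is witnessed by the rational inverse $(A : B)$. As a non-constant
  morphism from a complete curve it is then finite, and the projective line is normal.\<close>

definition normalization :: "nat \<Rightarrow> 'a::field mpoly set \<Rightarrow> (nat \<Rightarrow> 'a poly poly) \<Rightarrow> bool" where
  "normalization n I f \<longleftrightarrow>
     (\<exists>e. \<forall>i\<le>n. f i \<in> binary_forms e) \<and>
     (\<forall>a b. (a, b) \<noteq> (0, 0) \<longrightarrow> (\<exists>i\<le>n. beval (f i) a b \<noteq> 0)) \<and>
     I = {p \<in> polys n. substitute f p = 0} \<and>
     (\<exists>s. \<exists>A \<in> hom_polys n s. \<exists>B \<in> hom_polys n s.
        (substitute f A, substitute f B) \<noteq> (0, 0) \<and> substitute f A * yvar = substitute f B * xvar)"

definition pullback_linear_forms :: "nat \<Rightarrow> (nat \<Rightarrow> 'a::field poly poly) \<Rightarrow> 'a poly poly set" where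
  "pullback_linear_forms n f = substitute f ` hom_polys n 1"

global_interpretation bf: vector_space "bscale :: 'a::field \<Rightarrow> 'a poly poly \<Rightarrow> 'a poly poly"
proof
  fix a b :: 'a and p :: "'a poly poly"
  have "[:a + b:] = [:a:] + [:b:]" "[:a * b:] = [:a:] * [:b:]"
    by simp_all
  then show "bscale (a + b) p = bscale a p + bscale b p" "bscale a (bscale b p) = bscale (a * b) p"
    by (simp_all only: bscale_def smult_add_left smult_smult)
qed (simp_all add: bscale_def smult_add_right flip: one_pCons)

definition defined_over :: "'a::field set \<Rightarrow> 'a poly poly set \<Rightarrow> bool" where
  "defined_over F L \<longleftrightarrow>
     (\<exists>B. (\<forall>f\<in>B. \<forall>i j. bcoeff f i j \<in> F) \<and> bf.independent B \<and> bf.span B = L)"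

definition number_field_of_degree :: "'a::field_char_0 set \<Rightarrow> nat \<Rightarrow> bool" where
  "number_field_of_degree F l \<longleftrightarrow>
     subfield F (ring_of_type_algebra :: 'a ring) \<and>
     ring.dimension (ring_of_type_algebra :: 'a ring) l \<rat> F"


section \<open>The graded algebra of a space of binary forms\<close>

definition space_power :: "'a::field poly poly set \<Rightarrow> nat \<Rightarrow> 'a poly poly set" where
  "space_power L k = bf.span {prod_list ls | ls. length ls = k \<and> set ls \<subseteq> L}"

text \<open>The direct sum of the $L^k$ is realized inside $K[x,y][t]$, with $L^k$ embedded as $L^k t^k$:
  the coefficient of $t^k$ is the homogeneous part of degree \<open>k\<close>.\<close>

definition power_algebra :: "'a::field poly poly set \<Rightarrow> 'a poly poly poly set" where
  "power_algebra L = {f. \<forall>k. Polynomial.coeff f k \<in> space_power L k}"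

definition graded_part :: "nat \<Rightarrow> 'a::comm_ring_1 poly poly poly \<Rightarrow> 'a poly poly poly" where
  "graded_part k f = Polynomial.monom (Polynomial.coeff f k) k"

definition subalgebra :: "'a::comm_ring_1 poly poly poly set \<Rightarrow> bool" where
  "subalgebra S \<longleftrightarrow>
     (\<forall>c. [:[:[:c:]:]:] \<in> S) \<and> (\<forall>f\<in>S. \<forall>g\<in>S. f + g \<in> S \<and> f * g \<in> S)"

text \<open>Graded subalgebras of $K[x,y][t]$; they are domains.\<close>

definition fg_graded_domain :: "'a::field poly poly poly set \<Rightarrow> bool" where
  "fg_graded_domain S \<longleftrightarrow>
     subalgebra S \<and>
     (\<forall>f\<in>S. \<forall>k. graded_part k f \<in> S) \<and>
     (\<exists>G. finite G \<and> G \<subseteq> S \<and> (\<forall>T. subalgebra T \<and> G \<subseteq> T \<longrightarrow> S \<subseteq> T))"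


section \<open>Valuations with values in the lexicographically ordered group \<open>int \<times> int\<close>\<close>

text \<open>The value at 0 is irrelevant throughout.\<close>

definition valuation_on ::
    "'a::field poly poly poly set \<Rightarrow> ('a poly poly poly \<Rightarrow> int \<times> int) \<Rightarrow> bool" where
  "valuation_on S v \<longleftrightarrow>
     (\<forall>f\<in>S. \<forall>g\<in>S. f \<noteq> 0 \<longrightarrow> g \<noteq> 0 \<longrightarrow> v (f * g) = v f + v g) \<and>
     (\<forall>f\<in>S. \<forall>g\<in>S. f \<noteq> 0 \<longrightarrow> g \<noteq> 0 \<longrightarrow> f + g \<noteq> 0 \<longrightarrow> min (v f) (v g) \<le> v (f + g)) \<and>
     (\<forall>c. c \<noteq> 0 \<longrightarrow> v [:[:[:c:]:]:] = 0)"

definition homogeneous_valuation ::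
    "'a::field poly poly poly set \<Rightarrow> ('a poly poly poly \<Rightarrow> int \<times> int) \<Rightarrow> bool" where
  "homogeneous_valuation S v \<longleftrightarrow>
     (\<forall>f\<in>S. f \<noteq> 0 \<longrightarrow> v f = Min {v (graded_part k f) | k. Polynomial.coeff f k \<noteq> 0})"

definition zscale :: "int \<Rightarrow> int \<times> int \<Rightarrow> int \<times> int" where
  "zscale c p = (c * fst p, c * snd p)"

global_interpretation zm: Modules.module zscale
  by unfold_locales (simp_all add: zscale_def algebra_simps)

definition zrank :: "(int \<times> int) set \<Rightarrow> enat" where
  "zrank G = Sup {enat (card B) | B. finite B \<and> B \<subseteq> G \<and> zm.independent B}"

definition value_set ::
    "'a::field poly poly poly set \<Rightarrow> ('a poly poly poly \<Rightarrow> int \<times> int) \<Rightarrow> (int \<times> int) set" where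
  "value_set S v = v ` (S - {0})"

definition full_rank ::
    "'a::field poly poly poly set \<Rightarrow> ('a poly poly poly \<Rightarrow> int \<times> int) \<Rightarrow> bool" where
  "full_rank S v \<longleftrightarrow>
     zrank (zm.span (value_set S v)) = krull_dim (ring_of_type_algebra \<lparr>carrier := S\<rparr>)"

definition fg_semigroup :: "(int \<times> int) set \<Rightarrow> bool" where
  "fg_semigroup M \<longleftrightarrow>
     (\<exists>A. finite A \<and> M = {sum_list as | as. as \<noteq> [] \<and> set as \<subseteq> A})"

definition khovanskii_finite ::
    "'a::field poly poly poly set \<Rightarrow> ('a poly poly poly \<Rightarrow> int \<times> int) \<Rightarrow> bool" where
  "khovanskii_finite S v \<longleftrightarrow>
     fg_graded_domain S \<and> valuation_on S v \<and>
     homogeneous_valuation S v \<and> full_rank S v \<and> fg_semigroup (value_set S v)"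

definition point_form :: "'a::field \<Rightarrow> 'a \<Rightarrow> 'a poly poly" where
  "point_form \<alpha> \<beta> = bscale \<beta> xvar - bscale \<alpha> yvar"

text \<open>The library's \<open>multiplicity\<close> is not available here: it needs a choice of normalization on
  the coefficient field.\<close>

definition point_ord :: "'a::field \<Rightarrow> 'a \<Rightarrow> 'a poly poly \<Rightarrow> nat" where
  "point_ord \<alpha> \<beta> f = Max {m. point_form \<alpha> \<beta> ^ m dvd f}"

definition point_valuation :: "'a::field \<Rightarrow> 'a \<Rightarrow> 'a poly poly poly \<Rightarrow> int \<times> int" where
  "point_valuation \<alpha> \<beta> f =
     Min {(int k, int (point_ord \<alpha> \<beta> (Polynomial.coeff f k))) | k.
          Polynomial.coeff f k \<noteq> 0}"

end

theory Submission
 imports Defs "HOL-Number_Theory.Number_Theory"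
begin

text \<open>
 Let \<open>q\<close> be the linear form of the point. Both sides of the equivalence say that a power
 \<open>q ^ (d * k)\<close> with \<open>k \<ge> 1\<close> lies in \<open>L^k\<close>; the content is a bound on \<open>k\<close>.

 \<^bold>\<open>The valuation.\<close> The values \<open>(k, ord f)\<close> lie in the cone \<open>0 \<le> ord f \<le> d * k\<close>. The boundary ray of slope
 \<open>d\<close> carries a value exactly if a power \<open>q ^ (d * k)\<close> lies in \<open>L^k\<close>. The Hilbert polynomial
 \<open>d * t - 1\<close> shows that \<open>L^k\<close> has codimension two among all forms of degree \<open>d * k\<close> for large \<open>k\<close>, so values come
 arbitrarily close to the ray and the semigroup is finitely generated only if the ray is attained;
 the converse is Dickson's lemma (\<open>khovanskii_finite_iff\<close>).

 \<^bold>\<open>The singularities.\<close> In an affine chart let \<open>s\<close> be a general rational member of the linear system. The functions \<open>f / s ^ k\<close>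
 with \<open>f\<close> in \<open>L^k\<close> are, modulo a conductor, a subalgebra \<open>A\<close> of codimension two in the polynomial
 ring, the affine coordinate ring of the curve seen from its normalization, and for \<open>k \<ge> d ^ 2\<close> the form
 \<open>q ^ (d * k)\<close> lies in \<open>L^k\<close> exactly if the function \<open>u ^ k\<close> with \<open>u = q ^ d / s\<close> lies in \<open>A\<close> (\<open>member_vpow\<close>).
 Subalgebras of codimension two are classified by elementary means. Unless \<open>A\<close> separates points, it glues two points
 \<open>p1\<close> and \<open>p2\<close> and satisfies one further condition: a second gluing, or a condition on derivatives
 (\<open>node_subalgebra_cases\<close>). The points are roots of a quartic over \<open>F\<close>, the conductor
 (\<open>rational_conductor\<close>), and so lie in a field of degree at most \<open>24 * l\<close>.

 \<^bold>\<open>The bound.\<close> That \<open>u ^ k\<close> takes equal values at \<open>p1\<close> and \<open>p2\<close> says that \<open>u(p1) / u(p2)\<close> is a root of unity of order dividing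
 \<open>k\<close>. A derivative condition makes this root of unity an element of a field of bounded degree,
 which bounds its order. Two nodes give two roots of unity; up to \<open>d\<close>-th roots they are ratios of values of the
 linear form \<open>q\<close>, hence satisfy a bilinear relation with coefficients in a field of degree
 \<open>n = 24 * l * d ^ 2\<close>. Torsion points on such a curve have order at most
 \<open>256 * n ^ 4\<close> (\<open>torsion_order_absolute_bound\<close>), as one sees by comparing the relation with its conjugate under
 \<open>z \<mapsto> z ^ j\<close> for the least prime \<open>j\<close> that does not divide the order. As \<open>256 * n ^ 4 = (96 * d ^ 2 * l) ^ 4\<close>, this is
 within the stated bound.
\<close>

hide_const (open) Module.smult UnivPoly.monom
alias keys = Poly_Mapping.keys
alias lookup = Poly_Mapping.lookup

section \<open>Linear algebra\<close>

context vector_space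
begin

lemma family_dependent:
 assumes "finite I" "finite T" "card T < card I" "\<And>i. i \<in> I ==> v i \<in> span T"
 shows "\<exists>c. (\<exists>i\<in>I. c i ~= 0) \<and> (\<Sum>i\<in>I. scale (c i) (v i)) = 0"
proof (cases "inj_on v I")
 case True
 have "card (v ` I) = card I" using True by (rule card_image)
 then have "dependent (v ` I)"
  using independent_span_bound[OF assms(2), of "v ` I"] assms(3,4) by (metis image_subsetI not_less)
 then obtain u where u: "\<exists>x\<in>v ` I. u x ~= 0" "(\<Sum>x\<in>v ` I. scale (u x) x) = 0"
  using dependent_finite[of "v ` I"] assms(1) by blast
 have "(\<Sum>i\<in>I. scale (u (v i)) (v i)) = 0"
  using u(2) sum.reindex[OF True, of "\<lambda>x. scale (u x) x"] by simp
 then show ?thesis using u(1) by (intro exI[of _ "\<lambda>i. u (v i)"]) auto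
next
 case False
 then obtain i j where ij: "i \<in> I" "j \<in> I" "i ~= j" "v i = v j"
  by (auto simp: inj_on_def)
 define c where "c = (\<lambda>k. if k = i then 1 else if k = j then - 1 else (0::'a))"
 have "(\<Sum>k\<in>I. scale (c k) (v k)) = (\<Sum>k\<in>{i, j}. scale (c k) (v k))"
  using assms(1) ij by (intro sum.mono_neutral_right) (auto simp: c_def)
 also have "\<dots> = 0" using ij by (simp add: c_def)
 finally show ?thesis using ij by (intro exI[of _ c]) (auto simp: c_def)
qed

lemma exists_complement:
 assumes U: "subspace U" "subspace Y" "U \<subseteq> Y" and T: "finite T" "Y \<subseteq> span T"
 shows "\<exists>C. finite C \<and> C \<subseteq> Y \<and> card C + dim U = dim Y
  \<and> (\<forall>y\<in>Y. \<exists>c. y - (\<Sum>t\<in>C. scale (c t) t) \<in> U)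
  \<and> (\<forall>c. (\<Sum>t\<in>C. scale (c t) t) \<in> U --> (\<forall>t\<in>C. c t = 0))"
proof -
 obtain B where B: "B \<subseteq> U" "independent B" "U \<subseteq> span B" "card B = dim U"
  using basis_exists by blast
 obtain B' where B': "B \<subseteq> B'" "B' \<subseteq> Y" "independent B'" "Y \<subseteq> span B'"
  using maximal_independent_subset_extend[of B Y] B(1,2) U(3) by auto
 have finB': "finite B'"
  using independent_span_bound[OF T(1) B'(3)] B'(2) T(2) by blast
 then have finB: "finite B" using B'(1) finite_subset by blast
 have dimY: "dim Y = card B'"
  using B' dim_eq_card[of B' Y] span_minimal[OF B'(2) U(2)] span_superset span_mono
  by (metis span_subspace U(2) span_eq_dim dim_eq_card_independent)
 have spX: "span B = U" using B(1,3) U(1) by (metis span_subspace)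
 have spY: "span B' = Y" using B'(2,4) U(2) by (metis span_subspace)
 define C where "C = B' - B"
 have finC: "finite C" using finB' by (simp add: C_def)
 have BC: "B' = B \<union> C" "B \<inter> C = {}" using B'(1) by (auto simp: C_def)
 have 1: "card C + dim U = dim Y"
  using dimY B(4) BC finB finC by (simp add: card_Un_disjoint)
 have 2: "\<exists>c. y - (\<Sum>t\<in>C. scale (c t) t) \<in> U" if "y \<in> Y" for y
 proof -
  have "y \<in> span B'" using that spY by simp
  then obtain u where "y = (\<Sum>t\<in>B'. scale (u t) t)"
   using span_finite[OF finB'] by auto
  also have "\<dots> = (\<Sum>t\<in>B. scale (u t) t) + (\<Sum>t\<in>C. scale (u t) t)"
   using BC finB finC by (simp add: sum.union_disjoint)
  finally have "y - (\<Sum>t\<in>C. scale (u t) t) = (\<Sum>t\<in>B. scale (u t) t)" by simp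
  also have "\<dots> \<in> U" using B(1) U(1) by (intro subspace_sum subspace_scale) auto
  finally show ?thesis by blast
 qed
 have 3: "\<forall>t\<in>C. c t = 0" if "(\<Sum>t\<in>C. scale (c t) t) \<in> U" for c
 proof -
  have "(\<Sum>t\<in>C. scale (c t) t) \<in> span B" using that spX by simp
  then obtain u where u: "(\<Sum>t\<in>C. scale (c t) t) = (\<Sum>t\<in>B. scale (u t) t)"
   using span_finite[OF finB] by auto
  define w where "w = (\<lambda>t. if t \<in> C then c t else - u t)"
  have "(\<Sum>t\<in>B'. scale (w t) t) = (\<Sum>t\<in>B. scale (w t) t) + (\<Sum>t\<in>C. scale (w t) t)"
   using BC finB finC by (simp add: sum.union_disjoint)
  also have "(\<Sum>t\<in>B. scale (w t) t) = - (\<Sum>t\<in>B. scale (u t) t)"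
   using BC(2) by (subst sum_negf[symmetric], intro sum.cong) (auto simp: w_def)
  also have "(\<Sum>t\<in>C. scale (w t) t) = (\<Sum>t\<in>C. scale (c t) t)"
   by (intro sum.cong) (auto simp: w_def)
  finally have "(\<Sum>t\<in>B'. scale (w t) t) = 0" using u by simp
  then have "\<forall>t\<in>B'. w t = 0"
   using B'(3) finB' dependent_finite by blast
  then show ?thesis using BC by (force simp: w_def)
 qed
 show ?thesis
  using finC 1 2 3 B'(2) by (intro exI[of _ C]) (auto simp: C_def)
qed

lemma dim_le_of_complement:
 assumes "subspace U" "finite T" "U \<subseteq> span T" "finite C"
  and cov: "\<And>y. y \<in> Y ==> \<exists>c. y - (\<Sum>t\<in>C. scale (c t) t) \<in> U"
 shows "dim Y \<le> dim U + card C"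
proof -
 obtain B where B: "B \<subseteq> U" "independent B" "U \<subseteq> span B" "card B = dim U"
  using basis_exists by blast
 have finB: "finite B"
  using independent_span_bound[OF assms(2) B(2)] B(1) assms(3) by blast
 have "Y \<subseteq> span (B \<union> C)"
 proof
  fix y assume "y \<in> Y"
  then obtain c where "y - (\<Sum>t\<in>C. scale (c t) t) \<in> U" using cov by blast
  then have 1: "y - (\<Sum>t\<in>C. scale (c t) t) \<in> span (B \<union> C)"
   using B(3) span_mono[of B "B \<union> C"] by blast
  have "(\<Sum>t\<in>C. scale (c t) t) \<in> span (B \<union> C)"
   by (intro span_sum span_scale span_base) auto
  from span_add[OF 1 this] show "y \<in> span (B \<union> C)" by simp
 qed
 then have "dim Y \<le> card (B \<union> C)" using finB assms(4) by (intro dim_le_card) auto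
 also have "\<dots> \<le> dim U + card C" using card_Un_le[of B C] B(4) by simp
 finally show ?thesis .
qed

end

global_interpretation pv: vector_space "smult :: 'a::field => 'a poly => 'a poly"
 by unfold_locales (simp_all add: smult_add_right smult_add_left)

global_interpretation qv: vector_space "\<lambda>(r::rat) (x::'a::field_char_0). of_rat r * x"
 by unfold_locales (simp_all add: algebra_simps of_rat_add of_rat_mult)

text \<open>A homogeneous linear system with more unknowns than equations.\<close>

lemma underdetermined_system:
 fixes A :: "'j => 'i => 'a::field"
 assumes "finite I" "finite J" "card J < card I"
 shows "\<exists>c. (\<exists>i\<in>I. c i ~= 0) \<and> (\<forall>j\<in>J. (\<Sum>i\<in>I. c i * A j i) = 0)"
proof -
 obtain g where g: "bij_betw g {0..<card J} J"
  using ex_bij_betw_nat_finite[OF assms(2)] by blast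
 define v where "v = (\<lambda>i. \<Sum>j<card J. monom (A (g j) i) j)"
 have v: "v i \<in> pv.span (monom 1 ` {..<card J})" for i
 proof -
  have "v i = (\<Sum>j<card J. smult (A (g j) i) (monom 1 j))"
   by (simp add: v_def smult_monom)
  also have "\<dots> \<in> pv.span (monom 1 ` {..<card J})"
   by (intro pv.span_sum pv.span_scale pv.span_base) auto
  finally show ?thesis .
 qed
 have "card (monom (1::'a) ` {..<card J}) < card I"
  using card_image_le[of "{..<card J}" "monom (1::'a)"] assms(3) by simp
 then
 obtain c where c: "\<exists>i\<in>I. c i ~= 0" "(\<Sum>i\<in>I. smult (c i) (v i)) = 0"
  using pv.family_dependent[OF assms(1), where T = "monom 1 ` {..<card J}" and v = v] v
  by (meson finite_imageI finite_lessThan)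
 have "(\<Sum>i\<in>I. c i * A j i) = 0" if "j \<in> J" for j
 proof -
  have "j \<in> g ` {0..<card J}" using g that by (simp add: bij_betw_def)
  then obtain k where k: "k < card J" "g k = j" by auto
  have "coeff (v i) k = A j i" for i
   using k by (simp add: v_def coeff_sum)
  then have "coeff (\<Sum>i\<in>I. smult (c i) (v i)) k = (\<Sum>i\<in>I. c i * A j i)"
   by (simp add: coeff_sum)
  then show ?thesis using c(2) by simp
 qed
 then show ?thesis using c(1) by blast
qed

context vector_space_pair
begin

lemma dim_injective_image:
 assumes f: "Vector_Spaces.linear s1 s2 f" and S: "vs1.subspace S" and inj: "inj_on f S"
 shows "vs2.dim (f ` S) = vs1.dim S"
proof -
 obtain B where B: "B \<subseteq> S" "vs1.independent B" "S \<subseteq> vs1.span B" "card B = vs1.dim S"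
  by (rule vs1.basis_exists)
 have sp: "vs1.span B = S" using vs1.span_minimal[OF B(1) S] B(3) by blast
 have "vs2.independent (f ` B)" by (rule linear_independent_injective_image[OF f B(2)]) (simp add: sp inj)
 moreover have "vs2.span (f ` B) = f ` S" using linear_span_image[OF f, of B] sp by simp
 moreover have "card (f ` B) = card B" by (rule card_image[OF inj_on_subset[OF inj B(1)]])
 ultimately show ?thesis using B(1,4) by (intro vs2.dim_unique[of "f ` B"]) auto
qed

lemma rank_nullity:
 assumes f: "Vector_Spaces.linear s1 s2 f" and Y: "vs1.subspace Y" and T: "finite T" "Y \<subseteq> vs1.span T"
 shows "vs2.dim (f ` Y) + vs1.dim {y \<in> Y. f y = 0} = vs1.dim Y"
proof -
 interpret f: Vector_Spaces.linear s1 s2 f by fact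
 define U where "U = {y \<in> Y. f y = 0}"
 have U: "vs1.subspace U" unfolding U_def
  by (rule vs1.subspaceI) (auto simp: f.add f.scale vs1.subspace_0[OF Y] vs1.subspace_add[OF Y] vs1.subspace_scale[OF Y])
 have "U \<subseteq> Y" by (auto simp: U_def)
 from vs1.exists_complement[OF U Y this T]
 obtain C where C: "finite C" "C \<subseteq> Y" "card C + vs1.dim U = vs1.dim Y"
  and cov: "\<forall>y\<in>Y. \<exists>c. y - (\<Sum>t\<in>C. s1 (c t) t) \<in> U"
  and ind: "\<forall>c. (\<Sum>t\<in>C. s1 (c t) t) \<in> U --> (\<forall>t\<in>C. c t = 0)" by blast
 have "vs1.independent C"
  using ind vs1.subspace_0[OF U] unfolding vs1.dependent_finite[OF C(1)] by metis
 have sub: "vs1.span C \<subseteq> Y" by (rule vs1.span_minimal[OF C(2) Y])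
 have inj: "inj_on f (vs1.span C)"
 proof (rule f.inj_on_iff_eq_0[THEN iffD2, OF vs1.subspace_span], intro ballI impI)
  fix x assume x: "x \<in> vs1.span C" "f x = 0"
  then obtain c where c: "x = (\<Sum>t\<in>C. s1 (c t) t)" unfolding vs1.span_finite[OF C(1)] by blast
  have "x \<in> U" using x sub by (auto simp: U_def)
  then have "\<forall>t\<in>C. c t = 0" using ind c by blast
  then show "x = 0" unfolding c by (simp add: sum.neutral)
 qed
 have "f ` Y = f ` vs1.span C"
 proof
  show "f ` vs1.span C \<subseteq> f ` Y" using sub by blast
  show "f ` Y \<subseteq> f ` vs1.span C"
  proof
   fix z assume "z \<in> f ` Y"
   then obtain y where y: "y \<in> Y" "z = f y" by blast
   obtain c where "y - (\<Sum>t\<in>C. s1 (c t) t) \<in> U" using cov y(1) by blast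
   then have "f y = f (\<Sum>t\<in>C. s1 (c t) t)" by (simp add: U_def f.diff)
   moreover have "(\<Sum>t\<in>C. s1 (c t) t) \<in> vs1.span C"
    by (intro vs1.span_sum vs1.span_scale vs1.span_base)
   ultimately show "z \<in> f ` vs1.span C" unfolding y(2) by blast
  qed
 qed
 then have "vs2.dim (f ` Y) = vs1.dim (vs1.span C)" using dim_injective_image[OF f vs1.subspace_span inj] by simp
 also have "\<dots> = card C" using vs1.dim_eq_card_independent[OF \<open>vs1.independent C\<close>] by simp
 finally show ?thesis using C(3) unfolding U_def by simp
qed

end

section \<open>Conjugates of roots of unity\<close>

definition ieval :: "int poly => 'a::field_char_0 => 'a" where
 "ieval P x = poly (map_poly of_int P) x"

lemma ieval_pCons [simp]: "ieval (pCons a P) x = of_int a + x * ieval P x"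
 by (simp add: ieval_def map_poly_pCons)

lemma ieval_0 [simp]: "ieval 0 x = 0" by (simp add: ieval_def)

lemma ieval_1 [simp]: "ieval 1 x = 1" by (simp add: ieval_def)

lemma ieval_add [simp]: "ieval (P + Q) x = ieval P x + ieval Q x"
proof -
 have "map_poly of_int (P + Q) = map_poly of_int P + (map_poly of_int Q :: 'a poly)"
  by (intro poly_eqI) (simp add: coeff_map_poly)
 then show ?thesis by (simp add: ieval_def)
qed

lemma ieval_smult [simp]: "ieval (smult c P) x = of_int c * ieval P x"
 by (induction P) (auto simp: algebra_simps)

lemma ieval_minus [simp]: "ieval (- P) x = - ieval P x"
 using ieval_smult[of "-1" P x] by simp

lemma ieval_diff [simp]: "ieval (P - Q) x = ieval P x - ieval Q x"
 using ieval_add[of P "- Q" x] by simp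

lemma ieval_mult [simp]: "ieval (P * Q) x = ieval P x * ieval Q x"
 by (induction P) (auto simp: algebra_simps)

lemma ieval_power [simp]: "ieval (P ^ n) x = ieval P x ^ n"
 by (induction n) auto

lemma ieval_monom [simp]: "ieval (monom c n) x = of_int c * x ^ n"
 by (simp add: ieval_def map_poly_monom poly_monom)

lemma ieval_pcompose [simp]: "ieval (pcompose P Q) x = ieval P (ieval Q x)"
 by (induction P) (auto simp: pcompose_pCons)

lemma map_poly_of_int_eq_0 [simp]: "map_poly (of_int :: int => 'a::field_char_0) P = 0 \<longleftrightarrow> P = 0"
 by (subst map_poly_eq_0_iff) auto

lemma exists_minimal_int_poly:
 fixes x :: "'a::field_char_0"
 assumes "P0 ~= 0" "ieval P0 x = 0"
 obtains M where "M ~= 0" "ieval M x = 0" "\<And>P. ieval P x = 0 ==> M dvd P"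
  "\<And>P. ieval P x = 0 ==> P ~= 0 ==> degree M \<le> degree P"
proof -
 define S where "S = {P. P ~= 0 \<and> ieval P x = 0}"
 obtain M0 where M0: "M0 \<in> S" "\<And>P. P \<in> S ==> degree M0 \<le> degree P"
  using assms ex_has_least_nat[of "\<lambda>P. P \<in> S" P0 degree] by (auto simp: S_def)
 obtain M where M: "M0 = smult (content M0) M" "content M = 1"
  using content_decompose by blast
 have "content M0 ~= 0" using M0(1) by (simp add: S_def)
 moreover have "of_int (content M0) * ieval M x = 0"
  using M0(1) M(1) unfolding S_def by (metis (mono_tags, lifting) ieval_smult mem_Collect_eq)
 ultimately have Mx: "ieval M x = 0" by simp
 have Mne: "M ~= 0" using M(2) by auto
 have deg: "degree M = degree M0" using M(1) \<open>content M0 ~= 0\<close> by (metis degree_smult_eq)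
 have "M dvd P" if "ieval P x = 0" for P
 proof -
  obtain a Q where aQ: "a ~= 0" "smult a P = M * Q + pseudo_mod P M"
   using pseudo_mod(1)[OF Mne] by blast
  have "ieval (smult a P) x = ieval (M * Q + pseudo_mod P M) x"
   using aQ(2) by simp
  then have "ieval (pseudo_mod P M) x = 0" using that Mx by simp
  then have "pseudo_mod P M = 0"
   using pseudo_mod(2)[OF Mne, of P] M0(2)[of "pseudo_mod P M"] deg unfolding S_def by force
  then have "M dvd smult a P" using aQ(2) by simp
  then have "fract_poly M dvd smult (to_fract a) (fract_poly P)"
   using fract_poly_dvd[of M "smult a P"] by simp
  then have "fract_poly M dvd fract_poly P" using aQ(1) by (simp add: dvd_smult_iff)
  then show ?thesis using M(2) by (rule fract_poly_dvdD)
 qed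
 then show ?thesis using that Mne Mx M0(2) deg by (auto simp: S_def)
qed

lemma prime_dvd_power_minus_self:
 fixes a :: int
 assumes "prime p"
 shows "int p dvd a ^ p - a"
proof -
 define b where "b = nat (a mod int p)"
 have p0: "p > 0" using assms prime_gt_0_nat by blast
 have ab: "[a = int b] (mod int p)" using p0 by (simp add: b_def cong_def)
 have "[b ^ p = b] (mod p)"
 proof (cases "p dvd b")
  case True
  then have "p dvd b ^ p" using p0 by (simp add: dvd_power_le dvd_trans)
  with True show ?thesis by (metis cong_0_iff cong_sym cong_trans)
 next
  case False
  then have "[b * b ^ (p - 1) = b * 1] (mod p)"
   using fermat_theorem[OF assms False] cong_scalar_left by blast
  then show ?thesis using p0 by (metis Suc_pred' mult.right_neutral power_Suc)
 qed
 then have "[int b ^ p = int b] (mod int p)" by (metis cong_int_iff of_nat_power)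
 then have "[a ^ p = a] (mod int p)"
  using ab by (meson cong_pow cong_sym cong_trans)
 then show ?thesis by (simp add: cong_iff_dvd_diff)
qed

lemma frobenius_add:
 fixes A B :: "'a::comm_ring_1"
 assumes "prime p"
 shows "\<exists>T. (A + B) ^ p = A ^ p + B ^ p + of_nat p * T"
proof -
 have p0: "p > 0" using assms prime_gt_0_nat by blast
 have "\<exists>t. \<forall>k\<in>{1..<p}. of_nat (p choose k) * A ^ k * B ^ (p - k) = of_nat p * t k"
 proof (intro bchoice ballI)
  fix k assume "k \<in> {1..<p}"
  then have "p dvd (p choose k)" using assms by (intro dvd_choose_prime) auto
  then obtain c where "p choose k = p * c" by blast
  then show "\<exists>t. of_nat (p choose k) * A ^ k * B ^ (p - k) = of_nat p * t"
   by (intro exI[of _ "of_nat c * A ^ k * B ^ (p - k)"]) (simp add: algebra_simps)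
 qed
 then obtain t where t: "\<And>k. k \<in> {1..<p} ==> of_nat (p choose k) * A ^ k * B ^ (p - k) = of_nat p * t k"
  by blast
 have sp: "{..p} = insert 0 (insert p {1..<p})" using p0 by auto
 have "(A + B) ^ p = (\<Sum>k\<le>p. of_nat (p choose k) * A ^ k * B ^ (p - k))"
  by (rule binomial_ring)
 also have "\<dots> = B ^ p + (A ^ p + (\<Sum>k\<in>{1..<p}. of_nat (p choose k) * A ^ k * B ^ (p - k)))"
  unfolding sp using p0 by simp
 also have "(\<Sum>k\<in>{1..<p}. of_nat (p choose k) * A ^ k * B ^ (p - k)) = of_nat p * sum t {1..<p}"
  using t by (simp add: sum_distrib_left)
 finally show ?thesis by (intro exI[of _ "sum t {1..<p}"]) (simp add: algebra_simps)
qed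

text \<open>The Frobenius congruence \<open>P(X) ^ p = P(X ^ p)\<close> modulo \<open>p\<close>, the only
 arithmetic input to the irreducibility of cyclotomic polynomials below.\<close>

lemma frobenius_int_poly:
 fixes P :: "int poly"
 assumes "prime p"
 shows "\<exists>T. P ^ p = pcompose P (monom 1 p) + smult (int p) T"
proof (induction P)
 case 0
 have "p ~= 0" using assms by auto
 then show ?case by (intro exI[of _ 0]) (simp add: power_0_left)
next
 case (pCons a P)
 then obtain T where T: "P ^ p = pcompose P (monom 1 p) + smult (int p) T" by blast
 obtain b where b: "a ^ p - a = int p * b" using prime_dvd_power_minus_self[OF assms, of a] by blast
 define m where "m = monom (1::int) 1"
 have aP: "pCons a P = [:a:] + m * P" by (simp add: m_def monom_altdef)
 obtain T' where T': "([:a:] + m * P) ^ p = [:a:] ^ p + (m * P) ^ p + of_nat p * T'"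
  using frobenius_add[OF assms] by blast
 have 1: "[:a:] ^ p = [:a:] + smult (int p) [:b:]"
  using b by (simp add: poly_const_pow algebra_simps)
 have 2: "(m * P) ^ p = monom 1 p * (pcompose P (monom 1 p) + smult (int p) T)"
  using T by (simp add: power_mult_distrib m_def monom_power)
 have 3: "of_nat p * T' = smult (int p) T'" by (simp add: of_nat_poly)
 have "pCons a P ^ p = pcompose (pCons a P) (monom 1 p)
   + smult (int p) ([:b:] + monom 1 p * T + T')"
  unfolding aP T' 1 2 3 by (simp add: m_def pcompose_pCons monom_altdef algebra_simps smult_add_right)
 then show ?case by blast
qed

text \<open>Irreducibility of cyclotomic polynomials, by reduction modulo \<open>p\<close>: there \<open>P(z ^
 p)\<close> is \<open>P(z) ^ p\<close>, and \<open>X ^ N - 1\<close> stays separable.\<close>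

lemma root_of_unity_frobenius:
 fixes z :: "'a::field_char_0"
 assumes "z ^ N = 1" "N > 0" "prime p" "\<not> p dvd N" "ieval P z = 0"
 shows "ieval P (z ^ p) = 0"
proof -
 define C where "C = monom 1 N - (1 :: int poly)"
 have C0: "coeff C 0 = - 1" using assms(2) by (simp add: C_def)
 then have Cne: "C ~= 0" by auto
 have Cz: "ieval C z = 0" using assms(1) by (simp add: C_def)
 obtain M where M: "M ~= 0" "ieval M z = 0" "\<And>P. ieval P z = 0 ==> M dvd P"
  "\<And>P. ieval P z = 0 ==> P ~= 0 ==> degree M \<le> degree P"
  using exists_minimal_int_poly[OF Cne Cz] by blast
 have "M dvd C" using M(3) Cz by blast
 then obtain H where H: "C = M * H" by blast
 have "degree C \<le> N" unfolding C_def
  by (intro degree_diff_le) (auto simp: degree_monom_le)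
 moreover have CN: "coeff C N = 1" using assms(2) by (simp add: C_def)
 then have "N \<le> degree C" by (intro le_degree) auto
 ultimately have "degree C = N" by simp
 then have "lead_coeff C = 1" using CN by simp
 then have "lead_coeff M * lead_coeff H = 1" using H by (simp add: lead_coeff_mult)
 then have lM: "\<bar>lead_coeff M\<bar> = 1" by (metis abs_zmult_eq_1 abs_one abs_mult)
 have degM: "degree M > 0"
 proof (rule ccontr)
  assume "\<not> degree M > 0"
  then obtain c where "M = [:c:]" by (metis degree_eq_zeroE gr0I)
  then show False using M(1,2) by simp
 qed
 have zne: "z ~= 0" using assms(1,2) by (auto simp: power_0_left)
 have "ieval M (z ^ p) = 0"
 proof (rule ccontr)
  assume nz: "ieval M (z ^ p) ~= 0"
  have "ieval C (z ^ p) = 0"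
   using assms(1) by (simp add: C_def power_mult[symmetric] mult.commute[of p]) (simp add: power_mult)
  then have "ieval H (z ^ p) = 0" using H nz by simp
  obtain T where T: "H ^ p = pcompose H (monom 1 p) + smult (int p) T"
   using frobenius_int_poly[OF assms(3)] by blast
  have "ieval (H ^ p) z = ieval (pcompose H (monom 1 p) + smult (int p) T) z"
   using T by simp
  then have Hp: "ieval H z ^ p = of_nat p * ieval T z"
   using \<open>ieval H (z ^ p) = 0\<close> by simp
  have "pderiv C = pderiv M * H + M * pderiv H" by (simp add: H pderiv_mult algebra_simps)
  then have "ieval (pderiv C) z = ieval (pderiv M) z * ieval H z" using M(2) by simp
  moreover have "pderiv C = monom (int N) (N - 1)"
   by (simp add: C_def pderiv_diff pderiv_monom)
  ultimately have "of_nat N * z ^ (N - 1) = ieval (pderiv M) z * ieval H z" by simp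
  then have "of_nat N * z ^ (N - 1) * z = ieval (pderiv M) z * ieval H z * z" by simp
  moreover have "z ^ (N - 1) * z = 1" using assms(1,2) by (metis Suc_pred' power_Suc2)
  ultimately have N: "of_nat N = ieval (pderiv M) z * ieval H z * z"
   by (metis mult.assoc mult.right_neutral)
  define W where "W = pderiv M ^ p * T * monom 1 p"
  have "of_nat N ^ p = of_nat p * ieval W z"
   unfolding N by (simp add: power_mult_distrib Hp W_def)
  then have Weq: "of_int (int N ^ p) = of_int (int p) * ieval W z" by simp
  define k where "k = Suc (degree W) - degree M"
  define c where "c = lead_coeff M ^ k"
  obtain Q R where QR: "pseudo_divmod W M = (Q, R)" by fastforce
  have R1: "smult c W = M * Q + R"
   using pseudo_divmod(1)[OF M(1) QR] by (simp add: c_def k_def)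
  have R2: "R = 0 \<or> degree R < degree M" using pseudo_divmod(2)[OF M(1) QR] .
  have cabs: "\<bar>c\<bar> = 1" using lM by (simp add: c_def power_abs)
  have "of_int c * ieval W z = ieval R z"
   using arg_cong[OF R1, of "\<lambda>p. ieval p z"] M(2) by simp
  define D where "D = [:c * int N ^ p:] - smult (int p) R"
  have "ieval D z = of_int c * of_int (int N ^ p) - of_int (int p) * ieval R z"
   by (simp add: D_def)
  also have "\<dots> = 0" unfolding Weq \<open>of_int c * ieval W z = ieval R z\<close>[symmetric] by (simp add: algebra_simps)
  finally have "ieval D z = 0" .
  moreover have "degree D < degree M"
   unfolding D_def using R2 degM degree_smult_le[of "int p" R]
   by (intro degree_diff_less) auto
  ultimately have "D = 0" using M(4) by (meson not_le)
  then have "coeff D 0 = 0" by simp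
  then have "c * int N ^ p = int p * coeff R 0" by (simp add: D_def)
  then have "int p dvd c * int N ^ p" by simp
  then have "int p dvd int N ^ p"
   using cabs by (metis abs_mult abs_of_nat dvd_abs_iff mult_1 of_nat_power)
  then have "p dvd N ^ p" by (metis of_nat_dvd_iff of_nat_power)
  then show False using assms(3,4) prime_dvd_power by blast
 qed
 then have "M dvd P ==> ieval P (z ^ p) = 0" by auto
 then show ?thesis using M(3) assms(5) by blast
qed

lemma root_of_unity_conjugate:
 fixes z :: "'a::field_char_0"
 assumes "z ^ N = 1" "N > 0" "coprime h N" "ieval P z = 0"
 shows "ieval P (z ^ h) = 0"
 using assms
proof (induction h arbitrary: z rule: less_induct)
 case (less h)
 show ?case
 proof (cases "h \<le> 1")
  case True
  then consider "h = 0" | "h = 1" by linarith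
  then show ?thesis
  proof cases
   case 1
   then have "N = 1" using less.prems(3) by simp
   then show ?thesis using less.prems 1 by simp
  next
   case 2
   then show ?thesis using less.prems by simp
  qed
 next
  case False
  then obtain p where p: "prime p" "p dvd h" using prime_factor_nat[of h] by auto
  then obtain h' where h': "h = p * h'" by blast
  have "p > 1" using p(1) prime_gt_1_nat by blast
  then have lt: "h' < h" using h' False by (cases "h' = 0") auto
  have pN: "\<not> p dvd N" using less.prems(3) p
   by (metis coprime_common_divisor not_prime_unit)
  have "ieval P (z ^ p) = 0" using root_of_unity_frobenius[OF less.prems(1,2) p(1) pN less.prems(4)] .
  moreover have "(z ^ p) ^ N = 1"
   using less.prems(1) by (metis power_mult mult.commute power_one)
  moreover have "coprime h' N" using less.prems(3) h' by simp
  ultimately have "ieval P ((z ^ p) ^ h') = 0"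
   using less.IH[OF lt] less.prems(2) by blast
  then show ?thesis by (simp add: h' power_mult)
 qed
qed

definition primitive_root :: "nat => 'a::field => bool" where
 "primitive_root N z \<longleftrightarrow> N > 0 \<and> z ^ N = 1 \<and> (\<forall>k. 0 < k --> k < N --> z ^ k ~= 1)"

lemma primitive_root_nonzero: "primitive_root N z ==> z ~= 0"
 by (auto simp: primitive_root_def power_0_left)

lemma primitive_root_inj:
 assumes "primitive_root N z" "i < N" "j < N" "z ^ i = z ^ j"
 shows "i = j"
proof -
 have *: "i = j" if "i \<le> j" "i < N" "j < N" "z ^ i = z ^ j" for i j
 proof -
  have "z ^ i * z ^ (j - i) = z ^ i * 1"
   using that by (metis le_add_diff_inverse mult.right_neutral power_add)
  then have "z ^ (j - i) = 1" using primitive_root_nonzero[OF assms(1)] by simp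
  then show ?thesis using assms(1) that unfolding primitive_root_def
   by (metis diff_is_0_eq le_antisym less_imp_diff_less not_gr_zero)
 qed
 show ?thesis using *[of i j] *[of j i] assms by (metis nat_le_linear)
qed

text \<open>All \<open>totient N\<close> conjugates \<open>z ^ h\<close> with \<open>h\<close> coprime to
 \<open>N\<close> are roots of any integer polynomial that kills \<open>z\<close>.\<close>

lemma totient_le_degree:
 fixes z :: "'a::field_char_0"
 assumes "primitive_root N z" "P ~= 0" "ieval P z = 0"
 shows "totient N \<le> degree P"
proof (cases "N = 1")
 case True
 have "degree P ~= 0"
 proof
  assume "degree P = 0"
  then obtain c where "P = [:c:]" by (metis degree_eq_zeroE)
  then show False using assms by simp
 qed
 then show ?thesis using True by simp
next
 case False
 have N: "N > 0" "z ^ N = 1" using assms(1) by (auto simp: primitive_root_def)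
 define T where "T = totatives N"
 have T: "k < N" if "k \<in> T" for k
  using that N(1) False by (auto simp: T_def totatives_def le_less)
 have inj: "inj_on (\<lambda>k. z ^ k) T"
  using primitive_root_inj[OF assms(1)] T by (auto simp: inj_on_def)
 define Q where "Q = (map_poly of_int P :: 'a poly)"
 have Q: "Q ~= 0" using assms(2) by (simp add: Q_def)
 have "(\<lambda>k. z ^ k) ` T \<subseteq> {x. poly Q x = 0}"
  using root_of_unity_conjugate[OF N(2,1) _ assms(3)]
  by (auto simp: T_def totatives_def Q_def ieval_def)
 then have "card ((\<lambda>k. z ^ k) ` T) \<le> card {x. poly Q x = 0}"
  using poly_roots_finite[OF Q] by (intro card_mono) auto
 also have "\<dots> \<le> degree Q" using Q by (rule card_poly_roots_bound)
 also have "\<dots> \<le> degree P" unfolding Q_def by (rule map_poly_degree_leq)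
 finally show ?thesis using inj by (simp add: card_image totient_def T_def)
qed

section \<open>The least prime that does not divide an integer\<close>

text \<open>Erdos's count: a number below \<open>j\<close> is a squarefree number with prime factors below
 \<open>j\<close> times a square.\<close>

lemma smooth_numbers_bound:
 fixes j :: nat
 assumes "j > 0"
 shows "j - 1 \<le> 4 ^ card {p. prime p \<and> p < j}"
proof -
 define T where "T = {p. prime p \<and> p < j}"
 have finT: "finite T" by (rule finite_subset[of _ "{..<j}"]) (auto simp: T_def)
 define x where "x = j - 1"
 define s where "s = nat \<lfloor>sqrt (real x)\<rfloor>"
 define h where "h = (\<lambda>n::nat. (prime_factors (squarefree_part n), square_part n))"
 have "h n \<in> Pow T \<times> {1..s}" if n: "n \<in> {1..x}" for n
 proof -
  have n0: "n > 0" "n < j" using n assms by (auto simp: x_def)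
  have dec: "n = squarefree_part n * square_part n ^ 2" by (rule squarefree_decompose)
  have "squarefree_part n dvd n" using dec by (metis dvd_triv_left)
  then have "p < j" if "p dvd squarefree_part n" for p
   using n0 that dvd_imp_le[of p n] dvd_trans[of p _ n] by auto
  then have "prime_factors (squarefree_part n) \<subseteq> T" by (auto simp: T_def)
  moreover have sp: "square_part n \<ge> 1" using n0 by (metis One_nat_def Suc_leI neq0_conv square_part_0_iff)
  moreover have "square_part n ^ 2 \<le> n"
   using n0 by (intro dvd_imp_le) auto
  then have "square_part n ^ 2 \<le> x" using n by simp
  then have "real (square_part n) \<le> sqrt (real x)"
   by (intro real_le_rsqrt) (metis of_nat_le_iff of_nat_power)
  then have "square_part n \<le> s" by (simp add: s_def le_nat_floor)
  ultimately show ?thesis by (auto simp: h_def)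
 qed
 moreover have "inj_on h {1..x}"
 proof (intro inj_onI)
  fix a b assume ab: "a \<in> {1..x}" "b \<in> {1..x}" "h a = h b"
  have sf: "squarefree_part n = \<Prod>(prime_factors (squarefree_part n))" for n :: nat
  proof -
   have "squarefree_part n = (\<Prod>p\<in>prime_factors (squarefree_part n). p ^ multiplicity p (squarefree_part n))"
    by (rule prime_factorization_nat) (simp add: zero_less_iff_neq_zero)
   also have "\<dots> = \<Prod>(prime_factors (squarefree_part n))"
   proof (intro prod.cong refl)
    fix p assume p: "p \<in> prime_factors (squarefree_part n)"
    then have "multiplicity p (squarefree_part n) > 0" by (simp add: prime_factors_multiplicity)
    moreover have "multiplicity p (squarefree_part n) \<le> Suc 0" using p by auto
    ultimately have "multiplicity p (squarefree_part n) = 1" by simp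
    then show "p ^ multiplicity p (squarefree_part n) = p" by simp
   qed
   finally show ?thesis .
  qed
  have "squarefree_part a = squarefree_part b" "square_part a = square_part b"
   using ab(3) sf[of a] sf[of b] by (auto simp: h_def)
  then show "a = b" using squarefree_decompose[of a] squarefree_decompose[of b] by simp
 qed
 ultimately have "card {1..x} \<le> card (Pow T \<times> {1..s})"
  using finT by (intro card_inj_on_le[of h] image_subsetI) blast+
 then have "x \<le> 2 ^ card T * s" using finT by (simp add: card_cartesian_product card_Pow)
 then have "real x \<le> real (2 ^ card T * s)" by (simp only: of_nat_le_iff)
 also have "\<dots> \<le> 2 ^ card T * sqrt (real x)"
  by (simp add: s_def)
 finally have 1: "real x \<le> 2 ^ card T * sqrt (real x)" .
 have "real x \<le> 4 ^ card T"
 proof (cases "x = 0")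
  case False
  have "sqrt (real x) * sqrt (real x) \<le> 2 ^ card T * sqrt (real x)" using 1 by simp
  moreover have "0 < sqrt (real x)" using False by simp
  ultimately have "sqrt (real x) \<le> 2 ^ card T" by (rule mult_right_le_imp_le)
  then have "sqrt (real x) ^ 2 \<le> (2 ^ card T) ^ 2" by (intro power_mono) auto
  then show ?thesis by (simp add: power_mult[symmetric] mult.commute[of _ 2]) (simp add: power_mult)
 qed simp
 then have "real x \<le> real (4 ^ card T)" by simp
 then show ?thesis by (simp only: of_nat_le_iff x_def T_def)
qed

lemma prime_factors_prod_le:
 assumes "(N::nat) > 0"
 shows "real (\<Prod>(prime_factors N)) \<le> real N"
proof -
 have "\<Prod>(prime_factors N) \<le> (\<Prod>p\<in>prime_factors N. p ^ multiplicity p N)"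
 proof (intro prod_mono conjI)
  fix p assume p: "p \<in> prime_factors N"
  then have "multiplicity p N > 0" "p > 1" by (auto simp: prime_factors_multiplicity prime_gt_Suc_0_nat)
  then show "p \<le> p ^ multiplicity p N" by (simp add: self_le_power)
 qed simp
 also have "\<dots> = N" using prime_factorization_nat[OF assms] by simp
 finally show ?thesis by (simp only: of_nat_le_iff)
qed

text \<open>In \<open>totient N ^ 2 / N\<close> a prime divisor \<open>p\<close> contributes at least
 \<open>(p - 1)^2 / p\<close>. This is at least 1 except at \<open>p = 2\<close>, so that factors other than
 the one at 2 can be dropped.\<close>

lemma totient_square_bound:
 assumes "(N::nat) > 0" "finite T" "T \<subseteq> prime_factors N" "2 \<in> T \<or> odd N"
 shows "real N * (\<Prod>p\<in>T. (real p - 1)\<^sup>2 / real p) \<le> (real (totient N))\<^sup>2"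
proof -
 define P where "P = prime_factors N"
 have P: "finite P" "\<And>p. p \<in> P ==> prime p" "\<And>p. p \<in> P ==> p > 1" "\<And>p. p \<in> P ==> p dvd N"
  by (auto simp: P_def in_prime_factors_iff prime_gt_Suc_0_nat)
 have "(\<Prod>p\<in>T. (real p - 1)\<^sup>2 / real p) \<le> (\<Prod>p\<in>P. (real p - 1)\<^sup>2 / real p)"
 proof (rule prod_mono2[OF P(1)])
  show "T \<subseteq> P" using assms(3) by (simp add: P_def)
  fix p assume p: "p \<in> P - T"
  have "p ~= 2" using p assms(4) P(4)[of p] by auto
  then have "real p \<ge> 3" using P(3)[of p] p by simp
  then have "real p * 1 \<le> (real p - 1)\<^sup>2"
  proof -
   have "(real p - 1)\<^sup>2 - real p = (real p - 3) * real p + 1" by (simp add: power2_eq_square algebra_simps)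
   also have "\<dots> \<ge> 0" using \<open>real p \<ge> 3\<close> by simp
   finally show ?thesis by simp
  qed
  then show "1 \<le> (real p - 1)\<^sup>2 / real p" using \<open>real p \<ge> 3\<close> by simp
 qed (use assms(3) in \<open>auto\<close>)
 also have "\<dots> = (\<Prod>p\<in>P. real p * (1 - 1 / real p)\<^sup>2)"
  using P(3) by (intro prod.cong refl) (force simp: field_simps power2_eq_square)
 also have "\<dots> = real (\<Prod>P) * (\<Prod>p\<in>P. 1 - 1 / real p)\<^sup>2"
  by (simp add: prod.distrib prod_power_distrib)
 also have "\<dots> \<le> real N * (\<Prod>p\<in>P. 1 - 1 / real p)\<^sup>2"
  using prime_factors_prod_le[OF assms(1)] by (intro mult_right_mono) (auto simp: P_def)
 finally have "real N * (\<Prod>p\<in>T. (real p - 1)\<^sup>2 / real p) \<le> real N * (real N * (\<Prod>p\<in>P. 1 - 1 / real p)\<^sup>2)"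
  by (intro mult_left_mono) auto
 also have "\<dots> = (real (totient N))\<^sup>2"
  by (simp add: totient_formula2 P_def power2_eq_square)
 finally show ?thesis .
qed

lemma totient_square_ge_half:
 assumes "(N::nat) > 0"
 shows "N \<le> 2 * (totient N)\<^sup>2"
proof -
 have "real N / 2 \<le> (real (totient N))\<^sup>2"
 proof (cases "even N")
  case True
  have "{2} \<subseteq> prime_factors N" using True assms by (auto simp: prime_factors_dvd)
  from totient_square_bound[OF assms _ this] show ?thesis by simp
 next
  case False
  have "real N \<le> (real (totient N))\<^sup>2"
   using totient_square_bound[OF assms, of "{}"] False by (simp del: of_nat_power)
  then show ?thesis by linarith
 qed
 then have "real N \<le> real (2 * (totient N)\<^sup>2)" by simp
 then show ?thesis by (simp only: of_nat_le_iff)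
qed

text \<open>Here the worst prime powers are 2 and 3; they give the factors 1/8 and 16/27.\<close>

lemma totient_fourth_power_bound:
 assumes "(N::nat) > 0"
 shows "2 / 27 * real N ^ 3 \<le> real (totient N) ^ 4"
proof -
 define P where "P = prime_factors N"
 have P: "finite P" "\<And>p. p \<in> P ==> prime p" "\<And>p. p \<in> P ==> p > 1"
  by (auto simp: P_def in_prime_factors_iff prime_gt_Suc_0_nat)
 define h where "h = (\<lambda>p. (real p - 1) ^ 4 / real p ^ 3)"
 have hpos: "h p \<ge> 0" for p by (simp add: h_def)
 have "h p \<ge> 1" if "p \<in> P - {2,3}" for p
 proof -
  have "prime p" "p ~= 2" "p ~= 3" using that P(2) by auto
  have "p \<ge> 5"
  proof (rule ccontr)
   assume "\<not> p \<ge> 5"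
   then have "p = 0 \<or> p = 1 \<or> p = 2 \<or> p = 3 \<or> p = 4" by arith
   with \<open>prime p\<close> \<open>p ~= 2\<close> \<open>p ~= 3\<close> show False by auto
  qed
  then have p: "real p - 4 \<ge> 0" "real p > 0" "real p - 5 \<ge> 0" by auto
  have "(real p - 1) ^ 4 - real p ^ 3
    = real p ^ 3 * (real p - 5) + real p * (6 * (real p - 5) + 26) + 1"
   by (simp add: power4_eq_xxxx power3_eq_cube algebra_simps)
  moreover have "real p * (6 * (real p - 5) + 26) \<ge> 0" "real p ^ 3 * (real p - 5) \<ge> 0"
   using p by simp_all
  ultimately have "real p ^ 3 \<le> (real p - 1) ^ 4" by linarith
  then show ?thesis using p(2) by (simp add: h_def)
 qed
 then have rest: "1 \<le> (\<Prod>p\<in>P - {2,3}. h p)" by (intro prod_ge_1) auto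
 have "P \<inter> {2,3} = {} \<or> P \<inter> {2,3} = {2} \<or> P \<inter> {2,3} = {3} \<or> P \<inter> {2,3} = {2,3}" by blast
 then have "2 / 27 \<le> (\<Prod>p\<in>P \<inter> {2,3}. h p)"
  by (elim disjE) (simp_all add: h_def)
 then have "2 / 27 * 1 \<le> (\<Prod>p\<in>P \<inter> {2,3}. h p) * (\<Prod>p\<in>P - {2,3}. h p)"
  using rest by (intro mult_mono) auto
 also have "\<dots> = (\<Prod>p\<in>(P \<inter> {2,3}) \<union> (P - {2,3}). h p)"
  using P(1) by (subst prod.union_disjoint) auto
 also have "(P \<inter> {2,3}) \<union> (P - {2,3}) = P" by blast
 also have "(\<Prod>p\<in>P. h p) = (\<Prod>p\<in>P. real p * (1 - 1 / real p) ^ 4)"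
 proof (intro prod.cong refl)
  fix p assume "p \<in> P"
  then have "real p > 0" using P(3)[of p] by simp
  then have "1 - 1 / real p = (real p - 1) / real p" by (simp add: field_simps)
  then show "h p = real p * (1 - 1 / real p) ^ 4"
   using \<open>real p > 0\<close> by (simp add: h_def power_divide power4_eq_xxxx power3_eq_cube)
 qed
 also have "\<dots> = real (\<Prod>P) * (\<Prod>p\<in>P. 1 - 1 / real p) ^ 4"
  by (simp add: prod.distrib prod_power_distrib)
 also have "\<dots> \<le> real N * (\<Prod>p\<in>P. 1 - 1 / real p) ^ 4"
  using prime_factors_prod_le[OF assms(1)] by (intro mult_right_mono) (auto simp: P_def)
 finally have "2 / 27 \<le> real N * (\<Prod>p\<in>P. 1 - 1 / real p) ^ 4" by simp
 then have "2 / 27 * real N ^ 3 \<le> (real N * (\<Prod>p\<in>P. 1 - 1 / real p) ^ 4) * real N ^ 3"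
  by (intro mult_right_mono) auto
 also have "\<dots> = real (totient N) ^ 4"
  by (simp add: totient_formula2 P_def power_mult_distrib power4_eq_xxxx power3_eq_cube)
 finally show ?thesis .
qed

lemma square_quotient_ge_16:
 assumes "p \<ge> (18::nat)"
 shows "16 \<le> (real p - 1)\<^sup>2 / real p"
proof -
 have "real p \<ge> 18" using assms by simp
 have "(real p - 1)\<^sup>2 - 16 * real p = real p * (real p - 18) + 1" by (simp add: power2_eq_square algebra_simps)
 moreover have "real p * (real p - 18) \<ge> 0" using \<open>real p \<ge> 18\<close> by simp
 ultimately have "16 * real p \<le> (real p - 1)\<^sup>2" by linarith
 then show ?thesis using \<open>real p \<ge> 18\<close> by (simp add: field_simps)
qed

text \<open>If \<open>j\<close> is large, then \<open>N\<close> has many prime divisors below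
 \<open>j\<close>, and each of those from 18 on gains a factor 16 in \<open>totient N ^ 2 / N\<close>, whereas
 by the lemma above it costs only a factor 4 in the bound on \<open>j\<close>. If \<open>j\<close> is small,
 the bound on the fourth power of the totient suffices because \<open>N\<close> is large. The threshold is
 \<open>256 * 24 ^ 4\<close>.\<close>

lemma least_nondividing_prime_bound:
 fixes N j :: nat
 assumes N: "84934656 \<le> N" and j: "prime j" "\<And>p. prime p ==> p < j ==> p dvd N"
 shows "j\<^sup>2 * N \<le> 64 * (totient N)\<^sup>2"
proof (cases "j \<le> 400")
 case True
 have N0: "N > 0" using N by simp
 have "j ^ 4 \<le> 400 ^ 4" using True by (intro power_mono) auto
 also have "\<dots> \<le> 303 * N" using N by simp
 finally have "real (j ^ 4) \<le> real (303 * N)" by (simp only: of_nat_le_iff)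
 then have "real j ^ 4 * real N ^ 2 \<le> (303 * real N) * real N ^ 2"
  by (intro mult_right_mono) auto
 also have "\<dots> \<le> 4096 * (2 / 27 * real N ^ 3)" by (simp add: power2_eq_square power3_eq_cube)
 also have "\<dots> \<le> 4096 * real (totient N) ^ 4"
  using totient_fourth_power_bound[OF N0] by simp
 finally have "(real j ^ 2 * real N) ^ 2 \<le> (64 * real (totient N) ^ 2) ^ 2"
  by (simp add: power_mult_distrib power2_eq_square power4_eq_xxxx ac_simps)
 then have "real j ^ 2 * real N \<le> 64 * real (totient N) ^ 2"
  by (rule power2_le_imp_le) simp
 then have "real (j\<^sup>2 * N) \<le> real (64 * (totient N)\<^sup>2)" by simp
 then show ?thesis by (simp only: of_nat_le_iff)
next
 case False
 have N0: "N > 0" using N by simp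
 define T where "T = {p. prime p \<and> p < j}"
 define T0 where "T0 = {2,3,5,7,11,13,17,19,23,29,31,37,41,43,47,53,59,61::nat}"
 have finT: "finite T" by (rule finite_subset[of _ "{..<j}"]) (auto simp: T_def)
 have T0: "T0 \<subseteq> T" "finite T0" "card T0 = 18"
  using False by (auto simp: T_def T0_def)
 have TP: "T \<subseteq> prime_factors N" using j(2) N0 by (auto simp: T_def prime_factors_dvd)
 have 2: "2 \<in> T" using T0(1) by (auto simp: T0_def)
 define g where "g = (\<lambda>p. (real p - 1)\<^sup>2 / real p)"
 have "16 ^ card (T - T0) = (\<Prod>p\<in>T - T0. 16::real)" by simp
 also have "\<dots> \<le> (\<Prod>p\<in>T - T0. g p)"
 proof (intro prod_mono conjI)
  fix p assume p: "p \<in> T - T0"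
  have "p \<ge> 18"
  proof (rule ccontr)
   assume "\<not> p \<ge> 18"
   then have "p = 0 \<or> p = 1 \<or> p = 2 \<or> p = 3 \<or> p = 4 \<or> p = 5 \<or> p = 6 \<or> p = 7 \<or> p = 8 \<or> p = 9
    \<or> p = 10 \<or> p = 11 \<or> p = 12 \<or> p = 13 \<or> p = 14 \<or> p = 15 \<or> p = 16 \<or> p = 17" by arith
   then show False using p by (auto simp: T_def T0_def)
  qed
  then show "16 \<le> g p" unfolding g_def by (rule square_quotient_ge_16)
 qed simp
 finally have A: "16 ^ card (T - T0) \<le> (\<Prod>p\<in>T - T0. g p)" .
 have "(\<Prod>p\<in>T0. g p) = (\<Prod>p\<in>T0. (real p - 1)\<^sup>2) / (\<Prod>p\<in>T0. real p)"
  unfolding g_def by (rule prod_dividef)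
 also have "(\<Prod>p\<in>T0. real p) = 117288381359406970983270"
  by (simp add: T0_def)
 also have "(\<Prod>p\<in>T0. (real p - 1)\<^sup>2) = (\<Prod>p\<in>T0. real p - 1)\<^sup>2"
  by (simp add: prod_power_distrib)
 also have "(\<Prod>p\<in>T0. real p - 1) = 15433667505888952320000"
  by (simp add: T0_def)
 finally have B: "16 ^ 18 * 4 \<le> 64 * (\<Prod>p\<in>T0. g p)" by simp
 have "card T = card (T - T0) + 18"
  using card_Diff_subset[OF T0(2,1)] card_mono[OF finT T0(1)] T0(3) by simp
 moreover have "0 \<le> prod g T0" by (intro prod_nonneg) (simp add: g_def)
 ultimately have "4 * 16 ^ card T = (16 ^ 18 * 4) * (16::real) ^ card (T - T0)" by (simp add: power_add)
 also have "\<dots> \<le> (64 * (\<Prod>p\<in>T0. g p)) * (\<Prod>p\<in>T - T0. g p)"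
  by (rule mult_mono[OF B A]) (use \<open>0 \<le> prod g T0\<close> in \<open>simp only: zero_le_mult_iff; simp\<close>, simp)
 also have "\<dots> = 64 * (\<Prod>p\<in>T. g p)"
  using prod.subset_diff[OF T0(1) finT, of g] by simp
 finally have C: "4 * 16 ^ card T \<le> 64 * (\<Prod>p\<in>T. g p)" .
 have "j - 1 \<le> 4 ^ card T"
  using smooth_numbers_bound[of j] j(1) prime_gt_0_nat unfolding T_def by blast
 then have "j \<le> 2 * 4 ^ card T" using one_le_power[of "4::nat" "card T"] by linarith
 then have "j ^ 2 \<le> (2 * 4 ^ card T) ^ 2" by (intro power_mono) auto
 also have "\<dots> = 4 * 16 ^ card T" by (simp add: power_mult_distrib power_mult[symmetric] mult.commute[of _ 2]) (simp add: power_mult)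
 finally have "real (j ^ 2) \<le> real (4 * 16 ^ card T)" by (simp only: of_nat_le_iff)
 then have "real (j ^ 2) * real N \<le> 64 * (\<Prod>p\<in>T. g p) * real N"
  using C by (intro mult_right_mono) auto
 also have "\<dots> \<le> 64 * (real (totient N))\<^sup>2"
  using totient_square_bound[OF N0 finT TP] 2 by (simp add: g_def mult.commute)
 finally have "real (j\<^sup>2 * N) \<le> real (64 * (totient N)\<^sup>2)" by simp
 then show ?thesis by (simp only: of_nat_le_iff)
qed

section \<open>Subfields of finite degree over the rationals\<close>

text \<open>A subring that is spanned over the rational numbers by at most \<open>n\<close> elements; it is
 automatically a number field of degree at most \<open>n\<close>. An upper bound on the degree is all that is
 needed, and it behaves well under adjunction.\<close>

definition qalg :: "'a::field_char_0 set => nat => bool" where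
 "qalg S n \<longleftrightarrow> 1 \<in> S \<and> (\<forall>x\<in>S. \<forall>y\<in>S. x * y \<in> S) \<and>
   (\<exists>T. finite T \<and> card T \<le> n \<and> S = qv.span T)"

lemma qalgD:
 assumes "qalg S n"
 shows "1 \<in> S" "\<And>x y. x \<in> S ==> y \<in> S ==> x * y \<in> S" "\<And>x y. x \<in> S ==> y \<in> S ==> x + y \<in> S"
  "\<And>r. of_rat r \<in> S" "0 \<in> S" "\<And>x. x \<in> S ==> - x \<in> S" "\<And>x y. x \<in> S ==> y \<in> S ==> x - y \<in> S"
  "\<And>x k. x \<in> S ==> x ^ k \<in> S" "qv.subspace S"
proof -
 show 1: "1 \<in> S" and mult: "\<And>x y. x \<in> S ==> y \<in> S ==> x * y \<in> S" using assms by (auto simp: qalg_def)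
 show sub: "qv.subspace S" using assms by (auto simp: qalg_def)
 show "\<And>x y. x \<in> S ==> y \<in> S ==> x + y \<in> S" using sub by (rule qv.subspace_add)
 show "of_rat r \<in> S" for r using qv.subspace_scale[OF sub 1, of r] by simp
 show "0 \<in> S" using sub by (rule qv.subspace_0)
 show "\<And>x. x \<in> S ==> - x \<in> S" using sub by (rule qv.subspace_neg)
 show "\<And>x y. x \<in> S ==> y \<in> S ==> x - y \<in> S" using sub by (rule qv.subspace_diff)
 show "x ^ k \<in> S" if "x \<in> S" for x k using that by (induction k) (auto intro: 1 mult)
qed

lemma qalg_sum: "qalg S n ==> (\<And>i. i \<in> A ==> f i \<in> S) ==> sum f A \<in> S"
 by (rule qv.subspace_sum) (auto intro: qalgD)

lemma common_denominator:
 fixes c :: "nat => rat"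
 shows "\<exists>D>0. \<forall>i\<le>n. of_int D * c i \<in> \<int>"
proof -
 define D where "D = (\<Prod>i\<le>n. snd (quotient_of (c i)))"
 have pos: "D > 0" unfolding D_def by (intro prod_pos) (simp add: quotient_of_denom_pos')
 have "of_int D * c i \<in> \<int>" if "i \<le> n" for i
 proof -
  have "D = snd (quotient_of (c i)) * (\<Prod>i\<in>{..n} - {i}. snd (quotient_of (c i)))"
   unfolding D_def using that by (subst prod.remove[of _ i]) auto
  moreover obtain a b where ab: "quotient_of (c i) = (a, b)" by fastforce
  moreover have "c i = of_int a / of_int b" "b > 0"
   using ab quotient_of_div quotient_of_denom_pos by blast+
  ultimately have "of_int D * c i = of_int (a * (\<Prod>i\<in>{..n} - {i}. snd (quotient_of (c i))))"
   by simp
  then show ?thesis by (metis Ints_of_int)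
 qed
 with pos show ?thesis by blast
qed

lemma qalg_algebraic:
 fixes x :: "'a::field_char_0"
 assumes "qalg S n" "x \<in> S"
 obtains P where "P ~= 0" "degree P \<le> n" "ieval P x = 0"
proof -
 obtain T where T: "finite T" "card T \<le> n" "S = qv.span T" using assms(1) by (auto simp: qalg_def)
 have "\<exists>c. (\<exists>i\<in>{..n}. c i ~= 0) \<and> (\<Sum>i\<in>{..n}. of_rat (c i) * x ^ i) = 0"
  using T qalgD(8)[OF assms] by (intro qv.family_dependent[of _ T]) auto
 then obtain c where c: "\<exists>i\<le>n. c i ~= 0" "(\<Sum>i\<le>n. of_rat (c i) * x ^ i) = 0" by auto
 obtain D where D: "D > 0" "\<forall>i\<le>n. of_int D * c i \<in> \<int>" using common_denominator by blast
 then have "\<forall>i. \<exists>k. i \<le> n --> of_int D * c i = of_int k" by (auto elim: Ints_cases)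
 then obtain k where k: "\<And>i. i \<le> n ==> of_int D * c i = of_int (k i)" by metis
 define P where "P = (\<Sum>i\<le>n. monom (k i) i)"
 have Pc: "coeff P i = (if i \<le> n then k i else 0)" for i
  by (simp add: P_def coeff_sum)
 obtain i where i: "i \<le> n" "c i ~= 0" using c(1) by blast
 then have "k i ~= 0" using k[of i] D(1) by auto
 then have "P ~= 0" using Pc[of i] i(1) by auto
 moreover have "degree P \<le> n" by (intro degree_le) (simp add: Pc)
 moreover have "ieval P x = 0"
 proof -
  have "ieval P x = (\<Sum>i\<le>n. of_int (k i) * x ^ i)"
   unfolding P_def by (induction n) auto
  also have "\<dots> = (\<Sum>i\<le>n. of_int D * (of_rat (c i) * x ^ i))"
  proof (intro sum.cong refl)
   fix i assume "i \<in> {..n}"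
   then have "of_rat (of_int D * c i) = (of_rat (of_int (k i)) :: 'a)" using k by simp
   then have "of_int D * of_rat (c i) = (of_int (k i) :: 'a)" by (simp add: of_rat_mult)
   then show "of_int (k i) * x ^ i = of_int D * (of_rat (c i) * x ^ i)" by (simp add: mult.assoc[symmetric])
  qed
  also have "\<dots> = 0" using c(2) by (simp add: sum_distrib_left[symmetric])
  finally show ?thesis .
 qed
 ultimately show ?thesis using that by blast
qed

lemma totient_le_of_qalg:
 fixes z :: "'a::field_char_0"
 assumes "qalg S n" "z \<in> S" "primitive_root N z"
 shows "totient N \<le> n"
proof -
 obtain P where P: "P ~= 0" "degree P \<le> n" "ieval P z = 0" by (rule qalg_algebraic[OF assms(1,2)])
 then show ?thesis using totient_le_degree[OF assms(3) P(1,3)] by simp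
qed

lemma ieval_in_qalg: "qalg S n ==> x \<in> S ==> ieval P x \<in> S"
proof (induction P)
 case (pCons a P)
 have "of_int a \<in> S" using qalgD(4)[OF pCons(3), of "of_int a"] by simp
 then show ?case using pCons by (simp add: qalgD)
qed (simp add: qalgD)

text \<open>A nonzero integer polynomial that kills \<open>x\<close> expresses the inverse as a polynomial in
 \<open>x\<close>.\<close>

lemma qalg_inverse:
 assumes "qalg S n" "x \<in> S"
 shows "inverse x \<in> S"
proof (cases "x = 0")
 case True
 then show ?thesis using qalgD(5)[OF assms(1)] by simp
next
 case False
 obtain P where P: "P ~= 0" "degree P \<le> n" "ieval P x = 0" by (rule qalg_algebraic[OF assms])
 obtain M where M: "M ~= 0" "ieval M x = 0" "\<And>P. ieval P x = 0 ==> P ~= 0 ==> degree M \<le> degree P"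
  using exists_minimal_int_poly[OF P(1,3)] by metis
 obtain a M' where aM: "M = pCons a M'" by (cases M) auto
 have "a ~= 0"
 proof
  assume a: "a = 0"
  then have "ieval M' x = 0" "M' ~= 0" using M(1,2) aM False by auto
  then have "degree M \<le> degree M'" using M(3) by blast
  then show False using aM \<open>M' ~= 0\<close> by simp
 qed
 have "of_int a + x * ieval M' x = 0" using M(2) aM by simp
 then have "x * (of_rat (- 1 / of_int a) * ieval M' x) = 1"
  using \<open>a ~= 0\<close> by (simp add: of_rat_divide of_rat_minus field_simps add_eq_0_iff)
 then have "inverse x = of_rat (- 1 / of_int a) * ieval M' x" by (metis inverse_unique)
 also have "\<dots> \<in> S" using ieval_in_qalg[OF assms] qalgD(2,4)[OF assms(1)] by blast
 finally show ?thesis .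
qed

lemma qalg_divide: "qalg S n ==> x \<in> S ==> y \<in> S ==> x / y \<in> S"
 by (simp add: divide_inverse qalgD(2) qalg_inverse)

lemma qalg_mono:
 assumes "qalg S n" "n \<le> m"
 shows "qalg S m"
proof -
 obtain T where T: "finite T" "card T \<le> n" "S = qv.span T" using assms(1) by (auto simp: qalg_def)
 then have "card T \<le> m" using assms(2) by simp
 then show ?thesis using assms(1) T unfolding qalg_def by blast
qed

definition coeffs_in :: "'a::zero set => 'a poly => bool" where
 "coeffs_in S p \<longleftrightarrow> (\<forall>i. coeff p i \<in> S)"

lemma coeffs_in_0: "0 \<in> S ==> coeffs_in S 0" by (simp add: coeffs_in_def)

lemma coeffs_in_mono: "coeffs_in S p ==> S \<subseteq> S' ==> coeffs_in S' p"
 by (auto simp: coeffs_in_def)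

lemma coeffs_in_monom: "0 \<in> S ==> c \<in> S ==> coeffs_in S (monom c n)"
 by (simp add: coeffs_in_def)

lemma coeffs_in_pCons: "coeffs_in S (pCons a p) \<longleftrightarrow> a \<in> S \<and> coeffs_in S p"
 by (auto simp: coeffs_in_def coeff_pCons split: nat.splits)

lemma coeffs_in_add: "qalg S n ==> coeffs_in S p ==> coeffs_in S q ==> coeffs_in S (p + q)"
 by (simp add: coeffs_in_def qalgD)

lemma coeffs_in_diff: "qalg S n ==> coeffs_in S p ==> coeffs_in S q ==> coeffs_in S (p - q)"
 by (simp add: coeffs_in_def qalgD)

lemma coeffs_in_mult: "qalg S n ==> coeffs_in S p ==> coeffs_in S q ==> coeffs_in S (p * q)"
 unfolding coeffs_in_def coeff_mult by (auto intro!: qalg_sum qalgD(2))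

lemma coeffs_in_smult: "qalg S n ==> c \<in> S ==> coeffs_in S q ==> coeffs_in S (smult c q)"
 unfolding coeffs_in_def by (auto intro!: qalgD(2))

lemma coeffs_in_1: "qalg S n ==> coeffs_in S 1"
 by (simp add: one_pCons coeffs_in_pCons qalgD coeffs_in_0)

lemma coeffs_in_power: "qalg S n ==> coeffs_in S p ==> coeffs_in S (p ^ k)"
 by (induction k) (auto intro: coeffs_in_1 coeffs_in_mult)

lemma poly_in_qalg: "qalg S n ==> coeffs_in S p ==> x \<in> S ==> poly p x \<in> S"
 unfolding poly_altdef coeffs_in_def by (auto intro!: qalg_sum qalgD)

lemma coeffs_in_pderiv: "qalg S n ==> coeffs_in S p ==> coeffs_in S (pderiv p)"
 unfolding coeffs_in_def coeff_pderiv
 by (metis of_nat_in_Nats of_rat_of_nat_eq qalgD(2,4))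

definition adjoin :: "'a::comm_ring_1 set => 'a => 'a set" where
 "adjoin S x = {poly p x | p. coeffs_in S p}"

lemma adjoin_superset: "0 \<in> S ==> S \<subseteq> adjoin S x"
proof
 fix a assume "0 \<in> S" "a \<in> S"
 then show "a \<in> adjoin S x"
  unfolding adjoin_def by (intro CollectI exI[of _ "[:a:]"]) (auto simp: coeffs_in_pCons coeffs_in_0)
qed

lemma adjoin_self: "0 \<in> S ==> 1 \<in> S ==> x \<in> adjoin S x"
 unfolding adjoin_def by (intro CollectI exI[of _ "[:0, 1:]"]) (auto simp: coeffs_in_pCons coeffs_in_0)

lemma qalg_adjoin:
 assumes S: "qalg S n" and f: "coeffs_in S f" "f ~= 0" "poly f x = 0" "degree f \<le> m"
 shows "qalg (adjoin S x) (n * m)"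
proof -
 obtain T where T: "finite T" "card T \<le> n" "S = qv.span T" using S by (auto simp: qalg_def)
 define e where "e = degree f"
 define T' where "T' = (\<lambda>(t, i). t * x ^ i) ` (T \<times> {..<m})"
 define U where "U = qv.span T'"
 have finT': "finite T'" using T(1) by (simp add: T'_def)
 have "card T' \<le> card (T \<times> {..<m})" unfolding T'_def using T(1) by (intro card_image_le) auto
 then have cardT': "card T' \<le> n * m" using T(2)
  by (simp add: card_cartesian_product) (meson le_trans mult_le_mono1)
 have low: "s * x ^ i \<in> U" if "s \<in> S" "i < m" for s i
 proof -
  have "s \<in> qv.span T" using that T(3) by simp
  then show ?thesis
  proof (induction rule: qv.span_induct_alt)
   case base
   show ?case by (simp add: U_def qv.span_zero)
  next
   case (step c t y)
   have "t * x ^ i \<in> U" unfolding U_def T'_def using step(1) that(2) by (intro qv.span_base) auto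
   then have "of_rat c * (t * x ^ i) + y * x ^ i \<in> U"
    using step(2) unfolding U_def by (intro qv.span_add qv.span_scale)
   then show ?case by (simp add: algebra_simps)
  qed
 qed
 have lc: "coeff f e ~= 0" using f(2) by (simp add: e_def)
 have fx: "(\<Sum>i<e. coeff f i * x ^ i) = - (coeff f e * x ^ e)"
 proof -
  have "(\<Sum>i\<le>e. coeff f i * x ^ i) = 0" using f(3) by (simp add: poly_altdef e_def)
  then show ?thesis by (simp add: lessThan_Suc_atMost[symmetric] add_eq_0_iff)
 qed
 have pw: "s * x ^ k \<in> U" if "s \<in> S" for s k
  using that
 proof (induction k arbitrary: s rule: less_induct)
  case (less k)
  show ?case
  proof (cases "k < m")
   case True
   then show ?thesis using low less.prems by blast
  next
   case False
   then have "e \<le> k" using f(4) by (simp add: e_def)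
   have "s * x ^ k = (\<Sum>i<e. (- (s * coeff f i / coeff f e)) * x ^ (i + (k - e)))"
   proof -
    have "(\<Sum>i<e. (- (s * coeff f i / coeff f e)) * x ^ (i + (k - e)))
     = (- s / coeff f e) * x ^ (k - e) * (\<Sum>i<e. coeff f i * x ^ i)"
     by (simp add: sum_distrib_left sum_divide_distrib power_add algebra_simps sum_negf)
    also have "\<dots> = s * x ^ (e + (k - e))" using lc by (simp add: fx power_add)
    finally show ?thesis using \<open>e \<le> k\<close> by simp
   qed
   also have "\<dots> \<in> U" unfolding U_def
   proof (intro qv.span_sum)
    fix i assume "i \<in> {..<e}"
    then have "i + (k - e) < k" using \<open>e \<le> k\<close> by auto
    moreover have "- (s * coeff f i / coeff f e) \<in> S"
     using less.prems f(1) S unfolding coeffs_in_def by (intro qalgD(6) qalg_divide qalgD(2)) auto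
    ultimately show "- (s * coeff f i / coeff f e) * x ^ (i + (k - e)) \<in> qv.span T'"
     using less.IH unfolding U_def by blast
   qed
   finally show ?thesis .
  qed
 qed
 have "adjoin S x \<subseteq> U"
 proof
  fix y assume "y \<in> adjoin S x"
  then obtain p where p: "coeffs_in S p" "y = poly p x" by (auto simp: adjoin_def)
  then show "y \<in> U" unfolding p(2) poly_altdef U_def
   by (intro qv.span_sum) (use pw in \<open>auto simp: U_def coeffs_in_def\<close>)
 qed
 moreover have closed: "y * z \<in> adjoin S x" if "y \<in> adjoin S x" "z \<in> adjoin S x" for y z
  using that unfolding adjoin_def by (force intro: coeffs_in_mult[OF S] simp flip: poly_mult)
 have sub: "qv.subspace (adjoin S x)"
 proof (rule qv.subspaceI)
  show "0 \<in> adjoin S x" using adjoin_superset qalgD(5)[OF S] by blast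
  show "y + z \<in> adjoin S x" if "y \<in> adjoin S x" "z \<in> adjoin S x" for y z
   using that unfolding adjoin_def by (force intro: coeffs_in_add[OF S] simp flip: poly_add)
  show "of_rat c * y \<in> adjoin S x" if "y \<in> adjoin S x" for c y
   using closed[OF _ that, of "of_rat c"] adjoin_superset qalgD(4,5)[OF S] by blast
 qed
 have "T' \<subseteq> adjoin S x"
 proof
  fix y assume "y \<in> T'"
  then obtain t i where "t \<in> T" "y = t * x ^ i" by (auto simp: T'_def)
  then have "y = poly (monom t i) x" "t \<in> S" using T(3) by (auto simp: poly_monom qv.span_base)
  then show "y \<in> adjoin S x" unfolding adjoin_def using qalgD(5)[OF S] coeffs_in_monom by blast
 qed
 then have "U \<subseteq> adjoin S x" unfolding U_def by (rule qv.span_minimal) (rule sub)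
 ultimately have "adjoin S x = U" by blast
 moreover have "1 \<in> adjoin S x" using adjoin_superset qalgD(1,5)[OF S] by blast
 ultimately show ?thesis
  unfolding qalg_def using closed finT' cardT' U_def by blast
qed

text \<open>Roots are split off one after the other, which lowers the degree of the remaining polynomial each
 time; hence the factorial.\<close>

lemma qalg_adjoin_roots:
 assumes "qalg S n" "coeffs_in S c" "c ~= 0" "degree c \<le> D" "finite Z" "\<And>z. z \<in> Z ==> poly c z = 0"
 shows "\<exists>S'. S \<subseteq> S' \<and> Z \<subseteq> S' \<and> qalg S' (n * fact D)"
 using assms
proof (induction D arbitrary: S n c Z)
 case 0
 then have "Z = {}" by (metis degree_0_id all_not_in_conv bot_nat_0.extremum_uniqueI degree_eq_zeroE mult_zero_right add.right_neutral pCons_0_0 poly_0 poly_pCons)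
 then show ?case using 0 by auto
next
 case (Suc D)
 show ?case
 proof (cases "Z = {}")
  case True
  then show ?thesis using Suc.prems(1) qalg_mono[of S n "n * fact (Suc D)"] by (metis empty_subsetI fact_ge_1 mult.right_neutral mult_le_mono2 order_refl)
 next
  case False
  then obtain z where z: "z \<in> Z" by blast
  define S1 where "S1 = adjoin S z"
  have S1: "qalg S1 (n * Suc D)" unfolding S1_def using Suc.prems z by (intro qalg_adjoin[of S n c]) auto
  have SS1: "S \<subseteq> S1" "z \<in> S1" unfolding S1_def
   using adjoin_superset adjoin_self qalgD(1,5)[OF Suc.prems(1)] by blast+
  define c1 where "c1 = synthetic_div c z"
  have c: "c = [:-z, 1:] * c1" using synthetic_div_correct'[of z c] Suc.prems(6)[OF z] by (simp add: c1_def)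
  have c1ne: "c1 ~= 0" using c Suc.prems(3) by auto
  have "degree c = Suc (degree c1)" using c1ne unfolding c by (subst degree_mult_eq) auto
  then have deg: "degree c1 \<le> D" using Suc.prems(4) by simp
  have syn: "coeffs_in S1 (synthetic_div p z)" if "coeffs_in S1 p" for p
   using that
  proof (induction p)
   case (pCons a p)
   then show ?case using S1 SS1(2) by (auto simp: coeffs_in_pCons intro!: poly_in_qalg)
  qed (simp add: coeffs_in_0 qalgD(5)[OF S1])
  then have "coeffs_in S1 c1" unfolding c1_def using Suc.prems(2) SS1(1) coeffs_in_mono by blast
  moreover have "poly c1 y = 0" if "y \<in> Z - {z}" for y
   using Suc.prems(6)[of y] that unfolding c by auto
  ultimately obtain S' where S': "S1 \<subseteq> S'" "Z - {z} \<subseteq> S'" "qalg S' (n * Suc D * fact D)"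
   using Suc.IH[OF S1 _ c1ne deg, of "Z - {z}"] Suc.prems(5) by auto
  have "n * Suc D * fact D = n * fact (Suc D)" by (simp add: algebra_simps)
  then show ?thesis using S' SS1 by (intro exI[of _ S']) auto
 qed
qed

lemma qalg_compositum:
 assumes A: "qalg A n" and B: "qalg B m"
 shows "\<exists>C. A \<subseteq> C \<and> B \<subseteq> C \<and> qalg C (n * m)"
proof -
 obtain T where T: "finite T" "card T \<le> n" "A = qv.span T" using A by (auto simp: qalg_def)
 obtain T2 where T2: "finite T2" "card T2 \<le> m" "B = qv.span T2" using B by (auto simp: qalg_def)
 define W where "W = (\<lambda>(a, b). a * b) ` (T \<times> T2)"
 define C where "C = qv.span W"
 have finW: "finite W" using T(1) T2(1) by (simp add: W_def)
 have "card W \<le> card (T \<times> T2)" unfolding W_def using T(1) T2(1) by (intro card_image_le) auto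
 then have cardW: "card W \<le> n * m" using T(2) T2(2)
  by (simp add: card_cartesian_product) (meson le_trans mult_le_mono)
 have 1: "t * b \<in> C" if "t \<in> T" "b \<in> qv.span T2" for t b
  using that(2)
 proof (induction rule: qv.span_induct_alt)
  case base
  show ?case by (simp add: C_def qv.span_zero)
 next
  case (step c u y)
  have "t * u \<in> C" unfolding C_def W_def using step(1) that(1) by (intro qv.span_base) auto
  then have "of_rat c * (t * u) + t * y \<in> C"
   using step(2) unfolding C_def by (intro qv.span_add qv.span_scale)
  then show ?case by (simp add: algebra_simps)
 qed
 have 2: "a * b \<in> C" if "a \<in> A" "b \<in> B" for a b
 proof -
  have "a \<in> qv.span T" using that T(3) by simp
  then show ?thesis
  proof (induction rule: qv.span_induct_alt)
   case base
   show ?case by (simp add: C_def qv.span_zero)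
  next
   case (step c u y)
   have "u * b \<in> C" using 1 step(1) that(2) T2(3) by blast
   then have "of_rat c * (u * b) + y * b \<in> C"
    using step(2) unfolding C_def by (intro qv.span_add qv.span_scale)
   then show ?case by (simp add: algebra_simps)
  qed
 qed
 have AC: "A \<subseteq> C" using 2[OF _ qalgD(1)[OF B]] by auto
 have BC: "B \<subseteq> C" using 2[OF qalgD(1)[OF A]] by auto
 have 3: "w * y \<in> C" if w: "w \<in> W" and y: "y \<in> C" for w y
 proof -
  obtain a b where ab: "a \<in> A" "b \<in> B" "w = a * b"
   using w T(3) T2(3) unfolding W_def by (auto intro: qv.span_base)
  have "y \<in> qv.span W" using y by (simp add: C_def)
  then show ?thesis
  proof (induction rule: qv.span_induct_alt)
   case base
   show ?case by (simp add: C_def qv.span_zero)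
  next
   case (step c u y)
   obtain a' b' where ab': "a' \<in> A" "b' \<in> B" "u = a' * b'"
    using step(1) T(3) T2(3) unfolding W_def by (auto intro: qv.span_base)
   have "(a * a') * (b * b') \<in> C" using ab ab' qalgD(2)[OF A] qalgD(2)[OF B] by (intro 2) auto
   moreover have "w * u = (a * a') * (b * b')" unfolding ab(3) ab'(3) by (simp add: ac_simps)
   ultimately have "w * u \<in> C" by simp
   then have "of_rat c * (w * u) + w * y \<in> C"
    using step(2) unfolding C_def by (intro qv.span_add qv.span_scale)
   then show ?case by (simp add: algebra_simps)
  qed
 qed
 have "x * y \<in> C" if "x \<in> C" "y \<in> C" for x y
 proof -
  have "x \<in> qv.span W" using that by (simp add: C_def)
  then show ?thesis
  proof (induction rule: qv.span_induct_alt)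
   case base
   show ?case by (simp add: C_def qv.span_zero)
  next
   case (step c u z)
   have "u * y \<in> C" using 3 step(1) that(2) by blast
   then have "of_rat c * (u * y) + z * y \<in> C"
    using step(2) unfolding C_def by (intro qv.span_add qv.span_scale)
   then show ?case by (simp add: algebra_simps)
  qed
 qed
 then have "qalg C (n * m)"
  unfolding qalg_def using finW cardW AC qalgD(1)[OF A] C_def by blast
 then show ?thesis using AC BC by blast
qed

lemma number_field_qalg:
 fixes F :: "'a::field_char_0 set"
 assumes "number_field_of_degree F l"
 shows "qalg F l"
proof -
 let ?R = "ring_of_type_algebra :: 'a ring"
 interpret R: ring ?R by (rule ring_from_type_algebra)
 have sf: "subfield F ?R" and dim: "R.dimension l \<rat> F"
  using assms by (auto simp: number_field_of_degree_def)
 have "\<exists>T. finite T \<and> card T \<le> n \<and> E = qv.span T" if "R.dimension n K E" "K = \<rat>" for n K E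
  using that
 proof (induction rule: R.dimension.induct)
  case (zero_dim K)
  show ?case by (intro exI[of _ "{}"]) (auto simp: ring_of_type_algebra_def)
 next
  case (Suc_dim v E n K)
  then obtain T where T: "finite T" "card T \<le> n" "E = qv.span T" by blast
  have "u \<in> R.line_extension K v E \<longleftrightarrow> (\<exists>k\<in>K. \<exists>e\<in>E. u = k * v + e)" for u
   using R.line_extension_mem_iff[of u K v E] unfolding ring_of_type_algebra_def by simp
  then have "R.line_extension K v E = {k * v + e | k e. k \<in> \<rat> \<and> e \<in> qv.span T}"
   using T(3) Suc_dim.prems by blast
  also have "\<dots> = qv.span (insert v T)"
  proof (rule Set.set_eqI, rule iffI)
   fix u assume "u \<in> {k * v + e | k e. k \<in> \<rat> \<and> e \<in> qv.span T}"
   then obtain r e where "u = of_rat r * v + e" "e \<in> qv.span T" by (auto simp: Rats_def)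
   then show "u \<in> qv.span (insert v T)"
    unfolding qv.span_insert by (intro CollectI exI[of _ r]) simp
  next
   fix u assume "u \<in> qv.span (insert v T)"
   then obtain r where r: "u - of_rat r * v \<in> qv.span T" by (auto simp: qv.span_insert)
   have "u = of_rat r * v + (u - of_rat r * v)" by simp
   then show "u \<in> {k * v + e | k e. k \<in> \<rat> \<and> e \<in> qv.span T}"
    using r by (intro CollectI exI[of _ "of_rat r"] exI[of _ "u - of_rat r * v"]) auto
  qed
  finally have "R.line_extension K v E = qv.span (insert v T)" .
  moreover have "card (insert v T) \<le> Suc n" using T(1,2) by (simp add: card_insert_if)
  ultimately show ?case using T(1) by (intro exI[of _ "insert v T"]) auto
 qed
 then have "\<exists>T. finite T \<and> card T \<le> l \<and> F = qv.span T" using dim by blast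
 moreover have "1 \<in> F" "\<And>x y. x \<in> F ==> y \<in> F ==> x * y \<in> F"
  using subfieldE[OF sf] subringE[OF subfieldE(1)[OF sf]]
  by (auto simp: ring_of_type_algebra_def)
 ultimately show ?thesis unfolding qalg_def by blast
qed

section \<open>Extending embeddings of number fields\<close>

definition hom_on :: "'a::field_char_0 set => ('a => 'a) => bool" where
 "hom_on S h \<longleftrightarrow> (\<forall>r. h (of_rat r) = of_rat r) \<and>
   (\<forall>x\<in>S. \<forall>y\<in>S. h (x + y) = h x + h y \<and> h (x * y) = h x * h y)"

lemma hom_onD:
 assumes "hom_on S h"
 shows "h (of_rat r) = of_rat r" "h 0 = 0" "h 1 = 1"
  "x \<in> S ==> y \<in> S ==> h (x + y) = h x + h y" "x \<in> S ==> y \<in> S ==> h (x * y) = h x * h y"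
proof -
 have r: "h (of_rat r) = of_rat r" for r using assms by (auto simp: hom_on_def)
 show "h (of_rat r) = of_rat r" by (rule r)
 show "h 0 = 0" "h 1 = 1" using r[of 0] r[of 1] by simp_all
qed (use assms in \<open>auto simp: hom_on_def\<close>)

lemma hom_on_sum:
 assumes "qalg S n" "hom_on S h" "\<And>i. i \<in> A ==> f i \<in> S"
 shows "h (sum f A) = (\<Sum>i\<in>A. h (f i))"
 using assms(3)
proof (induction A rule: infinite_finite_induct)
 case (insert i A)
 then show ?case using hom_onD(4)[OF assms(2)] qalg_sum[OF assms(1), of A f] by simp
qed (simp_all add: hom_onD(2)[OF assms(2)])

lemma hom_on_power:
 "qalg S n ==> hom_on S h ==> x \<in> S ==> h (x ^ k) = h x ^ k"
 by (induction k) (auto simp: hom_onD qalgD)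

lemma hom_on_diff:
 assumes "qalg S n" "hom_on S h" "x \<in> S" "y \<in> S"
 shows "h (x - y) = h x - h y"
 using hom_onD(4)[OF assms(2), of "x - y" y] qalgD(7)[OF assms(1,3,4)] assms(4)
 by (simp add: algebra_simps)

lemma hom_on_nonzero:
 assumes "qalg S n" "hom_on S h" "x \<in> S" "x ~= 0"
 shows "h x ~= 0"
proof
 assume "h x = 0"
 then have "h (x * inverse x) = 0"
  using hom_onD(5)[OF assms(2,3) qalg_inverse[OF assms(1,3)]] by simp
 then show False using assms(4) hom_onD(3)[OF assms(2)] by simp
qed

lemma map_poly_hom_add:
 assumes "hom_on S h" "coeffs_in S p" "coeffs_in S q"
 shows "map_poly h (p + q) = map_poly h p + map_poly h q"
 using assms by (intro poly_eqI) (auto simp: coeff_map_poly hom_onD coeffs_in_def)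

lemma map_poly_hom_mult:
 assumes "qalg S n" "hom_on S h" "coeffs_in S p" "coeffs_in S q"
 shows "map_poly h (p * q) = map_poly h p * map_poly h q"
proof (intro poly_eqI)
 fix k
 have h0: "h 0 = 0" by (rule hom_onD[OF assms(2)])
 have "coeff (map_poly h (p * q)) k = h (\<Sum>i\<le>k. coeff p i * coeff q (k - i))"
  by (simp add: coeff_map_poly h0 coeff_mult)
 also have "\<dots> = (\<Sum>i\<le>k. h (coeff p i * coeff q (k - i)))"
  using assms by (intro hom_on_sum[OF assms(1,2)] qalgD(2)) (auto simp: coeffs_in_def)
 also have "\<dots> = coeff (map_poly h p * map_poly h q) k"
  using assms(3,4) by (simp add: coeff_mult coeff_map_poly h0 hom_onD(5)[OF assms(2)] coeffs_in_def)
 finally show "coeff (map_poly h (p * q)) k = coeff (map_poly h p * map_poly h q) k" .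
qed

lemma map_poly_hom_pCons:
 assumes "hom_on S h"
 shows "map_poly h (pCons a p) = pCons (h a) (map_poly h p)"
 by (intro poly_eqI) (simp add: coeff_map_poly hom_onD(2)[OF assms] coeff_pCons split: nat.splits)

lemma extend_hom:
 assumes S: "qalg S n" and h: "hom_on S h"
  and conj: "\<And>p. coeffs_in S p ==> poly p x = 0 ==> poly (map_poly h p) x' = 0"
 shows "\<exists>h'. hom_on (adjoin S x) h' \<and> (\<forall>y\<in>S. h' y = h y) \<and> h' x = x'"
proof -
 define h' where "h' = (\<lambda>y. poly (map_poly h (SOME p. coeffs_in S p \<and> poly p x = y)) x')"
 have h': "h' (poly p x) = poly (map_poly h p) x'" if p: "coeffs_in S p" for p
 proof -
  define q where "q = (SOME q. coeffs_in S q \<and> poly q x = poly p x)"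
  have q: "coeffs_in S q" "poly q x = poly p x"
   unfolding q_def by (rule someI2[of _ p], use p in auto)+
  have "poly (map_poly h (q - p)) x' = 0" using q p by (intro conj coeffs_in_diff[OF S]) auto
  moreover have "map_poly h (q - p) = map_poly h q - map_poly h p"
   using p q(1) by (intro poly_eqI)
    (auto simp: coeff_map_poly hom_onD(2)[OF h] hom_on_diff[OF S h] coeffs_in_def)
  ultimately show ?thesis by (simp add: h'_def q_def)
 qed
 have S': "h' y = h y" if "y \<in> S" for y
  using h'[of "[:y:]"] that qalgD(5)[OF S] by (simp add: coeffs_in_pCons coeffs_in_0 map_poly_hom_pCons[OF h])
 have "h' (y + z) = h' y + h' z \<and> h' (y * z) = h' y * h' z"
  if yz: "y \<in> adjoin S x" "z \<in> adjoin S x" for y z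
 proof -
  obtain p q where p: "coeffs_in S p" "y = poly p x" and q: "coeffs_in S q" "z = poly q x"
   using yz unfolding adjoin_def by blast
  have "h' (poly (p + q) x) = h' y + h' z" "h' (poly (p * q) x) = h' y * h' z"
   using h'[OF coeffs_in_add[OF S p(1) q(1)]] h'[OF coeffs_in_mult[OF S p(1) q(1)]]
    h'[OF p(1)] h'[OF q(1)] map_poly_hom_add[OF h p(1) q(1)] map_poly_hom_mult[OF S h p(1) q(1)]
   by (simp_all add: p(2) q(2))
  then show ?thesis using p q by simp
 qed
 then have "hom_on (adjoin S x) h'"
  unfolding hom_on_def using S' qalgD(4)[OF S] hom_onD(1)[OF h] by simp
 moreover have "h' x = x'"
  using h'[of "[:0, 1:]"] qalgD(1,5)[OF S]
  by (simp add: coeffs_in_pCons coeffs_in_0 map_poly_hom_pCons[OF h] hom_onD[OF h])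
 ultimately show ?thesis using S' by blast
qed

text \<open>Take a root of the image under \<open>h\<close> of the minimal polynomial of \<open>x\<close> over
 \<open>S\<close>.\<close>

lemma exists_conjugate:
 fixes x :: "'a::{alg_closed_field, field_char_0}"
 assumes S: "qalg S n" and h: "hom_on S h" and f: "coeffs_in S f" "f ~= 0" "poly f x = 0"
 shows "\<exists>x'. \<forall>p. coeffs_in S p --> poly p x = 0 --> poly (map_poly h p) x' = 0"
proof -
 define Q where "Q = (\<lambda>g. coeffs_in S g \<and> g ~= 0 \<and> poly g x = 0)"
 obtain g where g: "Q g" "\<And>p. Q p ==> degree g \<le> degree p"
  using f ex_has_least_nat[of Q f degree] unfolding Q_def by blast
 have g': "coeffs_in S g" "g ~= 0" "poly g x = 0" using g(1) by (auto simp: Q_def)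
 have h0: "h 0 = 0" by (rule hom_onD[OF h])
 have dg: "degree g > 0"
 proof (rule ccontr)
  assume "\<not> degree g > 0"
  then obtain c where "g = [:c:]" by (metis degree_eq_zeroE gr0I)
  then show False using g' by simp
 qed
 have "coeff (map_poly h g) (degree g) ~= 0"
  using g'(1,2) by (simp add: coeff_map_poly h0 coeffs_in_def hom_on_nonzero[OF S h])
 then have "degree (map_poly h g) \<ge> degree g" by (rule le_degree)
 then obtain x' where x': "poly (map_poly h g) x' = 0"
  using alg_closed_imp_poly_has_root[of "map_poly h g"] dg by auto
 have "poly (map_poly h p) x' = 0" if "coeffs_in S p" "poly p x = 0" for p
  using that
 proof (induction "degree p" arbitrary: p rule: less_induct)
  case less
  show ?case
  proof (cases "p = 0")
   case True
   then show ?thesis by simp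
  next
   case False
   then have le: "degree g \<le> degree p" using g(2)[of p] less.prems by (simp add: Q_def)
   define c where "c = lead_coeff p / lead_coeff g"
   define m where "m = monom c (degree p - degree g)"
   have c: "c \<in> S" unfolding c_def using less.prems(1) g'(1)
    by (intro qalg_divide[OF S]) (auto simp: coeffs_in_def)
   have m: "coeffs_in S m" unfolding m_def using c qalgD(5)[OF S] by (rule coeffs_in_monom[rotated])
   have cne: "c ~= 0" using False g'(2) by (simp add: c_def)
   define r where "r = p - m * g"
   have r: "coeffs_in S r" unfolding r_def
    using less.prems(1) m g'(1) by (intro coeffs_in_diff[OF S] coeffs_in_mult[OF S])
   have rx: "poly r x = 0" using less.prems(2) g'(3) by (simp add: r_def)
   have dm1: "degree (m * g) = degree p"
   proof -
    have "degree m = degree p - degree g" unfolding m_def by (rule degree_monom_eq[OF cne])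
    moreover have "m ~= 0" using cne by (simp add: m_def)
    ultimately show ?thesis using g'(2) le by (simp add: degree_mult_eq)
   qed
   have "lead_coeff (m * g) = c * lead_coeff g"
    by (simp add: lead_coeff_mult m_def degree_monom_eq cne)
   also have "\<dots> = lead_coeff p" using g'(2) by (simp add: c_def)
   finally have dm: "degree (m * g) = degree p" "lead_coeff (m * g) = lead_coeff p" using dm1 by auto
   have "poly (map_poly h r) x' = 0"
   proof (cases "r = 0")
    case False
    have "degree r < degree p"
    proof -
     have "degree r \<le> degree p" unfolding r_def using dm(1) by (intro degree_diff_le) auto
     moreover have "coeff r (degree p) = 0" using dm by (simp add: r_def)
     ultimately show ?thesis using False by (metis le_neq_implies_less leading_coeff_0_iff)
    qed
    then show ?thesis using less.hyps r rx by blast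
   qed simp
   moreover have "p = r + m * g" by (simp add: r_def)
   then have "map_poly h p = map_poly h r + map_poly h m * map_poly h g"
    using map_poly_hom_add[OF h r coeffs_in_mult[OF S m g'(1)]] map_poly_hom_mult[OF S h m g'(1)] by simp
   ultimately show ?thesis using x' by simp
  qed
 qed
 then show ?thesis by blast
qed

lemma extend_hom_finite:
 fixes S :: "'a::{alg_closed_field, field_char_0} set"
 assumes "finite A" "qalg S n" "hom_on S h" "\<And>x. x \<in> A ==> \<exists>P. P ~= 0 \<and> ieval P x = 0"
 shows "\<exists>S' n' h'. S \<subseteq> S' \<and> A \<subseteq> S' \<and> qalg S' n' \<and> hom_on S' h' \<and> (\<forall>y\<in>S. h' y = h y)"
 using assms(1,4)
proof (induction A rule: finite_induct)
 case empty
 then show ?case using assms(2,3) by blast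
next
 case (insert x A)
 then obtain S' n' h' where IH: "S \<subseteq> S'" "A \<subseteq> S'" "qalg S' n'" "hom_on S' h'" "\<forall>y\<in>S. h' y = h y"
  by blast
 obtain P where P: "P ~= 0" "ieval P x = 0" using insert.prems by blast
 define f where "f = (map_poly of_int P :: 'a poly)"
 have f: "coeffs_in S' f" "f ~= 0" "poly f x = 0"
  using P qalgD(4)[OF IH(3), of "of_int _"] by (auto simp: f_def coeffs_in_def coeff_map_poly ieval_def)
 obtain x' where "\<forall>p. coeffs_in S' p --> poly p x = 0 --> poly (map_poly h' p) x' = 0"
  using exists_conjugate[OF IH(3,4) f] by blast
 then obtain h2 where h2: "hom_on (adjoin S' x) h2" "\<forall>y\<in>S'. h2 y = h' y"
  using extend_hom[OF IH(3,4), of x x'] by blast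
 have "qalg (adjoin S' x) (n' * degree f)" using qalg_adjoin[OF IH(3) f] by simp
 moreover have "S' \<subseteq> adjoin S' x" "x \<in> adjoin S' x"
  using adjoin_superset adjoin_self qalgD(1,5)[OF IH(3)] by blast+
 ultimately show ?case using h2 IH by (intro exI[of _ "adjoin S' x"] exI[of _ "n' * degree f"] exI[of _ h2]) auto
qed

lemma qalg_image:
 assumes "hom_on S h" "E \<subseteq> S" "qalg S k" "qalg E n"
 shows "qalg (h ` E) n"
proof -
 obtain T where T: "finite T" "card T \<le> n" "E = qv.span T" using assms(4) by (auto simp: qalg_def)
 have scale: "h (of_rat r * x) = of_rat r * h x" if "x \<in> S" for r x
  using hom_onD(1,5)[OF assms(1)] that qalgD(4)[OF assms(3)] by simp
 have "h ` E = qv.span (h ` T)"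
 proof
  have "h x \<in> qv.span (h ` T)" if "x \<in> E" for x
  proof -
   have "x \<in> qv.span T" using that T(3) by simp
   then have "x \<in> E \<and> h x \<in> qv.span (h ` T)"
   proof (induction rule: qv.span_induct_alt)
    case base
    then show ?case using hom_onD(2)[OF assms(1)] qalgD(5)[OF assms(4)] by (simp add: qv.span_zero)
   next
    case (step c t y)
    have t: "t \<in> E" using step(1) T(3) by (simp add: qv.span_base)
    have ct: "of_rat c * t \<in> E" using t qalgD(2,4)[OF assms(4)] by blast
    have "h (of_rat c * t + y) = of_rat c * h t + h y"
     using hom_onD(4)[OF assms(1), of "of_rat c * t" y] ct step(2) assms(2) t scale[of t c]
     by (simp add: subset_iff)
    moreover have "h t \<in> qv.span (h ` T)" using step(1) by (simp add: qv.span_base)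
    then have "of_rat c * h t + h y \<in> qv.span (h ` T)"
     using step(2) by (intro qv.span_add qv.span_scale) auto
    ultimately show ?case using ct step(2) qalgD(3)[OF assms(4)] by simp
   qed
   then show ?thesis by blast
  qed
  then show "h ` E \<subseteq> qv.span (h ` T)" by blast
  have "qv.subspace (h ` E)"
  proof (rule qv.subspaceI)
   show "0 \<in> h ` E" using hom_onD(2)[OF assms(1)] qalgD(5)[OF assms(4)] by (metis imageI)
   show "x + y \<in> h ` E" if "x \<in> h ` E" "y \<in> h ` E" for x y
    using that hom_onD(4)[OF assms(1)] qalgD(3)[OF assms(4)] assms(2) by (smt (verit) imageE imageI subsetD)
   show "of_rat r * x \<in> h ` E" if "x \<in> h ` E" for r x
    using that scale qalgD(2,4)[OF assms(4)] assms(2) by (smt (verit) imageE imageI subsetD)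
  qed
  moreover have "h ` T \<subseteq> h ` E" using T(3) qv.span_superset by blast
  ultimately show "qv.span (h ` T) \<subseteq> h ` E" by (rule qv.span_minimal[rotated])
 qed
 moreover have "1 \<in> h ` E" using hom_onD(3)[OF assms(1)] qalgD(1)[OF assms(4)] by (metis imageI)
 moreover have "x * y \<in> h ` E" if "x \<in> h ` E" "y \<in> h ` E" for x y
  using that hom_onD(5)[OF assms(1)] qalgD(2)[OF assms(4)] assms(2) by (smt (verit) imageE imageI subsetD)
 moreover have "finite (h ` T)" "card (h ` T) \<le> n" using T(1,2) card_image_le[of T h] by auto
 ultimately show ?thesis unfolding qalg_def by blast
qed

section \<open>Primitive roots of unity\<close>

lemma power_gcd_eq_1:
 fixes z :: "'a::field"
 assumes "z ^ a = 1" "z ^ b = 1"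
 shows "z ^ gcd a b = 1"
proof (cases "a = 0")
 case False
 then obtain s t where st: "a * s = b * t + gcd a b" using bezout_nat by blast
 have "z ^ (a * s) = 1" "z ^ (b * t) = 1" using assms by (simp_all add: power_mult)
 then show ?thesis using st by (simp add: power_add)
qed (use assms in simp)

lemma primitive_root_dvd:
 assumes "primitive_root N z" "z ^ k = 1"
 shows "N dvd k"
proof -
 have "z ^ gcd N k = 1" using assms by (intro power_gcd_eq_1) (auto simp: primitive_root_def)
 moreover have "gcd N k > 0" "gcd N k \<le> N" using assms(1) by (auto simp: primitive_root_def gcd_le1_nat)
 ultimately have "gcd N k = N" using assms(1) by (metis le_neq_implies_less primitive_root_def)
 then show ?thesis by (metis gcd_dvd2)
qed

lemma exists_primitive_root:
 assumes "N > 0"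
 shows "\<exists>z::'a::{alg_closed_field, field_char_0}. primitive_root N z"
 using assms
proof (induction N rule: less_induct)
 case (less N)
 show ?case
 proof (cases "N = 1")
  case True
  then show ?thesis by (intro exI[of _ 1]) (simp add: primitive_root_def)
 next
  case False
  then obtain p where p: "prime p" "p dvd N" using prime_factor_nat by blast
  then obtain M where M: "N = p * M" by blast
  have p1: "p > 1" using p(1) prime_gt_1_nat by blast
  have "M > 0" "M < N" using M less.prems p1 by auto
  then obtain z :: 'a where z: "primitive_root M z" using less.IH by blast
  show ?thesis
  proof (cases "p dvd M")
   case True
   obtain w where w: "w ^ p = z" using nth_root_exists[of p z] p1 by auto
   have "primitive_root N w" unfolding primitive_root_def
   proof (intro conjI allI impI)
    show "N > 0" by (rule less.prems)
    show "w ^ N = 1" using z by (simp add: M power_mult w primitive_root_def)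
    fix k assume k: "0 < k" "k < N"
    show "w ^ k ~= 1"
    proof
     assume wk: "w ^ k = 1"
     have "z ^ k = (w ^ k) ^ p" unfolding w[symmetric] by (metis mult.commute power_mult)
     then have "z ^ k = 1" using wk by simp
     then have "M dvd k" using primitive_root_dvd[OF z] by blast
     then obtain k' where k': "k = p * k'" using True dvd_trans by blast
     then have "z ^ k' = 1" using wk by (simp add: power_mult w)
     then have "M dvd k'" using primitive_root_dvd[OF z] by blast
     then have "M \<le> k'" using k k' by (intro dvd_imp_le) auto
     then show False using k(2) k' M by simp
    qed
   qed
   then show ?thesis by blast
  next
   case False
   define f where "f = (\<Sum>i<p. monom (1::'a) i)"
   have "coeff f (p - 1) = 1" using p1 by (simp add: f_def coeff_sum)
   then have "degree f \<ge> p - 1" by (intro le_degree) auto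
   then have "degree f > 0" using p1 by linarith
   then obtain o' where o: "poly f o' = 0" using alg_closed_imp_poly_has_root[of f] by auto
   have fs: "poly f x = (\<Sum>i<p. x ^ i)" for x by (simp add: f_def poly_sum poly_monom)
   have "o' ^ p - 1 = (o' - 1) * (\<Sum>i<p. o' ^ i)" by (rule power_diff_1_eq)
   then have op: "o' ^ p = 1" using o fs by simp
   have o1: "o' ~= 1" using o fs[of 1] p1 by auto
   have prim: "primitive_root p o'" unfolding primitive_root_def
   proof (intro conjI allI impI notI)
    fix k assume k: "0 < k" "k < p" "o' ^ k = 1"
    have "gcd p k = 1" using p(1) k by (metis coprime_iff_gcd_eq_1 nat_dvd_not_less prime_imp_coprime)
    then show False using power_gcd_eq_1[OF op k(3)] o1 by simp
   qed (use p1 op in auto)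
   have "primitive_root N (z * o')" unfolding primitive_root_def
   proof (intro conjI allI impI notI)
    show "N > 0" by (rule less.prems)
    have "z ^ N = (z ^ M) ^ p" by (metis M mult.commute power_mult)
    then show "(z * o') ^ N = 1" using z op by (simp add: power_mult_distrib primitive_root_def) (simp add: M power_mult)
    fix k assume k: "0 < k" "k < N" "(z * o') ^ k = 1"
    have cop: "coprime p M" using p(1) False by (rule prime_imp_coprime)
    have "(z * o') ^ (k * p) = 1" "(z * o') ^ (k * M) = 1" using k(3) by (simp_all add: power_mult)
    moreover have "o' ^ (k * p) = 1" "z ^ (k * M) = 1"
     using op z by (simp_all add: mult.commute[of k] power_mult primitive_root_def)
    ultimately have "z ^ (k * p) = 1" "o' ^ (k * M) = 1" by (simp_all add: power_mult_distrib)
    then have "M dvd k * p" "p dvd k * M" using primitive_root_dvd z prim by blast+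
    then have "M dvd k" "p dvd k"
     using cop by (simp_all add: coprime_dvd_mult_left_iff coprime_commute)
    then have "N dvd k" unfolding M using cop by (intro divides_mult)
    then show False using k by (simp add: nat_dvd_not_less)
   qed
   then show ?thesis by blast
  qed
 qed
qed

lemma root_of_unity_is_power:
 assumes z: "primitive_root N z" and x: "x ^ N = 1"
 shows "\<exists>a. x = z ^ a"
proof -
 define f where "f = monom 1 N - (1 :: 'a poly)"
 have N: "N > 0" using z by (simp add: primitive_root_def)
 have "coeff f 0 = - 1" using N by (simp add: f_def)
 then have f: "f ~= 0" by auto
 have "degree f \<le> N" unfolding f_def by (intro degree_diff_le) (auto simp: degree_monom_le)
 then have card: "card {y. poly f y = 0} \<le> N" using card_poly_roots_bound[OF f] by simp
 have fin: "finite {y. poly f y = 0}" using f by (rule poly_roots_finite)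
 have inj: "inj_on (\<lambda>i. z ^ i) {..<N}" using primitive_root_inj[OF z] by (auto simp: inj_on_def)
 have "(z ^ i) ^ N = 1" for i using z by (metis mult.commute power_mult power_one primitive_root_def)
 then have sub: "(\<lambda>i. z ^ i) ` {..<N} \<subseteq> {y. poly f y = 0}" by (auto simp: f_def poly_monom)
 have "card ((\<lambda>i. z ^ i) ` {..<N}) = N" using inj by (simp add: card_image)
 then have "(\<lambda>i. z ^ i) ` {..<N} = {y. poly f y = 0}"
  using card_subset_eq[OF fin sub] card card_mono[OF fin sub] by simp
 moreover have "poly f x = 0" using x by (simp add: f_def poly_monom)
 ultimately show ?thesis by blast
qed

text \<open>Bezout's identity for the exponents, used to show that a field that contains \<open>x\<close> and
 \<open>y\<close> contains a generator of the cyclic group that they generate.\<close>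

lemma power_gcd_in_qalg:
 assumes "qalg S n" "z ^ a \<in> S" "z ^ b \<in> S" "z ~= 0"
 shows "z ^ gcd a b \<in> S"
proof (cases "a = 0")
 case False
 then obtain s t where st: "a * s = b * t + gcd a b" using bezout_nat by blast
 have "z ^ gcd a b = (z ^ a) ^ s / (z ^ b) ^ t"
  using st assms(4) by (simp add: power_mult[symmetric] power_add)
 then show ?thesis using assms by (simp add: qalg_divide qalgD)
qed (use assms in simp)

section \<open>Torsion points on a conic in the torus\<close>

lemma poly_pderiv_square_mult:
 fixes u :: "'a::field poly"
 shows "poly u r = 0 ==> poly (pderiv (u ^ 2 * G)) r = 0"
 by (simp add: pderiv_mult power2_eq_square)

text \<open>Let \<open>z\<close> generate the group of roots of unity generated by \<open>x\<close> and
 \<open>y\<close>. Since \<open>j\<close> does not divide \<open>N\<close>, some embedding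
 \<open>\<tau>\<close> sends \<open>z\<close> to \<open>z ^ j\<close> and hence \<open>x\<close> and
 \<open>y\<close> to their \<open>j\<close>-th powers. Applying \<open>\<tau>\<close> to the relation and
 eliminating \<open>y\<close> gives an equation of degree at most \<open>2 * j\<close> for \<open>x\<close>
 over the compositum of \<open>E\<close> and its image. Nondegeneracy of the relation keeps that equation from
 being trivial. So \<open>z\<close> lies in a field of degree at most \<open>n * n * (2 * j)\<close>.\<close>

lemma torsion_order_bound:
 fixes x y :: "'a::{alg_closed_field, field_char_0}"
 assumes E: "qalg E n" and co: "l1 \<in> E" "l2 \<in> E" "m1 \<in> E" "m2 \<in> E"
  and ne: "l1 ~= 0" "l2 ~= 0" "l1 * m2 ~= l2 * m1"
  and rel: "y * (m1 * x + m2) = l1 * x + l2"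
  and N: "N > 0" "x ^ N = 1" "y ^ N = 1" and min: "\<And>k. 0 < k ==> x ^ k = 1 ==> y ^ k = 1 ==> N \<le> k"
  and j: "prime j" "\<not> j dvd N"
 shows "totient N \<le> n * n * (2 * j)"
proof -
 obtain z :: 'a where z: "primitive_root N z" using exists_primitive_root[OF N(1)] by blast
 have zN: "z ^ N = 1" and zne: "z ~= 0" using z primitive_root_nonzero by (auto simp: primitive_root_def)
 obtain a b where a: "x = z ^ a" and b: "y = z ^ b" using root_of_unity_is_power[OF z] N by blast
 have g1: "gcd (gcd a b) N = 1"
 proof -
  define g where "g = gcd (gcd a b) N"
  have gN: "g dvd N" "g dvd a" "g dvd b" by (auto simp: g_def intro: dvd_trans[OF gcd_dvd1])
  then obtain M where M: "N = g * M" by blast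
  have "x ^ M = 1" "y ^ M = 1"
  proof -
   obtain a' b' where ab: "a = g * a'" "b = g * b'" using gN by blast
   have "x ^ M = (z ^ N) ^ a'" "y ^ M = (z ^ N) ^ b'"
    unfolding a b ab M by (simp_all add: power_mult[symmetric] ac_simps)
   then show "x ^ M = 1" "y ^ M = 1" by (simp_all add: zN)
  qed
  then have "N \<le> M" using min[of M] M N(1) by (cases "M = 0") auto
  then show ?thesis using M N(1) unfolding g_def[symmetric] by (cases g) auto
 qed
 have Q: "qalg (range of_rat :: 'a set) 1" unfolding qalg_def
 proof (intro conjI exI[of _ "{1::'a}"])
  show "(1::'a) \<in> range of_rat" by (metis of_rat_1 rangeI)
  show "\<forall>x\<in>range of_rat. \<forall>y\<in>range of_rat. x * y \<in> (range of_rat :: 'a set)"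
   by (auto simp: of_rat_mult[symmetric])
  show "(range of_rat :: 'a set) = qv.span {1}" by (auto simp: qv.span_singleton)
 qed auto
 have homQ: "hom_on (range of_rat :: 'a set) (\<lambda>x. x)" by (simp add: hom_on_def)
 have conjz: "poly (map_poly (\<lambda>x. x) p) (z ^ j) = 0" if p: "coeffs_in (range of_rat) p" "poly p z = 0" for p
 proof -
  define c where "c = (\<lambda>i. SOME r. coeff p i = of_rat r)"
  have c: "coeff p i = of_rat (c i)" for i
   unfolding c_def using p(1) by (intro someI_ex[of "\<lambda>r. coeff p i = of_rat r"]) (auto simp: coeffs_in_def)
  obtain D where D: "D > 0" "\<forall>i\<le>degree p. of_int D * c i \<in> \<int>" using common_denominator by blast
  then have "\<forall>i. \<exists>k. i \<le> degree p --> of_int D * c i = of_int k" by (auto elim: Ints_cases)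
  then obtain k where k: "\<And>i. i \<le> degree p ==> of_int D * c i = of_int (k i)" by metis
  define P where "P = (\<Sum>i\<le>degree p. monom (k i) i)"
  have "coeff (map_poly of_int P) i = coeff (smult (of_int D) p) i" for i
  proof (cases "i \<le> degree p")
   case True
   then have "of_rat (of_int D * c i) = (of_rat (of_int (k i)) :: 'a)" using k by simp
   then show ?thesis using True by (simp add: coeff_map_poly P_def coeff_sum of_rat_mult c)
  next
   case False
   then show ?thesis by (simp add: coeff_map_poly P_def coeff_sum coeff_eq_0)
  qed
  then have "map_poly of_int P = smult (of_int D) p" by (intro poly_eqI) blast
  then have P: "ieval P u = of_int D * poly p u" for u by (simp add: ieval_def)
  have "ieval P z = 0" using P p(2) by simp
  then have "ieval P (z ^ j) = 0" using root_of_unity_frobenius[OF zN N(1) j] by blast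
  then show ?thesis using P D(1) by simp
 qed
 define S0 where "S0 = adjoin (range of_rat) z"
 obtain h0 where h0: "hom_on S0 h0" "h0 z = z ^ j"
  using extend_hom[OF Q homQ conjz] unfolding S0_def by blast
 have S0: "qalg S0 N"
 proof -
  define f where "f = monom 1 N - (1 :: 'a poly)"
  have "coeff f 0 = - 1" using N by (simp add: f_def)
  then have f: "f ~= 0" by auto
  have "degree f \<le> N" unfolding f_def by (intro degree_diff_le) (auto simp: degree_monom_le)
  moreover have "coeffs_in (range of_rat) f" unfolding f_def
   using qalgD[OF Q] by (intro coeffs_in_diff[OF Q] coeffs_in_monom coeffs_in_1[OF Q]) auto
  ultimately have "qalg S0 (1 * N)" unfolding S0_def
   using f zN by (intro qalg_adjoin[OF Q]) (auto simp: f_def poly_monom)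
  then show ?thesis by simp
 qed
 have zS0: "z \<in> S0" unfolding S0_def using adjoin_self qalgD(1,5)[OF Q] by blast
 obtain T where T: "finite T" "card T \<le> n" "E = qv.span T" using E by (auto simp: qalg_def)
 have alg: "\<exists>P. P ~= 0 \<and> ieval P t = 0" if "t \<in> T" for t
  using qalg_algebraic[OF E, of t] that T(3) by (metis qv.span_base)
 obtain S' n' h where S': "S0 \<subseteq> S'" "T \<subseteq> S'" "qalg S' n'" "hom_on S' h" "\<forall>y\<in>S0. h y = h0 y"
  using extend_hom_finite[OF T(1) S0 h0(1) alg] by blast
 have ES: "E \<subseteq> S'" using S'(2) T(3) qalgD(9)[OF S'(3)] by (metis qv.span_minimal)
 have hz: "h z = z ^ j" using S'(5) zS0 h0(2) by simp
 have zS: "z \<in> S'" using S'(1) zS0 by blast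
 have hx: "h x = x ^ j" and hy: "h y = y ^ j"
  unfolding a b using hom_on_power[OF S'(3,4) zS] hz by (simp_all add: power_mult[symmetric] mult.commute)
 have xS: "x \<in> S'" "y \<in> S'" unfolding a b using qalgD(8)[OF S'(3) zS] by auto
 have coS: "l1 \<in> S'" "l2 \<in> S'" "m1 \<in> S'" "m2 \<in> S'" using co ES by auto
 have rel': "y ^ j * (h m1 * x ^ j + h m2) = h l1 * x ^ j + h l2"
 proof -
  have "h (y * (m1 * x + m2)) = h (l1 * x + l2)" using rel by simp
  then show ?thesis using xS coS hom_onD(4,5)[OF S'(4)] qalgD(2,3)[OF S'(3)] hx hy by simp
 qed
 have l12: "h l1 ~= 0" "h l2 ~= 0" using hom_on_nonzero[OF S'(3,4)] coS ne by auto
 have hE: "qalg (h ` E) n" by (rule qalg_image[OF S'(4) ES S'(3) E])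
 obtain C where C: "E \<subseteq> C" "h ` E \<subseteq> C" "qalg C (n * n)" using qalg_compositum[OF E hE] by blast
 have coC: "l1 \<in> C" "l2 \<in> C" "m1 \<in> C" "m2 \<in> C" "h l1 \<in> C" "h l2 \<in> C" "h m1 \<in> C" "h m2 \<in> C"
  using co C by auto
 have j2: "j \<ge> 2" using j(1) by (rule prime_ge_2_nat)
 define A1 where "A1 = monom (h l1) j + [:h l2:]"
 define A2 where "A2 = monom (h m1) j + [:h m2:]"
 define P where "P = A1 * [:m2, m1:] ^ j - A2 * [:l2, l1:] ^ j"
 have c0: "coeffs_in C 0" using qalgD(5)[OF C(3)] by (rule coeffs_in_0)
 have PC: "coeffs_in C P" unfolding P_def A1_def A2_def
  using coC qalgD(5)[OF C(3)] c0
  by (intro coeffs_in_diff[OF C(3)] coeffs_in_mult[OF C(3)] coeffs_in_add[OF C(3)] coeffs_in_power[OF C(3)] coeffs_in_monom)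
    (auto simp: coeffs_in_pCons)
 have degs: "degree P \<le> 2 * j"
 proof -
  have 1: "degree A1 \<le> j" "degree A2 \<le> j"
   unfolding A1_def A2_def by (intro degree_add_le; simp add: degree_monom_le)+
  have 2: "degree ([:u, v:] ^ j) \<le> j" for u v :: 'a
  proof -
   have "degree [:u, v:] \<le> 1" by simp
   then have "degree [:u, v:] * j \<le> j" by (metis mult_1 mult_le_mono1)
   then show ?thesis by (rule le_trans[OF degree_power_le])
  qed
  have "degree (A1 * [:m2, m1:] ^ j) \<le> j + j" "degree (A2 * [:l2, l1:] ^ j) \<le> j + j"
   using 1 2 by (meson add_mono degree_mult_le le_trans)+
  then show ?thesis unfolding P_def by (intro degree_diff_le) auto
 qed
 have Px: "poly P x = 0"
 proof -
  have "poly P x = (h l1 * x ^ j + h l2) * (m1 * x + m2) ^ j - (h m1 * x ^ j + h m2) * (l1 * x + l2) ^ j"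
   by (simp add: P_def A1_def A2_def poly_monom algebra_simps)
  also have "\<dots> = 0" unfolding rel'[symmetric] rel[symmetric] power_mult_distrib by (simp add: mult.assoc mult.left_commute)
  finally show ?thesis .
 qed
 have Pne: "P ~= 0"
 proof
  assume "P = 0"
  define r where "r = - l2 / l1"
  have r0: "r ~= 0" using ne by (simp add: r_def)
  have lr: "[:l2, l1:] = smult l1 [:- r, 1:]" using ne(1) by (simp add: r_def)
  have "[:- r, 1:] ^ j dvd A2 * [:l2, l1:] ^ j" unfolding lr by (simp only: smult_power mult_smult_right dvd_smult dvd_mult dvd_refl)
  then have "[:- r, 1:] ^ j dvd A1 * [:m2, m1:] ^ j" using \<open>P = 0\<close> by (simp add: P_def)
  moreover have "[:- r, 1:] ^ 2 dvd [:- r, 1:] ^ j" using j2 by (rule le_imp_power_dvd)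
  ultimately have d2: "[:- r, 1:] ^ 2 dvd A1 * [:m2, m1:] ^ j" by (rule dvd_trans[rotated])
  have mr: "poly [:m2, m1:] r ~= 0"
  proof
   assume "poly [:m2, m1:] r = 0"
   then have "m2 = l2 / l1 * m1" by (simp add: r_def)
   then show False using ne by simp
  qed
  obtain G where G: "A1 * [:m2, m1:] ^ j = [:- r, 1:] ^ 2 * G" using d2 by blast
  have "poly (A1 * [:m2, m1:] ^ j) r = 0" unfolding G by simp
  then have A1r: "poly A1 r = 0" using mr by simp
  have "poly (pderiv (A1 * [:m2, m1:] ^ j)) r = 0"
   unfolding G by (rule poly_pderiv_square_mult) simp
  then have "poly (pderiv A1) r * poly [:m2, m1:] r ^ j = 0"
   using A1r by (auto simp: pderiv_mult)
  then have "poly (pderiv A1) r = 0" using mr by simp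
  then have "of_nat j * h l1 * r ^ (j - 1) = 0"
   by (simp add: A1_def pderiv_add pderiv_monom poly_monom pderiv_pCons)
  then show False using l12 r0 j2 by simp
 qed
 define C' where "C' = adjoin C x"
 have C': "qalg C' (n * n * (2 * j))" unfolding C'_def by (rule qalg_adjoin[OF C(3) PC Pne Px degs])
 have CC': "C \<subseteq> C'" "x \<in> C'" unfolding C'_def using adjoin_superset adjoin_self qalgD(1,5)[OF C(3)] by blast+
 have mx: "m1 * x + m2 ~= 0"
 proof
  assume m0: "m1 * x + m2 = 0"
  then have "l1 * x + l2 = 0" using rel by simp
  then have "l1 * (m1 * x + m2) - m1 * (l1 * x + l2) = 0" using m0 by simp
  then show False using ne(3) by (simp add: algebra_simps)
 qed
 then have "y = (l1 * x + l2) / (m1 * x + m2)" using rel by (simp add: field_simps)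
 also have "\<dots> \<in> C'" using CC' coC by (intro qalg_divide[OF C'] qalgD(2,3)[OF C']) auto
 finally have yC': "z ^ b \<in> C'" using b by simp
 have xC': "z ^ a \<in> C'" using CC' a by simp
 have "z ^ N \<in> C'" using zN qalgD(1)[OF C'] by simp
 then have "z ^ gcd (gcd a b) N \<in> C'"
  using power_gcd_in_qalg[OF C'] power_gcd_in_qalg[OF C' xC' yC' zne] zne by blast
 then have "z \<in> C'" using g1 by simp
 then show ?thesis using totient_le_of_qalg[OF C' _ z] by blast
qed

text \<open>The previous bound is applied to the least prime \<open>j\<close> that does not divide
 \<open>N\<close>; it is so small compared with the totient that it cancels: \<open>j ^ 2 * N \<le> 64 *
 totient N ^ 2 \<le> 256 * n ^ 4 * j ^ 2\<close>.\<close>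

lemma torsion_order_absolute_bound:
 fixes x y :: "'a::{alg_closed_field, field_char_0}"
 assumes E: "qalg E n" and co: "l1 \<in> E" "l2 \<in> E" "m1 \<in> E" "m2 \<in> E"
  and ne: "l1 ~= 0" "l2 ~= 0" "l1 * m2 ~= l2 * m1"
  and rel: "y * (m1 * x + m2) = l1 * x + l2"
  and N: "N > 0" "x ^ N = 1" "y ^ N = 1" and min: "\<And>k. 0 < k ==> x ^ k = 1 ==> y ^ k = 1 ==> N \<le> k"
  and n: "n \<ge> 24"
 shows "N \<le> 256 * n ^ 4"
proof (rule ccontr)
 assume "\<not> N \<le> 256 * n ^ 4"
 then have big: "256 * n ^ 4 < N" by simp
 have "(24::nat) ^ 4 \<le> n ^ 4" using n by (rule power_mono) simp
 then have N0: "84934656 \<le> N" using big by simp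
 define Q where "Q = (\<lambda>p. prime p \<and> \<not> p dvd N)"
 obtain p where "prime p" "p > N" using bigger_prime by blast
 then have "Q p" using N(1) by (auto simp: Q_def dest: dvd_imp_le)
 define j where "j = (LEAST p. Q p)"
 have Qj: "Q j" unfolding j_def using \<open>Q p\<close> by (rule LeastI)
 have less: "p dvd N" if "prime p" "p < j" for p
  using not_less_Least[of p Q] that by (auto simp: j_def Q_def)
 have j: "prime j" "\<not> j dvd N" using Qj by (auto simp: Q_def)
 have "totient N \<le> n * n * (2 * j)"
  by (rule torsion_order_bound[OF E co ne rel N min j])
 then have "(totient N)\<^sup>2 \<le> (n * n * (2 * j))\<^sup>2" by (intro power_mono) auto
 then have "64 * (totient N)\<^sup>2 \<le> j\<^sup>2 * (256 * n ^ 4)"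
  by (simp add: power2_eq_square power4_eq_xxxx ac_simps)
 moreover have "j\<^sup>2 * N \<le> 64 * (totient N)\<^sup>2"
  by (rule least_nondividing_prime_bound[OF N0 j(1) less])
 ultimately have "j\<^sup>2 * N \<le> j\<^sup>2 * (256 * n ^ 4)" by (rule order_trans[rotated])
 moreover have "j > 0" using j(1) prime_gt_0_nat by blast
 ultimately show False using big by simp
qed

lemma root_of_unity_order_bound:
 fixes z :: "'a::field_char_0"
 assumes "qalg S n" "z \<in> S" "k > 0" "z ^ k = 1"
 obtains N where "N > 0" "z ^ N = 1" "N \<le> 2 * n\<^sup>2"
proof -
 define N where "N = (LEAST k. 0 < k \<and> z ^ k = 1)"
 have N: "0 < N" "z ^ N = 1" using LeastI[of "\<lambda>k. 0 < k \<and> z ^ k = 1" k] assms(3,4) by (auto simp: N_def)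
 have "primitive_root N z" unfolding primitive_root_def
  using N not_less_Least[of _ "\<lambda>k. 0 < k \<and> z ^ k = 1"] by (auto simp: N_def)
 then have "totient N \<le> n" using totient_le_of_qalg assms by blast
 then have "(totient N)\<^sup>2 \<le> n\<^sup>2" by (intro power_mono) auto
 then have "N \<le> 2 * n\<^sup>2" using totient_square_ge_half[OF N(1)] by linarith
 then show ?thesis using that N by blast
qed

section \<open>Descent of solutions of linear systems to a subfield\<close>

text \<open>A substitute for an \<open>F\<close>-linear retraction of \<open>K\<close> onto \<open>F\<close>,
 on finitely many elements only.\<close>

lemma descent:
 fixes F :: "'a::field_char_0 set"
 assumes F: "qalg F l" and "finite U"
 shows "\<exists>\<pi>. (\<forall>x\<in>insert 1 U. \<pi> x \<in> F) \<and> \<pi> 1 = 1 \<and>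
  (\<forall>a. (\<forall>x\<in>insert 1 U. a x \<in> F) --> (\<Sum>x\<in>insert 1 U. a x * x) = 0 --> (\<Sum>x\<in>insert 1 U. a x * \<pi> x) = 0)"
 using assms(2)
proof (induction U rule: finite_induct)
 case empty
 show ?case using qalgD(1)[OF F] by (intro exI[of _ "\<lambda>x. x"]) auto
next
 case (insert x U)
 obtain \<pi> where P: "(\<forall>x\<in>insert 1 U. \<pi> x \<in> F) \<and> \<pi> 1 = 1 \<and>
  (\<forall>a. (\<forall>x\<in>insert 1 U. a x \<in> F) --> (\<Sum>x\<in>insert 1 U. a x * x) = 0 --> (\<Sum>x\<in>insert 1 U. a x * \<pi> x) = 0)"
  using insert.IH by (rule exE)
 note pi = P[THEN conjunct1, rule_format] P[THEN conjunct2, THEN conjunct1]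
  P[THEN conjunct2, THEN conjunct2, rule_format]
 define Y where "Y = insert 1 U"
 have finY: "finite Y" using insert.hyps by (simp add: Y_def)
 show ?case
 proof (cases "x = 1")
  case True
  then have "insert 1 (insert x U) = insert 1 U" by simp
  then show ?thesis using pi by (intro exI[of _ \<pi>]) auto
 next
  case False
  then have xY: "x \<notin> Y" using insert.hyps by (simp add: Y_def)
  have eq: "insert 1 (insert x U) = insert x Y" by (auto simp: Y_def)
  show ?thesis
  proof (cases "\<exists>b. (\<forall>y\<in>Y. b y \<in> F) \<and> x = (\<Sum>y\<in>Y. b y * y)")
   case True
   then obtain b where b: "\<And>y. y \<in> Y ==> b y \<in> F" "x = (\<Sum>y\<in>Y. b y * y)" by blast
   define p where "p = \<pi>(x := (\<Sum>y\<in>Y. b y * \<pi> y))"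
   have pY: "p y = \<pi> y" if "y \<in> Y" for y using that xY by (auto simp: p_def)
   have px: "p x = (\<Sum>y\<in>Y. b y * \<pi> y)" by (simp add: p_def)
   have "p y \<in> F" if "y \<in> insert x Y" for y
    using that pi(1) b(1) by (auto simp: p_def Y_def[symmetric] intro!: qalg_sum[OF F] qalgD(2)[OF F])
   moreover have "p 1 = 1" using pY[of 1] pi(2) by (simp add: Y_def)
   moreover have "(\<Sum>y\<in>insert x Y. a y * p y) = 0"
    if a: "\<And>y. y \<in> insert x Y ==> a y \<in> F" and 0: "(\<Sum>y\<in>insert x Y. a y * y) = 0" for a
   proof -
    have "(\<Sum>y\<in>Y. (a y + a x * b y) * y) = (\<Sum>y\<in>Y. a y * y) + a x * (\<Sum>y\<in>Y. b y * y)"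
     by (simp add: algebra_simps sum.distrib sum_distrib_left)
    also have "\<dots> = (\<Sum>y\<in>insert x Y. a y * y)"
     using finY xY unfolding b(2)[symmetric] by simp
    finally have "(\<Sum>y\<in>Y. (a y + a x * b y) * y) = (\<Sum>y\<in>insert x Y. a y * y)" .
    then have "(\<Sum>y\<in>Y. (a y + a x * b y) * y) = 0" using 0 by simp
    then have "(\<Sum>y\<in>Y. (a y + a x * b y) * \<pi> y) = 0"
     unfolding Y_def using a b(1) by (intro pi(3)) (auto simp: Y_def intro!: qalgD(2,3)[OF F])
    also have "(\<Sum>y\<in>Y. (a y + a x * b y) * \<pi> y) = a x * p x + (\<Sum>y\<in>Y. a y * \<pi> y)"
     unfolding px by (simp add: algebra_simps sum.distrib sum_distrib_left)
    also have "(\<Sum>y\<in>Y. a y * \<pi> y) = (\<Sum>y\<in>Y. a y * p y)" by (intro sum.cong) (auto simp: pY)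
    finally show ?thesis using finY xY by simp
   qed
   ultimately show ?thesis unfolding eq by (intro exI[of _ p] conjI ballI allI impI) blast+
  next
   case no: False
   define p where "p = \<pi>(x := 0)"
   have pY: "p y = \<pi> y" if "y \<in> Y" for y using that xY by (auto simp: p_def)
   have "p y \<in> F" if "y \<in> insert x Y" for y
    using that pi(1) qalgD(5)[OF F] by (auto simp: p_def Y_def)
   moreover have "p 1 = 1" using pY[of 1] pi(2) by (simp add: Y_def)
   moreover have "(\<Sum>y\<in>insert x Y. a y * p y) = 0"
    if a: "\<And>y. y \<in> insert x Y ==> a y \<in> F" and 0: "(\<Sum>y\<in>insert x Y. a y * y) = 0" for a
   proof -
    have 1: "a x * x + (\<Sum>y\<in>Y. a y * y) = 0" using 0 finY xY by simp
    have ax: "a x = 0"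
    proof (rule ccontr)
     assume ne: "a x ~= 0"
     have "a x * x = - (\<Sum>y\<in>Y. a y * y)" using 1 by (simp add: eq_neg_iff_add_eq_0)
     then have "x = - (\<Sum>y\<in>Y. a y * y) / a x" using ne by (simp add: field_simps)
     also have "\<dots> = (\<Sum>y\<in>Y. (- a y / a x) * y)"
      by (simp add: sum_divide_distrib sum_negf)
     finally have "x = (\<Sum>y\<in>Y. (- a y / a x) * y)" .
     moreover have "- a y / a x \<in> F" if "y \<in> Y" for y
      using a that by (intro qalg_divide[OF F] qalgD(6)[OF F]) auto
     ultimately have "\<exists>b. (\<forall>y\<in>Y. b y \<in> F) \<and> x = (\<Sum>y\<in>Y. b y * y)"
      by (intro exI[of _ "\<lambda>y. - a y / a x"] conjI ballI)
     then show False using no by (rule notE[rotated])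
    qed
    then have "(\<Sum>y\<in>Y. a y * \<pi> y) = 0"
     unfolding Y_def using a 1 by (intro pi(3)) (auto simp: Y_def)
    moreover have "(\<Sum>y\<in>Y. a y * \<pi> y) = (\<Sum>y\<in>Y. a y * p y)" by (intro sum.cong) (auto simp: pY)
    ultimately show ?thesis using finY xY ax by simp
   qed
   ultimately show ?thesis unfolding eq by (intro exI[of _ p] conjI ballI allI impI) blast+
  qed
 qed
qed

lemma descent_family:
 fixes F :: "'a::field_char_0 set"
 assumes F: "qalg F l" and "finite U"
 shows "\<exists>\<pi>. (\<forall>x\<in>U. \<pi> x \<in> F) \<and> \<pi> 1 = 1 \<and> \<pi> 0 = 0 \<and>
  (\<forall>x (I :: 'i set) a v. x \<in> U --> finite I --> (\<forall>i\<in>I. a i \<in> F \<and> v i \<in> U) -->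
    x = (\<Sum>i\<in>I. a i * v i) --> \<pi> x = (\<Sum>i\<in>I. a i * \<pi> (v i)))"
proof -
 define Y where "Y = insert 1 (insert 0 U)"
 have finY: "finite Y" using assms(2) by (simp add: Y_def)
 have fin0: "finite (insert 0 U)" using assms(2) by simp
 obtain \<pi> where P: "(\<forall>x\<in>Y. \<pi> x \<in> F) \<and> \<pi> 1 = 1 \<and>
  (\<forall>a. (\<forall>x\<in>Y. a x \<in> F) --> (\<Sum>x\<in>Y. a x * x) = 0 --> (\<Sum>x\<in>Y. a x * \<pi> x) = 0)"
  using descent[OF F fin0] unfolding Y_def by (rule exE)
 note pi = P[THEN conjunct1, rule_format] P[THEN conjunct2, THEN conjunct1]
  P[THEN conjunct2, THEN conjunct2, rule_format]
 have fam: "\<pi> x = (\<Sum>i\<in>I. a i * \<pi> (v i))"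
  if x: "x \<in> Y" and I: "finite I" "\<And>i. i \<in> I ==> a i \<in> F \<and> v i \<in> Y" and eq: "x = (\<Sum>i\<in>I. a i * v i)"
  for x and I :: "'i set" and a v
 proof -
  define c where "c = (\<lambda>y. (\<Sum>i\<in>{i\<in>I. v i = y}. a i) - (if y = x then 1 else 0))"
  have cF: "c y \<in> F" for y
   using I(2) qalgD(1,5)[OF F] unfolding c_def by (intro qalgD(7)[OF F] qalg_sum[OF F]) auto
  have gen: "(\<Sum>y\<in>Y. c y * g y) = (\<Sum>i\<in>I. a i * g (v i)) - g x" for g
  proof -
   have "(\<Sum>y\<in>Y. c y * g y) = (\<Sum>y\<in>Y. (\<Sum>i\<in>{i\<in>I. v i = y}. a i) * g y) - (\<Sum>y\<in>Y. (if y = x then 1 else 0) * g y)"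
    by (simp add: c_def left_diff_distrib sum_subtractf)
   also have "(\<Sum>y\<in>Y. (if y = x then 1 else 0) * g y) = (\<Sum>y\<in>Y. if y = x then g y else 0)"
    by (intro sum.cong) auto
   also have "\<dots> = g x" using x finY by simp
   also have "(\<Sum>y\<in>Y. (\<Sum>i\<in>{i\<in>I. v i = y}. a i) * g y) = (\<Sum>y\<in>Y. \<Sum>i\<in>{i\<in>I. v i = y}. a i * g (v i))"
    by (auto simp: sum_distrib_right intro!: sum.cong)
   also have "\<dots> = (\<Sum>i\<in>I. a i * g (v i))"
    using I finY by (intro sum.group) auto
   finally show ?thesis .
  qed
  have "(\<Sum>y\<in>Y. c y * y) = 0" using gen[of "\<lambda>y. y"] eq by simp
  then have "(\<Sum>y\<in>Y. c y * \<pi> y) = 0" using pi(3)[of c] cF by blast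
  then show ?thesis using gen[of \<pi>] by simp
 qed
 have "(\<Sum>x\<in>Y. (if x = 0 then 1 else 0) * \<pi> x) = 0"
  using qalgD(1,5)[OF F] by (intro pi(3)) (auto intro!: sum.neutral)
 also have "(\<Sum>x\<in>Y. (if x = 0 then 1 else 0) * \<pi> x) = (\<Sum>x\<in>Y. if x = 0 then \<pi> x else 0)"
  by (intro sum.cong) auto
 also have "\<dots> = \<pi> 0" using finY by (simp add: Y_def)
 finally have "\<pi> 0 = 0" .
 then show ?thesis
  using pi(1,2) by (intro exI[of _ \<pi>] conjI ballI allI impI fam) (auto simp: Y_def)
qed

text \<open>Divide \<open>c\<close> by its leading coefficient, write down that its multiples are combinations
 of the rational elements \<open>w\<close>, and apply the descent map to all coefficients. The leading
 coefficient 1 is preserved.\<close>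

lemma descend_span_multiples:
 fixes F :: "'a::field_char_0 set"
 assumes F: "qalg F l" and W: "\<And>w. w \<in> W ==> coeffs_in F w" and c: "c ~= 0" and M: "finite M"
  and sp: "\<And>m. m \<in> M ==> monom 1 m * c \<in> pv.span W"
 shows "\<exists>c'. c' ~= 0 \<and> coeffs_in F c' \<and> degree c' = degree c \<and> (\<forall>m\<in>M. monom 1 m * c' \<in> pv.span W)"
proof -
 define c1 where "c1 = smult (inverse (lead_coeff c)) c"
 have c1: "lead_coeff c1 = 1" "degree c1 = degree c" using c by (auto simp: c1_def)
 have "monom 1 m * c1 \<in> pv.span W" if "m \<in> M" for m
  unfolding c1_def mult_smult_right using sp[OF that] by (rule pv.span_scale)
 then have "\<exists>T r. finite T \<and> T \<subseteq> W \<and> monom 1 m * c1 = (\<Sum>a\<in>T. smult (r a) a)" if "m \<in> M" for m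
  using that unfolding pv.span_explicit by blast
 then obtain T r where T: "\<And>m. m \<in> M ==> finite (T m)" "\<And>m. m \<in> M ==> T m \<subseteq> W"
  "\<And>m. m \<in> M ==> monom 1 m * c1 = (\<Sum>a\<in>T m. smult (r m a) a)"
  by metis
 define U where "U = insert 0 ((\<lambda>i. coeff c1 i) ` {..degree c1} \<union> (\<Union>m\<in>M. r m ` T m))"
 have finU: "finite U" using M T(1) by (simp add: U_def)
 have coU: "coeff c1 i \<in> U" for i
  by (cases "i \<le> degree c1") (auto simp: U_def coeff_eq_0)
 obtain \<pi> where P: "(\<forall>x\<in>U. \<pi> x \<in> F) \<and> \<pi> 1 = 1 \<and> \<pi> 0 = 0 \<and>
  (\<forall>x (I :: 'a poly set) a v. x \<in> U --> finite I --> (\<forall>i\<in>I. a i \<in> F \<and> v i \<in> U) -->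
    x = (\<Sum>i\<in>I. a i * v i) --> \<pi> x = (\<Sum>i\<in>I. a i * \<pi> (v i)))"
  using descent_family[OF F finU] by (rule exE)
 note pi = P[THEN conjunct1, rule_format] P[THEN conjunct2, THEN conjunct1]
  P[THEN conjunct2, THEN conjunct2, THEN conjunct1] P[THEN conjunct2, THEN conjunct2, THEN conjunct2, rule_format]
 define c' where "c' = map_poly \<pi> c1"
 have c'c: "coeff c' i = \<pi> (coeff c1 i)" for i by (simp add: c'_def coeff_map_poly pi(3))
 have "degree c' \<le> degree c1" unfolding c'_def by (rule map_poly_degree_leq)
 moreover have "coeff c' (degree c1) = 1" using c1(1) pi(2) by (simp add: c'c)
 moreover then have "degree c1 \<le> degree c'" by (intro le_degree) simp
 ultimately have deg: "degree c' = degree c" "c' ~= 0" using c1(2) by auto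
 have "monom 1 m * c' \<in> pv.span W" if m: "m \<in> M" for m
 proof -
  have "monom 1 m * c' = (\<Sum>a\<in>T m. smult (\<pi> (r m a)) a)"
  proof (intro poly_eqI)
   fix n
   have rel: "coeff (monom 1 m * c1) n = (\<Sum>a\<in>T m. coeff a n * r m a)"
    using T(3)[OF m] by (simp add: coeff_sum mult.commute)
   have "coeff (monom 1 m * c') n = \<pi> (coeff (monom 1 m * c1) n)"
    by (simp add: coeff_monom_mult c'c pi(3))
   also have "\<dots> = (\<Sum>a\<in>T m. coeff a n * \<pi> (r m a))"
   proof (rule pi(4)[OF _ T(1)[OF m] _ rel])
    show "coeff (monom 1 m * c1) n \<in> U" using coU by (auto simp: coeff_monom_mult U_def)
    show "coeff i n \<in> F \<and> r m i \<in> U" if "i \<in> T m" for i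
     using that m T(2)[OF m] W by (auto simp: U_def coeffs_in_def)
   qed
   finally show "coeff (monom 1 m * c') n = coeff (\<Sum>a\<in>T m. smult (\<pi> (r m a)) a) n"
    by (simp add: coeff_sum mult.commute)
  qed
  also have "\<dots> \<in> pv.span W" using T(2)[OF m] by (intro pv.span_sum pv.span_scale pv.span_base) auto
  finally show ?thesis .
 qed
 moreover have "coeffs_in F c'" unfolding coeffs_in_def c'c using pi(1) coU by blast
 ultimately show ?thesis using deg by blast
qed

lemma descend_bezout:
 fixes F :: "'a::field_char_0 set"
 assumes F: "qalg F l" and s: "coeffs_in F s" and a: "coeffs_in F a" and uh: "u * s + h * a = 1"
 obtains u' where "coeffs_in F u'" "a dvd s * u' - 1"
proof -
 define U where "U = insert 1 (insert 0 ((\<lambda>i. coeff u i) ` {..degree u} \<union> (\<lambda>i. coeff h i) ` {..degree h}))"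
 have finU: "finite U" by (simp add: U_def)
 have coU: "coeff u i \<in> U" "coeff h i \<in> U" for i
  by (cases "i \<le> degree u"; auto simp: U_def coeff_eq_0) (cases "i \<le> degree h"; auto simp: U_def coeff_eq_0)
 obtain \<pi> where P: "(\<forall>x\<in>U. \<pi> x \<in> F) \<and> \<pi> 1 = 1 \<and> \<pi> 0 = 0 \<and>
  (\<forall>x (I :: (bool \<times> nat) set) a v. x \<in> U --> finite I --> (\<forall>i\<in>I. a i \<in> F \<and> v i \<in> U) -->
    x = (\<Sum>i\<in>I. a i * v i) --> \<pi> x = (\<Sum>i\<in>I. a i * \<pi> (v i)))"
  using descent_family[OF F finU] by (rule exE)
 note pi = P[THEN conjunct1, rule_format] P[THEN conjunct2, THEN conjunct1]
  P[THEN conjunct2, THEN conjunct2, THEN conjunct1] P[THEN conjunct2, THEN conjunct2, THEN conjunct2, rule_format]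
 define u' where "u' = map_poly \<pi> u"
 define h' where "h' = map_poly \<pi> h"
 have c: "coeff u' i = \<pi> (coeff u i)" "coeff h' i = \<pi> (coeff h i)" for i
  by (simp_all add: u'_def h'_def coeff_map_poly pi(3))
 have "s * u' + a * h' = 1"
 proof (intro poly_eqI)
  fix n
  define A where "A = (\<lambda>(b, i). if b then coeff s i else coeff a i)"
  define V where "V = (\<lambda>(b, i). if b then coeff u (n - i) else coeff h (n - i))"
  have split: "(\<Sum>i\<in>UNIV \<times> {..n}. g i) = (\<Sum>i\<le>n. g (True, i)) + (\<Sum>i\<le>n. g (False, i))" for g :: "_ => 'a"
   using sum.cartesian_product[of "\<lambda>x y. g (x, y)" "{..n}" UNIV] by (simp add: UNIV_bool add.commute)
  have "coeff 1 n = coeff (s * u + a * h) n" using uh by (simp add: mult.commute)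
  also have "\<dots> = (\<Sum>i\<in>UNIV \<times> {..n}. A i * V i)" by (simp add: coeff_mult split A_def V_def)
  finally have rel: "coeff 1 n = (\<Sum>i\<in>UNIV \<times> {..n}. A i * V i)" .
  have "\<pi> (coeff 1 n) = (\<Sum>i\<in>UNIV \<times> {..n}. A i * \<pi> (V i))"
  proof (rule pi(4)[OF _ _ _ rel])
   show "coeff 1 n \<in> U" by (simp add: U_def)
   show "A i \<in> F \<and> V i \<in> U" for i
    using s a coU by (cases i) (auto simp: A_def V_def coeffs_in_def)
  qed simp
  also have "\<dots> = coeff (s * u' + a * h') n" by (simp add: coeff_mult split A_def V_def c)
  finally show "coeff (s * u' + a * h') n = coeff 1 n" using pi(2,3) by (cases "n = 0") auto
 qed
 then have "s * u' - 1 = a * (- h')" by (simp add: algebra_simps)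
 moreover have "coeffs_in F u'" using pi(1) coU by (simp add: coeffs_in_def c)
 ultimately show ?thesis using that by (metis dvd_triv_left)
qed

section \<open>Subalgebras of codimension two of a polynomial ring\<close>

definition subalg :: "'a::field poly set => bool" where
 "subalg A \<longleftrightarrow> pv.subspace A \<and> 1 \<in> A \<and> (\<forall>f\<in>A. \<forall>g\<in>A. f * g \<in> A)"

lemma subalgD:
 assumes "subalg A"
 shows "pv.subspace A" "1 \<in> A" "0 \<in> A" "\<And>f g. f \<in> A ==> g \<in> A ==> f * g \<in> A"
  "\<And>f g. f \<in> A ==> g \<in> A ==> f + g \<in> A" "\<And>f g. f \<in> A ==> g \<in> A ==> f - g \<in> A"
  "\<And>f c. f \<in> A ==> smult c f \<in> A" "\<And>c. [:c:] \<in> A" "\<And>f n. f \<in> A ==> f ^ n \<in> A"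
proof -
 show s: "pv.subspace A" and one: "1 \<in> A" and m: "\<And>f g. f \<in> A ==> g \<in> A ==> f * g \<in> A"
  using assms by (auto simp: subalg_def)
 show "0 \<in> A" using s by (rule pv.subspace_0)
 show "\<And>f g. f \<in> A ==> g \<in> A ==> f + g \<in> A" using s by (rule pv.subspace_add)
 show "\<And>f g. f \<in> A ==> g \<in> A ==> f - g \<in> A" using s by (rule pv.subspace_diff)
 show sc: "\<And>f c. f \<in> A ==> smult c f \<in> A" using s by (rule pv.subspace_scale)
 show "[:c:] \<in> A" for c using sc[OF one, of c] by (simp add: one_pCons)
 show "f ^ n \<in> A" if "f \<in> A" for f n using that by (induction n) (auto intro: one m)
qed

lemma subalg_smult_cancel:
 assumes "subalg A" "smult c f \<in> A" "c ~= 0"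
 shows "f \<in> A"
 using subalgD(7)[OF assms(1,2), of "inverse c"] assms(3) by simp

definition alg_char :: "'a::field poly set => ('a poly => 'a) => bool" where
 "alg_char B \<chi> \<longleftrightarrow> \<chi> 1 = 1 \<and> (\<forall>f\<in>B. \<forall>g\<in>B. \<chi> (f + g) = \<chi> f + \<chi> g \<and> \<chi> (f * g) = \<chi> f * \<chi> g) \<and>
   (\<forall>f\<in>B. \<forall>c. \<chi> (smult c f) = c * \<chi> f)"

definition point_derivation :: "'a::field poly set => ('a poly => 'a) => ('a poly => 'a) => bool" where
 "point_derivation B \<chi> \<phi> \<longleftrightarrow>
   (\<forall>f\<in>B. \<forall>g\<in>B. \<phi> (f + g) = \<phi> f + \<phi> g \<and> \<phi> (f * g) = \<chi> f * \<phi> g + \<chi> g * \<phi> f) \<and>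
   (\<forall>f\<in>B. \<forall>c. \<phi> (smult c f) = c * \<phi> f)"

lemma alg_char_power:
 assumes "alg_char B \<chi>" "subalg B" "f \<in> B"
 shows "\<chi> (f ^ n) = \<chi> f ^ n"
 by (induction n) (use assms subalgD(9)[OF assms(2,3)] in \<open>auto simp: alg_char_def\<close>)

lemma point_derivation_power:
 assumes "alg_char B \<chi>" "point_derivation B \<chi> \<phi>" "subalg B" "f \<in> B"
 shows "\<phi> (f ^ Suc n) = of_nat (Suc n) * \<chi> f ^ n * \<phi> f"
proof (induction n)
 case (Suc n)
 have "\<phi> (f * f ^ Suc n) = \<chi> f * \<phi> (f ^ Suc n) + \<chi> (f ^ Suc n) * \<phi> f"
  using assms(2) assms(4) subalgD(9)[OF assms(3,4), of "Suc n"] unfolding point_derivation_def by blast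
 then show ?case unfolding Suc alg_char_power[OF assms(1,3,4)] by (simp add: algebra_simps)
qed simp

text \<open>Modulo the largest ideal of \<open>B\<close> inside \<open>A\<close>, the element \<open>w\<close>
 satisfies a quadratic equation over the ground field. Distinct roots give two characters, a double root gives
 a derivation.\<close>

lemma codim1_subalgebra:
 fixes A B :: "'a::alg_closed_field poly set"
 assumes A: "subalg A" and B: "subalg B" and AB: "A \<subseteq> B"
  and w: "w \<in> B" "w \<notin> A" and cov: "\<And>f. f \<in> B ==> \<exists>c. f - smult c w \<in> A"
 shows "(\<exists>\<chi>1 \<chi>2. alg_char B \<chi>1 \<and> alg_char B \<chi>2 \<and> (\<forall>f\<in>B. f \<in> A \<longleftrightarrow> \<chi>1 f = \<chi>2 f)) \<or>
  (\<exists>\<chi> \<phi>. alg_char B \<chi> \<and> point_derivation B \<chi> \<phi> \<and> (\<forall>f\<in>B. f \<in> A \<longleftrightarrow> \<phi> f = 0))"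
proof -
 let ?sm = "smult"
 define \<phi> where "\<phi> = (\<lambda>f. SOME c. f - ?sm c w \<in> A)"
 have phi: "f - ?sm (\<phi> f) w \<in> A" if "f \<in> B" for f
  unfolding \<phi>_def using cov[OF that] by (rule someI_ex)
 have cw: "c = 0" if "?sm c w \<in> A" for c
 proof (rule ccontr)
  assume "c ~= 0"
  then have "w = ?sm (inverse c) (?sm c w)" by simp
  then show False using subalgD(7)[OF A that] w(2) by metis
 qed
 have phi_unique: "\<phi> f = c" if "f \<in> B" "f - ?sm c w \<in> A" for f c
 proof -
  have "(f - ?sm (\<phi> f) w) - (f - ?sm c w) \<in> A" using phi that subalgD(6)[OF A] by blast
  then have "?sm (c - \<phi> f) w \<in> A" by (simp add: smult_diff_left)
  then show ?thesis using cw by fastforce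
 qed
 define m where "m = {a \<in> A. a * w \<in> A}"
 define \<psi> where "\<psi> = (\<lambda>f. \<phi> ((f - ?sm (\<phi> f) w) * w))"
 have msub: "f \<in> m ==> g \<in> m ==> f + g \<in> m" "f \<in> m ==> g \<in> m ==> f - g \<in> m" "f \<in> m ==> ?sm c f \<in> m" for f g c
  using subalgD[OF A] by (auto simp: m_def algebra_simps)
 have mideal: "f * g \<in> m" if f: "f \<in> m" and g: "g \<in> B" for f g
 proof -
  have *: "f * h \<in> A" if h: "h \<in> B" for h
  proof -
   have "f * (h - ?sm (\<phi> h) w) + ?sm (\<phi> h) (f * w) \<in> A"
    using f phi[OF h] subalgD[OF A] by (simp add: m_def)
   then show ?thesis by (simp add: algebra_simps)
  qed
  have "f * (g * w) \<in> A" using g w(1) subalgD(4)[OF B] by (intro *) blast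
  then show ?thesis using *[OF g] by (simp add: m_def mult.assoc)
 qed
 have rep: "f - ([:\<psi> f:] + ?sm (\<phi> f) w) \<in> m" if f: "f \<in> B" for f
 proof -
  define a where "a = f - ?sm (\<phi> f) w"
  have a: "a \<in> A" unfolding a_def by (rule phi[OF f])
  have "a * w \<in> B" using a AB w(1) subalgD(4)[OF B] by blast
  then have "a * w - ?sm (\<psi> f) w \<in> A" unfolding \<psi>_def a_def[symmetric] by (rule phi)
  then have "(a - [:\<psi> f:]) * w \<in> A" by (simp add: algebra_simps)
  moreover have "a - [:\<psi> f:] \<in> A" using a subalgD(6,8)[OF A] by blast
  ultimately show ?thesis by (simp add: m_def a_def algebra_simps)
 qed
 have rep_unique: "c = c' \<and> e = e'" if "f - ([:c:] + ?sm e w) \<in> m" "f - ([:c':] + ?sm e' w) \<in> m" for f c c' e e'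
 proof -
  have d: "(f - ([:c:] + ?sm e w)) - (f - ([:c':] + ?sm e' w)) \<in> m" using msub(2) that by blast
  have eq: "(f - ([:c:] + ?sm e w)) - (f - ([:c':] + ?sm e' w)) = [:c' - c:] + ?sm (e' - e) w"
   by (simp add: smult_diff_left)
  have "([:c' - c:] + ?sm (e' - e) w) - [:c' - c:] \<in> A"
   using d unfolding eq by (intro subalgD(6)[OF A] subalgD(8)[OF A]) (simp add: m_def)
  then have "?sm (e' - e) w \<in> A" by simp
  then have e: "e' - e = 0" by (rule cw)
  then have "?sm (c' - c) w \<in> A" using d unfolding eq by (simp add: m_def)
  then have "c' - c = 0" by (rule cw)
  with e show ?thesis by simp
 qed
 have char: "\<psi> f = c \<and> \<phi> f = e" if "f \<in> B" "f - ([:c:] + ?sm e w) \<in> m" for f c e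
  using rep_unique[OF rep[OF that(1)] that(2)] by simp
 define \<alpha> where "\<alpha> = \<phi> (w * w)"
 define \<kappa> where "\<kappa> = \<psi> (w * w)"
 have wwB: "w * w \<in> B" using w(1) subalgD(4)[OF B] by blast
 have ww: "w * w - ([:\<kappa>:] + ?sm \<alpha> w) \<in> m" unfolding \<alpha>_def \<kappa>_def by (rule rep[OF wwB])
 have add: "\<psi> (f + g) = \<psi> f + \<psi> g \<and> \<phi> (f + g) = \<phi> f + \<phi> g" if "f \<in> B" "g \<in> B" for f g
 proof (rule char)
  show "f + g \<in> B" using that subalgD(5)[OF B] by blast
  have "(f - ([:\<psi> f:] + ?sm (\<phi> f) w)) + (g - ([:\<psi> g:] + ?sm (\<phi> g) w)) \<in> m"
   using rep that msub(1) by blast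
  moreover have "[:\<psi> f + \<psi> g:] = [:\<psi> f:] + [:\<psi> g:]" by simp
  ultimately show "f + g - ([:\<psi> f + \<psi> g:] + ?sm (\<phi> f + \<phi> g) w) \<in> m"
   by (simp only: smult_add_left) (simp only: algebra_simps)
 qed
 have sca: "\<psi> (?sm c f) = c * \<psi> f \<and> \<phi> (?sm c f) = c * \<phi> f" if "f \<in> B" for f c
 proof (rule char)
  show "?sm c f \<in> B" using that subalgD(7)[OF B] by blast
  have "?sm c (f - ([:\<psi> f:] + ?sm (\<phi> f) w)) \<in> m" using rep that msub(3) by blast
  then show "?sm c f - ([:c * \<psi> f:] + ?sm (c * \<phi> f) w) \<in> m"
   by (simp add: smult_diff_right smult_add_right)
 qed
 have mul: "\<psi> (f * g) = \<psi> f * \<psi> g + \<kappa> * (\<phi> f * \<phi> g) \<and>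
   \<phi> (f * g) = \<psi> f * \<phi> g + \<phi> f * \<psi> g + \<alpha> * (\<phi> f * \<phi> g)" if f: "f \<in> B" and g: "g \<in> B" for f g
 proof (rule char)
  show "f * g \<in> B" using f g subalgD(4)[OF B] by blast
  define f1 where "f1 = [:\<psi> f:] + ?sm (\<phi> f) w"
  define g1 where "g1 = [:\<psi> g:] + ?sm (\<phi> g) w"
  have f1: "f1 \<in> B" unfolding f1_def by (intro subalgD(5)[OF B] subalgD(7)[OF B] subalgD(8)[OF B] w(1))
  have "(f - f1) * g \<in> m" "(g - g1) * f1 \<in> m"
   using mideal rep[OF f] rep[OF g] f1 g unfolding f1_def g1_def by blast+
  then have "(f - f1) * g + (g - g1) * f1 + ?sm (\<phi> f * \<phi> g) (w * w - ([:\<kappa>:] + ?sm \<alpha> w)) \<in> m"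
   by (intro msub(1) msub(3)[OF ww])
  also have "(f - f1) * g + (g - g1) * f1 + ?sm (\<phi> f * \<phi> g) (w * w - ([:\<kappa>:] + ?sm \<alpha> w))
   = f * g - g1 * f1 + ?sm (\<phi> f * \<phi> g) (w * w - ([:\<kappa>:] + ?sm \<alpha> w))" by (simp add: algebra_simps)
  also have "\<dots> = f * g - ([:\<psi> f * \<psi> g + \<kappa> * (\<phi> f * \<phi> g):] + ?sm (\<psi> f * \<phi> g + \<phi> f * \<psi> g + \<alpha> * (\<phi> f * \<phi> g)) w)"
  proof -
   define K where "K = (\<lambda>c::'a. [:c:])"
   have K: "K (x + y) = K x + K y" "K (x * y) = K x * K y" for x y by (simp_all add: K_def)
   have sm: "?sm x p = K x * p" for x p by (simp add: K_def)
   have kc: "[:x:] = K x" for x by (simp add: K_def)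
   show ?thesis unfolding f1_def g1_def sm kc K by (simp add: algebra_simps)
  qed
  finally show "f * g - ([:\<psi> f * \<psi> g + \<kappa> * (\<phi> f * \<phi> g):] + ?sm (\<psi> f * \<phi> g + \<phi> f * \<psi> g + \<alpha> * (\<phi> f * \<phi> g)) w) \<in> m" .
 qed
 have one: "\<psi> 1 = 1 \<and> \<phi> 1 = 0"
 proof (rule char)
  show "1 \<in> B" by (rule subalgD(2)[OF B])
  show "1 - ([:1:] + ?sm 0 w) \<in> m" using subalgD(3)[OF A] by (simp add: m_def one_pCons)
 qed
 have Aphi: "f \<in> A \<longleftrightarrow> \<phi> f = 0" if "f \<in> B" for f
 proof
  assume "f \<in> A"
  then show "\<phi> f = 0" using phi_unique[OF that, of 0] by simp
 next
  assume "\<phi> f = 0"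
  then show "f \<in> A" using phi[OF that] by simp
 qed
 have "degree [:- \<kappa>, - \<alpha>, 1:] > 0" by simp
 then obtain \<rho> where "poly [:- \<kappa>, - \<alpha>, 1:] \<rho> = 0"
  using alg_closed_imp_poly_has_root by blast
 then have rho: "\<rho> * \<rho> = \<alpha> * \<rho> + \<kappa>" by (simp add: algebra_simps)
 define \<sigma> where "\<sigma> = \<alpha> - \<rho>"
 have sigma: "\<sigma> * \<sigma> = \<alpha> * \<sigma> + \<kappa>"
 proof -
  have "\<sigma> * \<sigma> - \<alpha> * \<sigma> = \<rho> * \<rho> - \<alpha> * \<rho>" by (simp add: \<sigma>_def algebra_simps)
  then show ?thesis using rho by (simp add: algebra_simps)
 qed
 have ch: "alg_char B (\<lambda>f. \<psi> f + \<phi> f * r)" if r: "r * r = \<alpha> * r + \<kappa>" for r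
 proof -
  have "\<psi> (f * g) + \<phi> (f * g) * r = (\<psi> f + \<phi> f * r) * (\<psi> g + \<phi> g * r)" if "f \<in> B" "g \<in> B" for f g
  proof -
   have "(\<psi> f + \<phi> f * r) * (\<psi> g + \<phi> g * r) = \<psi> f * \<psi> g + (\<psi> f * \<phi> g + \<phi> f * \<psi> g) * r + \<phi> f * \<phi> g * (r * r)"
    by (simp add: algebra_simps)
   then show ?thesis using mul[OF that] by (simp add: r algebra_simps)
  qed
  then show ?thesis unfolding alg_char_def using one add sca by (auto simp: algebra_simps)
 qed
 show ?thesis
 proof (cases "\<rho> = \<sigma>")
  case False
  have "f \<in> A \<longleftrightarrow> \<psi> f + \<phi> f * \<rho> = \<psi> f + \<phi> f * \<sigma>" if "f \<in> B" for f
   using Aphi[OF that] False by auto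
  then show ?thesis using ch[OF rho] ch[OF sigma] by blast
 next
  case True
  then have al: "\<alpha> = \<rho> + \<rho>" by (simp add: \<sigma>_def)
  have "point_derivation B (\<lambda>f. \<psi> f + \<phi> f * \<rho>) \<phi>"
   unfolding point_derivation_def using add sca mul by (auto simp: al algebra_simps)
  then show ?thesis using ch[OF rho] Aphi by blast
 qed
qed

lemma alg_char_UNIV:
 assumes "alg_char UNIV \<chi>"
 shows "\<exists>p. \<forall>f. \<chi> f = poly f p"
proof -
 have c: "\<chi> (f + g) = \<chi> f + \<chi> g" "\<chi> (f * g) = \<chi> f * \<chi> g" "\<chi> (smult c f) = c * \<chi> f" "\<chi> 1 = 1" for f g c
  using assms by (auto simp: alg_char_def)
 have "\<chi> f = poly f (\<chi> [:0, 1:])" for f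
 proof (induction f)
  case 0
  show ?case using c(3)[of 0 0] by simp
 next
  case (pCons a f)
  have "pCons a f = smult a 1 + [:0, 1:] * f" by (simp add: one_pCons)
  then have "\<chi> (pCons a f) = \<chi> (smult a 1 + [:0, 1:] * f)" by simp
  then show ?case using pCons by (simp only: c) simp
 qed
 then show ?thesis by blast
qed

lemma point_derivation_UNIV:
 assumes ch: "\<And>f. \<chi> f = poly f p" and d: "point_derivation UNIV \<chi> \<phi>"
 shows "\<phi> f = \<phi> [:0, 1:] * poly (pderiv f) p"
proof -
 have c: "\<phi> (f + g) = \<phi> f + \<phi> g" "\<phi> (f * g) = poly f p * \<phi> g + poly g p * \<phi> f" "\<phi> (smult c f) = c * \<phi> f" for f g c
  using d ch by (auto simp: point_derivation_def)
 have "\<phi> 1 = \<phi> 1 + \<phi> 1" using c(2)[of 1 1] by (simp only: mult_1 poly_1)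
 then have one: "\<phi> 1 = 0" by (metis add_cancel_right_right)
 show ?thesis
 proof (induction f)
  case 0
  show ?case using c(3)[of 0 0] by simp
 next
  case (pCons a f)
  have "pCons a f = smult a 1 + [:0, 1:] * f" by (simp add: one_pCons)
  then have "\<phi> (pCons a f) = \<phi> (smult a 1 + [:0, 1:] * f)" by simp
  then show ?case using pCons by (simp only: c one) (simp add: pderiv_pCons algebra_simps)
 qed
qed

text \<open>If \<open>\<chi> g\<close> is nonzero, then the quotient of \<open>\<chi> (g * X)\<close> by it is
 the point, with \<open>X\<close> the polynomial variable; otherwise \<open>\<chi>\<close> kills all multiples
 of \<open>g\<close>, and the point is \<open>p1\<close>.\<close>

lemma alg_char_lift:
 assumes B: "subalg B" and ch: "alg_char B \<chi>" and g: "\<And>h. g * h \<in> B"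
  and rep: "\<And>f. f \<in> B ==> \<exists>h. f = [:poly f p1:] + g * h"
 shows "\<exists>p. \<forall>f\<in>B. \<chi> f = poly f p"
proof (cases "\<exists>h. \<chi> (g * h) ~= 0")
 case True
 then obtain h where h: "\<chi> (g * h) ~= 0" by blast
 have c: "\<And>f g. f \<in> B ==> g \<in> B ==> \<chi> (f + g) = \<chi> f + \<chi> g" "\<And>f g. f \<in> B ==> g \<in> B ==> \<chi> (f * g) = \<chi> f * \<chi> g"
  "\<And>f c. f \<in> B ==> \<chi> (smult c f) = c * \<chi> f" "\<chi> 1 = 1"
  using ch by (auto simp: alg_char_def)
 define \<chi>' where "\<chi>' = (\<lambda>f. \<chi> (g * (h * f)) / \<chi> (g * h))"
 have "alg_char UNIV \<chi>'" unfolding alg_char_def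
 proof (intro conjI ballI allI)
  show "\<chi>' 1 = 1" using h by (simp add: \<chi>'_def)
  fix f f'
  show "\<chi>' (f + f') = \<chi>' f + \<chi>' f'"
   using c(1)[OF g g, of "h * f" "h * f'"] by (simp add: \<chi>'_def algebra_simps add_divide_distrib)
  show "\<chi>' (smult k f) = k * \<chi>' f" for k
   using c(3)[OF g, of k "h * f"] by (simp add: \<chi>'_def)
  have "\<chi> ((g * (h * (f * f'))) * (g * h)) = \<chi> ((g * (h * f)) * (g * (h * f')))"
   by (simp add: algebra_simps)
  then have "\<chi> (g * (h * (f * f'))) * \<chi> (g * h) = \<chi> (g * (h * f)) * \<chi> (g * (h * f'))"
   using c(2)[OF g g] by metis
  then show "\<chi>' (f * f') = \<chi>' f * \<chi>' f'" using h by (simp add: \<chi>'_def field_simps)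
 qed
 then obtain p where p: "\<And>f. \<chi>' f = poly f p" using alg_char_UNIV by blast
 have "\<chi> f = poly f p" if "f \<in> B" for f
 proof -
  have "\<chi> ((g * h) * f) = \<chi> (g * h) * \<chi> f" using c(2)[OF g that] by blast
  then have "\<chi>' f = \<chi> f" using h by (simp add: \<chi>'_def mult.assoc)
  then show ?thesis using p by simp
 qed
 then show ?thesis by blast
next
 case False
 have "\<chi> f = poly f p1" if f: "f \<in> B" for f
 proof -
  obtain h where h: "f = [:poly f p1:] + g * h" using rep[OF f] by blast
  have "\<chi> f = \<chi> (smult (poly f p1) 1 + g * h)" using h by (simp add: one_pCons)
  also have "\<dots> = poly f p1 * \<chi> 1 + \<chi> (g * h)"
   using ch g subalgD(2,7)[OF B] unfolding alg_char_def by metis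
  also have "\<dots> = poly f p1" using False ch by (simp add: alg_char_def)
  finally show ?thesis .
 qed
 then show ?thesis by blast
qed

definition codim2 :: "'a::field poly set => 'a poly => 'a poly => bool" where
 "codim2 A w1 w2 \<longleftrightarrow> (\<forall>f. \<exists>c1 c2. f - (smult c1 w1 + smult c2 w2) \<in> A) \<and>
   (\<forall>c1 c2. smult c1 w1 + smult c2 w2 \<in> A --> c1 = 0 \<and> c2 = 0)"

lemma codim2_family:
 assumes A: "subalg A" and c: "codim2 A w1 w2" and I: "finite I" "finite J" "2 * card J < card I"
 shows "\<exists>c. (\<exists>i\<in>I. c i ~= 0) \<and> (\<forall>j\<in>J. (\<Sum>i\<in>I. smult (c i) (v j i)) \<in> A)"
proof -
 have "\<forall>f. \<exists>c1 c2. f - (smult c1 w1 + smult c2 w2) \<in> A" using c by (auto simp: codim2_def)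
 then obtain X1 X2 where X12: "\<And>f. f - (smult (X1 f) w1 + smult (X2 f) w2) \<in> A" by metis
 define M where "M = (\<lambda>(j, b) i. if b then X1 (v j i) else X2 (v j i))"
 have "card (J \<times> (UNIV :: bool set)) < card I" using I by (simp add: card_cartesian_product)
 then obtain c where c: "\<exists>i\<in>I. c i ~= 0" "\<forall>j\<in>J \<times> UNIV. (\<Sum>i\<in>I. c i * M j i) = 0"
  using underdetermined_system[of I "J \<times> UNIV" M] I by auto
 have "(\<Sum>i\<in>I. smult (c i) (v j i)) \<in> A" if j: "j \<in> J" for j
 proof -
  have z: "(\<Sum>i\<in>I. c i * X1 (v j i)) = 0" "(\<Sum>i\<in>I. c i * X2 (v j i)) = 0"
   using bspec[OF c(2), of "(j, True)"] bspec[OF c(2), of "(j, False)"] j by (simp_all add: M_def)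
  have "(\<Sum>i\<in>I. smult (c i) (v j i - (smult (X1 (v j i)) w1 + smult (X2 (v j i)) w2))) \<in> A"
   using X12 subalgD(1)[OF A] by (intro pv.subspace_sum pv.subspace_scale)
  also have "(\<Sum>i\<in>I. smult (c i) (v j i - (smult (X1 (v j i)) w1 + smult (X2 (v j i)) w2)))
   = (\<Sum>i\<in>I. smult (c i) (v j i)) - smult (\<Sum>i\<in>I. c i * X1 (v j i)) w1
     - smult (\<Sum>i\<in>I. c i * X2 (v j i)) w2"
   by (simp add: smult_diff_right smult_add_right sum_subtractf sum.distrib smult_sum diff_diff_eq)
  also have "\<dots> = (\<Sum>i\<in>I. smult (c i) (v j i))" by (simp add: z)
  finally show ?thesis .
 qed
 then show ?thesis using c(1) by blast
qed

lemma codim2_three: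
 assumes A: "subalg A" and c: "codim2 A w1 w2"
 shows "\<exists>a b e. (a, b, e) ~= (0, 0, 0) \<and> smult a f + smult b g + smult e h \<in> A"
proof -
 obtain c where c: "\<exists>i\<in>{0,1,2::nat}. c i ~= 0"
  "(\<Sum>i\<in>{0,1,2}. smult (c i) (if i = 0 then f else if i = 1 then g else h)) \<in> A"
  using codim2_family[OF A c, of "{0,1,2::nat}" "{0::nat}" "\<lambda>_ i. if i = 0 then f else if i = 1 then g else h"] by auto
 then show ?thesis by (intro exI[of _ "c 0"] exI[of _ "c 1"] exI[of _ "c 2"]) (auto simp: add.assoc)
qed

text \<open>The quotient of the polynomial ring by \<open>A\<close> is a two-dimensional module over
 \<open>A\<close>. If it is cyclic, a generator works as \<open>e\<close>; otherwise every element of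
 \<open>A\<close> acts on it as a scalar, and any \<open>e\<close> outside \<open>A\<close> works.\<close>

lemma conductor_witness:
 assumes A: "subalg A" and c: "codim2 A w1 w2"
 shows "\<exists>e. \<forall>f. f \<in> A --> f * e \<in> A --> (\<forall>h. f * h \<in> A)"
proof -
 let ?sm = "smult"
 have three: "\<exists>a b e. (a, b, e) ~= (0, 0, 0) \<and> ?sm a f + ?sm b g + ?sm e h \<in> A" for f g h
  by (rule codim2_three[OF A c])
 show ?thesis
 proof (cases "\<exists>r a0. a0 \<in> A \<and> (\<forall>c1 c2. ?sm c1 r + ?sm c2 (a0 * r) \<in> A --> c1 = 0 \<and> c2 = 0)")
  case True
  from True obtain r where Tr: "\<exists>a0. a0 \<in> A \<and> (\<forall>c1 c2. ?sm c1 r + ?sm c2 (a0 * r) \<in> A --> c1 = 0 \<and> c2 = 0)"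
   by (rule exE)
  from Tr obtain a0 where a0: "a0 \<in> A \<and> (\<forall>c1 c2. ?sm c1 r + ?sm c2 (a0 * r) \<in> A --> c1 = 0 \<and> c2 = 0)"
   by (rule exE)
  note r = a0[THEN conjunct1] a0[THEN conjunct2, rule_format]
  have "f * h \<in> A" if f: "f \<in> A" "f * r \<in> A" for f h
  proof -
   obtain x y z where xyz: "(x, y, z) ~= (0, 0, 0)" "?sm x h + ?sm y r + ?sm z (a0 * r) \<in> A"
    using three by blast
   have x: "x ~= 0" using xyz r(2)[of y z] by (cases "x = 0") auto
   define b where "b = ?sm x h + ?sm y r + ?sm z (a0 * r)"
   have "f * b - ?sm y (f * r) - ?sm z (a0 * (f * r)) \<in> A"
    using xyz(2) unfolding b_def[symmetric]
    by (intro subalgD(6)[OF A] subalgD(7)[OF A] subalgD(4)[OF A f(1)] subalgD(4)[OF A r(1) f(2)] f(2))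
   also have "f * b - ?sm y (f * r) - ?sm z (a0 * (f * r)) = ?sm x (f * h)"
    by (simp add: b_def algebra_simps)
   finally have "?sm (inverse x) (?sm x (f * h)) \<in> A" by (rule subalgD(7)[OF A])
   then show ?thesis using x by simp
  qed
  then show ?thesis by blast
 next
  case False
  then have dep: "\<exists>c1 c2. ?sm c1 r + ?sm c2 (a0 * r) \<in> A \<and> (c1, c2) ~= (0, 0)" if "a0 \<in> A" for a0 r
   using that by (metis prod.inject)
  have eig: "\<exists>k. f * r - ?sm k r \<in> A" if f: "f \<in> A" and r: "r \<notin> A" for f r
  proof -
   obtain c1 c2 where c12: "?sm c1 r + ?sm c2 (f * r) \<in> A" "(c1, c2) ~= (0, 0)" using dep[OF f] by blast
   have c2: "c2 ~= 0"
   proof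
    assume "c2 = 0"
    then have "?sm c1 r \<in> A" "c1 ~= 0" using c12 by auto
    then show False using r subalg_smult_cancel[OF A] by blast
   qed
   have "?sm (inverse c2) (?sm c1 r + ?sm c2 (f * r)) \<in> A" using c12(1) by (rule subalgD(7)[OF A])
   then have "f * r - ?sm (- inverse c2 * c1) r \<in> A" using c2 by (simp add: smult_add_right add.commute)
   then show ?thesis by blast
  qed
  have w1: "w1 \<notin> A"
  proof
   assume "w1 \<in> A"
   then have "?sm 1 w1 + ?sm 0 w2 \<in> A" by simp
   then show False using c unfolding codim2_def by (metis zero_neq_one)
  qed
  have "f * h \<in> A" if f: "f \<in> A" "f * w1 \<in> A" for f h
  proof (cases "h \<in> A")
   case True
   then show ?thesis using f subalgD(4)[OF A] by blast
  next
   case hA: False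
   obtain k where k: "f * h - ?sm k h \<in> A" using eig[OF f(1) hA] by blast
   show ?thesis
   proof (cases "h + w1 \<in> A")
    case True
    have "f * (h + w1) - f * w1 \<in> A" using True f subalgD(4,6)[OF A] by blast
    then show ?thesis by (simp add: algebra_simps)
   next
    case hw: False
    obtain k' where k': "f * (h + w1) - ?sm k' (h + w1) \<in> A" using eig[OF f(1) hw] by blast
    have "(f * h - ?sm k h) - (f * (h + w1) - ?sm k' (h + w1)) + f * w1 \<in> A"
     using k k' f subalgD(5,6)[OF A] by blast
    then have d: "?sm (k' - k) h + ?sm k' w1 \<in> A"
     by (simp add: algebra_simps smult_add_right smult_diff_left)
    show ?thesis
    proof (cases "k = 0")
     case True
     then show ?thesis using k by simp
    next
     case kne: False
     show ?thesis
     proof (cases "k' = k")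
      case True
      then have "?sm k w1 \<in> A" using d by auto
      then show ?thesis using w1 kne subalg_smult_cancel[OF A] by blast
     next
      case False
      have "f * (?sm (k' - k) h + ?sm k' w1) - ?sm k' (f * w1) \<in> A"
       using f d subalgD(4,6,7)[OF A] by blast
      also have "f * (?sm (k' - k) h + ?sm k' w1) - ?sm k' (f * w1) = ?sm (k' - k) (f * h)"
       by (simp only: distrib_left mult_smult_right) simp
      finally show ?thesis using False subalg_smult_cancel[OF A] by simp
     qed
    qed
   qed
  qed
  then show ?thesis by blast
 qed
qed

text \<open>Membership of \<open>f\<close> and \<open>f * e\<close> in \<open>A\<close> are four linear
 conditions on the five coefficients of a polynomial of degree at most four.\<close>

lemma conductor_quartic:
 assumes A: "subalg A" and c: "codim2 A w1 w2"
 shows "\<exists>q. q ~= 0 \<and> degree q \<le> 4 \<and> (\<forall>h. q * h \<in> A)"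
proof -
 obtain e where e: "\<And>f h. f \<in> A ==> f * e \<in> A ==> f * h \<in> A" using conductor_witness[OF A c] by blast
 define v where "v = (\<lambda>(b::bool) i. if b then monom 1 i else monom 1 i * e)"
 obtain c where c: "\<exists>i\<in>{..<5::nat}. c i ~= 0"
  "\<forall>j\<in>UNIV. (\<Sum>i\<in>{..<5}. smult (c i) (v j i)) \<in> A"
  using codim2_family[OF A c, of "{..<5::nat}" "UNIV :: bool set" v] by auto
 define q where "q = (\<Sum>i\<in>{..<5::nat}. monom (c i) i)"
 have co: "coeff q i = (if i < 5 then c i else 0)" for i by (simp add: q_def coeff_sum)
 have "q ~= 0" using c(1) co by (metis coeff_0 lessThan_iff)
 moreover have "degree q \<le> 4" by (intro degree_le) (simp add: co)
 moreover have "q \<in> A"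
  using bspec[OF c(2), of True] by (simp add: v_def q_def smult_monom)
 moreover have "q * e \<in> A"
  using bspec[OF c(2), of False] by (simp add: v_def q_def sum_distrib_right smult_monom flip: mult_smult_left)
 ultimately show ?thesis using e by blast
qed

lemma node_algebra_rep:
 fixes p1 p2 :: "'a::field"
 assumes "p1 ~= p2" "poly f p1 = poly f p2"
 shows "\<exists>h. f = [:poly f p1:] + ([:- p1, 1:] * [:- p2, 1:]) * h"
proof -
 have "[:- p1, 1:] dvd f - [:poly f p1:]" by (simp add: dvd_iff_poly_eq_0)
 then obtain h1 where h1: "f - [:poly f p1:] = [:- p1, 1:] * h1" by blast
 have "poly (f - [:poly f p1:]) p2 = 0" using assms(2) by simp
 then have "poly h1 p2 = 0" using assms(1) unfolding h1 by simp
 then have "[:- p2, 1:] dvd h1" by (simp add: dvd_iff_poly_eq_0)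
 then obtain h where "h1 = [:- p2, 1:] * h" by blast
 then have "f - [:poly f p1:] = ([:- p1, 1:] * [:- p2, 1:]) * h" unfolding h1 by (simp only: mult.assoc)
 then show ?thesis by (metis add.commute diff_add_cancel)
qed

lemma poly_pderiv_linear_mult: "poly (pderiv ([:- p, 1:] * h)) p = poly h p"
 for p :: "'a::field"
 by (subst pderiv_mult) (simp add: pderiv_pCons)

lemma cusp_algebra_rep:
 fixes p :: "'a::field"
 assumes "poly (pderiv f) p = 0"
 shows "\<exists>h. f = [:poly f p:] + ([:- p, 1:] * [:- p, 1:]) * h"
proof -
 have "[:- p, 1:] dvd f - [:poly f p:]" by (simp add: dvd_iff_poly_eq_0)
 then obtain h1 where h1: "f - [:poly f p:] = [:- p, 1:] * h1" by blast
 have "poly (pderiv (f - [:poly f p:])) p = poly h1 p" unfolding h1 by (rule poly_pderiv_linear_mult)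
 then have "poly (pderiv f) p = poly h1 p" by (simp add: pderiv_diff pderiv_pCons)
 then have "[:- p, 1:] dvd h1" using assms by (simp add: dvd_iff_poly_eq_0)
 then obtain h where "h1 = [:- p, 1:] * h" by blast
 then have "f - [:poly f p:] = ([:- p, 1:] * [:- p, 1:]) * h" unfolding h1 by (simp only: mult.assoc)
 then show ?thesis by (metis add.commute diff_add_cancel)
qed

lemma subalg_node: "subalg {f :: 'a::field poly. poly f p1 = poly f p2}"
 unfolding subalg_def by (auto intro!: pv.subspaceI)

text \<open>In the algebra \<open>B\<close> of all polynomials with equal values at the two points,
 \<open>A\<close> has codimension one, and the characters and derivations of \<open>B\<close> come from points
 and tangent vectors.\<close>

lemma node_subalgebra_cases:
 fixes A :: "'a::alg_closed_field poly set"
 assumes A: "subalg A" and c: "codim2 A w1 w2"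
  and p: "p1 ~= p2" and glue: "\<And>f. f \<in> A ==> poly f p1 = poly f p2"
 obtains
  (nodes) p3 p4 where "p3 ~= p1" "p3 ~= p2" "p4 ~= p3"
   "\<And>f. f \<in> A \<longleftrightarrow> poly f p1 = poly f p2 \<and> poly f p3 = poly f p4"
 | (tangent) a b l m where "a = p1 \<and> b = p2 \<or> a = b \<and> a ~= p1 \<and> a ~= p2 \<and> m = 0" "(l, m) ~= (0, 0)"
   "\<And>f. f \<in> A \<longleftrightarrow> poly f p1 = poly f p2 \<and> l * poly (pderiv f) a + m * poly (pderiv f) b = 0"
proof -
 let ?sm = "smult"
 define B where "B = {f :: 'a poly. poly f p1 = poly f p2}"
 have B: "subalg B" unfolding B_def by (rule subalg_node)
 have AB: "A \<subseteq> B" using glue by (auto simp: B_def)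
 obtain w where w: "w \<in> B" "w \<notin> A"
 proof (rule ccontr)
  assume no: "\<not> thesis"
  then have BA: "B \<subseteq> A" using that by blast
  define d1 where "d1 = poly w1 p1 - poly w1 p2"
  define d2 where "d2 = poly w2 p1 - poly w2 p2"
  have ind: "c1 = 0 \<and> c2 = 0" if "?sm c1 w1 + ?sm c2 w2 \<in> B" for c1 c2
   using c BA that unfolding codim2_def by blast
  have "?sm d2 w1 + ?sm (- d1) w2 \<in> B" by (simp add: B_def d1_def d2_def algebra_simps)
  then have "d1 = 0" using ind by fastforce
  then have "?sm 1 w1 + ?sm 0 w2 \<in> B" by (simp add: B_def d1_def)
  then show False using ind[of 1 0] by simp
 qed
 have cov: "\<exists>c. f - ?sm c w \<in> A" if f: "f \<in> B" for f
 proof -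
  obtain x y z where xyz: "(x, y, z) ~= (0, 0, 0)" "?sm x f + ?sm y w + ?sm z [:0, 1:] \<in> A"
   using codim2_three[OF A c] by blast
  have "?sm x f + ?sm y w + ?sm z [:0, 1:] \<in> B" using xyz(2) AB by blast
  then have z: "z = 0" using f w(1) p by (simp add: B_def)
  have x: "x ~= 0"
  proof
   assume x: "x = 0"
   then have "?sm y w \<in> A" "y ~= 0" using xyz z by auto
   then show False using w(2) subalg_smult_cancel[OF A] by blast
  qed
  have "?sm (inverse x) (?sm x f + ?sm y w + ?sm z [:0, 1:]) \<in> A" using xyz(2) by (rule subalgD(7)[OF A])
  then have "f - ?sm (- inverse x * y) w \<in> A" using x z by (simp add: smult_add_right)
  then show ?thesis by blast
 qed
 define g where "g = [:- p1, 1:] * [:- p2, 1:]"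
 have gp: "poly g p1 = 0" "poly g p2 = 0" by (simp_all add: g_def)
 have gB: "g * h \<in> B" for h by (simp add: B_def gp)
 have rep: "\<exists>h. f = [:poly f p1:] + g * h" if "f \<in> B" for f
  unfolding g_def using that p by (intro node_algebra_rep) (auto simp: B_def)
 have lift: "\<exists>p. \<forall>f\<in>B. \<chi> f = poly f p" if "alg_char B \<chi>" for \<chi>
  by (rule alg_char_lift[OF B that gB rep])
 from codim1_subalgebra[OF A B AB w cov] consider
  (N) \<chi>1 \<chi>2 where "alg_char B \<chi>1" "alg_char B \<chi>2" "\<And>f. f \<in> B ==> f \<in> A \<longleftrightarrow> \<chi>1 f = \<chi>2 f"
 | (D) \<chi> \<phi> where "alg_char B \<chi>" "point_derivation B \<chi> \<phi>" "\<And>f. f \<in> B ==> f \<in> A \<longleftrightarrow> \<phi> f = 0"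
  by blast
 then show ?thesis
 proof cases
  case N
  obtain a b where ab: "\<And>f. f \<in> B ==> \<chi>1 f = poly f a" "\<And>f. f \<in> B ==> \<chi>2 f = poly f b"
   using lift N(1,2) by metis
  have mem: "f \<in> A \<longleftrightarrow> poly f p1 = poly f p2 \<and> poly f a = poly f b" for f
   using N(3)[of f] ab[of f] AB by (auto simp: B_def)
  have wab: "poly w a ~= poly w b" "poly w p1 = poly w p2" using w mem[of w] by (auto simp: B_def)
  then have "a ~= b" by auto
  show ?thesis
  proof (cases "a = p1 \<or> a = p2")
   case False
   then show ?thesis using nodes[of a b] \<open>a ~= b\<close> mem by auto
  next
   case True
   then have "b ~= p1" "b ~= p2" using wab by auto
   then show ?thesis using \<open>a ~= b\<close> by (intro nodes[of b a]) (auto simp: mem)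
  qed
 next
  case D
  obtain a where a: "\<And>f. f \<in> B ==> \<chi> f = poly f a" using lift[OF D(1)] by blast
  have d: "\<phi> (f + h) = \<phi> f + \<phi> h" "\<phi> (f * h) = poly f a * \<phi> h + poly h a * \<phi> f" "\<phi> (?sm k f) = k * \<phi> f"
   if "f \<in> B" "h \<in> B" for f h k
   using D(2) that a unfolding point_derivation_def by auto
  have oneB: "1 \<in> B" by (simp add: B_def)
  have "\<phi> 1 = \<phi> 1 + \<phi> 1" using d(2)[OF oneB oneB] by (simp only: mult_1 poly_1)
  then have phi1: "\<phi> 1 = 0" by (metis add_cancel_right_right)
  have fin: ?thesis if ab: "a' = p1 \<and> b' = p2 \<or> a' = b' \<and> a' ~= p1 \<and> a' ~= p2 \<and> m = 0"
   and eq: "\<And>f. f \<in> B ==> \<phi> f = l * poly (pderiv f) a' + m * poly (pderiv f) b'" for a' b' l m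
  proof -
   have "(l, m) ~= (0, 0)" using eq[OF w(1)] D(3)[OF w(1)] w(2) by auto
   moreover have "f \<in> A \<longleftrightarrow> poly f p1 = poly f p2 \<and> l * poly (pderiv f) a' + m * poly (pderiv f) b' = 0" for f
    using eq[of f] D(3)[of f] AB by (auto simp: B_def)
   ultimately show ?thesis using ab tangent by blast
  qed
  show ?thesis
  proof (cases "a = p1 \<or> a = p2")
   case True
   define z where "z = ([:0, 1:] :: 'a poly)"
   define D where "D = p1 - p2"
   have D: "D ~= 0" using p by (simp add: D_def)
   have ga: "poly g a = 0" using True gp by auto
   have g1: "g \<in> B" "g * z \<in> B" using gB[of 1] gB[of z] by simp_all
   have eq: "\<phi> f = (\<phi> g * (1 / D - p1 / (D * D)) + \<phi> (g * z) / (D * D)) * poly (pderiv f) p1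
    + (\<phi> (g * z) / (D * D) - \<phi> g * p1 / (D * D)) * poly (pderiv f) p2" if f: "f \<in> B" for f
   proof -
    obtain h where h: "f = [:poly f p1:] + g * h" using rep[OF f] by blast
    define k where "k = h mod g"
    define k' where "k' = h div g"
    have hk: "h = k + g * k'" by (simp add: k_def k'_def)
    have "g ~= 0" by (simp add: g_def)
    moreover have "degree g = 2" by (simp add: g_def degree_mult_eq)
    ultimately have "k = 0 \<or> degree k < 2" unfolding k_def using degree_mod_less[of g h] by auto
    then have "degree k \<le> 1" by auto
    then obtain \<alpha> \<beta> where k: "k = [:\<alpha>, \<beta>:]"
     by (metis degree_eq_zeroE le_SucE One_nat_def le_zero_eq pCons_0_0 degree1_coeffs)
    have "g * h = ?sm \<alpha> g + (?sm \<beta> (g * z) + g * (g * k'))"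
    proof -
     have "k = ?sm \<alpha> 1 + ?sm \<beta> z" by (simp add: k z_def one_pCons)
     then show ?thesis unfolding hk by (simp add: algebra_simps)
    qed
    moreover have "[:poly f p1:] = ?sm (poly f p1) 1" by (simp add: one_pCons)
    ultimately have fk: "f = ?sm (poly f p1) 1 + (?sm \<alpha> g + (?sm \<beta> (g * z) + g * (g * k')))"
     using h by metis
    have in_B: "?sm (poly f p1) 1 \<in> B" "?sm \<alpha> g \<in> B" "?sm \<beta> (g * z) \<in> B" "g * (g * k') \<in> B" "g * k' \<in> B"
     by (intro subalgD(7)[OF B] oneB g1 gB)+
    have "\<phi> (g * (g * k')) = 0" using d(2)[OF g1(1) in_B(5)] ga by simp
    moreover have "\<phi> (?sm (poly f p1) 1) = 0" "\<phi> (?sm \<alpha> g) = \<alpha> * \<phi> g" "\<phi> (?sm \<beta> (g * z)) = \<beta> * \<phi> (g * z)"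
     using d(3)[OF oneB oneB] d(3)[OF g1(1) oneB] d(3)[OF g1(2) oneB] phi1 by simp_all
    moreover have "\<phi> (?sm (poly f p1) 1 + (?sm \<alpha> g + (?sm \<beta> (g * z) + g * (g * k'))))
     = \<phi> (?sm (poly f p1) 1) + (\<phi> (?sm \<alpha> g) + (\<phi> (?sm \<beta> (g * z)) + \<phi> (g * (g * k'))))"
     by (subst d(1); (intro subalgD(5)[OF B] in_B)?)+ (rule refl)
    ultimately have phif: "\<phi> f = \<alpha> * \<phi> g + \<beta> * \<phi> (g * z)" using fk by (metis add_0 add.right_neutral)
    have "pderiv f = pderiv ([:poly f p1:] + [:- p1, 1:] * ([:- p2, 1:] * h))"
     using h unfolding g_def mult.assoc by (rule arg_cong)
    then have "poly (pderiv f) p1 = poly (pderiv ([:- p1, 1:] * ([:- p2, 1:] * h))) p1"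
     by (simp only: pderiv_add poly_add) (simp add: pderiv_pCons)
    also have "\<dots> = D * poly h p1" unfolding poly_pderiv_linear_mult by (simp add: D_def algebra_simps)
    also have "poly h p1 = \<alpha> + \<beta> * p1" unfolding hk using gp by (simp add: k algebra_simps)
    finally have d1: "poly (pderiv f) p1 = D * (\<alpha> + \<beta> * p1)" .
    have "pderiv f = pderiv ([:poly f p1:] + [:- p2, 1:] * ([:- p1, 1:] * h))"
     using h unfolding g_def mult.assoc mult.left_commute[of "[:- p1, 1:]"] by (rule arg_cong)
    then have "poly (pderiv f) p2 = poly (pderiv ([:- p2, 1:] * ([:- p1, 1:] * h))) p2"
     by (simp only: pderiv_add poly_add) (simp add: pderiv_pCons)
    also have "\<dots> = - D * poly h p2" unfolding poly_pderiv_linear_mult by (simp add: D_def algebra_simps)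
    also have "poly h p2 = \<alpha> + \<beta> * p2" unfolding hk using gp by (simp add: k algebra_simps)
    finally have d2: "poly (pderiv f) p2 = - D * (\<alpha> + \<beta> * p2)" .
    have p2: "p2 = p1 - D" by (simp add: D_def)
    show ?thesis unfolding phif d1 d2 unfolding p2 using D by (simp add: field_simps)
   qed
   show ?thesis by (rule fin[OF _ eq]) auto
  next
   case False
   have "poly g a = (a - p1) * (a - p2)" by (simp add: g_def algebra_simps)
   then have ga: "poly g a ~= 0" using False by simp
   define \<phi>' where "\<phi>' = (\<lambda>f. (\<phi> (g * f) - poly f a * \<phi> g) / poly g a)"
   have g1: "g \<in> B" using gB[of 1] by simp
   have "point_derivation UNIV (\<lambda>f. poly f a) \<phi>'" unfolding point_derivation_def
   proof (intro conjI ballI allI)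
    fix f h :: "'a poly"
    show "\<phi>' (f + h) = \<phi>' f + \<phi>' h"
     using d(1)[OF gB gB, of f h] by (simp add: \<phi>'_def algebra_simps add_divide_distrib diff_divide_distrib)
    show "\<phi>' (?sm k f) = k * \<phi>' f" for k
     using d(3)[OF gB g1, of k f] by (simp add: \<phi>'_def algebra_simps diff_divide_distrib)
    have "\<phi> ((g * f) * (g * h)) = \<phi> (g * (g * (f * h)))" by (simp add: algebra_simps)
    then have "poly (g * f) a * \<phi> (g * h) + poly (g * h) a * \<phi> (g * f) =
     poly g a * \<phi> (g * (f * h)) + poly (g * (f * h)) a * \<phi> g"
     using d(2)[OF gB gB] d(2)[OF g1 gB] by metis
    then have "poly g a * \<phi> (g * (f * h)) = poly g a * (poly f a * \<phi> (g * h) + poly h a * \<phi> (g * f) - poly f a * poly h a * \<phi> g)"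
     by (simp add: algebra_simps)
    then have eq: "\<phi> (g * (f * h)) = poly f a * \<phi> (g * h) + poly h a * \<phi> (g * f) - poly f a * poly h a * \<phi> g"
     using ga by simp
    then show "\<phi>' (f * h) = poly f a * \<phi>' h + poly h a * \<phi>' f"
     unfolding \<phi>'_def eq poly_mult using ga by (simp add: divide_simps) (simp add: algebra_simps)
   qed
   then have phi': "\<phi>' f = \<phi>' [:0, 1:] * poly (pderiv f) a" for f
    by (rule point_derivation_UNIV[rotated]) simp
   have phi: "\<phi> f = \<phi>' f" if "f \<in> B" for f
    using d(2)[OF g1 that] ga by (simp add: \<phi>'_def)
   have "\<phi> f = \<phi>' [:0, 1:] * poly (pderiv f) a + 0 * poly (pderiv f) a" if "f \<in> B" for f
    unfolding phi[OF that] using phi'[of f] by simp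
   then show ?thesis using False by (intro fin[of a a 0 "\<phi>' [:0, 1:]"]) auto
  qed
 qed
qed

definition separates :: "'a::field poly set => bool" where
 "separates A \<longleftrightarrow> (\<forall>p1 p2. p1 ~= p2 --> (\<exists>f\<in>A. poly f p1 ~= poly f p2))"

lemma codim1_separating:
 fixes A B :: "'a::{alg_closed_field, field_char_0} poly set"
 assumes A: "subalg A" and B: "subalg B" and AB: "A \<subseteq> B"
  and w: "w \<in> B" "w \<notin> A" and cov: "\<And>f. f \<in> B ==> \<exists>c. f - smult c w \<in> A"
  and lift: "\<And>\<chi>. alg_char B \<chi> ==> \<exists>p. \<forall>f\<in>B. \<chi> f = poly f p"
  and sep: "separates A"
 shows "\<exists>\<chi> \<phi>. alg_char B \<chi> \<and> point_derivation B \<chi> \<phi> \<and> (\<forall>f\<in>B. f \<in> A \<longleftrightarrow> \<phi> f = 0)"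
proof -
 from codim1_subalgebra[OF A B AB w cov] consider
  (N) \<chi>1 \<chi>2 where "alg_char B \<chi>1" "alg_char B \<chi>2" "\<And>f. f \<in> B ==> f \<in> A \<longleftrightarrow> \<chi>1 f = \<chi>2 f"
 | (D) \<chi> \<phi> where "alg_char B \<chi>" "point_derivation B \<chi> \<phi>" "\<And>f. f \<in> B ==> f \<in> A \<longleftrightarrow> \<phi> f = 0"
  by blast
 then show ?thesis
 proof cases
  case N
  obtain a b where ab: "\<And>f. f \<in> B ==> \<chi>1 f = poly f a" "\<And>f. f \<in> B ==> \<chi>2 f = poly f b"
   using lift N(1,2) by metis
  have mem: "f \<in> A \<longleftrightarrow> poly f a = poly f b" if "f \<in> B" for f using N(3) ab that by simp
  have "a ~= b" using mem[OF w(1)] w(2) by auto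
  then obtain f where "f \<in> A" "poly f a ~= poly f b" using sep by (auto simp: separates_def)
  then show ?thesis using mem AB by blast
 next
  case D
  then show ?thesis by blast
 qed
qed

text \<open>If points are separated, then \<open>A\<close> is the kernel in \<open>B\<close> of a derivation
 \<open>\<phi>\<close> over a character \<open>\<chi>\<close>. From \<open>\<phi> (x ^ k) = 0\<close> it
 follows that \<open>\<phi> x = 0\<close> or \<open>\<chi> x = 0\<close>, and in the second case \<open>\<phi>
 (x ^ 2) = 0\<close>.\<close>

lemma codim1_separating_power:
 fixes A B :: "'a::{alg_closed_field, field_char_0} poly set"
 assumes A: "subalg A" and B: "subalg B" and AB: "A \<subseteq> B"
  and w: "w \<in> B" "w \<notin> A" and cov: "\<And>f. f \<in> B ==> \<exists>c. f - smult c w \<in> A"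
  and lift: "\<And>\<chi>. alg_char B \<chi> ==> \<exists>p. \<forall>f\<in>B. \<chi> f = poly f p"
  and sep: "separates A" and x: "x \<in> B" "x ^ k \<in> A" "k > 0"
 shows "x \<in> A \<or> x ^ 2 \<in> A"
proof -
 obtain \<chi> \<phi> where D: "alg_char B \<chi>" "point_derivation B \<chi> \<phi>" "\<And>f. f \<in> B ==> f \<in> A \<longleftrightarrow> \<phi> f = 0"
  using codim1_separating[OF A B AB w cov lift sep] by metis
 obtain k' where k': "k = Suc k'" using x(3) by (cases k) auto
 have "\<phi> (x ^ Suc k') = 0" using D(3)[of "x ^ Suc k'"] x k' subalgD(9)[OF B x(1)] by blast
 then have "of_nat (Suc k') * \<chi> x ^ k' * \<phi> x = 0"
  unfolding point_derivation_power[OF D(1,2) B x(1)] .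
 then have "\<phi> x = 0 \<or> \<chi> x = 0" by (auto simp del: of_nat_Suc)
 moreover have "\<phi> (x ^ 2) = 0" if "\<chi> x = 0"
  using point_derivation_power[OF D(1,2) B x(1), of 1] that by (simp add: numeral_2_eq_2)
 moreover have "x ^ 2 \<in> B" by (rule subalgD(9)[OF B x(1)])
 ultimately show ?thesis using D(3) x(1) by blast
qed

lemma subalg_UNIV: "subalg UNIV" by (simp add: subalg_def pv.subspace_UNIV)

lemma codim1_separating_cusp:
 fixes A :: "'a::{alg_closed_field, field_char_0} poly set"
 assumes A: "subalg A" and w: "w \<notin> A" and cov: "\<And>f. \<exists>c. f - smult c w \<in> A"
  and sep: "separates A"
 obtains p where "A = {f. poly (pderiv f) p = 0}"
proof -
 have lift: "\<exists>p. \<forall>f\<in>UNIV. \<chi> f = poly f p" if "alg_char UNIV \<chi>" for \<chi> :: "'a poly => 'a"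
  using alg_char_UNIV[OF that] by blast
 obtain \<chi> \<phi> where D: "alg_char UNIV \<chi>" "point_derivation UNIV \<chi> \<phi>" "\<And>f. f \<in> UNIV ==> f \<in> A \<longleftrightarrow> \<phi> f = 0"
  using codim1_separating[OF A subalg_UNIV subset_UNIV UNIV_I w cov lift sep] by metis
 obtain p where p: "\<And>f. \<chi> f = poly f p" using alg_char_UNIV[OF D(1)] by metis
 have phi: "\<phi> f = \<phi> [:0, 1:] * poly (pderiv f) p" for f by (rule point_derivation_UNIV[OF p D(2)])
 have ne: "\<phi> [:0, 1:] ~= 0" using D(3)[of w] w phi[of w] by auto
 have "f \<in> A \<longleftrightarrow> poly (pderiv f) p = 0" for f using D(3)[of f] phi[of f] ne by simp
 then have "A = {f. poly (pderiv f) p = 0}" by blast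
 then show ?thesis by (rule that)
qed

text \<open>Over an algebraically closed field the two-dimensional module of \<open>A\<close> given by the
 quotient has a common eigenvector; together with \<open>A\<close> it spans a candidate for an intermediate
 subalgebra.\<close>

lemma common_eigenvector:
 fixes A :: "'a::alg_closed_field poly set"
 assumes A: "subalg A" and c: "codim2 A w1 w2"
 shows "\<exists>t. t \<notin> A \<and> (\<forall>a\<in>A. \<exists>k. a * t - smult k t \<in> A)"
proof -
 let ?sm = "smult"
 have w1: "w1 \<notin> A"
 proof
  assume "w1 \<in> A"
  then have "?sm 1 w1 + ?sm 0 w2 \<in> A" by simp
  then show False using c unfolding codim2_def by (metis zero_neq_one)
 qed
 show ?thesis
 proof (cases "\<forall>a\<in>A. \<exists>k. \<forall>r. a * r - ?sm k r \<in> A")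
  case True
  then show ?thesis using w1 by blast
 next
  case False
  then obtain a where a: "a \<in> A" "\<And>k. \<exists>r. a * r - ?sm k r \<notin> A" by blast
  obtain t k where t: "t \<notin> A" "a * t - ?sm k t \<in> A"
  proof (cases "\<exists>k. a * w1 - ?sm k w1 \<in> A")
   case True
   then show ?thesis using that w1 by blast
  next
   case ind: False
   obtain x y z where xyz: "(x, y, z) ~= (0, 0, 0)" "?sm x (a * (a * w1)) + ?sm y (a * w1) + ?sm z w1 \<in> A"
    using codim2_three[OF A c] by blast
   have x: "x ~= 0"
   proof
    assume x: "x = 0"
    show False
    proof (cases "y = 0")
     case True
     then show False using xyz x w1 subalg_smult_cancel[OF A] by auto
    next
     case False
     have "?sm y (a * w1 - ?sm (- (z / y)) w1) \<in> A" using xyz(2) x False by (simp add: smult_diff_right smult_add_right)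
     then show False using ind False subalg_smult_cancel[OF A] by blast
    qed
   qed
   have "degree [:z / x, y / x, 1:] > 0" by simp
   then obtain \<rho> where "poly [:z / x, y / x, 1:] \<rho> = 0" using alg_closed_imp_poly_has_root by blast
   then have rho: "z / x = - (\<rho> * (y / x + \<rho>))" by (simp add: algebra_simps add_eq_0_iff)
   define t where "t = a * w1 - ?sm (- (y / x) - \<rho>) w1"
   have "t \<notin> A" unfolding t_def using ind by blast
   moreover have "a * t - ?sm \<rho> t \<in> A"
   proof -
    have "?sm x (a * t - ?sm \<rho> t) = ?sm x (a * (a * w1)) + ?sm y (a * w1) + ?sm z w1"
    proof -
     have z: "z = x * (z / x)" and y: "y = x * (y / x)" using x by simp_all
     define y' where "y' = y / x"
     have z': "z = x * (- (\<rho> * (y' + \<rho>)))" using z unfolding rho y'_def .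
     have y2: "y = x * y'" using y unfolding y'_def .
     show ?thesis unfolding t_def z' y'_def[symmetric] y2
      by (simp add: algebra_simps smult_add_left smult_add_right smult_diff_left smult_diff_right)
    qed
    then show ?thesis using xyz(2) x subalg_smult_cancel[OF A] by metis
   qed
   ultimately show ?thesis using that by blast
  qed
  obtain s where s: "a * s - ?sm k s \<notin> A" using a(2) by blast
  have "\<exists>k'. b * t - ?sm k' t \<in> A" if b: "b \<in> A" for b
  proof -
   obtain x y z where xyz: "(x, y, z) ~= (0, 0, 0)" "?sm x (b * t) + ?sm y t + ?sm z s \<in> A"
    using codim2_three[OF A c] by blast
   define e where "e = ?sm x (b * t) + ?sm y t + ?sm z s"
   have e: "e \<in> A" using xyz(2) by (simp add: e_def)
   have "a * e - ?sm k e - ?sm x (b * (a * t - ?sm k t)) - ?sm y (a * t - ?sm k t) \<in> A"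
    by (intro subalgD(6)[OF A] subalgD(7)[OF A] subalgD(4)[OF A] a(1) e b t(2))
   also have "a * e - ?sm k e - ?sm x (b * (a * t - ?sm k t)) - ?sm y (a * t - ?sm k t) = ?sm z (a * s - ?sm k s)"
    by (simp add: e_def algebra_simps smult_add_right smult_diff_right)
   finally have z: "z = 0" using s subalg_smult_cancel[OF A] by blast
   have x: "x ~= 0"
   proof
    assume "x = 0"
    then have "?sm y t \<in> A" "y ~= 0" using xyz z by auto
    then show False using t(1) subalg_smult_cancel[OF A] by blast
   qed
   have "?sm x (b * t - ?sm (- (y / x)) t) \<in> A" using xyz(2) z x by (simp add: smult_diff_right smult_add_right)
   then show ?thesis using x subalg_smult_cancel[OF A] by blast
  qed
  then show ?thesis using t(1) by blast
 qed
qed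

lemma pderiv_square_mult:
 fixes x :: "'a::field poly"
 shows "pderiv x = 1 ==> pderiv ([:c:] + (x * x) * h) = x * (h + h + x * pderiv h)"
 by (simp add: pderiv_add pderiv_mult pderiv_pCons algebra_simps)

lemma pderiv_cube_mult:
 fixes x :: "'a::field poly"
 shows "pderiv x = 1 ==> pderiv ([:c:] + x ^ 3 * h) = x ^ 2 * (h + h + h + x * pderiv h)"
 by (simp add: pderiv_add pderiv_mult pderiv_pCons power3_eq_cube power2_eq_square algebra_simps)

lemma triple_point_power:
 fixes u :: "'a::field_char_0 poly"
 assumes k: "k > 0" and uk: "u ^ k = [:c:] + [:- p, 1:] ^ 3 * h"
 shows "\<exists>i\<in>{1, 3}. \<exists>c h. u ^ i = [:c:] + [:- p, 1:] ^ 3 * h"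
proof (cases "poly u p = 0")
 case True
 then have "[:- p, 1:] dvd u" by (simp add: dvd_iff_poly_eq_0)
 then obtain v where v: "u = [:- p, 1:] * v" by blast
 have "u ^ 3 = [:0:] + [:- p, 1:] ^ 3 * v ^ 3" unfolding v by (simp only: power_mult_distrib pCons_0_0 add_0)
 then show ?thesis by blast
next
 case False
 define x where "x = [:- p, 1:]"
 have xp: "poly x p = 0" by (simp add: x_def)
 obtain k' where k': "k = Suc k'" using k by (cases k) auto
 have "pderiv (u ^ k) = pderiv ([:c:] + x ^ 3 * h)" unfolding x_def uk ..
 also have "\<dots> = x ^ 2 * (h + h + h + x * pderiv h)"
  by (rule pderiv_cube_mult) (simp add: x_def pderiv_pCons)
 finally have "smult (of_nat k) (u ^ k' * pderiv u) = x ^ 2 * (h + h + h + x * pderiv h)"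
  unfolding k' pderiv_power_Suc by (simp del: of_nat_Suc)
 then have d: "x ^ 2 dvd smult (of_nat k) (u ^ k' * pderiv u)" by simp
 then have "x ^ 2 dvd u ^ k' * pderiv u" using k by (simp add: dvd_smult_iff)
 then obtain q where q: "u ^ k' * pderiv u = x ^ 2 * q" by blast
 have "poly (u ^ k' * pderiv u) p = 0" unfolding q by (simp add: xp)
 then have "poly (pderiv u) p = 0" using False by simp
 then have "x dvd pderiv u" unfolding x_def by (simp add: dvd_iff_poly_eq_0)
 then obtain v1 where v1: "pderiv u = x * v1" by blast
 have xne: "x ~= 0" by (simp add: x_def)
 have "x * (u ^ k' * v1) = x * (x * q)" using q v1 by (simp add: power2_eq_square ac_simps)
 then have "u ^ k' * v1 = x * q" using xne by simp
 then have "poly (u ^ k' * v1) p = 0" using xp by simp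
 then have v1p: "poly v1 p = 0" using False by simp
 obtain h0 where h0: "u = [:poly u p:] + (x * x) * h0"
  using cusp_algebra_rep[of u p] v1 xp unfolding x_def by auto
 have "pderiv u = pderiv ([:poly u p:] + (x * x) * h0)" using h0 by (rule arg_cong)
 also have "\<dots> = x * (h0 + h0 + x * pderiv h0)"
  by (rule pderiv_square_mult) (simp add: x_def pderiv_pCons)
 finally have "x * v1 = x * (h0 + h0 + x * pderiv h0)" unfolding v1 .
 then have "v1 = h0 + h0 + x * pderiv h0" using xne by simp
 then have "poly (h0 + h0 + x * pderiv h0) p = 0" using v1p by simp
 then have "poly h0 p = 0" using xp by simp
 then have "x dvd h0" unfolding x_def by (simp add: dvd_iff_poly_eq_0)
 then obtain h1 where h1: "h0 = x * h1" by blast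
 have "u ^ 1 = [:poly u p:] + x ^ 3 * h1" using h0 unfolding h1 by (simp add: power3_eq_cube mult.assoc)
 then show ?thesis unfolding x_def by blast
qed

text \<open>Unibranch singularities put no arithmetic condition on \<open>u\<close>. Either there is a
 subalgebra strictly between \<open>A\<close> and the polynomial ring, and two steps of codimension one give
 \<open>u ^ 4\<close> at worst, or \<open>A\<close> consists of a constant plus multiples of the cube of a
 linear form, and \<open>u\<close> or \<open>u ^ 3\<close> lies in \<open>A\<close>. The exponent 12 covers
 all cases.\<close>

lemma separating_power:
 fixes A :: "'a::{alg_closed_field, field_char_0} poly set"
 assumes A: "subalg A" and c: "codim2 A w1 w2" and sep: "separates A"
  and u: "u ^ k \<in> A" "k > 0"
 shows "u ^ 12 \<in> A"
proof -
 let ?sm = "smult"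
 have three: "\<exists>a b e. (a, b, e) ~= (0, 0, 0) \<and> ?sm a f + ?sm b g + ?sm e h \<in> A" for f g h
  by (rule codim2_three[OF A c])
 have ind: "c1 = 0 \<and> c2 = 0" if "?sm c1 w1 + ?sm c2 w2 \<in> A" for c1 c2
  using c that by (auto simp: codim2_def)
 obtain t where t: "t \<notin> A" "\<And>a. a \<in> A ==> \<exists>k. a * t - ?sm k t \<in> A" using common_eigenvector[OF A c] by blast
 define T where "T = {f. \<exists>k. f - ?sm k t \<in> A}"
 have Tsub: "pv.subspace T"
 proof (rule pv.subspaceI)
  show "0 \<in> T" using subalgD(3)[OF A] unfolding T_def by (intro CollectI exI[of _ 0]) simp
  fix f g assume "f \<in> T" "g \<in> T"
  then obtain a b where "f - ?sm a t \<in> A" "g - ?sm b t \<in> A" by (auto simp: T_def)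
  then have "(f - ?sm a t) + (g - ?sm b t) \<in> A" by (rule subalgD(5)[OF A])
  then show "f + g \<in> T" unfolding T_def by (intro CollectI exI[of _ "a + b"]) (simp add: smult_add_left algebra_simps)
 next
  fix c f assume "f \<in> T"
  then obtain a where "f - ?sm a t \<in> A" by (auto simp: T_def)
  then have "?sm c (f - ?sm a t) \<in> A" by (rule subalgD(7)[OF A])
  then show "?sm c f \<in> T" unfolding T_def by (intro CollectI exI[of _ "c * a"]) (simp add: smult_diff_right)
 qed
 have AT: "A \<subseteq> T"
 proof
  fix f assume "f \<in> A"
  then show "f \<in> T" unfolding T_def by (intro CollectI exI[of _ 0]) simp
 qed
 have tT: "t \<in> T" using subalgD(3)[OF A] unfolding T_def by (intro CollectI exI[of _ 1]) simp
 have ATT: "a * f \<in> T" if a: "a \<in> A" and f: "f \<in> T" for a f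
 proof -
  obtain k where k: "f - ?sm k t \<in> A" using f by (auto simp: T_def)
  obtain k' where k': "a * t - ?sm k' t \<in> A" using t(2)[OF a] by blast
  have "a * (f - ?sm k t) + ?sm k (a * t - ?sm k' t) \<in> A"
   by (intro subalgD(5)[OF A] subalgD(4)[OF A] subalgD(7)[OF A] a k k')
  then show ?thesis unfolding T_def by (intro CollectI exI[of _ "k * k'"]) (simp add: algebra_simps smult_diff_right)
 qed
 have "\<exists>s. s \<notin> T"
 proof (rule ccontr)
  assume "\<not> (\<exists>s. s \<notin> T)"
  then have "w1 \<in> T" "w2 \<in> T" by auto
  then obtain k1 k2 where k: "w1 - ?sm k1 t \<in> A" "w2 - ?sm k2 t \<in> A" unfolding T_def by blast
  have "?sm k2 (w1 - ?sm k1 t) - ?sm k1 (w2 - ?sm k2 t) \<in> A"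
   by (intro subalgD(6)[OF A] subalgD(7)[OF A] k)
  then have "?sm k2 w1 + ?sm (- k1) w2 \<in> A" by (simp add: smult_diff_right mult.commute)
  then have "k1 = 0" using ind by fastforce
  then have "?sm 1 w1 + ?sm 0 w2 \<in> A" using k(1) by simp
  then show False using ind by (metis zero_neq_one)
 qed
 then obtain s where s: "s \<notin> T" by blast
 have Tcov: "\<exists>c. f - ?sm c s \<in> T" for f
 proof -
  obtain x y z where xyz: "(x, y, z) ~= (0, 0, 0)" "?sm x f + ?sm y s + ?sm z t \<in> A" using three by blast
  have x: "x ~= 0"
  proof
   assume x: "x = 0"
   have "y ~= 0"
   proof
    assume "y = 0"
    then have "?sm z t \<in> A" "z ~= 0" using xyz x by auto
    then show False using t(1) subalg_smult_cancel[OF A] by blast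
   qed
   have "?sm y (s - ?sm (- (z / y)) t) \<in> A" using xyz x \<open>y ~= 0\<close> by (simp add: smult_diff_right smult_add_right)
   then have "s - ?sm (- (z / y)) t \<in> A" using \<open>y ~= 0\<close> subalg_smult_cancel[OF A] by blast
   then show False using s unfolding T_def by blast
  qed
  have "?sm x (f - ?sm (- (y / x)) s - ?sm (- (z / x)) t) \<in> A"
   using xyz(2) x by (simp add: smult_diff_right smult_add_right)
  then have "f - ?sm (- (y / x)) s - ?sm (- (z / x)) t \<in> A" using x subalg_smult_cancel[OF A] by blast
  then show ?thesis unfolding T_def by blast
 qed
 define m where "m = {b \<in> A. b * s \<in> T}"
 have mT: "b * f \<in> T" if b: "b \<in> m" for b f
 proof -
  obtain k where k: "f - ?sm k s \<in> T" using Tcov by blast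
  have "b * (f - ?sm k s) + ?sm k (b * s) \<in> T"
   using b ATT[OF _ k] by (intro pv.subspace_add[OF Tsub] pv.subspace_scale[OF Tsub]) (auto simp: m_def)
  then show ?thesis by (simp add: algebra_simps)
 qed
 have Am: "\<exists>k. a - [:k:] \<in> m" if a: "a \<in> A" for a
 proof -
  obtain k where "a * s - ?sm k s \<in> T" using Tcov by blast
  then have "(a - [:k:]) * s \<in> T" by (simp add: algebra_simps)
  moreover have "a - [:k:] \<in> A" by (intro subalgD(6)[OF A] a subalgD(8)[OF A])
  ultimately show ?thesis by (auto simp: m_def)
 qed
 have "\<exists>i\<in>{1,2,3,4}. u ^ i \<in> A"
 proof (cases "\<exists>b\<in>m. \<exists>r. b * r \<notin> A")
  case True
  then obtain b r where br: "b \<in> m" "b * r \<notin> A" by blast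
  define t' where "t' = b * r"
  have t'T: "t' \<in> T" unfolding t'_def by (rule mT[OF br(1)])
  have cov': "\<exists>c. f - ?sm c t' \<in> A" if f: "f \<in> T" for f
  proof -
   obtain k where k: "f - ?sm k t \<in> A" using f by (auto simp: T_def)
   obtain k' where k': "t' - ?sm k' t \<in> A" using t'T by (auto simp: T_def)
   have "k' ~= 0" using k' br(2) by (auto simp: t'_def)
   have "(f - ?sm k t) - ?sm (k / k') (t' - ?sm k' t) \<in> A"
    by (intro subalgD(6)[OF A] subalgD(7)[OF A] k k')
   then show ?thesis using \<open>k' ~= 0\<close> by (intro exI[of _ "k / k'"]) (simp add: smult_diff_right)
  qed
  have t't': "t' * f \<in> T" for f unfolding t'_def mult.assoc by (rule mT[OF br(1)])
  have Talg: "subalg T" unfolding subalg_def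
  proof (intro conjI ballI)
   show "pv.subspace T" by (rule Tsub)
   show "1 \<in> T" using AT subalgD(2)[OF A] by blast
   fix f g assume f: "f \<in> T" and g: "g \<in> T"
   obtain k where k: "f - ?sm k t' \<in> A" using cov'[OF f] by blast
   have "(f - ?sm k t') * g + ?sm k (t' * g) \<in> T"
    by (intro pv.subspace_add[OF Tsub] pv.subspace_scale[OF Tsub] ATT k g t't')
   then show "f * g \<in> T" by (simp add: algebra_simps)
  qed
  have sepT: "separates T" using sep AT unfolding separates_def by blast
  obtain p where p: "T = {f. poly (pderiv f) p = 0}" by (rule codim1_separating_cusp[OF Talg s Tcov sepT])
  have liftU: "\<exists>p. \<forall>f\<in>UNIV. \<chi> f = poly f p" if "alg_char UNIV \<chi>" for \<chi> :: "'a poly => 'a"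
   using alg_char_UNIV[OF that] by blast
  have "u ^ k \<in> T" using u(1) AT by blast
  from codim1_separating_power[OF Talg subalg_UNIV subset_UNIV UNIV_I s Tcov liftU sepT UNIV_I this u(2)]
  have "u ^ 1 \<in> T \<or> u ^ 2 \<in> T" by simp
  then obtain i where i: "i \<in> {1, 2::nat}" "u ^ i \<in> T" by blast
  have lift: "\<exists>p. \<forall>f\<in>T. \<chi> f = poly f p" if ch: "alg_char T \<chi>" for \<chi>
  proof (rule alg_char_lift[OF Talg ch, of "[:- p, 1:] * [:- p, 1:]" p])
   show "[:- p, 1:] * [:- p, 1:] * h \<in> T" for h
    unfolding p mult.assoc by (simp add: poly_pderiv_linear_mult del: mult_pCons_left)
   show "\<exists>h. f = [:poly f p:] + [:- p, 1:] * [:- p, 1:] * h" if "f \<in> T" for f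
    using that unfolding p by (intro cusp_algebra_rep) simp
  qed
  have "(u ^ i) ^ k \<in> A" using subalgD(9)[OF A u(1), of i] by (simp add: power_mult[symmetric] mult.commute)
  from codim1_separating_power[OF A Talg AT t'T _ cov' lift sep i(2) this u(2)] br(2)
  have "u ^ i \<in> A \<or> u ^ (i * 2) \<in> A" by (simp add: t'_def power_mult)
  then show ?thesis using i(1) by auto
 next
  case False
  then have mA: "b * r \<in> A" if "b \<in> m" for b r using that by blast
  have mi: "b * r \<in> m" if "b \<in> m" for b r
   using mA[OF that] AT by (auto simp: m_def mult.assoc)
  have msub: "f - g \<in> m" "f + g \<in> m" "?sm k f \<in> m" if "f \<in> m" "g \<in> m" for f g k
   using that subalgD(5,6,7)[OF A] pv.subspace_diff[OF Tsub] pv.subspace_add[OF Tsub] pv.subspace_scale[OF Tsub]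
   by (auto simp: m_def algebra_simps)
  define z where "z = ([:0, 1:] :: 'a poly)"
  obtain c1 c2 c3 where c123: "(c1, c2, c3) ~= (0, 0, 0)" "?sm c1 z + ?sm c2 (z ^ 2) + ?sm c3 (z ^ 3) \<in> A"
   using three by blast
  obtain c0 where c0: "?sm c1 z + ?sm c2 (z ^ 2) + ?sm c3 (z ^ 3) - [:c0:] \<in> m" using Am[OF c123(2)] by blast
  define g where "g = [:- c0, c1, c2, c3:]"
  have gm: "g \<in> m" using c0 by (simp add: g_def z_def power2_eq_square power3_eq_cube)
  have gne: "g ~= 0" using c123(1) by (auto simp: g_def)
  have small: "f = 0" if f: "f \<in> m" and deg: "degree f \<le> 2" for f
  proof (rule ccontr)
   assume fne: "f ~= 0"
   have rep: "\<exists>k. h - ?sm k z \<in> A" for h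
   proof -
    define r where "r = h mod f"
    have "r = 0 \<or> degree r < degree f" unfolding r_def using degree_mod_less[OF fne] by blast
    then have "degree r \<le> 1" using deg by auto
    then obtain x y where r: "r = [:x, y:]" by (metis degree1_coeffs degree_eq_zeroE le_SucE One_nat_def le_zero_eq pCons_0_0)
    have hr: "h = f * (h div f) + r" by (simp add: r_def)
    have "h - ?sm y z = f * (h div f) + (r - ?sm y z)" by (subst hr) (simp only: add_diff_eq)
    also have "r - ?sm y z = [:x:]" by (simp add: r z_def)
    also have "f * (h div f) + [:x:] \<in> A" by (intro subalgD(5)[OF A] subalgD(8)[OF A] mA f)
    finally show ?thesis by blast
   qed
   obtain k1 k2 where k: "w1 - ?sm k1 z \<in> A" "w2 - ?sm k2 z \<in> A" using rep by blast
   have "?sm k2 (w1 - ?sm k1 z) - ?sm k1 (w2 - ?sm k2 z) \<in> A"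
    by (intro subalgD(6)[OF A] subalgD(7)[OF A] k)
   then have "?sm k2 w1 + ?sm (- k1) w2 \<in> A" by (simp add: smult_diff_right mult.commute)
   then have "k1 = 0" using ind by fastforce
   then have "?sm 1 w1 + ?sm 0 w2 \<in> A" using k(1) by simp
   then show False using ind by (metis zero_neq_one)
  qed
  have "degree g \<le> 3" by (simp add: g_def)
  then have dg: "degree g = 3" using small[OF gm] gne by fastforce
  have mg: "\<exists>h. f = g * h" if f: "f \<in> m" for f
  proof -
   have "f mod g = f - g * (f div g)" by (simp add: minus_mult_div_eq_mod)
   also have "\<dots> \<in> m" by (intro msub(1) mi f gm)
   finally have "f mod g \<in> m" .
   moreover have "degree (f mod g) \<le> 2" using degree_mod_less[OF gne, of f] dg by auto
   ultimately have "f mod g = 0" by (rule small)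
   then show ?thesis by (metis dvd_def mod_eq_0_iff_dvd)
  qed
  have Ag: "\<exists>c h. f = [:c:] + g * h" if "f \<in> A" for f
  proof -
   obtain k where k: "f - [:k:] \<in> m" using Am[OF \<open>f \<in> A\<close>] by blast
   obtain h where "f - [:k:] = g * h" using mg[OF k] by blast
   then have "f = [:k:] + g * h" by (simp add: algebra_simps)
   then show ?thesis by blast
  qed
  have gA: "[:c:] + g * h \<in> A" for c h by (intro subalgD(5)[OF A] subalgD(8)[OF A] mA gm)
  obtain p where gp: "poly g p = 0" using alg_closed_imp_poly_has_root[of g] dg by auto
  have only: "q = p" if "poly g q = 0" for q
  proof (rule ccontr)
   assume "q ~= p"
   then obtain f where f: "f \<in> A" "poly f q ~= poly f p" using sep unfolding separates_def by blast
   obtain c h where "f = [:c:] + g * h" using Ag[OF f(1)] by blast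
   then show False using f(2) gp that by simp
  qed
  obtain A' where A': "size A' = degree g" "g = ?sm (lead_coeff g) (\<Prod>x\<in>#A'. [:- x, 1:])"
   using alg_closed_imp_factorization[OF gne] by blast
  have "x = p" if x: "x \<in># A'" for x
  proof -
   obtain B where "A' = add_mset x B" using x by (rule mset_add)
   then have "poly (?sm (lead_coeff g) (\<Prod>x\<in>#A'. [:- x, 1:])) x = 0" by simp
   then show ?thesis using A'(2) only by metis
  qed
  then have "set_mset A' \<subseteq> {p}" by blast
  then have "A' = replicate_mset 3 p" using set_mset_subset_singletonD[of A' p] A'(1) dg by simp
  then have "g = ?sm (lead_coeff g) ([:- p, 1:] ^ 3)" "lead_coeff g ~= 0" using A'(2) gne by simp_all
  then obtain L where g3: "g = ?sm L ([:- p, 1:] ^ 3)" and lg: "L ~= 0" by blast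
  obtain c h where "u ^ k = [:c:] + g * h" using Ag[OF u(1)] by blast
  also have "\<dots> = [:c:] + [:- p, 1:] ^ 3 * ?sm L h" by (simp only: g3 mult_smult_left mult_smult_right)
  finally obtain i c h where i: "i \<in> {1, 3::nat}" "u ^ i = [:c:] + [:- p, 1:] ^ 3 * h"
   using triple_point_power[OF u(2)] by blast
  have "g * ?sm (inverse L) h = ?sm (L * inverse L) ([:- p, 1:] ^ 3 * h)"
   by (simp only: g3 mult_smult_left mult_smult_right smult_smult mult.commute[of L])
  also have "\<dots> = [:- p, 1:] ^ 3 * h" by (simp only: right_inverse[OF lg] smult_1_left)
  finally have "[:- p, 1:] ^ 3 * h = g * ?sm (inverse L) h" by (rule sym)
  then have "u ^ i \<in> A" using i(2) gA by metis
  then show ?thesis using i(1) by auto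
 qed
 then obtain i where i: "i \<in> {1,2,3,4::nat}" "u ^ i \<in> A" by blast
 then have "u ^ 12 = (u ^ i) ^ (12 div i)" by (auto simp: power_mult[symmetric])
 then show ?thesis using subalgD(9)[OF A i(2)] by simp
qed

section \<open>Powers of a space of polynomials\<close>

definition polys_le :: "nat => 'a::field poly set" where
 "polys_le m = {f. degree f \<le> m}"

lemma polys_le_subspace: "pv.subspace (polys_le m)"
 by (rule pv.subspaceI) (auto simp: polys_le_def degree_add_le intro: le_trans[OF degree_smult_le])

lemma polys_le_span: "(polys_le m :: 'a::field poly set) = pv.span (monom 1 ` {..m})"
proof
 show "(polys_le m :: 'a poly set) \<subseteq> pv.span (monom 1 ` {..m})"
 proof
  fix f :: "'a poly" assume "f \<in> polys_le m"
  then have "degree f \<le> m" by (simp add: polys_le_def)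
  have "f = (\<Sum>i\<le>degree f. smult (coeff f i) (monom 1 i))"
   by (simp add: smult_monom poly_as_sum_of_monoms)
  also have "\<dots> \<in> pv.span (monom 1 ` {..m})"
   using \<open>degree f \<le> m\<close> by (intro pv.span_sum pv.span_scale pv.span_base) auto
  finally show "f \<in> pv.span (monom 1 ` {..m})" .
 qed
 show "pv.span (monom 1 ` {..m}) \<subseteq> (polys_le m :: 'a poly set)"
  by (rule pv.span_minimal[OF _ polys_le_subspace]) (auto simp: polys_le_def intro: le_trans[OF degree_monom_le])
qed

lemma polys_le_dim: "pv.dim (polys_le m :: 'a::field poly set) = m + 1"
proof -
 have inj: "inj_on (monom (1::'a)) {..m}" by (auto simp: inj_on_def monom_eq_iff')
 have "pv.independent (monom (1::'a) ` {..m})"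
 proof (rule notI)
  assume "pv.dependent (monom (1::'a) ` {..m})"
  then obtain c where c: "\<exists>v\<in>monom (1::'a) ` {..m}. c v ~= 0"
   "(\<Sum>v\<in>monom (1::'a) ` {..m}. smult (c v) v) = 0"
   by (auto simp: pv.dependent_finite)
  from c(2) have 0: "(\<Sum>i\<le>m. monom (c (monom 1 i)) i) = 0"
   by (simp add: sum.reindex[OF inj] smult_monom)
  have "c (monom 1 i) = 0" if "i \<le> m" for i
   using arg_cong[OF 0, of "\<lambda>p. coeff p i"] that by (simp add: coeff_sum)
  then show False using c(1) by auto
 qed
 then have "pv.dim (monom (1::'a) ` {..m}) = card (monom (1::'a) ` {..m})"
  by (rule pv.dim_eq_card_independent)
 then show ?thesis unfolding polys_le_span by (simp add: card_image[OF inj])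
qed

definition vpow :: "'a::field poly set => nat => 'a poly set" where
 "vpow V k = pv.span {prod_list ls | ls. length ls = k \<and> set ls \<subseteq> V}"

lemma vpow_subspace: "pv.subspace (vpow V k)" by (simp add: vpow_def)

lemma vpow_prod_list: "length ls = k ==> set ls \<subseteq> V ==> prod_list ls \<in> vpow V k"
 unfolding vpow_def by (rule pv.span_base) blast

lemma vpow_base: "f \<in> V ==> f \<in> vpow V 1"
 using vpow_prod_list[of "[f]" 1 V] by simp

lemma vpow_one: "1 \<in> vpow V 0"
 using vpow_prod_list[of "[]" 0 V] by simp

lemma span_mult_closed:
 assumes W: "pv.subspace W" and b: "\<And>x y. x \<in> A ==> y \<in> B ==> x * y \<in> W"
  and f: "f \<in> pv.span A" and g: "g \<in> pv.span B"
 shows "f * g \<in> W"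
proof -
 have 1: "x * g \<in> W" if x: "x \<in> A" for x
  using g
 proof (induction rule: pv.span_induct_alt)
  case base
  show ?case using pv.subspace_0[OF W] by simp
 next
  case (step c y z)
  have "smult c (x * y) + x * z \<in> W"
   by (intro pv.subspace_add[OF W] pv.subspace_scale[OF W] b x step)
  then show ?case by (simp add: algebra_simps)
 qed
 show ?thesis
  using f
 proof (induction rule: pv.span_induct_alt)
  case base
  show ?case using pv.subspace_0[OF W] by simp
 next
  case (step c y z)
  have "smult c (y * g) + z * g \<in> W"
   by (intro pv.subspace_add[OF W] pv.subspace_scale[OF W] 1 step)
  then show ?case by (simp add: algebra_simps)
 qed
qed

lemma vpow_mult: "f \<in> vpow V k ==> g \<in> vpow V m ==> f * g \<in> vpow V (k + m)"
 unfolding vpow_def[of V k] vpow_def[of V m]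
proof (rule span_mult_closed[OF vpow_subspace])
 fix x y assume "x \<in> {prod_list ls |ls. length ls = k \<and> set ls \<subseteq> V}" "y \<in> {prod_list ls |ls. length ls = m \<and> set ls \<subseteq> V}"
 then obtain ls ls' where "x = prod_list ls" "length ls = k" "set ls \<subseteq> V" "y = prod_list ls'" "length ls' = m" "set ls' \<subseteq> V"
  by blast
 then show "x * y \<in> vpow V (k + m)" using vpow_prod_list[of "ls @ ls'" "k + m" V] by simp
qed

lemma vpow_power: "f \<in> V ==> f ^ k \<in> vpow V k"
 by (induction k) (use vpow_one vpow_mult[OF vpow_base] in auto)

lemma vpow_power_mult: "f \<in> V ==> g \<in> vpow V m ==> f ^ k * g \<in> vpow V (k + m)"
 using vpow_mult[OF vpow_power] .

lemma vpow_Suc_induct: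
 assumes f: "f \<in> vpow V (Suc k)" and W: "pv.subspace W"
  and b: "\<And>l g. l \<in> V ==> g \<in> vpow V k ==> l * g \<in> W"
 shows "f \<in> W"
proof -
 have "{prod_list ls | ls. length ls = Suc k \<and> set ls \<subseteq> V} \<subseteq> W"
 proof
  fix x assume "x \<in> {prod_list ls | ls. length ls = Suc k \<and> set ls \<subseteq> V}"
  then obtain ls where "x = prod_list ls" "length ls = Suc k" "set ls \<subseteq> V" by blast
  then obtain l ls' where "x = l * prod_list ls'" "l \<in> V" "length ls' = k" "set ls' \<subseteq> V"
   by (cases ls) auto
  then show "x \<in> W" using b vpow_prod_list by blast
 qed
 then show ?thesis using f W pv.span_minimal unfolding vpow_def by blast
qed

lemma vpow_le:
 assumes "V \<subseteq> polys_le d"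
 shows "vpow V k \<subseteq> polys_le (d * k)"
proof (induction k)
 case 0
 show ?case unfolding vpow_def by (rule pv.span_minimal[OF _ polys_le_subspace]) (auto simp: polys_le_def)
next
 case (Suc k)
 show ?case
 proof
  fix f assume "f \<in> vpow V (Suc k)"
  then show "f \<in> polys_le (d * Suc k)"
  proof (rule vpow_Suc_induct[OF _ polys_le_subspace])
   fix l g assume "l \<in> V" "g \<in> vpow V k"
   then have "degree l \<le> d" "degree g \<le> d * k" using assms Suc by (auto simp: polys_le_def)
   then show "l * g \<in> polys_le (d * Suc k)" using degree_mult_le[of l g] by (simp add: polys_le_def)
  qed
 qed
qed

lemma vpow_span:
 assumes "V = pv.span B"
 shows "vpow V k = pv.span {prod_list ls | ls. length ls = k \<and> set ls \<subseteq> B}"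
proof
 show "pv.span {prod_list ls | ls. length ls = k \<and> set ls \<subseteq> B} \<subseteq> vpow V k"
  unfolding vpow_def using assms pv.span_superset[of B] by (intro pv.span_mono) blast
 show "vpow V k \<subseteq> pv.span {prod_list ls | ls. length ls = k \<and> set ls \<subseteq> B}"
 proof (induction k)
  case 0
  show ?case unfolding vpow_def by (intro pv.span_mono) auto
 next
  case (Suc k)
  show ?case
  proof
   fix f assume "f \<in> vpow V (Suc k)"
   then show "f \<in> pv.span {prod_list ls | ls. length ls = Suc k \<and> set ls \<subseteq> B}"
   proof (rule vpow_Suc_induct[OF _ pv.subspace_span])
    fix l g assume l: "l \<in> V" and g: "g \<in> vpow V k"
    show "l * g \<in> pv.span {prod_list ls | ls. length ls = Suc k \<and> set ls \<subseteq> B}"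
    proof (rule span_mult_closed[OF pv.subspace_span])
     show "l \<in> pv.span B" using l assms by simp
     show "g \<in> pv.span {prod_list ls | ls. length ls = k \<and> set ls \<subseteq> B}" using g Suc by blast
     fix x y assume "x \<in> B" "y \<in> {prod_list ls | ls. length ls = k \<and> set ls \<subseteq> B}"
     then obtain ls where "y = prod_list ls" "length ls = k" "set ls \<subseteq> B" by blast
     then have "x * y = prod_list (x # ls)" "length (x # ls) = Suc k" "set (x # ls) \<subseteq> B"
      using \<open>x \<in> B\<close> by auto
     then show "x * y \<in> pv.span {prod_list ls | ls. length ls = Suc k \<and> set ls \<subseteq> B}"
      by (intro pv.span_base) blast
    qed
   qed
  qed
 qed
qed

section \<open>General members of a linear system\<close>

lemma finite_bad_multiples:
 fixes x y :: "'a::field_char_0"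
 assumes "x ~= 0 \<or> y ~= 0"
 shows "finite {n::nat. of_nat n * x + y = 0}"
proof (cases "x = 0")
 case False
 have "n = m" if "of_nat n * x + y = 0" "of_nat m * x + y = 0" for n m :: nat
 proof -
  have "of_nat n * x = of_nat m * x" using that by (metis add_right_cancel)
  then show ?thesis using False by simp
 qed
 then have "\<exists>n0. {n::nat. of_nat n * x + y = 0} \<subseteq> {n0}" by blast
 then show ?thesis by (meson finite.emptyI finite.insertI finite_subset)
qed (use assms in simp)

text \<open>One member on which each of finitely many functionals does not vanish: integral combinations avoid
 the finitely many bad multiples, so that rationality of coefficients is kept.\<close>

lemma general_member:
 fixes V0 :: "'a::field_char_0 poly set"
 assumes "finite \<Phi>" "V0 ~= {}"
  and cl: "\<And>f g n. f \<in> V0 ==> g \<in> V0 ==> smult (of_nat n) f + g \<in> V0"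
  and lin: "\<And>\<phi> f g c. \<phi> \<in> \<Phi> ==> \<phi> (smult c f + g) = c * \<phi> f + \<phi> g"
  and ne: "\<And>\<phi>. \<phi> \<in> \<Phi> ==> \<exists>f\<in>V0. \<phi> f ~= (0::'a)"
 shows "\<exists>f\<in>V0. \<forall>\<phi>\<in>\<Phi>. \<phi> f ~= 0"
 using assms(1) lin ne
proof (induction \<Phi> rule: finite_induct)
 case empty
 then show ?case using assms(2) by blast
next
 case (insert \<phi> \<Phi>)
 then obtain f where f: "f \<in> V0" "\<forall>\<phi>\<in>\<Phi>. \<phi> f ~= 0" by auto
 obtain g where g: "g \<in> V0" "\<phi> g ~= 0" using insert.prems(2) by blast
 define bad where "bad = (\<Union>\<psi>\<in>insert \<phi> \<Phi>. {n::nat. of_nat n * \<psi> f + \<psi> g = 0})"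
 have "finite bad" unfolding bad_def
  using insert.hyps(1) f(2) g(2) by (intro finite_UN_I finite_bad_multiples) auto
 then obtain n where n: "n \<notin> bad" using infinite_UNIV_nat by (metis ex_new_if_finite)
 have "\<psi> (smult (of_nat n) f + g) ~= 0" if "\<psi> \<in> insert \<phi> \<Phi>" for \<psi>
  using n that insert.prems(1)[OF that] by (auto simp: bad_def)
 then show ?case using cl[OF f(1) g(1), of n] by blast
qed

text \<open>Take a nonzero combination of least degree; it divides both polynomials, hence is
 constant.\<close>

lemma no_common_root_bezout:
 fixes s a :: "'a::alg_closed_field poly"
 assumes "s ~= 0" and nr: "\<And>z. poly s z = 0 ==> poly a z ~= 0"
 obtains u h where "u * s + h * a = 1"
proof -
 define Q where "Q = (\<lambda>g. g ~= 0 \<and> (\<exists>u h. g = u * s + h * a))"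
 have "Q s" unfolding Q_def using assms(1) by (intro conjI exI[of _ 1] exI[of _ 0]) auto
 then obtain g where g: "Q g" "\<And>f. Q f ==> degree g \<le> degree f"
  using ex_has_least_nat[of Q s degree] by blast
 obtain u h where gu: "g = u * s + h * a" and gne: "g ~= 0" using g(1) by (auto simp: Q_def)
 have dv: "g dvd f" if f: "f = u' * s + h' * a" for f u' h'
 proof (rule ccontr)
  assume nd: "\<not> g dvd f"
  then have ne: "f mod g ~= 0" by (simp add: dvd_eq_mod_eq_0)
  have "f mod g = f - g * (f div g)" by (simp add: minus_mult_div_eq_mod)
  also have "\<dots> = (u' - u * (f div g)) * s + (h' - h * (f div g)) * a"
   unfolding f gu by (simp add: algebra_simps)
  finally have "Q (f mod g)" unfolding Q_def using ne by blast
  then have "degree g \<le> degree (f mod g)" by (rule g(2))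
  then show False using degree_mod_less[OF gne, of f] ne by auto
 qed
 have "g dvd s" "g dvd a" using dv[of s 1 0] dv[of a 0 1] by auto
 then have "poly g z ~= 0" for z using nr[of z] by (auto elim!: dvdE)
 then have "degree g = 0" using alg_closed_imp_poly_has_root[of g] by blast
 then obtain c where c: "g = [:c:]" by (metis degree_eq_zeroE)
 have "smult (inverse c) g = 1" using gne c by (simp add: one_pCons)
 then have "smult (inverse c) u * s + smult (inverse c) h * a = 1"
  unfolding gu by (simp add: smult_add_right)
 then show ?thesis by (rule that)
qed

lemma prod_linear_dvd:
 fixes f :: "'a::field poly"
 assumes "finite Z" "\<And>z. z \<in> Z ==> poly f z = 0"
 shows "(\<Prod>z\<in>Z. [:- z, 1:]) dvd f"
 using assms
proof (induction Z arbitrary: f rule: finite_induct)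
 case (insert z Z)
 obtain h where h: "f = (\<Prod>z\<in>Z. [:- z, 1:]) * h" using insert.IH[of f] insert.prems by (auto elim: dvdE)
 have "poly (\<Prod>z\<in>Z. [:- z, 1:]) z ~= 0" using insert.hyps by (auto simp: poly_prod)
 then have "poly h z = 0" using insert.prems[of z] unfolding h by simp
 then have "[:- z, 1:] dvd h" by (simp add: dvd_iff_poly_eq_0)
 then obtain k where k: "h = [:- z, 1:] * k" by blast
 have "f = (\<Prod>z\<in>insert z Z. [:- z, 1:]) * k"
  using insert.hyps unfolding h k prod.insert[OF insert.hyps] by (simp only: ac_simps)
 then show ?case by (rule dvdI)
qed simp

section \<open>Base point free systems, conductors and regularity\<close>

global_interpretation pvp: vector_space_pair "smult :: 'a::field => 'a poly => 'a poly"
 "smult :: 'a::field => 'a poly => 'a poly" ..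

locale base_point_free_system =
 fixes V :: "'a::{alg_closed_field, field_char_0} poly set" and d :: nat
 assumes V: "pv.subspace V" and Vd: "V \<subseteq> polys_le d" and d0: "d > 0"
  and bpf: "\<And>z. \<exists>f\<in>V. poly f z ~= 0" and inf: "\<exists>f\<in>V. coeff f d ~= 0"
begin

lemma vpow_deg: "f \<in> vpow V k ==> degree f \<le> d * k"
 using vpow_le[OF Vd, of k] by (auto simp: polys_le_def)

lemma pencil:
 "\<exists>s0 s1. s0 \<in> V \<and> s1 \<in> V \<and> coeff s0 d ~= 0 \<and> (\<forall>z. poly s0 z = 0 --> poly s1 z ~= 0)"
proof -
 obtain s0 where s0: "s0 \<in> V" "coeff s0 d ~= 0" using inf by blast
 have s0ne: "s0 ~= 0" using s0(2) by auto
 have "\<exists>f\<in>V. \<forall>\<phi>\<in>(\<lambda>z f. poly f z) ` {z. poly s0 z = 0}. \<phi> f ~= 0"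
 proof (rule general_member)
  show "finite ((\<lambda>z f. poly f z) ` {z. poly s0 z = 0})" using poly_roots_finite[OF s0ne] by simp
  show "V ~= {}" using s0(1) by blast
 qed (use bpf in \<open>auto intro: pv.subspace_add[OF V] pv.subspace_scale[OF V]\<close>)
 then obtain s1 where "s1 \<in> V" "\<And>z. poly s0 z = 0 ==> poly s1 z ~= 0" by auto
 then show ?thesis using s0 by blast
qed

lemma multiples_generate:
 assumes W: "pv.subspace W" and i: "i \<ge> 1" and f: "degree f \<le> d * Suc i"
  and b: "\<And>l g. l \<in> V ==> degree g \<le> d * i ==> l * g \<in> W"
 shows "f \<in> W"
proof -
 obtain s0 s1 where s: "s0 \<in> V" "s1 \<in> V" "coeff s0 d ~= 0" "\<And>z. poly s0 z = 0 ==> poly s1 z ~= 0"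
  using pencil by blast
 have s0ne: "s0 ~= 0" using s(3) by auto
 have ds0: "degree s0 = d" using s(1,3) Vd le_degree[OF s(3)] by (auto simp: polys_le_def)
 have ds1: "degree s1 \<le> d" using s(2) Vd by (auto simp: polys_le_def)
 obtain u h where uh: "u * s0 + h * s1 = 1" by (rule no_common_root_bezout[OF s0ne s(4)])
 define r where "r = (f * h) mod s0"
 have dr: "degree r < d" unfolding r_def using degree_mod_less[OF s0ne, of "f * h"] ds0 d0 by auto
 have "f - r * s1 = f * (u * s0 + h * s1) - r * s1" using uh by simp
 also have "\<dots> = f * u * s0 + (f * h - r) * s1" by (simp add: algebra_simps)
 also have "f * h - r = s0 * ((f * h) div s0)" unfolding r_def by (simp add: minus_mod_eq_mult_div)
 finally have q: "f - r * s1 = s0 * (f * u + ((f * h) div s0) * s1)" by (simp add: algebra_simps)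
 define q where "q = f * u + ((f * h) div s0) * s1"
 have fq: "f = s1 * r + s0 * q" using q by (simp add: q_def algebra_simps)
 have "d * 1 \<le> d * i" using i by (intro mult_le_mono2)
 then have di: "d \<le> d * i" by simp
 have dq: "degree q \<le> d * i"
 proof (cases "q = 0")
  case False
  have "degree (r * s1) \<le> degree r + degree s1" by (rule degree_mult_le)
  moreover have "d * Suc i = d + d * i" by simp
  ultimately have "degree (r * s1) \<le> d * Suc i" using dr ds1 di by linarith
  then have "degree (f - r * s1) \<le> d * Suc i" using f by (intro degree_diff_le)
  then have "degree (s0 * q) \<le> d * Suc i" using q by (simp add: q_def)
  then show ?thesis using False s0ne ds0 by (simp add: degree_mult_eq)
 qed simp
 have "degree r \<le> d * i" using dr di by linarith
 then have "s1 * r \<in> W" "s0 * q \<in> W" using b[OF s(2), of r] b[OF s(1) dq] by blast+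
 then show ?thesis unfolding fq by (rule pv.subspace_add[OF W])
qed

text \<open>Multiplication by \<open>s0\<close> embeds \<open>vpow V k\<close>, and a power of a member
 \<open>s1\<close> without common zeros with \<open>s0\<close> is not in the image.\<close>

lemma dim_vpow_strict: "pv.dim (vpow V k) < pv.dim (vpow V (Suc k))"
proof -
 obtain s0 s1 where s: "s0 \<in> V" "s1 \<in> V" "coeff s0 d ~= 0" "\<And>z. poly s0 z = 0 ==> poly s1 z ~= 0"
  using pencil by blast
 have s0: "s0 ~= 0" using s(3) by auto
 define U where "U = (\<lambda>f. s0 * f) ` vpow V k"
 have lin: "Vector_Spaces.linear smult smult (\<lambda>f. s0 * f)"
  by (simp add: Vector_Spaces.linear_iff pv.vector_space_axioms distrib_left)
 have dimU: "pv.dim U = pv.dim (vpow V k)" unfolding U_def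
  using s0 by (intro pvp.dim_injective_image[OF lin vpow_subspace]) (auto simp: inj_on_def)
 have U: "pv.subspace U" unfolding U_def by (rule pvp.linear_subspace_image[OF lin vpow_subspace])
 have sub: "U \<subseteq> vpow V (Suc k)" unfolding U_def using vpow_mult[OF vpow_base[OF s(1)]] by auto
 have fin: "finite (monom (1::'a) ` {..d * Suc k})" by simp
 have sp: "vpow V (Suc k) \<subseteq> pv.span (monom (1::'a) ` {..d * Suc k})"
  using vpow_le[OF Vd, of "Suc k"] by (simp only: polys_le_span)
 from pv.exists_complement[OF U vpow_subspace sub fin sp]
 obtain C where C: "finite C" "card C + pv.dim U = pv.dim (vpow V (Suc k))"
  "\<forall>y\<in>vpow V (Suc k). \<exists>c. y - (\<Sum>t\<in>C. smult (c t) t) \<in> U" by blast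
 have "degree s0 \<ge> d" using s(3) by (rule le_degree)
 then obtain z where z: "poly s0 z = 0" using d0 alg_closed_imp_poly_has_root[of s0] by auto
 have "s1 ^ Suc k \<notin> U"
 proof
  assume "s1 ^ Suc k \<in> U"
  then obtain f where "s1 ^ Suc k = s0 * f" by (auto simp: U_def)
  then have "poly (s1 ^ Suc k) z = 0" using z by simp
  then show False using s(4)[OF z] by simp
 qed
 moreover have "s1 ^ Suc k \<in> vpow V (Suc k)" by (rule vpow_power[OF s(2)])
 ultimately have "C ~= {}" using C(3) by auto
 then have "card C > 0" using C(1) by (simp add: card_gt_0_iff)
 then show ?thesis using C(2) dimU by simp
qed

end

locale linear_system = base_point_free_system V d
 for V :: "'a::{alg_closed_field, field_char_0} poly set" and d :: nat +
 assumes codim: "\<exists>k0. \<forall>k\<ge>k0. pv.dim (vpow V k) + 2 = d * k + 1"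
begin

lemma complement:
 "\<exists>k0. \<forall>k\<ge>k0. \<exists>c1 c2. degree c1 \<le> d * k \<and> degree c2 \<le> d * k \<and>
   (\<forall>f. degree f \<le> d * k --> (\<exists>x y. f - (smult x c1 + smult y c2) \<in> vpow V k)) \<and>
   (\<forall>x y. smult x c1 + smult y c2 \<in> vpow V k --> x = 0 \<and> y = 0)"
proof -
 obtain k0 where k0: "\<And>k. k \<ge> k0 ==> pv.dim (vpow V k) + 2 = d * k + 1" using codim by blast
 have "\<exists>c1 c2. degree c1 \<le> d * k \<and> degree c2 \<le> d * k \<and>
   (\<forall>f. degree f \<le> d * k --> (\<exists>x y. f - (smult x c1 + smult y c2) \<in> vpow V k)) \<and>
   (\<forall>x y. smult x c1 + smult y c2 \<in> vpow V k --> x = 0 \<and> y = 0)" if k: "k \<ge> k0" for k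
 proof -
  have fin: "finite (monom (1::'a) ` {..d * k})" by simp
  have sub: "polys_le (d * k) \<subseteq> pv.span (monom (1::'a) ` {..d * k})" by (simp add: polys_le_span)
  obtain C where CC: "finite C \<and> C \<subseteq> polys_le (d * k) \<and>
   card C + pv.dim (vpow V k) = pv.dim (polys_le (d * k) :: 'a poly set) \<and>
   (\<forall>y\<in>polys_le (d * k). \<exists>c. y - (\<Sum>t\<in>C. smult (c t) t) \<in> vpow V k) \<and>
   (\<forall>c. (\<Sum>t\<in>C. smult (c t) t) \<in> vpow V k --> (\<forall>t\<in>C. c t = 0))"
   using pv.exists_complement[OF vpow_subspace polys_le_subspace vpow_le[OF Vd] fin sub] by (rule exE)
  note C = CC[THEN conjunct1] CC[THEN conjunct2, THEN conjunct1] CC[THEN conjunct2, THEN conjunct2, THEN conjunct1]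
   CC[THEN conjunct2, THEN conjunct2, THEN conjunct2, THEN conjunct1]
   CC[THEN conjunct2, THEN conjunct2, THEN conjunct2, THEN conjunct2]
  have "card C = 2" using C(3) k0[OF k] by (simp add: polys_le_dim)
  then obtain c1 c2 where c: "C = {c1, c2}" "c1 ~= c2" by (metis card_2_iff)
  have "\<exists>x y. f - (smult x c1 + smult y c2) \<in> vpow V k" if df: "degree f \<le> d * k" for f
  proof -
   obtain c' where "f - (\<Sum>t\<in>C. smult (c' t) t) \<in> vpow V k"
    using C(4) df by (auto simp: polys_le_def)
   then show ?thesis using c by auto
  qed
  moreover have "x = 0 \<and> y = 0" if "smult x c1 + smult y c2 \<in> vpow V k" for x y
   using spec[OF C(5), of "\<lambda>t. if t = c1 then x else y"] that c by auto
  ultimately show ?thesis using C(2) c(1) by (intro exI[of _ c1] exI[of _ c2]) (auto simp: polys_le_def)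
 qed
 then show ?thesis by blast
qed

text \<open>A dimension count: membership of all \<open>monom 1 m * a\<close> with \<open>m \<le> d *
 i0\<close> imposes two linear conditions for each \<open>m\<close>, a number that does not depend on
 \<open>j\<close>, while the dimension of \<open>vpow V j\<close> grows with \<open>j\<close>.\<close>

lemma conductor_exists:
 "\<exists>j i0 a. a ~= 0 \<and> a \<in> vpow V j \<and> i0 \<ge> 1 \<and> (\<forall>m\<le>d * i0. monom 1 m * a \<in> vpow V (i0 + j))"
proof -
 obtain k0 where k0: "\<forall>k\<ge>k0. \<exists>c1 c2. degree c1 \<le> d * k \<and> degree c2 \<le> d * k \<and>
   (\<forall>f. degree f \<le> d * k --> (\<exists>x y. f - (smult x c1 + smult y c2) \<in> vpow V k)) \<and>
   (\<forall>x y. smult x c1 + smult y c2 \<in> vpow V k --> x = 0 \<and> y = 0)"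
  using complement by (rule exE)
 obtain k1 where k1: "\<And>k. k \<ge> k1 ==> pv.dim (vpow V k) + 2 = d * k + 1" using codim by blast
 define i0 where "i0 = max 1 k0"
 define j where "j = max k1 (2 * (d * i0 + 1) + 2)"
 obtain B where B: "B \<subseteq> vpow V j" "pv.independent B" "vpow V j \<subseteq> pv.span B" "card B = pv.dim (vpow V j)"
  using pv.basis_exists by blast
 have "B \<subseteq> pv.span (monom 1 ` {..d * j})" using B(1) vpow_le[OF Vd] polys_le_span by blast
 then have finB: "finite B" using pv.independent_span_bound[OF _ B(2)] by blast
 have "2 * (d * i0 + 1) + 2 \<le> j" by (simp add: j_def)
 also have "j \<le> d * j" using d0 by simp
 finally have cardB: "2 * (d * i0 + 1) < card B" using B(4) k1[of j] by (simp add: j_def)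
 have "k0 \<le> i0 + j" by (simp add: i0_def)
 from k0[rule_format, OF this] obtain c1 c2 where
  c: "\<forall>f. degree f \<le> d * (i0 + j) --> (\<exists>x y. f - (smult x c1 + smult y c2) \<in> vpow V (i0 + j))"
  by blast
 define W where "W = vpow V (i0 + j)"
 have Wsub: "pv.subspace W" unfolding W_def by (rule vpow_subspace)
 have "\<forall>f. \<exists>x y. degree f \<le> d * (i0 + j) --> f - (smult x c1 + smult y c2) \<in> W"
  using c unfolding W_def by metis
 then obtain X1 X2 where X12: "\<And>f. degree f \<le> d * (i0 + j) ==> f - (smult (X1 f) c1 + smult (X2 f) c2) \<in> W"
  by metis
 define v where "v = (\<lambda>m b. monom (1::'a) m * b)"
 define M where "M = (\<lambda>(m, t::bool) b. if t then X1 (v m b) else X2 (v m b))"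
 have "card ({..d * i0} \<times> (UNIV :: bool set)) < card B" using cardB by (simp add: card_cartesian_product)
 then obtain e where e: "\<exists>b\<in>B. e b ~= 0" "\<forall>j\<in>{..d * i0} \<times> UNIV. (\<Sum>b\<in>B. e b * M j b) = 0"
  using underdetermined_system[OF finB, of "{..d * i0} \<times> UNIV" M] by auto
 define a where "a = (\<Sum>b\<in>B. smult (e b) b)"
 have "a ~= 0" using e(1) B(2) finB unfolding a_def by (auto simp: pv.dependent_finite)
 moreover have "a \<in> vpow V j" unfolding a_def
  using B(1) by (intro pv.subspace_sum[OF vpow_subspace] pv.subspace_scale[OF vpow_subspace]) auto
 moreover have "monom 1 m * a \<in> W" if m: "m \<le> d * i0" for m
 proof -
  have dv: "degree (v m b) \<le> d * (i0 + j)" if "b \<in> B" for b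
  proof -
   have "degree (v m b) \<le> degree (monom (1::'a) m) + degree b" unfolding v_def by (rule degree_mult_le)
   also have "\<dots> \<le> d * i0 + d * j" using m that B(1) vpow_deg degree_monom_le[of "1::'a" m] by (intro add_mono) auto
   finally show ?thesis by (simp add: algebra_simps)
  qed
  have z: "(\<Sum>b\<in>B. e b * X1 (v m b)) = 0" "(\<Sum>b\<in>B. e b * X2 (v m b)) = 0"
   using bspec[OF e(2), of "(m, True)"] bspec[OF e(2), of "(m, False)"] m by (simp_all add: M_def)
  have "(\<Sum>b\<in>B. smult (e b) (v m b - (smult (X1 (v m b)) c1 + smult (X2 (v m b)) c2))) \<in> W"
   using X12[OF dv] by (intro pv.subspace_sum[OF Wsub] pv.subspace_scale[OF Wsub])
  also have "(\<Sum>b\<in>B. smult (e b) (v m b - (smult (X1 (v m b)) c1 + smult (X2 (v m b)) c2)))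
   = (\<Sum>b\<in>B. smult (e b) (v m b)) - smult (\<Sum>b\<in>B. e b * X1 (v m b)) c1
     - smult (\<Sum>b\<in>B. e b * X2 (v m b)) c2"
   by (simp add: smult_diff_right smult_add_right sum_subtractf sum.distrib smult_sum diff_diff_eq)
  also have "\<dots> = (\<Sum>b\<in>B. smult (e b) (v m b))" by (simp add: z)
  also have "\<dots> = monom 1 m * a" by (simp add: a_def v_def sum_distrib_left)
  finally show ?thesis .
 qed
 ultimately show ?thesis by (intro exI[of _ j] exI[of _ i0] exI[of _ a]) (auto simp: i0_def W_def)
qed

text \<open>Products of members of \<open>V\<close> with all polynomials of degree at most \<open>d *
 i\<close> generate everything of degree \<open>d * (i + 1)\<close>, because \<open>V\<close> has no base
 points.\<close>

lemma conductor_multiples: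
 assumes i0: "i0 \<ge> 1" and a: "\<And>m. m \<le> d * i0 ==> monom 1 m * a \<in> vpow V (i0 + j)"
  and i: "i \<ge> i0" and h: "degree h \<le> d * i"
 shows "a * h \<in> vpow V (i + j)"
 using i h
proof (induction i arbitrary: h rule: dec_induct)
 case base
 have "h = (\<Sum>m\<le>degree h. smult (coeff h m) (monom 1 m))"
  by (simp add: smult_monom poly_as_sum_of_monoms)
 then have "a * h = a * (\<Sum>m\<le>degree h. smult (coeff h m) (monom 1 m))" by simp
 also have "\<dots> = (\<Sum>m\<le>degree h. smult (coeff h m) (monom 1 m * a))"
  by (simp add: sum_distrib_left mult.commute)
 also have "\<dots> \<in> vpow V (i0 + j)"
  using a base by (intro pv.subspace_sum[OF vpow_subspace] pv.subspace_scale[OF vpow_subspace]) auto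
 finally show ?case .
next
 case (step n)
 define W where "W = {f. a * f \<in> vpow V (Suc n + j)}"
 have "pv.subspace W" unfolding W_def
  by (rule pv.subspaceI)
   (auto simp: distrib_left pv.subspace_0[OF vpow_subspace] intro: pv.subspace_add[OF vpow_subspace] pv.subspace_scale[OF vpow_subspace])
 then have "h \<in> W"
 proof (rule multiples_generate)
  show "n \<ge> 1" using i0 step by simp
  show "degree h \<le> d * Suc n" by (rule step.prems)
  fix l g :: "'a poly" assume "l \<in> V" "degree g \<le> d * n"
  then have "l \<in> vpow V 1" "a * g \<in> vpow V (n + j)" using step.IH vpow_base by blast+
  then have "l * (a * g) \<in> vpow V (1 + (n + j))" by (rule vpow_mult)
  then show "l * g \<in> W" by (simp add: W_def mult.left_commute)
 qed
 then show ?case by (simp add: W_def)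
qed

end

context linear_system
begin

text \<open>A member of the linear system with simple zeros that the linear system separates.\<close>

definition good_section :: "'a poly => bool" where
 "good_section s \<longleftrightarrow> s \<in> V \<and> coeff s d ~= 0 \<and> (\<forall>z. poly s z = 0 --> poly (pderiv s) z ~= 0) \<and>
   (\<forall>p p'. poly s p = 0 --> poly s p' = 0 --> p ~= p' --> (\<exists>l\<in>V. poly l p = 0 \<and> poly l p' ~= 0))"

lemma vpow_eval_proportional:
 assumes "\<And>l. l \<in> V ==> poly l p' = c * poly l p" and f: "f \<in> vpow V k"
 shows "poly f p' = c ^ k * poly f p"
 using f
proof (induction k arbitrary: f)
 case 0
 have "vpow V 0 \<subseteq> {f. poly f p' = poly f p}"
  unfolding vpow_def by (rule pv.span_minimal) (auto intro!: pv.subspaceI)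
 then show ?case using 0 by auto
next
 case (Suc k)
 have "f \<in> {f. poly f p' = c ^ Suc k * poly f p}"
  using Suc.prems
 proof (rule vpow_Suc_induct)
  show "pv.subspace {f. poly f p' = c ^ Suc k * poly f p}"
   by (intro pv.subspaceI) (auto simp: algebra_simps)
  fix l g assume "l \<in> V" "g \<in> vpow V k"
  then show "l * g \<in> {f. poly f p' = c ^ Suc k * poly f p}" using assms(1) Suc.IH by simp
 qed
 then show ?case by simp
qed

text \<open>Two points with proportional values on \<open>V\<close> have proportional values on all powers of
 \<open>V\<close>, which the multiples of the conductor contradict.\<close>

lemma separation_off_conductor:
 assumes a: "\<And>i h. i \<ge> i0 ==> degree h \<le> d * i ==> a * h \<in> vpow V (i + j)"
  and p: "p ~= p'" "poly a p' ~= 0"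
 shows "\<exists>l\<in>V. poly l p = 0 \<and> poly l p' ~= 0"
proof (rule ccontr)
 assume no: "\<not> ?thesis"
 obtain t where t: "t \<in> V" "poly t p ~= 0" using bpf by blast
 define c where "c = poly t p' / poly t p"
 have propo: "poly l p' = c * poly l p" if l: "l \<in> V" for l
 proof -
  define m where "m = smult (poly t p) l - smult (poly l p) t"
  have "m \<in> V" unfolding m_def by (intro pv.subspace_diff[OF V] pv.subspace_scale[OF V] l t(1))
  moreover have "poly m p = 0" by (simp add: m_def)
  ultimately have "poly m p' = 0" using no by blast
  then show ?thesis using t(2) by (simp add: m_def c_def field_simps)
 qed
 define i where "i = max i0 1"
 have "1 * 1 \<le> d * i" using d0 by (intro mult_le_mono) (auto simp: i_def)
 then have "a * [:- p, 1:] \<in> vpow V (i + j)" by (intro a) (auto simp: i_def)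
 then have "poly (a * [:- p, 1:]) p' = c ^ (i + j) * poly (a * [:- p, 1:]) p"
  using vpow_eval_proportional[of p' c p, OF propo] by blast
 then show False using p by simp
qed

context
 fixes s :: "'a poly"
 assumes gs: "good_section s"
begin

definition Z :: "'a set" where "Z = {z. poly s z = 0}"

lemma s_facts: "s \<in> V" "s ~= 0" "degree s = d" "finite Z"
proof -
 show "s \<in> V" "s ~= 0" using gs by (auto simp: good_section_def)
 show "finite Z" unfolding Z_def by (rule poly_roots_finite[OF \<open>s ~= 0\<close>])
 show "degree s = d" using gs Vd le_degree[of s d] by (auto simp: good_section_def polys_le_def)
qed

lemma s_product: "\<exists>c. c ~= 0 \<and> s = smult c (\<Prod>z\<in>Z. [:- z, 1:])"
proof -
 obtain q where q: "s = (\<Prod>z\<in>Z. [:- z, 1:]) * q"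
  using prod_linear_dvd[OF s_facts(4), of s] by (auto simp: Z_def elim: dvdE)
 have "poly q z ~= 0" for z
 proof
  assume qz: "poly q z = 0"
  then have z: "z \<in> Z" unfolding Z_def by (subst q) simp
  have "poly (\<Prod>z\<in>Z. [:- z, 1:]) z = 0" using z s_facts(4) by (auto simp: poly_prod)
  then have "poly (pderiv s) z = 0" using qz by (subst q) (simp add: pderiv_mult)
  then show False using gs z by (auto simp: good_section_def Z_def)
 qed
 then have "degree q = 0" using alg_closed_imp_poly_has_root[of q] by blast
 then obtain c where c: "q = [:c:]" by (metis degree_eq_zeroE)
 have "c ~= 0" using s_facts(2) q c by auto
 then show ?thesis using q c by (intro exI[of _ c]) simp
qed

lemma s_dvd_iff: "s dvd f \<longleftrightarrow> (\<forall>z\<in>Z. poly f z = 0)"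
proof
 assume "s dvd f"
 then show "\<forall>z\<in>Z. poly f z = 0" by (auto simp: Z_def elim!: dvdE)
next
 assume "\<forall>z\<in>Z. poly f z = 0"
 then have "(\<Prod>z\<in>Z. [:- z, 1:]) dvd f" using prod_linear_dvd[OF s_facts(4)] by blast
 then show "s dvd f" using s_product by (metis smult_dvd)
qed

lemma card_Z: "card Z = d"
proof -
 obtain c where c: "c ~= 0" "s = smult c (\<Prod>z\<in>Z. [:- z, 1:])" using s_product by blast
 define P where "P = (\<Prod>z\<in>Z. [:- z, 1:])"
 have "degree s = degree P" using c unfolding P_def[symmetric] by (metis degree_smult_eq)
 then have "degree s = degree (\<Prod>z\<in>Z. [:- z, 1:])" by (simp only: P_def)
 also have "\<dots> = (\<Sum>z\<in>Z. degree [:- z, 1:])" by (rule degree_prod_eq_sum_degree) auto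
 finally show ?thesis using s_facts(3) by simp
qed

lemma exists_nonvanishing: "\<exists>t\<in>V. \<forall>z\<in>Z. poly t z ~= 0"
proof -
 have "\<exists>f\<in>V. \<forall>\<phi>\<in>(\<lambda>z f. poly f z) ` Z. \<phi> f ~= 0"
 proof (rule general_member)
  show "finite ((\<lambda>z f. poly f z) ` Z)" using s_facts(4) by simp
  show "V ~= {}" using s_facts(1) by blast
 qed (use bpf in \<open>auto intro: pv.subspace_add[OF V] pv.subspace_scale[OF V]\<close>)
 then show ?thesis by auto
qed

lemma separating_forms:
 assumes p: "p \<in> Z" and k: "k + 1 \<ge> d"
 shows "\<exists>e\<in>vpow V k. poly e p = 1 \<and> (\<forall>z\<in>Z - {p}. poly e z = 0)"
proof -
 have "\<forall>z\<in>Z - {p}. \<exists>l. l \<in> V \<and> poly l z = 0 \<and> poly l p ~= 0"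
  using gs p by (auto simp: good_section_def Z_def) (metis)
 then obtain l where l: "\<And>z. z \<in> Z - {p} ==> l z \<in> V \<and> poly (l z) z = 0 \<and> poly (l z) p ~= 0" by metis
 have pr: "(\<Prod>z\<in>A. l z) \<in> vpow V (card A)" if "finite A" "A \<subseteq> Z - {p}" for A
  using that
 proof (induction A rule: finite_induct)
  case empty
  then show ?case using vpow_one by simp
 next
  case (insert z A)
  then have "l z \<in> vpow V 1" "(\<Prod>z\<in>A. l z) \<in> vpow V (card A)" using l vpow_base by auto
  then have "l z * (\<Prod>z\<in>A. l z) \<in> vpow V (1 + card A)" by (rule vpow_mult)
  then show ?case using insert.hyps by simp
 qed
 obtain t where t: "t \<in> V" "\<And>z. z \<in> Z ==> poly t z ~= 0" using exists_nonvanishing by blast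
 define e where "e = t ^ (k + 1 - d) * (\<Prod>z\<in>Z - {p}. l z)"
 have "card (Z - {p}) = d - 1" using p s_facts(4) card_Z by simp
 then have "(\<Prod>z\<in>Z - {p}. l z) \<in> vpow V (d - 1)" using pr[of "Z - {p}"] s_facts(4) by simp
 then have "e \<in> vpow V ((k + 1 - d) + (d - 1))" unfolding e_def by (rule vpow_power_mult[OF t(1)])
 moreover have "(k + 1 - d) + (d - 1) = k" using k d0 by simp
 ultimately have ek: "e \<in> vpow V k" by simp
 have ep: "poly e p ~= 0" using t(2)[OF p] l s_facts(4) by (auto simp: e_def poly_prod)
 have ez: "poly e z = 0" if "z \<in> Z - {p}" for z
  using that l[OF that] s_facts(4) by (auto simp: e_def poly_prod)
 have "smult (inverse (poly e p)) e \<in> vpow V k" by (rule pv.subspace_scale[OF vpow_subspace ek])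
 then show ?thesis using ep ez by (intro bexI[of _ "smult (inverse (poly e p)) e"]) auto
qed

lemma interpolation:
 assumes k: "k + 1 \<ge> d"
 shows "\<exists>g\<in>vpow V k. \<forall>z\<in>Z. poly g z = c z"
proof -
 obtain e where e: "\<And>p. p \<in> Z ==> e p \<in> vpow V k \<and> poly (e p) p = 1 \<and> (\<forall>z\<in>Z - {p}. poly (e p) z = 0)"
  using separating_forms[OF _ k] by metis
 define g where "g = (\<Sum>p\<in>Z. smult (c p) (e p))"
 have "g \<in> vpow V k" unfolding g_def
  using e by (intro pv.subspace_sum[OF vpow_subspace] pv.subspace_scale[OF vpow_subspace]) blast
 moreover have "poly g z = c z" if z: "z \<in> Z" for z
 proof -
  have "poly g z = (\<Sum>p\<in>Z. c p * poly (e p) z)" by (simp add: g_def poly_sum)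
  also have "\<dots> = (\<Sum>p\<in>Z. if p = z then c z else 0)"
   using e z by (intro sum.cong refl) (metis Diff_iff empty_iff insert_iff mult.right_neutral mult_zero_right)
  also have "\<dots> = c z" using z s_facts(4) by simp
  finally show ?thesis .
 qed
 ultimately show ?thesis by blast
qed

text \<open>The zeros of \<open>s\<close> are a hyperplane section of \<open>d\<close> distinct points, and
 the powers of \<open>V\<close> from \<open>d - 1\<close> on interpolate arbitrary values there.\<close>

lemma hyperplane_decomposition:
 assumes k: "Suc k \<ge> d" and f: "degree f \<le> d * Suc k"
 shows "\<exists>g\<in>vpow V (Suc k). \<exists>h. degree h \<le> d * k \<and> f = g + s * h"
proof -
 obtain g where g: "g \<in> vpow V (Suc k)" "\<forall>z\<in>Z. poly g z = poly f z"
  using interpolation[of "Suc k" "poly f"] k by auto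
 then have "s dvd f - g" by (simp add: s_dvd_iff)
 then obtain h where h: "f - g = s * h" by blast
 have "degree h \<le> d * k"
 proof (cases "h = 0")
  case False
  have "degree (s * h) \<le> d * Suc k" unfolding h[symmetric] using f vpow_deg[OF g(1)] by (rule degree_diff_le)
  then show ?thesis using False s_facts by (simp add: degree_mult_eq)
 qed simp
 moreover have "f = g + s * h" using h by (simp add: algebra_simps)
 ultimately show ?thesis using g(1) by blast
qed

text \<open>In degree \<open>k\<close> the ideal of the curve is saturated with respect to
 \<open>s\<close>.\<close>

definition inj_at :: "nat => bool" where
 "inj_at k \<longleftrightarrow> (\<forall>f. degree f \<le> d * k --> s * f \<in> vpow V (Suc k) --> f \<in> vpow V k)"

text \<open>A Koszul-type argument: with a second member \<open>t\<close> that does not vanish on the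
 hyperplane section, saturation propagates upwards.\<close>

lemma inj_at_Suc:
 assumes k: "k + 1 \<ge> d" and inj: "inj_at k"
 shows "inj_at (Suc k)"
 unfolding inj_at_def
proof (intro allI impI)
 fix f assume f: "degree f \<le> d * Suc k" "s * f \<in> vpow V (Suc (Suc k))"
 obtain t where t: "t \<in> V" "\<And>z. z \<in> Z ==> poly t z ~= 0" using exists_nonvanishing by blast
 define J where "J = {g \<in> vpow V (Suc k). \<forall>z\<in>Z. poly g z = 0}"
 define Y where "Y = pv.span {l * g | l g. l \<in> V \<and> g \<in> J}"
 have Ysub: "pv.subspace Y" by (simp add: Y_def)
 have Yb: "l * g \<in> Y" if "l \<in> V" "g \<in> J" for l g unfolding Y_def using that by (intro pv.span_base) blast
 define W where "W = {x. \<exists>y\<in>Y. \<exists>h\<in>vpow V (Suc k). x = y + t * h}"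
 have Wsub: "pv.subspace W"
 proof (rule pv.subspaceI)
  show "0 \<in> W" unfolding W_def using pv.subspace_0[OF Ysub] pv.subspace_0[OF vpow_subspace[of V "Suc k"]] by force
  fix x x' assume "x \<in> W" "x' \<in> W"
  then obtain y h y' h' where "y \<in> Y" "h \<in> vpow V (Suc k)" "x = y + t * h" "y' \<in> Y" "h' \<in> vpow V (Suc k)" "x' = y' + t * h'"
   unfolding W_def by blast
  then have "y + y' \<in> Y" "h + h' \<in> vpow V (Suc k)" "x + x' = (y + y') + t * (h + h')"
   using pv.subspace_add[OF Ysub] pv.subspace_add[OF vpow_subspace] by (auto simp: algebra_simps)
  then show "x + x' \<in> W" unfolding W_def by blast
 next
  fix c x assume "x \<in> W"
  then obtain y h where "y \<in> Y" "h \<in> vpow V (Suc k)" "x = y + t * h" unfolding W_def by blast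
  then have "smult c y \<in> Y" "smult c h \<in> vpow V (Suc k)"
   "smult c x = smult c y + t * smult c h"
   using pv.subspace_scale[OF Ysub] pv.subspace_scale[OF vpow_subspace] by (auto simp: smult_add_right)
  then show "smult c x \<in> W" unfolding W_def by blast
 qed
 have "s * f \<in> W"
  using f(2)
 proof (rule vpow_Suc_induct[OF _ Wsub])
  fix l g assume l: "l \<in> V" and g: "g \<in> vpow V (Suc k)"
  obtain e where e: "e \<in> vpow V k" "\<forall>z\<in>Z. poly e z = poly g z / poly t z"
   using interpolation[of k "\<lambda>z. poly g z / poly t z"] k by auto
  have te: "t * e \<in> vpow V (Suc k)" using vpow_mult[OF vpow_base[OF t(1)] e(1)] by simp
  have "g - t * e \<in> J" unfolding J_def
   using e(2) t(2) pv.subspace_diff[OF vpow_subspace g te] by auto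
  then have "l * (g - t * e) \<in> Y" using l Yb by blast
  moreover have "l * e \<in> vpow V (Suc k)" using vpow_mult[OF vpow_base[OF l] e(1)] by simp
  moreover have "l * g = l * (g - t * e) + t * (l * e)" by (simp add: algebra_simps)
  ultimately show "l * g \<in> W" unfolding W_def by blast
 qed
 then obtain y h where yh: "y \<in> Y" "h \<in> vpow V (Suc k)" "s * f = y + t * h" unfolding W_def by blast
 have Yz: "Y \<subseteq> {y. \<forall>z\<in>Z. poly y z = 0}" unfolding Y_def
  by (rule pv.span_minimal) (auto simp: J_def intro!: pv.subspaceI)
 have "h \<in> J"
 proof -
  have "poly h z = 0" if z: "z \<in> Z" for z
  proof -
   have "poly (s * f) z = 0" using z by (simp add: Z_def)
   moreover have "poly y z = 0" using Yz yh(1) z by blast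
   ultimately show ?thesis unfolding yh(3) using t(2)[OF z] by simp
  qed
  then show ?thesis using yh(2) by (simp add: J_def)
 qed
 then have sfY: "s * f \<in> Y" unfolding yh(3) using yh(1) Yb t(1) by (intro pv.subspace_add[OF Ysub]) auto
 have "Y \<subseteq> (\<lambda>x. s * x) ` vpow V (Suc k)" unfolding Y_def
 proof (rule pv.span_minimal)
  show "pv.subspace ((\<lambda>x. s * x) ` vpow V (Suc k))"
  proof (rule pv.subspaceI)
   show "0 \<in> (\<lambda>x. s * x) ` vpow V (Suc k)" using pv.subspace_0[OF vpow_subspace[of V "Suc k"]] by force
   show "x + y \<in> (\<lambda>x. s * x) ` vpow V (Suc k)" if "x \<in> (\<lambda>x. s * x) ` vpow V (Suc k)" "y \<in> (\<lambda>x. s * x) ` vpow V (Suc k)" for x y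
    using that pv.subspace_add[OF vpow_subspace[of V "Suc k"]] by (force simp: distrib_left[symmetric])
   show "smult c x \<in> (\<lambda>x. s * x) ` vpow V (Suc k)" if "x \<in> (\<lambda>x. s * x) ` vpow V (Suc k)" for c x
    using that pv.subspace_scale[OF vpow_subspace[of V "Suc k"]] by (force simp: mult_smult_right[symmetric] simp del: mult_smult_right)
  qed
  show "{l * g |l g. l \<in> V \<and> g \<in> J} \<subseteq> (\<lambda>x. s * x) ` vpow V (Suc k)"
  proof
   fix x assume "x \<in> {l * g |l g. l \<in> V \<and> g \<in> J}"
   then obtain l g where lg: "l \<in> V" "g \<in> J" "x = l * g" by blast
   have "s dvd g" using lg(2) by (simp add: J_def s_dvd_iff)
   then obtain g' where g': "g = s * g'" by blast
   have "degree g' \<le> d * k"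
   proof (cases "g' = 0")
    case False
    have "degree (s * g') \<le> d * Suc k" using lg(2) vpow_deg[of g "Suc k"] unfolding g'[symmetric] J_def by blast
    then show ?thesis using False s_facts by (simp add: degree_mult_eq)
   qed simp
   then have "g' \<in> vpow V k" using inj lg(2) unfolding inj_at_def J_def g' by blast
   then have "l * g' \<in> vpow V (Suc k)" using vpow_mult[OF vpow_base[OF lg(1)]] by simp
   moreover have "x = s * (l * g')" unfolding lg(3) g' by (simp add: ac_simps)
   ultimately show "x \<in> (\<lambda>x. s * x) ` vpow V (Suc k)" by blast
  qed
 qed
 then obtain x where "s * f = s * x" "x \<in> vpow V (Suc k)" using sfY by blast
 then show "f \<in> vpow V (Suc k)" using s_facts(2) by simp
qed

text \<open>Growth by \<open>d\<close> comes from the hyperplane section; each failure of saturation adds at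
 least one more dimension.\<close>

lemma dim_growth:
 assumes k: "k + 1 \<ge> d"
 shows "pv.dim (vpow V (Suc k)) \<ge> pv.dim (vpow V k) + d + (if inj_at k then 0 else 1)"
proof -
 define U where "U = {f. degree f \<le> d * k \<and> s * f \<in> vpow V (Suc k)}"
 have Usub: "pv.subspace U"
 proof (rule pv.subspaceI)
  show "0 \<in> U" using pv.subspace_0[OF vpow_subspace[of V "Suc k"]] by (simp add: U_def)
  show "x + y \<in> U" if "x \<in> U" "y \<in> U" for x y
   using that pv.subspace_add[OF vpow_subspace[of V "Suc k"]] by (auto simp: U_def distrib_left degree_add_le)
  show "smult c x \<in> U" if "x \<in> U" for c x
   using that pv.subspace_scale[OF vpow_subspace[of V "Suc k"]]
   by (auto simp: U_def intro: le_trans[OF degree_smult_le])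
 qed
 have VU: "vpow V k \<subseteq> U"
  using vpow_deg vpow_mult[OF vpow_base[OF s_facts(1)]] by (auto simp: U_def)
 have fin: "finite (monom (1::'a) ` {..m})" for m by simp
 have UP: "U \<subseteq> polys_le (d * k)" by (auto simp: U_def polys_le_def)
 have Psp: "polys_le m \<subseteq> pv.span (monom (1::'a) ` {..m})" for m by (simp add: polys_le_span)
 from pv.exists_complement[OF Usub polys_le_subspace UP fin Psp]
 obtain C where C: "finite C" "card C + pv.dim U = d * k + 1"
  "\<forall>y\<in>polys_le (d * k). \<exists>c. y - (\<Sum>t\<in>C. smult (c t) t) \<in> U"
  by (auto simp: polys_le_dim)
 define C' where "C' = (\<lambda>t. s * t) ` C"
 have inj: "inj_on (\<lambda>t. s * t) C" using s_facts(2) by (auto simp: inj_on_def)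
 have "pv.dim (polys_le (d * Suc k) :: 'a poly set) \<le> pv.dim (vpow V (Suc k)) + card C'"
 proof (rule pv.dim_le_of_complement[OF vpow_subspace fin])
  show "vpow V (Suc k) \<subseteq> pv.span (monom (1::'a) ` {..d * Suc k})"
   using vpow_le[OF Vd] Psp by blast
  show "finite C'" using C(1) by (simp add: C'_def)
  fix y :: "'a poly" assume "y \<in> polys_le (d * Suc k)"
  then obtain g h where gh: "g \<in> vpow V (Suc k)" "degree h \<le> d * k" "y = g + s * h"
   using hyperplane_decomposition[of k y] k by (auto simp: polys_le_def)
  then obtain c where c: "h - (\<Sum>t\<in>C. smult (c t) t) \<in> U" using C(3) by (auto simp: polys_le_def)
  have "y - (\<Sum>t\<in>C. smult (c t) (s * t)) = g + s * (h - (\<Sum>t\<in>C. smult (c t) t))"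
   by (simp add: gh(3) sum_distrib_left algebra_simps)
  also have "\<dots> \<in> vpow V (Suc k)"
   using c by (intro pv.subspace_add[OF vpow_subspace] gh(1)) (simp add: U_def)
  finally have "y - (\<Sum>t\<in>C. smult (c t) (s * t)) \<in> vpow V (Suc k)" .
  moreover have "(\<Sum>t\<in>C. smult (c t) (s * t)) = (\<Sum>t\<in>C'. smult (c (t div s)) t)"
   unfolding C'_def sum.reindex[OF inj] using s_facts(2) by simp
  ultimately show "\<exists>c. y - (\<Sum>t\<in>C'. smult (c t) t) \<in> vpow V (Suc k)"
   by (intro exI[of _ "\<lambda>t. c (t div s)"]) simp
 qed
 then have 1: "d * Suc k + 1 \<le> pv.dim (vpow V (Suc k)) + card C"
  unfolding polys_le_dim C'_def card_image[OF inj] by simp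
 have Usp: "U \<subseteq> pv.span (monom (1::'a) ` {..d * k})" using UP Psp by blast
 from pv.exists_complement[OF vpow_subspace Usub VU fin Usp]
 obtain D where D: "finite D" "card D + pv.dim (vpow V k) = pv.dim U"
  "\<forall>y\<in>U. \<exists>c. y - (\<Sum>t\<in>D. smult (c t) t) \<in> vpow V k" by blast
 have "card D \<ge> 1" if "\<not> inj_at k"
 proof (rule ccontr)
  assume "\<not> card D \<ge> 1"
  then have "D = {}" using D(1) by (simp add: not_le)
  then have "U \<subseteq> vpow V k" using D(3) by auto
  then show False using that unfolding inj_at_def U_def by blast
 qed
 then have "pv.dim U \<ge> pv.dim (vpow V k) + (if inj_at k then 0 else 1)" using D(2) by auto
 then show ?thesis using 1 C(2) by simp
qed

lemma dim_vpow_le: "pv.dim (vpow V k) \<le> d * k + 1"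
proof -
 have "pv.dim (vpow V k) \<le> card (monom (1::'a) ` {..d * k})"
  using vpow_le[OF Vd] polys_le_span by (intro pv.dim_le_card) auto
 also have "\<dots> \<le> d * k + 1" using card_image_le[of "{..d * k}" "monom (1::'a)"] by simp
 finally show ?thesis .
qed

text \<open>If saturation failed from \<open>d - 1\<close> up to \<open>d ^ 2\<close>, then the extra
 dimensions would exceed the room of \<open>d * k + 1\<close>. Once it holds it persists.\<close>

lemma regularity:
 assumes "k \<ge> d\<^sup>2"
 shows "inj_at k"
proof -
 have "\<exists>i\<le>d * (d - 1). inj_at (d - 1 + i)"
 proof (rule ccontr)
  assume no: "\<not> ?thesis"
  have "pv.dim (vpow V (d - 1 + i)) \<ge> pv.dim (vpow V (d - 1)) + i * (d + 1)" if "i \<le> d * (d - 1) + 1" for i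
   using that
  proof (induction i)
   case (Suc i)
   then have "\<not> inj_at (d - 1 + i)" using no by auto
   then show ?case using Suc dim_growth[of "d - 1 + i"] d0 by simp
  qed simp
  from this[of "d * (d - 1) + 1"]
  have 1: "pv.dim (vpow V (d - 1)) + (d * (d - 1) + 1) * (d + 1) \<le> pv.dim (vpow V (d - 1 + (d * (d - 1) + 1)))" by simp
  have "pv.dim (vpow V (d - 1)) \<ge> 1"
  proof -
   obtain t where t: "t \<in> V" "poly t 0 ~= 0" using bpf by blast
   define x where "x = t ^ (d - 1)"
   have "x \<in> vpow V (d - 1)" "x ~= 0" using t vpow_power by (auto simp: x_def)
   then have "pv.independent {x}" "{x} \<subseteq> vpow V (d - 1)" by (auto simp: pv.dependent_single)
   have "\<not> vpow V (d - 1) \<subseteq> {0}" using \<open>x \<in> vpow V (d - 1)\<close> \<open>x ~= 0\<close> by blast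
   obtain B where B: "B \<subseteq> vpow V (d - 1)" "pv.independent B" "vpow V (d - 1) \<subseteq> pv.span B" "card B = pv.dim (vpow V (d - 1))"
    using pv.basis_exists by blast
   have "B \<subseteq> pv.span (monom 1 ` {..d * (d - 1)})" using B(1) vpow_le[OF Vd] polys_le_span by blast
   then have "finite B" using pv.independent_span_bound[OF _ B(2)] by blast
   moreover have "B ~= {}" using B(3) \<open>\<not> vpow V (d - 1) \<subseteq> {0}\<close> by auto
   ultimately show ?thesis using B(4) by (metis One_nat_def Suc_leI card_gt_0_iff)
  qed
  moreover have "pv.dim (vpow V (d - 1 + (d * (d - 1) + 1))) \<le> d * (d - 1 + (d * (d - 1) + 1)) + 1"
   by (rule dim_vpow_le)
  ultimately have "1 + (d * (d - 1) + 1) * (d + 1) \<le> d * (d - 1 + (d * (d - 1) + 1)) + 1" using 1 by linarith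
  then show False by (simp add: algebra_simps)
 qed
 then obtain i where i: "i \<le> d * (d - 1)" "inj_at (d - 1 + i)" by blast
 have le: "d - 1 + i \<le> k"
 proof -
  have "d - 1 + i \<le> d + d * (d - 1)" using i(1) by simp
  also have "\<dots> = d\<^sup>2" using d0 by (cases d) (auto simp: power2_eq_square)
  finally show ?thesis using assms by simp
 qed
 show ?thesis
  using le
 proof (induction k rule: dec_induct)
  case base
  show ?case by (rule i(2))
 next
  case (step n)
  then show ?case by (intro inj_at_Suc) auto
 qed
qed

end

end

locale rational_system = linear_system V d
 for V :: "'a::{alg_closed_field, field_char_0} poly set" and d :: nat +
 fixes F :: "'a set" and l :: nat and B :: "'a poly set" and a :: "'a poly" and i0 j :: nat
 assumes F: "qalg F l" and VB: "V = pv.span B" and BF: "\<And>b. b \<in> B ==> coeffs_in F b"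
  and a0: "a ~= 0" and aF: "coeffs_in F a" and adeg: "degree a = d * j"
  and cond: "\<And>i h. i \<ge> i0 ==> degree h \<le> d * i ==> a * h \<in> vpow V (i + j)"
begin

lemma rational_functional:
 assumes lin: "\<And>f g c. \<phi> (smult c f + g) = c * \<phi> f + (\<phi> g :: 'a)" and f: "f \<in> V" "\<phi> f ~= 0"
 shows "\<exists>f\<in>{f \<in> V. coeffs_in F f}. \<phi> f ~= 0"
proof (rule ccontr)
 assume no: "\<not> ?thesis"
 have "\<phi> 0 = 0" using lin[of 1 0 0] by simp
 have "f \<in> pv.span B" using f(1) VB by simp
 then have "\<phi> f = 0"
 proof (induction rule: pv.span_induct_alt)
  case (step c x y)
  have "x \<in> V" using step(1) VB by (simp add: pv.span_base)
  then show ?case using no step BF lin by auto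
 qed (rule \<open>\<phi> 0 = 0\<close>)
 then show False using f(2) by simp
qed

text \<open>A pencil argument over \<open>F\<close>: in the pencil spanned by two rational members without
 common zeros, the members with a multiple zero correspond to the zeros of the Wronskian \<open>w\<close>, so
 only finitely many are bad.\<close>

lemma exists_good_section:
 "\<exists>s. good_section s \<and> coeffs_in F s \<and> (\<forall>z. poly a z = 0 --> poly s z ~= 0)"
proof -
 define V0 where "V0 = {f \<in> V. coeffs_in F f}"
 have V0: "V0 ~= {}" using pv.subspace_0[OF V] coeffs_in_0[OF qalgD(5)[OF F]] by (auto simp: V0_def)
 have natF: "of_nat n \<in> F" for n using qalgD(4)[OF F, of "of_nat n"] by simp
 have cl: "smult (of_nat n) f + g \<in> V0" if "f \<in> V0" "g \<in> V0" for f g n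
  using that natF by (auto simp: V0_def intro: pv.subspace_add[OF V] pv.subspace_scale[OF V]
    coeffs_in_add[OF F] coeffs_in_smult[OF F])
 have ev: "\<exists>f\<in>V0. poly f z ~= 0" for z
  using bpf[of z] rational_functional[of "\<lambda>f. poly f z"] unfolding V0_def by auto
 have cf: "\<exists>f\<in>V0. coeff f d ~= 0"
  using inf rational_functional[of "\<lambda>f. coeff f d"] unfolding V0_def by auto
 have "\<exists>f\<in>V0. \<forall>\<phi>\<in>insert (\<lambda>f. coeff f d) ((\<lambda>z f. poly f z) ` {z. poly a z = 0}). \<phi> f ~= 0"
 proof (rule general_member[OF _ V0 cl])
  show "finite (insert (\<lambda>f. coeff f d) ((\<lambda>z f. poly f z) ` {z. poly a z = 0}))"
   using poly_roots_finite[OF a0] by simp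
 qed (use ev cf in auto)
 then obtain s0 where s0: "s0 \<in> V0" "coeff s0 d ~= 0" "\<And>z. poly a z = 0 ==> poly s0 z ~= 0" by auto
 have s0ne: "s0 ~= 0" using s0(2) by auto
 have "\<exists>f\<in>V0. \<forall>\<phi>\<in>(\<lambda>z f. poly f z) ` {z. poly s0 z = 0}. \<phi> f ~= 0"
 proof (rule general_member[OF _ V0 cl])
  show "finite ((\<lambda>z f. poly f z) ` {z. poly s0 z = 0})" using poly_roots_finite[OF s0ne] by simp
 qed (use ev in auto)
 then obtain s1 where s1: "s1 \<in> V0" "\<And>z. poly s0 z = 0 ==> poly s1 z ~= 0" by auto
 define w where "w = s0 * pderiv s1 - pderiv s0 * s1"
 have ds0: "degree s0 = d" using s0(1,2) Vd le_degree[OF s0(2)] by (auto simp: polys_le_def V0_def)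
 have wne: "w ~= 0"
 proof
  assume w: "w = 0"
  obtain u h where uh: "u * s0 + h * s1 = 1" by (rule no_common_root_bezout[OF s0ne s1(2)])
  have "pderiv s0 = pderiv s0 * (u * s0 + h * s1)" by (simp only: uh mult.right_neutral)
  also have "\<dots> = s0 * (pderiv s0 * u + h * pderiv s1) - h * w"
   by (simp add: w_def algebra_simps)
  finally have "pderiv s0 = s0 * (pderiv s0 * u + h * pderiv s1)" unfolding w by simp
  then have "s0 dvd pderiv s0" by (rule dvdI)
  moreover have "pderiv s0 ~= 0" using ds0 d0 by (simp add: pderiv_eq_0_iff)
  ultimately have "degree s0 \<le> degree (pderiv s0)" by (rule dvd_imp_degree_le)
  then show False using ds0 d0 by (simp add: degree_pderiv)
 qed
 define bad where "bad = {0} \<union> {n::nat. of_nat n * coeff s1 d + coeff s0 d = 0} \<union>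
  (\<Union>z\<in>{z. poly a z = 0} \<union> {z. poly w z = 0}. {n::nat. of_nat n * poly s1 z + poly s0 z = 0})"
 have "finite bad" unfolding bad_def
  using poly_roots_finite[OF a0] poly_roots_finite[OF wne] s0(2) s1(2)
  by (intro finite_UnI finite_UN_I finite_bad_multiples) auto
 then obtain n where n: "n \<notin> bad" using infinite_UNIV_nat by (metis ex_new_if_finite)
 define s where "s = smult (of_nat n) s1 + s0"
 have s: "s \<in> V" "coeffs_in F s" using cl[OF s1(1) s0(1), of n] by (auto simp: s_def V0_def)
 have sd: "coeff s d ~= 0" using n by (auto simp: bad_def s_def)
 have sa: "poly s z ~= 0" if "poly a z = 0" for z using n that by (auto simp: bad_def s_def)
 have n0: "of_nat n ~= (0::'a)" using n by (auto simp: bad_def)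
 have "poly (pderiv s) z ~= 0" if z: "poly s z = 0" for z
 proof
  assume "poly (pderiv s) z = 0"
  then have 1: "of_nat n * poly (pderiv s1) z = - poly (pderiv s0) z"
   by (simp add: s_def pderiv_add pderiv_smult add_eq_0_iff2)
  have 2: "of_nat n * poly s1 z = - poly s0 z" using z by (simp add: s_def add_eq_0_iff2)
  have "of_nat n * poly w z = poly s0 z * (of_nat n * poly (pderiv s1) z) - poly (pderiv s0) z * (of_nat n * poly s1 z)"
   by (simp add: w_def algebra_simps)
  also have "\<dots> = 0" unfolding 1 2 by simp
  finally have "poly w z = 0" using n0 by simp
  then show False using n z by (auto simp: bad_def s_def)
 qed
 moreover have "\<exists>f\<in>V. poly f p = 0 \<and> poly f p' ~= 0" if "poly s p = 0" "poly s p' = 0" "p ~= p'" for p p'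
 proof (rule separation_off_conductor[OF cond that(3)])
  show "poly a p' ~= 0" using sa[of p'] that(2) by blast
 qed
 ultimately have "good_section s" unfolding good_section_def using s sd by blast
 then show ?thesis using s(2) sa by blast
qed

end

text \<open>The polynomial \<open>\<sigma>\<close> is an inverse of \<open>s\<close> modulo the conductor
 \<open>a\<close>. It plays the role of \<open>1 / s\<close> and makes functions on the chart out of
 forms.\<close>

locale presented_curve = rational_system V d F l B a i0 j
 for V :: "'a::{alg_closed_field, field_char_0} poly set" and d F l B a i0 j +
 fixes s \<sigma> :: "'a poly"
 assumes gs: "good_section s" and sF: "coeffs_in F s" and sa: "\<And>z. poly a z = 0 ==> poly s z ~= 0"
  and sgF: "coeffs_in F \<sigma>" and sg: "a dvd s * \<sigma> - 1"
begin

text \<open>The functions on the affine line that descend to the curve, after division by a power of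
 \<open>s\<close>.\<close>

definition A :: "'a poly set" where
 "A = {g. \<exists>k. \<exists>f\<in>vpow V k. a dvd g * s ^ k - f}"

lemma sV: "s \<in> V" using gs by (simp add: good_section_def)

lemma A_I: "f \<in> vpow V k ==> a dvd g * s ^ k - f ==> g \<in> A"
 unfolding A_def by blast

lemma subalg_A: "subalg A"
proof -
 have add: "g1 + g2 \<in> A" if gg: "g1 \<in> A" "g2 \<in> A" for g1 g2
 proof -
  obtain k1 f1 k2 f2 where 1: "f1 \<in> vpow V k1" "a dvd g1 * s ^ k1 - f1"
   and 2: "f2 \<in> vpow V k2" "a dvd g2 * s ^ k2 - f2" using gg unfolding A_def by blast
  have "s ^ k2 * f1 \<in> vpow V (k2 + k1)" "s ^ k1 * f2 \<in> vpow V (k1 + k2)"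
   using vpow_power_mult[OF sV] 1(1) 2(1) by blast+
  then have "s ^ k2 * f1 + s ^ k1 * f2 \<in> vpow V (k1 + k2)"
   by (intro pv.subspace_add[OF vpow_subspace]) (simp_all add: add.commute)
  moreover have "(g1 + g2) * s ^ (k1 + k2) - (s ^ k2 * f1 + s ^ k1 * f2)
   = (g1 * s ^ k1 - f1) * s ^ k2 + (g2 * s ^ k2 - f2) * s ^ k1"
   by (simp add: power_add algebra_simps)
  ultimately show ?thesis using 1(2) 2(2) by (intro A_I) (auto intro!: dvd_add dvd_mult2)
 qed
 have mult: "g1 * g2 \<in> A" if gg: "g1 \<in> A" "g2 \<in> A" for g1 g2
 proof -
  obtain k1 f1 k2 f2 where 1: "f1 \<in> vpow V k1" "a dvd g1 * s ^ k1 - f1"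
   and 2: "f2 \<in> vpow V k2" "a dvd g2 * s ^ k2 - f2" using gg unfolding A_def by blast
  have "f1 * f2 \<in> vpow V (k1 + k2)" using 1(1) 2(1) by (rule vpow_mult)
  moreover have "(g1 * g2) * s ^ (k1 + k2) - f1 * f2
   = (g1 * s ^ k1 - f1) * (g2 * s ^ k2) + (g2 * s ^ k2 - f2) * f1"
   by (simp add: power_add algebra_simps)
  ultimately show ?thesis using 1(2) 2(2) by (intro A_I) (auto intro!: dvd_add dvd_mult2)
 qed
 have scale: "smult c g \<in> A" if gg: "g \<in> A" for c g
 proof -
  obtain k f where 1: "f \<in> vpow V k" "a dvd g * s ^ k - f" using gg unfolding A_def by blast
  have "smult c g * s ^ k - smult c f = smult c (g * s ^ k - f)"
   by (simp add: smult_diff_right)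
  then have "a dvd smult c g * s ^ k - smult c f" using 1(2) by (simp only: dvd_smult)
  then show ?thesis using pv.subspace_scale[OF vpow_subspace 1(1), of c] by (intro A_I)
 qed
 have one: "1 \<in> A" by (rule A_I[OF vpow_one]) simp
 have zero: "0 \<in> A" using scale[OF one, of 0] by simp
 show ?thesis unfolding subalg_def
  using add mult scale one zero by (auto intro!: pv.subspaceI)
qed

lemma conductor_A: "a * h \<in> A"
 by (rule A_I[OF pv.subspace_0[OF vpow_subspace], of _ 0]) simp

lemma sigma_power: "a dvd (s * \<sigma>) ^ k - 1"
 using sg by (metis dvd_trans power_diff_1_eq dvd_triv_left)

text \<open>Multiplication by \<open>s\<close> can be undone in degrees from \<open>d ^ 2\<close> on.\<close>

lemma inj_power:
 assumes "k \<ge> d\<^sup>2" "degree f \<le> d * k" "s ^ n * f \<in> vpow V (k + n)"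
 shows "f \<in> vpow V k"
 using assms
proof (induction n arbitrary: k f)
 case (Suc n)
 have "s * f \<in> vpow V (Suc k)"
 proof (rule Suc.IH)
  have "degree (s * f) \<le> degree s + degree f" by (rule degree_mult_le)
  then show "degree (s * f) \<le> d * Suc k" using Suc.prems(2) s_facts(3)[OF gs] by simp
  show "s ^ n * (s * f) \<in> vpow V (Suc k + n)" using Suc.prems(3) by (simp add: ac_simps)
 qed (use Suc.prems(1) in simp)
 then show ?case using regularity[OF gs Suc.prems(1)] Suc.prems(2) by (simp add: inj_at_def[OF gs])
qed simp

text \<open>This translates membership in \<open>A\<close> back into membership in a power of
 \<open>V\<close>. Both sides agree modulo the conductor after multiplication by a power of \<open>s\<close>,
 and regularity removes that power.\<close>

lemma member_vpow:
 assumes k: "k \<ge> d\<^sup>2" and f: "degree f \<le> d * k" and gf: "a dvd g * s ^ k - f" and g: "g \<in> A"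
 shows "f \<in> vpow V k"
proof -
 obtain k' f' where f': "f' \<in> vpow V k'" "a dvd g * s ^ k' - f'" using g by (auto simp: A_def)
 define n where "n = i0 + j + k'"
 have M: "k + n - k' + k' = k + n" by (simp add: n_def)
 have f'M: "s ^ (k + n - k') * f' \<in> vpow V (k + n)" using vpow_power_mult[OF sV f'(1), of "k + n - k'"] M by simp
 have "s ^ n * f - s ^ (k + n - k') * f' = (g * s ^ k' - f') * s ^ (k + n - k') - (g * s ^ k - f) * s ^ n"
 proof -
  have "s ^ k' * s ^ (k + n - k') = s ^ k * s ^ n" using M by (metis add.commute power_add)
  then have "g * s ^ k' * s ^ (k + n - k') = g * s ^ k * s ^ n" by (simp only: mult.assoc)
  then show ?thesis unfolding left_diff_distrib by (simp add: mult.commute[of f] mult.commute[of f'])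
 qed
 then have "a dvd s ^ n * f - s ^ (k + n - k') * f'" using gf f'(2) by (auto intro!: dvd_diff dvd_mult2)
 then obtain h where h: "s ^ n * f - s ^ (k + n - k') * f' = a * h" by blast
 have ds: "degree (s ^ n) \<le> d * n" using degree_power_le[of s n] s_facts(3)[OF gs] by simp
 have "a * h \<in> vpow V (k + n)"
 proof (cases "h = 0")
  case True
  then show ?thesis using pv.subspace_0[OF vpow_subspace] by simp
 next
  case False
  have "degree (s ^ n * f) \<le> d * n + d * k"
   using degree_mult_le[of "s ^ n" f] ds f by linarith
  then have "degree (s ^ n * f) \<le> d * (k + n)" by (simp add: algebra_simps)
  then have "degree (a * h) \<le> d * (k + n)" unfolding h[symmetric] using vpow_deg[OF f'M] by (rule degree_diff_le)
  then have "d * j + degree h \<le> d * (k + n)" using False a0 adeg by (simp add: degree_mult_eq)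
  moreover have nj: "k + n - j + j = k + n" by (simp add: n_def)
  then have "d * (k + n - j) + d * j = d * (k + n)" by (metis add_mult_distrib2)
  ultimately have "degree h \<le> d * (k + n - j)" by linarith
  then have "a * h \<in> vpow V (k + n - j + j)" by (intro cond) (auto simp: n_def)
  then show ?thesis using nj by simp
 qed
 then have "s ^ n * f \<in> vpow V (k + n)"
  using h pv.subspace_add[OF vpow_subspace _ f'M, of "a * h"] by (metis add.commute diff_add_cancel)
 then show ?thesis by (rule inj_power[OF k f])
qed

text \<open>Complements of \<open>vpow V K\<close> for large \<open>K\<close> are transported to complements
 of \<open>A\<close>.\<close>

lemma codim2_A: "\<exists>w1 w2. codim2 A w1 w2"
proof -
 obtain k0 where k0: "\<forall>k\<ge>k0. \<exists>c1 c2. degree c1 \<le> d * k \<and> degree c2 \<le> d * k \<and>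
   (\<forall>f. degree f \<le> d * k --> (\<exists>x y. f - (smult x c1 + smult y c2) \<in> vpow V k)) \<and>
   (\<forall>x y. smult x c1 + smult y c2 \<in> vpow V k --> x = 0 \<and> y = 0)"
  using complement by (rule exE)
 define K where "K = k0 + d\<^sup>2 + j"
 have "k0 \<le> K" by (simp add: K_def)
 from k0[rule_format, OF this] obtain c1 c2 where c: "degree c1 \<le> d * K" "degree c2 \<le> d * K"
   "\<And>f. degree f \<le> d * K ==> \<exists>x y. f - (smult x c1 + smult y c2) \<in> vpow V K"
   "\<And>x y. smult x c1 + smult y c2 \<in> vpow V K ==> x = 0 \<and> y = 0" by metis
 have mod: "a dvd (\<sigma> ^ K * f) * s ^ K - f" for f
 proof -
  have "(\<sigma> ^ K * f) * s ^ K - f = ((s * \<sigma>) ^ K - 1) * f" by (simp add: power_mult_distrib algebra_simps)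
  then show ?thesis using sigma_power[of K] by simp
 qed
 have "codim2 A (\<sigma> ^ K * c1) (\<sigma> ^ K * c2)" unfolding codim2_def
 proof (intro conjI allI impI)
  fix g
  define f where "f = (g * s ^ K) mod a"
  have "degree f \<le> d * K"
  proof (cases "f = 0")
   case False
   then have "degree f < d * j" using degree_mod_less[OF a0, of "g * s ^ K"] adeg by (auto simp: f_def)
   also have "d * j \<le> d * K" by (simp add: K_def)
   finally show ?thesis by simp
  qed simp
  then obtain x y where xy: "f - (smult x c1 + smult y c2) \<in> vpow V K" using c(3) by blast
  define c' where "c' = smult x c1 + smult y c2"
  have "a dvd (g - \<sigma> ^ K * c') * s ^ K - (f - c')"
  proof -
   have "(g - \<sigma> ^ K * c') * s ^ K - (f - c') = (g * s ^ K - f) - ((\<sigma> ^ K * c') * s ^ K - c')"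
    by (simp add: algebra_simps)
   moreover have "a dvd g * s ^ K - f" unfolding f_def by (simp add: minus_mod_eq_mult_div)
   ultimately show ?thesis using mod[of c'] by (simp only: dvd_diff)
  qed
  then have "g - \<sigma> ^ K * c' \<in> A" using xy unfolding c'_def by (intro A_I)
  moreover have "\<sigma> ^ K * c' = smult x (\<sigma> ^ K * c1) + smult y (\<sigma> ^ K * c2)"
   by (simp add: c'_def distrib_left)
  ultimately show "\<exists>x y. g - (smult x (\<sigma> ^ K * c1) + smult y (\<sigma> ^ K * c2)) \<in> A" by auto
 next
  fix x y assume A: "smult x (\<sigma> ^ K * c1) + smult y (\<sigma> ^ K * c2) \<in> A"
  define c' where "c' = smult x c1 + smult y c2"
  have "\<sigma> ^ K * c' \<in> A" using A by (simp add: c'_def distrib_left)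
  moreover have "degree c' \<le> d * K" unfolding c'_def
   using c(1,2) by (intro degree_add_le) (auto intro: le_trans[OF degree_smult_le])
  ultimately have "c' \<in> vpow V K" using mod by (intro member_vpow[of K c' "\<sigma> ^ K * c'"]) (auto simp: K_def)
  then show "x = 0" "y = 0" using c(4) unfolding c'_def by blast+
 qed
 then show ?thesis by blast
qed

definition W :: "'a poly set" where
 "W = {\<sigma> ^ k * prod_list ls | k ls. length ls = k \<and> set ls \<subseteq> B} \<union> range (\<lambda>m. a * monom 1 m)"

lemma W_rational: "w \<in> W ==> coeffs_in F w"
proof -
 have pl: "coeffs_in F (prod_list ls)" if "set ls \<subseteq> B" for ls
  using that by (induction ls) (auto intro: coeffs_in_1[OF F] coeffs_in_mult[OF F] BF)
 show "w \<in> W ==> coeffs_in F w"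
  unfolding W_def using pl aF sgF qalgD(1,5)[OF F]
  by (auto intro!: coeffs_in_mult[OF F] coeffs_in_power[OF F] coeffs_in_monom)
qed

lemma W_subset: "W \<subseteq> A"
proof
 fix w assume "w \<in> W"
 then consider k ls where "w = \<sigma> ^ k * prod_list ls" "length ls = k" "set ls \<subseteq> B" | m where "w = a * monom 1 m"
  by (auto simp: W_def)
 then show "w \<in> A"
 proof cases
  case 1
  have "set ls \<subseteq> V" using 1(3) VB pv.span_superset by blast
  then have "prod_list ls \<in> vpow V k" using 1(2) by (intro vpow_prod_list)
  moreover have "w * s ^ k - prod_list ls = ((s * \<sigma>) ^ k - 1) * prod_list ls"
   by (simp add: 1(1) power_mult_distrib algebra_simps)
  ultimately show ?thesis using sigma_power[of k] by (intro A_I) auto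
 next
  case 2
  then show ?thesis using conductor_A by simp
 qed
qed

lemma A_span: "A = pv.span W"
proof
 show "pv.span W \<subseteq> A" by (rule pv.span_minimal[OF W_subset subalgD(1)[OF subalg_A]])
 show "A \<subseteq> pv.span W"
 proof
  fix g assume "g \<in> A"
  then obtain k f where kf: "f \<in> vpow V k" "a dvd g * s ^ k - f" by (auto simp: A_def)
  have 1: "\<sigma> ^ k * f \<in> pv.span W"
  proof -
   have "f \<in> pv.span {prod_list ls | ls. length ls = k \<and> set ls \<subseteq> B}" using kf(1) vpow_span[OF VB] by blast
   then show ?thesis
   proof (induction rule: pv.span_induct_alt)
    case base
    show ?case by (simp add: pv.span_zero)
   next
    case (step c x y)
    have "\<sigma> ^ k * x \<in> pv.span W" using step(1) by (intro pv.span_base) (auto simp: W_def)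
    then have "smult c (\<sigma> ^ k * x) + \<sigma> ^ k * y \<in> pv.span W"
     using step(2) by (intro pv.span_add pv.span_scale)
    then show ?case by (simp add: algebra_simps)
   qed
  qed
  have "g - \<sigma> ^ k * f = \<sigma> ^ k * (g * s ^ k - f) - g * ((s * \<sigma>) ^ k - 1)"
   by (simp add: power_mult_distrib algebra_simps)
  then have "a dvd g - \<sigma> ^ k * f" using kf(2) sigma_power[of k] by simp
  then obtain h where h: "g - \<sigma> ^ k * f = a * h" by blast
  have "h = (\<Sum>m\<le>degree h. smult (coeff h m) (monom 1 m))"
   by (simp add: smult_monom poly_as_sum_of_monoms)
  then have "a * h = a * (\<Sum>m\<le>degree h. smult (coeff h m) (monom 1 m))" by simp
  also have "\<dots> = (\<Sum>m\<le>degree h. smult (coeff h m) (a * monom 1 m))"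
   by (simp add: sum_distrib_left)
  also have "\<dots> \<in> pv.span W"
   by (intro pv.span_sum pv.span_scale pv.span_base) (auto simp: W_def)
  finally have "\<sigma> ^ k * f + a * h \<in> pv.span W" using 1 by (intro pv.span_add)
  then show "g \<in> pv.span W" using h by (metis add.commute diff_add_cancel)
 qed
qed

text \<open>Since \<open>A\<close> is spanned by polynomials over \<open>F\<close>, its conductor has elements
 over \<open>F\<close>.\<close>

lemma rational_conductor: "\<exists>c. c ~= 0 \<and> degree c \<le> 4 \<and> coeffs_in F c \<and> (\<forall>h. c * h \<in> A)"
proof -
 obtain w1 w2 where "codim2 A w1 w2" using codim2_A by blast
 then obtain q where q: "q ~= 0" "degree q \<le> 4" "\<And>h. q * h \<in> A" using conductor_quartic[OF subalg_A] by blast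
 have "\<exists>c. c ~= 0 \<and> coeffs_in F c \<and> degree c = degree q \<and> (\<forall>m\<in>{..degree a}. monom 1 m * c \<in> pv.span W)"
  by (rule descend_span_multiples[OF F W_rational q(1)]) (use q(3) in \<open>auto simp: A_span[symmetric] mult.commute[of _ q]\<close>)
 then obtain c where c: "c ~= 0" "coeffs_in F c" "degree c = degree q"
  "\<And>m. m \<le> degree a ==> monom 1 m * c \<in> A" by (auto simp: A_span[symmetric])
 have "c * h \<in> A" for h
 proof -
  define g where "g = h mod a"
  have "degree g \<le> degree a" unfolding g_def using degree_mod_less[OF a0, of h] by auto
  have "g = (\<Sum>m\<le>degree g. smult (coeff g m) (monom 1 m))"
   by (simp add: smult_monom poly_as_sum_of_monoms)
  then have "c * g = c * (\<Sum>m\<le>degree g. smult (coeff g m) (monom 1 m))" by simp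
  also have "\<dots> = (\<Sum>m\<le>degree g. smult (coeff g m) (monom 1 m * c))"
   by (simp add: sum_distrib_left mult.commute)
  also have "\<dots> \<in> A" using \<open>degree g \<le> degree a\<close>
   by (intro pv.subspace_sum[OF subalgD(1)[OF subalg_A]] subalgD(7)[OF subalg_A] c(4)) auto
  finally have 1: "c * g \<in> A" .
  have "h = a * (h div a) + g" by (simp add: g_def)
  then have "c * h = c * (a * (h div a) + g)" by (rule arg_cong)
  then have "c * h = c * g + a * (c * (h div a))" by (simp add: algebra_simps)
  then show ?thesis using subalgD(5)[OF subalg_A 1 conductor_A] by simp
 qed
 then show ?thesis using c(1-3) q(2) by auto
qed

end

lemma linear_interpolation:
 fixes q :: "'a::field poly"
 assumes "degree q \<le> 1" "p1 ~= p2"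
 shows "poly q z = (z - p2) / (p1 - p2) * poly q p1 + (p1 - z) / (p1 - p2) * poly q p2"
  and "poly (pderiv q) z = (poly q p1 - poly q p2) / (p1 - p2)"
proof -
 obtain b c where q: "q = [:b, c:]"
  using assms(1) by (metis One_nat_def degree_pCons_eq_if degree_eq_zeroE le_SucE le_zero_eq less_one pCons_cases Suc_le_mono degree_0 zero_le)
 have D: "p1 - p2 ~= 0" using assms(2) by simp
 have "(z - p2) / (p1 - p2) * poly q p1 + (p1 - z) / (p1 - p2) * poly q p2
  = ((z - p2) * poly q p1 + (p1 - z) * poly q p2) / (p1 - p2)" by (simp add: add_divide_distrib)
 also have "(z - p2) * poly q p1 + (p1 - z) * poly q p2 = (p1 - p2) * poly q z" by (simp add: q algebra_simps)
 also have "(p1 - p2) * poly q z / (p1 - p2) = poly q z" using D by simp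
 finally show "poly q z = (z - p2) / (p1 - p2) * poly q p1 + (p1 - z) / (p1 - p2) * poly q p2" by (rule sym)
 show "poly (pderiv q) z = (poly q p1 - poly q p2) / (p1 - p2)"
  using D by (simp add: q pderiv_pCons field_simps)
qed

lemma exists_root_of:
 fixes c :: "'a::alg_closed_field"
 assumes "d > 0"
 shows "\<exists>x. x ^ d = c"
 using nth_root_exists[OF assms] by blast

context presented_curve
begin

lemma l_pos: "l > 0"
proof (rule ccontr)
 assume "\<not> l > 0"
 then obtain T where "finite T" "card T = 0" "F = qv.span T" using F by (auto simp: qalg_def)
 then have "F = {0}" by simp
 then show False using qalgD(1)[OF F] by simp
qed

lemma conductor_glued:
 assumes g: "\<And>h. g * h \<in> A" and gl: "\<And>f. f \<in> A ==> poly f p = poly f p'" and p: "p ~= p'"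
 shows "poly g p = 0" "poly g p' = 0"
 using gl[OF g[of "[:- p', 1:]"]] gl[OF g[of "[:- p, 1:]"]] p by auto

lemma sigma_root:
 assumes "poly a p = 0"
 shows "poly s p * poly \<sigma> p = 1"
proof -
 obtain h where "s * \<sigma> - 1 = a * h" using sg by blast
 then have "poly (s * \<sigma> - 1) p = poly (a * h) p" by simp
 then show ?thesis using assms by simp
qed

text \<open>So \<open>\<sigma> * q ^ d\<close> represents the function \<open>q ^ d / s\<close>.\<close>

lemma u_power_congruent: "a dvd (\<sigma> * q ^ d) ^ k * s ^ k - q ^ (d * k)"
proof -
 have "(\<sigma> * q ^ d) ^ k * s ^ k - q ^ (d * k) = ((s * \<sigma>) ^ k - 1) * q ^ (d * k)"
  by (simp add: power_mult_distrib power_mult algebra_simps)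
 then show ?thesis using sigma_power[of k] by simp
qed

context
 fixes q :: "'a poly" and k0 :: nat
 assumes q: "q ~= 0" "degree q \<le> 1" and k0: "k0 > 0" and uA: "(\<sigma> * q ^ d) ^ k0 \<in> A"
begin

definition u :: "'a poly" where "u = \<sigma> * q ^ d"

lemma u_eval: "poly u p = poly \<sigma> p * poly q p ^ d" by (simp add: u_def)

lemma q_glued_nonzero:
 assumes gl: "\<And>f. f \<in> A ==> poly f p = poly f p'" and p: "p ~= p'"
 shows "poly q p ~= 0" "poly q p' ~= 0" "poly \<sigma> p ~= 0" "poly \<sigma> p' ~= 0" "(poly u p / poly u p') ^ k0 = 1"
proof -
 have az: "poly a p = 0" "poly a p' = 0" using conductor_glued[OF conductor_A gl p] by auto
 show sg0: "poly \<sigma> p ~= 0" "poly \<sigma> p' ~= 0" using sigma_root[OF az(1)] sigma_root[OF az(2)] by auto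
 have e: "poly u p ^ k0 = poly u p' ^ k0" using gl[OF uA] by (simp add: u_def)
 have both: "\<not> (poly q p = 0 \<and> poly q p' = 0)"
 proof
  assume z: "poly q p = 0 \<and> poly q p' = 0"
  have "card {x. poly q x = 0} \<le> 1" using card_poly_roots_bound[OF q(1)] q(2) by simp
  moreover have "{p, p'} \<subseteq> {x. poly q x = 0}" using z by auto
  then have "card {p, p'} \<le> card {x. poly q x = 0}" by (rule card_mono[OF poly_roots_finite[OF q(1)]])
  ultimately show False using p by simp
 qed
 show "poly q p ~= 0" "poly q p' ~= 0" using both e sg0 k0 d0 by (auto simp: u_eval power_0_left)
 then show "(poly u p / poly u p') ^ k0 = 1" using e sg0 by (simp add: power_divide u_eval)
qed

lemma glued_power:
 assumes gl: "\<And>f. f \<in> A ==> poly f p = poly f p'" and p: "p ~= p'" and N: "(poly u p / poly u p') ^ N = 1"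
 shows "poly (u ^ N) p = poly (u ^ N) p'"
 using N q_glued_nonzero[OF gl p] by (simp add: power_divide u_eval divide_eq_eq)

text \<open>The field of definition of the singular points and of their preimages.\<close>

lemma singular_points_field:
 assumes "finite Y" "\<And>z g. z \<in> Y ==> (\<And>h. g * h \<in> A) ==> poly g z = 0"
 shows "\<exists>E. F \<subseteq> E \<and> Y \<subseteq> E \<and> qalg E (24 * l)"
proof -
 obtain c where c: "c ~= 0" "degree c \<le> 4" "coeffs_in F c" "\<And>h. c * h \<in> A" using rational_conductor by blast
 have "\<exists>E. F \<subseteq> E \<and> Y \<subseteq> E \<and> qalg E (l * fact 4)"
  by (rule qalg_adjoin_roots[OF F c(3,1,2) assms(1)]) (use assms(2)[OF _ c(4)] in blast)
 then show ?thesis by (simp add: fact_numeral mult.commute)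
qed

text \<open>The ratios \<open>q(p1) / q(p2)\<close> and \<open>q(p3) / q(p4)\<close> become roots of unity
 \<open>x\<close> and \<open>y\<close> after division by \<open>d\<close>-th roots \<open>g\<close> and
 \<open>g'\<close> of rational quantities. As \<open>q\<close> is linear, its values at four points satisfy
 linear relations, so \<open>(x, y)\<close> is a torsion point on a conic over a field of degree \<open>24 * l
 * d * d\<close>: 24 for the four points and \<open>d\<close> for each root.\<close>

lemma two_nodes_bound:
 assumes p: "p1 ~= p2" "p3 ~= p1" "p3 ~= p2" "p4 ~= p3"
  and iff: "\<And>f. f \<in> A \<longleftrightarrow> poly f p1 = poly f p2 \<and> poly f p3 = poly f p4"
 shows "\<exists>N>0. N \<le> 256 * (24 * l * d * d) ^ 4 \<and> u ^ N \<in> A"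
proof -
 have g12: "\<And>f. f \<in> A ==> poly f p1 = poly f p2" and g34: "\<And>f. f \<in> A ==> poly f p3 = poly f p4"
  using iff by blast+
 have p34: "p3 ~= p4" using p(4) by simp
 note n12 = q_glued_nonzero[OF g12 p(1)] and n34 = q_glued_nonzero[OF g34 p34]
 obtain E where E: "F \<subseteq> E" "{p1, p2, p3, p4} \<subseteq> E" "qalg E (24 * l)"
  using singular_points_field[of "{p1, p2, p3, p4}"] conductor_glued[OF _ g12 p(1)] conductor_glued[OF _ g34 p34]
  by (metis (no_types, lifting) finite.emptyI finite_insert insertE singletonD)
 have sgE: "coeffs_in E \<sigma>" using coeffs_in_mono[OF sgF E(1)] .
 have radical: "\<exists>g E'. g ^ d = c \<and> g \<in> E' \<and> S \<subseteq> E' \<and> qalg E' (n * d)"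
  if S: "qalg S n" and c: "c \<in> S" for S n and c :: 'a
 proof -
  obtain g where g: "g ^ d = c" using exists_root_of[OF d0, of c] by (rule exE)
  define f where "f = monom 1 d - [:c:]"
  have "coeff f d = 1" using d0 by (cases d) (auto simp: f_def)
  then have f0: "f ~= 0" by auto
  have cf: "coeffs_in S f" unfolding f_def using c qalgD[OF S]
   by (intro coeffs_in_diff[OF S] coeffs_in_monom) (auto simp: coeffs_in_pCons coeffs_in_0)
  have "degree f \<le> d" unfolding f_def by (intro degree_diff_le) (auto simp: degree_monom_le)
  moreover have "poly f g = 0" by (simp add: f_def poly_monom g)
  ultimately have "qalg (adjoin S g) (n * d)" by (intro qalg_adjoin[OF S cf f0])
  then show ?thesis using g adjoin_self[of S g] adjoin_superset[of S g] qalgD[OF S] by blast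
 qed
 have sE: "poly \<sigma> z \<in> E" if "z \<in> {p1, p2, p3, p4}" for z
  using poly_in_qalg[OF E(3) sgE, of z] that E(2) by blast
 obtain g E1 where g: "g ^ d = poly \<sigma> p2 / poly \<sigma> p1" "g \<in> E1" "E \<subseteq> E1" "qalg E1 (24 * l * d)"
  using radical[OF E(3) qalg_divide[OF E(3) sE sE], of p2 p1] by auto
 have "poly \<sigma> p4 / poly \<sigma> p3 \<in> E1" using qalg_divide[OF E(3) sE sE, of p4 p3] g(3) by auto
 then obtain g' E2 where g': "g' ^ d = poly \<sigma> p4 / poly \<sigma> p3" "g' \<in> E2" "E1 \<subseteq> E2" "qalg E2 (24 * l * d * d)"
  using radical[OF g(4)] by blast
 have inE2: "g \<in> E2" "p1 \<in> E2" "p2 \<in> E2" "p3 \<in> E2" "p4 \<in> E2" using g g' E(2) by auto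
 have gne: "g ~= 0" using g(1) n12 d0 by (metis divide_eq_0_iff power_0_left less_numeral_extra(3))
 have gne': "g' ~= 0" using g'(1) n34 d0 by (metis divide_eq_0_iff power_0_left less_numeral_extra(3))
 define x where "x = poly q p1 / poly q p2 / g"
 define y where "y = poly q p3 / poly q p4 / g'"
 have xd: "x ^ d = poly u p1 / poly u p2" unfolding x_def power_divide g(1) u_eval by (simp add: ac_simps)
 have yd: "y ^ d = poly u p3 / poly u p4" unfolding y_def power_divide g'(1) u_eval by (simp add: ac_simps)
 define P where "P = (\<lambda>N. N > 0 \<and> x ^ N = 1 \<and> y ^ N = 1)"
 have "P (d * k0)" unfolding P_def using n12(5) n34(5) d0 k0 by (simp add: power_mult xd yd)
 then obtain N where N: "P N" "\<And>k. P k ==> N \<le> k" by (metis LeastI Least_le)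
 define D where "D = p1 - p2"
 have D: "D ~= 0" using p(1) by (simp add: D_def)
 define la1 where "la1 = (p3 - p2) / D"
 define la2 where "la2 = (p1 - p3) / D"
 define mu1 where "mu1 = (p4 - p2) / D"
 define mu2 where "mu2 = (p1 - p4) / D"
 have q3: "poly q p3 = la1 * poly q p1 + la2 * poly q p2" and q4: "poly q p4 = mu1 * poly q p1 + mu2 * poly q p2"
  unfolding la1_def la2_def mu1_def mu2_def D_def by (rule linear_interpolation(1)[OF q(2) p(1)])+
 have det: "la1 * mu2 - la2 * mu1 = (p3 - p4) / D"
 proof -
  have "(p3 - p2) * (p1 - p4) - (p1 - p3) * (p4 - p2) = (p3 - p4) * D" by (simp add: D_def algebra_simps)
  moreover have "la1 * mu2 - la2 * mu1 = ((p3 - p2) * (p1 - p4) - (p1 - p3) * (p4 - p2)) / (D * D)"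
   unfolding la1_def la2_def mu1_def mu2_def times_divide_times_eq diff_divide_distrib[symmetric] ..
  ultimately show ?thesis using D by simp
 qed
 have ne: "la1 ~= 0" "la2 ~= 0" "la1 * mu2 ~= la2 * mu1"
  using p D det by (auto simp: la1_def la2_def)
 have DE: "D \<in> E2" unfolding D_def by (intro qalgD(7)[OF g'(4)] inE2)
 have lamE: "la1 \<in> E2" "la2 \<in> E2" "mu1 \<in> E2" "mu2 \<in> E2"
  unfolding la1_def la2_def mu1_def mu2_def
  by (intro qalg_divide[OF g'(4)] qalgD(7)[OF g'(4)] inE2 DE)+
 have "24 \<le> 24 * l * d * d" using l_pos d0 by simp
 have "N \<le> 256 * (24 * l * d * d) ^ 4"
 proof (rule torsion_order_absolute_bound[OF g'(4)])
  show "la1 * g \<in> E2" "la2 \<in> E2" "mu1 * g * g' \<in> E2" "mu2 * g' \<in> E2"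
   using lamE inE2 g'(2) by (auto intro!: qalgD(2)[OF g'(4)])
  show "la1 * g ~= 0" "la2 ~= 0" using ne gne by auto
  show "la1 * g * (mu2 * g') ~= la2 * (mu1 * g * g')"
  proof
   assume "la1 * g * (mu2 * g') = la2 * (mu1 * g * g')"
   then have "(la1 * mu2 - la2 * mu1) * (g * g') = 0" by (simp add: algebra_simps)
   then show False using ne(3) gne gne' by simp
  qed
  have "poly q p3 = y * g' * poly q p4" "poly q p1 = x * g * poly q p2"
   using n12 n34 gne gne' by (simp_all add: x_def y_def)
  then have "la1 * (x * g * poly q p2) + la2 * poly q p2 = y * g' * (mu1 * (x * g * poly q p2) + mu2 * poly q p2)"
   using q3 q4 by metis
  then have "poly q p2 * (y * (mu1 * g * g' * x + mu2 * g')) = poly q p2 * (la1 * g * x + la2)"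
   by (simp add: algebra_simps)
  then show "y * (mu1 * g * g' * x + mu2 * g') = la1 * g * x + la2" using n12 by simp
  show "N > 0" "x ^ N = 1" "y ^ N = 1" using N(1) by (auto simp: P_def)
  show "N \<le> k" if "0 < k" "x ^ k = 1" "y ^ k = 1" for k using N(2) that by (simp add: P_def)
  show "24 \<le> 24 * l * d * d" by fact
 qed
 moreover have "u ^ N \<in> A"
 proof -
  have "(poly u p1 / poly u p2) ^ N = 1" "(poly u p3 / poly u p4) ^ N = 1"
   using N(1) unfolding xd[symmetric] yd[symmetric] P_def by (metis mult.commute power_mult power_one)+
  then show ?thesis unfolding iff using glued_power[OF g12 p(1)] glued_power[OF g34 p34] by blast
 qed
 ultimately show ?thesis using N(1) by (auto simp: P_def)
qed

lemma u_ratio: "poly u p1 / poly u p2 = poly \<sigma> p1 / poly \<sigma> p2 * (poly q p1 / poly q p2) ^ d"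
 by (simp add: u_eval power_divide)

lemma ratio_order:
 assumes g12: "\<And>f. f \<in> A ==> poly f p1 = poly f p2" and p: "p1 ~= p2"
  and E: "qalg E n" "poly q p1 / poly q p2 \<in> E" "poly \<sigma> p1 \<in> E" "poly \<sigma> p2 \<in> E"
 shows "\<exists>N>0. N \<le> 2 * n\<^sup>2 \<and> poly (u ^ N) p1 = poly (u ^ N) p2 \<and> (poly u p1 / poly u p2) ^ N = 1"
proof -
 have "poly u p1 / poly u p2 \<in> E"
  unfolding u_ratio by (intro qalgD(2,8)[OF E(1)] qalg_divide[OF E(1)] E)
 then obtain N where "N > 0" "(poly u p1 / poly u p2) ^ N = 1" "N \<le> 2 * n\<^sup>2"
  by (rule root_of_unity_order_bound[OF E(1) _ k0 q_glued_nonzero(5)[OF g12 p]])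
 then show ?thesis using glued_power[OF g12 p] by blast
qed

text \<open>Vanishing of the derivative of \<open>u ^ k\<close> at \<open>p3\<close> is a linear equation for
 \<open>x = q(p1) / q(p2)\<close> over the field of the three points. So \<open>x\<close> and the root of
 unity \<open>u(p1) / u(p2)\<close> lie in that field.\<close>

lemma node_cusp_bound:
 assumes p: "p1 ~= p2" "p3 ~= p1" "p3 ~= p2"
  and iff: "\<And>f. f \<in> A \<longleftrightarrow> poly f p1 = poly f p2 \<and> poly (pderiv f) p3 = 0"
 shows "\<exists>N>0. N \<le> 4 * (48 * l)\<^sup>2 \<and> u ^ N \<in> A"
proof -
 have g12: "\<And>f. f \<in> A ==> poly f p1 = poly f p2" using iff by blast
 note n12 = q_glued_nonzero[OF g12 p(1)]
 have cz: "poly g p3 = 0" if g: "\<And>h. g * h \<in> A" for g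
 proof -
  have "poly (pderiv (g * 1)) p3 = 0" "poly (pderiv (g * [:0, 1:])) p3 = 0" using g iff by blast+
  then show ?thesis by (simp add: pderiv_mult pderiv_pCons)
 qed
 obtain E where E: "F \<subseteq> E" "{p1, p2, p3} \<subseteq> E" "qalg E (24 * l)"
  using singular_points_field[of "{p1, p2, p3}"] conductor_glued[OF _ g12 p(1)] cz
  by (metis (no_types, lifting) finite.emptyI finite_insert insertE singletonD)
 have sgE: "coeffs_in E \<sigma>" "coeffs_in E (pderiv \<sigma>)"
  using coeffs_in_mono[OF sgF E(1)] coeffs_in_pderiv[OF E(3)] by blast+
 have pE: "p1 \<in> E" "p2 \<in> E" "p3 \<in> E" using E(2) by auto
 have sE: "poly \<sigma> z \<in> E" "poly (pderiv \<sigma>) z \<in> E" if "z \<in> E" for z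
  using poly_in_qalg[OF E(3)] sgE that by blast+
 have s3: "poly \<sigma> p3 ~= 0" using sigma_root[OF cz[OF conductor_A]] by auto
 define x where "x = poly q p1 / poly q p2"
 define D where "D = p1 - p2"
 have D: "D ~= 0" "D \<in> E" using p(1) pE by (auto simp: D_def intro: qalgD(7)[OF E(3)])
 define la1 where "la1 = (p3 - p2) / D"
 define la2 where "la2 = (p1 - p3) / D"
 have q3: "poly q p3 = poly q p2 * (la1 * x + la2)"
 proof -
  have "poly q p3 = la1 * poly q p1 + la2 * poly q p2"
   unfolding la1_def la2_def D_def by (rule linear_interpolation(1)[OF q(2) p(1)])
  also have "poly q p1 = x * poly q p2" using n12 by (simp add: x_def)
  finally show ?thesis by (simp add: algebra_simps)
 qed
 have q': "poly (pderiv q) p3 = poly q p2 * ((x - 1) / D)"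
 proof -
  have "poly (pderiv q) p3 = (poly q p1 - poly q p2) / D"
   unfolding D_def by (rule linear_interpolation(2)[OF q(2) p(1)])
  also have "poly q p1 = x * poly q p2" using n12 by (simp add: x_def)
  finally show ?thesis by (simp add: algebra_simps)
 qed
 have laE: "la1 \<in> E" "la2 \<in> E" unfolding la1_def la2_def
  by (intro qalg_divide[OF E(3)] qalgD(7)[OF E(3)] pE D(2))+
 have "poly (pderiv (u ^ k0)) p3 = 0" using uA iff unfolding u_def by blast
 then have "of_nat k0 * poly u p3 ^ (k0 - 1) * poly (pderiv u) p3 = 0"
  by (simp add: pderiv_power poly_power)
 then have uz: "poly u p3 = 0 \<or> poly (pderiv u) p3 = 0" using k0 by auto
 have xE: "x \<in> E"
 proof (cases "poly q p3 = 0")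
  case True
  then have "la1 * x + la2 = 0" using q3 n12 by simp
  moreover have "la1 ~= 0" using p D by (simp add: la1_def)
  ultimately have "x = - la2 / la1" by (simp add: eq_neg_iff_add_eq_0 field_simps)
  then show ?thesis using laE by (auto intro: qalg_divide[OF E(3)] qalgD(6)[OF E(3)])
 next
  case False
  then have "poly u p3 ~= 0" using s3 by (simp add: u_eval)
  then have "poly (pderiv u) p3 = 0" using uz by blast
  then have "poly q p3 ^ (d - 1) * (poly (pderiv \<sigma>) p3 * poly q p3 + of_nat d * poly \<sigma> p3 * poly (pderiv q) p3) = 0"
  proof -
   have "d = Suc (d - 1)" using d0 by simp
   then have "poly q p3 ^ d = poly q p3 ^ (d - 1) * poly q p3" by (metis power_Suc2)
   moreover assume "poly (pderiv u) p3 = 0"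
   ultimately show ?thesis
    by (simp add: u_def pderiv_mult pderiv_power poly_power algebra_simps)
  qed
  then have "poly (pderiv \<sigma>) p3 * poly q p3 + of_nat d * poly \<sigma> p3 * poly (pderiv q) p3 = 0" using False by simp
  then have "poly q p2 * (poly (pderiv \<sigma>) p3 * (la1 * x + la2) + of_nat d * poly \<sigma> p3 * ((x - 1) / D)) = 0"
   unfolding q3 q' by (simp add: algebra_simps)
  then have e: "poly (pderiv \<sigma>) p3 * (la1 * x + la2) + of_nat d * poly \<sigma> p3 * ((x - 1) / D) = 0" using n12 by simp
  define A1 where "A1 = poly (pderiv \<sigma>) p3 * la1 + of_nat d * poly \<sigma> p3 / D"
  define A2 where "A2 = poly (pderiv \<sigma>) p3 * la2 - of_nat d * poly \<sigma> p3 / D"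
  have e2: "A1 * x + A2 = 0" using e by (simp add: A1_def A2_def algebra_simps diff_divide_distrib)
  have "A1 ~= 0"
  proof
   assume A1: "A1 = 0"
   then have "A2 = 0" using e2 by simp
   then have "poly (pderiv \<sigma>) p3 * (la1 + la2) = 0" using A1 by (simp add: A1_def A2_def algebra_simps)
   moreover have "la1 + la2 = 1" using D(1) by (simp add: la1_def la2_def D_def flip: add_divide_distrib)
   ultimately show False using A1 s3 d0 D(1) by (simp add: A1_def)
  qed
  then have x: "x = - A2 / A1" using e2 by (simp add: eq_neg_iff_add_eq_0 field_simps)
  have dE: "of_nat d \<in> E" using qalgD(4)[OF E(3), of "of_nat d"] by simp
  have "A1 \<in> E" "A2 \<in> E" unfolding A1_def A2_def using sE[OF pE(3)] laE D(2) dE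
   by (auto intro!: qalgD(2,3,7)[OF E(3)] qalg_divide[OF E(3)])
  then show ?thesis unfolding x by (intro qalg_divide[OF E(3)] qalgD(6)[OF E(3)])
 qed
 obtain N where N: "N > 0" "N \<le> 2 * (24 * l)\<^sup>2" "poly (u ^ N) p1 = poly (u ^ N) p2"
  using ratio_order[OF g12 p(1) E(3) xE[unfolded x_def] sE(1)[OF pE(1)] sE(1)[OF pE(2)]] by blast
 \<comment> \<open>\<open>u\<close> may vanish at \<open>p3\<close>; then only its square has a vanishing derivative there.\<close>
 have "poly (pderiv (u ^ (2 * N))) p3 = 0"
 proof -
  have "poly u p3 ^ (2 * N - 1) * poly (pderiv u) p3 = 0" using uz N(1) by (auto simp: power_0_left)
  then show ?thesis by (simp add: pderiv_power poly_power)
 qed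
 moreover have "poly (u ^ (2 * N)) p1 = poly (u ^ (2 * N)) p2" using N(3) by (simp add: power_mult mult.commute[of 2])
 ultimately have "u ^ (2 * N) \<in> A" by (simp only: iff)
 moreover have "2 * N \<le> 4 * (48 * l)\<^sup>2" using N(2) by (simp add: power_mult_distrib)
 ultimately show ?thesis using N(1) by (intro exI[of _ "2 * N"]) auto
qed

lemma proportional_relation:
 fixes b c :: "'b::field"
 assumes "b * c' = c * b'" "(b, c) ~= (0, 0)" "b * x + c * y = 0"
 shows "b' * x + c' * y = 0"
proof -
 have "c * (b' * x + c' * y) = c' * (b * x + c * y)" "b * (b' * x + c' * y) = b' * (b * x + c * y)"
  using assms(1) by (simp_all add: algebra_simps)
 then show ?thesis using assms(2,3) by auto
qed

text \<open>The condition on the two derivatives is defined over the field generated by the two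
 points.\<close>

lemma rational_tangent_condition:
 assumes p: "p1 ~= p2" and E: "qalg E n" "F \<subseteq> E" "p1 \<in> E" "p2 \<in> E" and lm: "(b, c) ~= (0, 0)"
  and iff: "\<And>f. f \<in> A \<longleftrightarrow> poly f p1 = poly f p2 \<and> b * poly (pderiv f) p1 + c * poly (pderiv f) p2 = 0"
 shows "\<exists>b'\<in>E. \<exists>c'\<in>E. (b', c') ~= (0, 0) \<and>
  (\<forall>f. f \<in> A \<longleftrightarrow> poly f p1 = poly f p2 \<and> b' * poly (pderiv f) p1 + c' * poly (pderiv f) p2 = 0)"
proof -
 define D where "D = p1 - p2"
 have D: "D ~= 0" using p by (simp add: D_def)
 have "\<exists>w\<in>W. poly (pderiv w) p1 ~= 0 \<or> poly (pderiv w) p2 ~= 0"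
 proof (rule ccontr)
  assume no: "\<not> ?thesis"
  define S where "S = {f. poly (pderiv f) p1 = 0 \<and> poly (pderiv f) p2 = 0}"
  have "pv.subspace S" unfolding S_def by (intro pv.subspaceI) (auto simp: pderiv_add pderiv_smult)
  then have AS: "A \<subseteq> S" unfolding A_span using no by (intro pv.span_minimal) (auto simp: S_def)
  define g where "g = smult (c / D) [:- p2, 1:] - smult (b / D) [:- p1, 1:]"
  have "poly g p1 = c / D * (p1 - p2)" "poly g p2 = b / D * (p1 - p2)"
   unfolding g_def by (simp_all add: algebra_simps diff_divide_distrib)
  then have g: "poly g p1 = c" "poly g p2 = b" using D by (simp_all flip: D_def)
  define f where "f = [:- p1, 1:] * ([:- p2, 1:] * g)"
  have f2: "f = [:- p2, 1:] * ([:- p1, 1:] * g)" unfolding f_def by (simp only: mult.left_commute)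
  have "poly (pderiv f) p1 = poly ([:- p2, 1:] * g) p1" unfolding f_def by (rule poly_pderiv_linear_mult)
  then have d1: "poly (pderiv f) p1 = D * c" by (simp add: g D_def algebra_simps)
  have "poly (pderiv f) p2 = poly ([:- p1, 1:] * g) p2" unfolding f2 by (rule poly_pderiv_linear_mult)
  then have d2: "poly (pderiv f) p2 = - D * b" by (simp add: g D_def algebra_simps)
  have "poly f p1 = poly f p2" by (simp add: f_def)
  then have "f \<in> A" using d1 d2 by (simp add: iff)
  then show False using AS d1 d2 D lm by (auto simp: S_def)
 qed
 then obtain w where w: "w \<in> W" "poly (pderiv w) p1 ~= 0 \<or> poly (pderiv w) p2 ~= 0" by blast
 define b' where "b' = poly (pderiv w) p2"
 define c' where "c' = - poly (pderiv w) p1"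
 have cw: "coeffs_in E (pderiv w)" using W_rational[OF w(1)] E(2) coeffs_in_mono coeffs_in_pderiv[OF E(1)] by blast
 have "w \<in> A" using w(1) W_subset by blast
 then have "b * (- c') + c * b' = 0" by (simp add: iff b'_def c'_def)
 then have prop1: "b * c' = c * b'" by (simp add: algebra_simps)
 have lm': "(b', c') ~= (0, 0)" using w(2) by (auto simp: b'_def c'_def)
 have "b * x + c * y = 0 \<longleftrightarrow> b' * x + c' * y = 0" for x y
  using proportional_relation[OF prop1 lm] proportional_relation[OF _ lm', of c b x y] prop1
  by (metis mult.commute)
 moreover have "b' \<in> E" "c' \<in> E" unfolding b'_def c'_def
  using poly_in_qalg[OF E(1) cw] E(3,4) qalgD(6)[OF E(1)] by blast+
 ultimately show ?thesis using lm' iff by auto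
qed

text \<open>The condition on the derivatives is the vanishing of \<open>L * r p1 + M * r p2\<close> with
 \<open>r\<close> the logarithmic derivative of \<open>u\<close>; it is independent of the exponent. Written
 in terms of \<open>x = q(p1) / q(p2)\<close> it is a nontrivial quadratic equation \<open>T\<close>, whence
 the degree \<open>48 * l\<close>.\<close>

lemma tangent_node_bound:
 assumes p: "p1 ~= p2" and lm: "(b, c) ~= (0, 0)"
  and iff0: "\<And>f. f \<in> A \<longleftrightarrow> poly f p1 = poly f p2 \<and> b * poly (pderiv f) p1 + c * poly (pderiv f) p2 = 0"
 shows "\<exists>N>0. N \<le> 4 * (48 * l)\<^sup>2 \<and> u ^ N \<in> A"
proof -
 have g12: "\<And>f. f \<in> A ==> poly f p1 = poly f p2" using iff0 by blast
 note n12 = q_glued_nonzero[OF g12 p]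
 obtain E where E: "F \<subseteq> E" "{p1, p2} \<subseteq> E" "qalg E (24 * l)"
  using singular_points_field[of "{p1, p2}"] conductor_glued[OF _ g12 p]
  by (metis (no_types, lifting) finite.emptyI finite_insert insertE singletonD)
 have pE: "p1 \<in> E" "p2 \<in> E" using E(2) by auto
 obtain L M where LM: "L \<in> E" "M \<in> E" "(L, M) ~= (0, 0)"
  "\<And>f. f \<in> A \<longleftrightarrow> poly f p1 = poly f p2 \<and> L * poly (pderiv f) p1 + M * poly (pderiv f) p2 = 0"
  using rational_tangent_condition[OF p E(3,1) pE lm iff0] by blast
 have sgE: "coeffs_in E \<sigma>" "coeffs_in E (pderiv \<sigma>)"
  using coeffs_in_mono[OF sgF E(1)] coeffs_in_pderiv[OF E(3)] by blast+
 have sE: "poly \<sigma> z \<in> E" "poly (pderiv \<sigma>) z \<in> E" if "z \<in> E" for z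
  using poly_in_qalg[OF E(3)] sgE that by blast+
 define x where "x = poly q p1 / poly q p2"
 have x0: "x ~= 0" using n12 by (simp add: x_def)
 define D where "D = p1 - p2"
 have D: "D ~= 0" "D \<in> E" using p pE by (auto simp: D_def intro: qalgD(7)[OF E(3)])
 define r where "r = (\<lambda>z. poly (pderiv u) z / poly u z)"
 have un: "poly u p1 ~= 0" "poly u p2 ~= 0" using n12 by (auto simp: u_eval)
 have du: "poly (pderiv (u ^ k)) z = of_nat k * poly (u ^ k) z * r z" if "poly u z ~= 0" "k > 0" for k z
 proof -
  have "poly (u ^ k) z = poly u z ^ (k - 1) * poly u z" using that(2) by (cases k) (auto simp: poly_power)
  then show ?thesis using that(1) by (simp add: pderiv_power poly_power r_def)
 qed
 have uA': "u ^ k0 \<in> A" using uA by (simp add: u_def)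
 have crit: "u ^ k \<in> A \<longleftrightarrow> poly (u ^ k) p1 = poly (u ^ k) p2 \<and> L * r p1 + M * r p2 = 0" if k: "k > 0" for k
 proof -
  have "L * poly (pderiv (u ^ k)) p1 + M * poly (pderiv (u ^ k)) p2 = of_nat k * poly (u ^ k) p1 * (L * r p1 + M * r p2)"
   if "poly (u ^ k) p1 = poly (u ^ k) p2"
   unfolding du[OF un(1) k] du[OF un(2) k] that by (simp add: algebra_simps)
  moreover have "of_nat k * poly (u ^ k) p1 ~= 0" using k un by (simp add: poly_power)
  ultimately show ?thesis unfolding LM(4)[of "u ^ k"] by (metis mult_eq_0_iff)
 qed
 have rel: "L * r p1 + M * r p2 = 0" using crit[OF k0] uA' by blast
 define t where "t = (\<lambda>z. poly (pderiv \<sigma>) z / poly \<sigma> z)"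
 have tE: "t p1 \<in> E" "t p2 \<in> E" unfolding t_def by (intro qalg_divide[OF E(3)] sE pE)+
 have rz: "r z = t z + of_nat d * (poly (pderiv q) z / poly q z)" if "poly \<sigma> z ~= 0" "poly q z ~= 0" for z
 proof -
  have "d = Suc (d - 1)" using d0 by simp
  then have qd: "poly q z ^ d = poly q z ^ (d - 1) * poly q z" by (metis power_Suc2)
  have "poly (pderiv u) z = poly (pderiv \<sigma>) z * poly q z ^ d + poly \<sigma> z * (of_nat d * poly q z ^ (d - 1) * poly (pderiv q) z)"
   by (simp add: u_def pderiv_mult pderiv_power poly_power algebra_simps)
  then have "r z = poly (pderiv \<sigma>) z * poly q z ^ d / (poly \<sigma> z * poly q z ^ d)
   + poly \<sigma> z * (of_nat d * poly q z ^ (d - 1) * poly (pderiv q) z) / (poly \<sigma> z * poly q z ^ d)"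
   by (simp add: r_def u_eval add_divide_distrib)
  then show ?thesis using that unfolding qd by (simp add: t_def)
 qed
 have q': "poly (pderiv q) z = poly q p2 * (x - 1) / D" for z
 proof -
  have "poly (pderiv q) z = (poly q p1 - poly q p2) / D"
   unfolding D_def by (rule linear_interpolation(2)[OF q(2) p])
  also have "poly q p1 = x * poly q p2" using n12 by (simp add: x_def)
  finally show ?thesis by (simp add: algebra_simps)
 qed
 have r1: "r p1 = t p1 + of_nat d * ((x - 1) / D / x)"
 proof -
  have "poly q p1 = x * poly q p2" using n12 by (simp add: x_def)
  then have "poly (pderiv q) p1 / poly q p1 = (x - 1) / D / x" using n12 unfolding q' by simp
  then show ?thesis using rz[of p1] n12 by simp
 qed
 have r2: "r p2 = t p2 + of_nat d * ((x - 1) / D)"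
 proof -
  have "poly (pderiv q) p2 / poly q p2 = (x - 1) / D" using n12 unfolding q' by simp
  then show ?thesis using rz[of p2] n12 by simp
 qed
 define \<kappa> where "\<kappa> = (L * t p1 + M * t p2) * D"
 define T where "T = [:- (L * of_nat d), \<kappa> + L * of_nat d - M * of_nat d, M * of_nat d:]"
 have "poly T x = D * x * (L * (t p1 + of_nat d * ((x - 1) / D / x)) + M * (t p2 + of_nat d * ((x - 1) / D)))"
 proof -
  have 1: "D * x * (of_nat d * ((x - 1) / D / x)) = of_nat d * (x - 1)"
   "D * x * (of_nat d * ((x - 1) / D)) = of_nat d * (x - 1) * x" using D(1) x0 by simp_all
  have "D * x * (L * (t p1 + of_nat d * ((x - 1) / D / x)) + M * (t p2 + of_nat d * ((x - 1) / D)))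
   = \<kappa> * x + L * (D * x * (of_nat d * ((x - 1) / D / x))) + M * (D * x * (of_nat d * ((x - 1) / D)))"
   unfolding \<kappa>_def by (simp only: distrib_left distrib_right ac_simps)
  also have "\<dots> = poly T x" unfolding 1 by (simp add: T_def algebra_simps)
  finally show ?thesis by (rule sym)
 qed
 then have Tx: "poly T x = 0" using rel unfolding r1 r2 by simp
 have T0: "T ~= 0" using LM(3) d0 by (auto simp: T_def)
 have dE: "of_nat d \<in> E" using qalgD(4)[OF E(3), of "of_nat d"] by simp
 have "\<kappa> \<in> E" unfolding \<kappa>_def using LM(1,2) tE D(2) by (auto intro!: qalgD(2,3)[OF E(3)])
 then have "coeffs_in E T" unfolding T_def coeffs_in_pCons using LM(1,2) dE coeffs_in_0[OF qalgD(5)[OF E(3)]]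
  by (auto intro!: qalgD(2,3,6,7)[OF E(3)])
 then have E': "qalg (adjoin E x) (24 * l * 2)" by (intro qalg_adjoin[OF E(3) _ T0 Tx]) (simp_all add: T_def)
 have sub: "E \<subseteq> adjoin E x" "x \<in> adjoin E x" using adjoin_superset adjoin_self qalgD(1,5)[OF E(3)] by blast+
 obtain N where N: "N > 0" "N \<le> 2 * (24 * l * 2)\<^sup>2" "poly (u ^ N) p1 = poly (u ^ N) p2"
  using ratio_order[OF g12 p E'[unfolded x_def] sub(2)[unfolded x_def]] sub(1) sE(1)[OF pE(1)] sE(1)[OF pE(2)]
  unfolding x_def by blast
 have "u ^ N \<in> A" using crit[OF N(1)] N(3) rel by blast
 moreover have "N \<le> 4 * (48 * l)\<^sup>2" using N(2) by (simp add: power_mult_distrib)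
 ultimately show ?thesis using N(1) by blast
qed

lemma torsion_exponent_bound: "\<exists>N>0. N \<le> 256 * (24 * l * d * d) ^ 4 \<and> u ^ N \<in> A"
proof -
 obtain w1 w2 where c: "codim2 A w1 w2" using codim2_A by blast
 have d1: "d \<ge> 1" and l1: "l \<ge> 1" using d0 l_pos by simp_all
 have "(24 * l) ^ 4 \<le> (24 * l * d * d) ^ 4" using d1 by (intro power_mono) simp_all
 then have n1: "256 * (24 * l) ^ 4 \<le> 256 * (24 * l * d * d) ^ 4" by simp
 have "l ^ 2 \<le> l ^ 4" using l1 by (intro power_increasing) simp_all
 then have b1: "4 * (48 * l)\<^sup>2 \<le> 256 * (24 * l) ^ 4" by (simp add: power_mult_distrib)
 have "12 \<le> 4 * (48 * l)\<^sup>2" using l1 by (simp add: power_mult_distrib)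
 show ?thesis
 proof (cases "separates A")
  case True
  have "u ^ 12 \<in> A" using separating_power[OF subalg_A c True _ k0] uA by (simp add: u_def)
  then show ?thesis using n1 b1 \<open>12 \<le> 4 * (48 * l)\<^sup>2\<close> by (intro exI[of _ 12]) linarith
 next
  case False
  then obtain p1 p2 where p: "p1 ~= p2" "\<And>f. f \<in> A ==> poly f p1 = poly f p2"
   unfolding separates_def by blast
  show ?thesis
  proof (rule node_subalgebra_cases[OF subalg_A c p])
   fix p3 p4 assume "p3 ~= p1" "p3 ~= p2" "p4 ~= p3"
    "\<And>f. f \<in> A \<longleftrightarrow> poly f p1 = poly f p2 \<and> poly f p3 = poly f p4"
   then show ?thesis using two_nodes_bound[OF p(1)] by blast
  next
   fix a' b' L M assume t: "a' = p1 \<and> b' = p2 \<or> a' = b' \<and> a' ~= p1 \<and> a' ~= p2 \<and> M = 0" "(L, M) ~= (0, 0)"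
    "\<And>f. f \<in> A \<longleftrightarrow> poly f p1 = poly f p2 \<and> L * poly (pderiv f) a' + M * poly (pderiv f) b' = 0"
   have "\<exists>N>0. N \<le> 4 * (48 * l)\<^sup>2 \<and> u ^ N \<in> A"
   proof (cases "a' = p1 \<and> b' = p2")
    case True
    then show ?thesis using t(3) by (intro tangent_node_bound[OF p(1) t(2)]) simp
   next
    case False
    then have "a' ~= p1" "a' ~= p2" "M = 0" using t(1) by auto
    then show ?thesis using t(2,3) by (intro node_cusp_bound[OF p(1), of a']) auto
   qed
   then show ?thesis using n1 b1 by (meson le_trans)
  qed
 qed
qed

end

text \<open>The exponent \<open>N\<close> from the previous lemma is replaced by a multiple that is at least
 \<open>d ^ 2\<close>, where membership in \<open>A\<close> and in the power of \<open>V\<close>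
 agree.\<close>

theorem bounded_power_membership:
 assumes q: "q ~= 0" "degree q \<le> 1" and k0: "k0 > 0" "q ^ (d * k0) \<in> vpow V k0"
 shows "\<exists>k\<ge>1. k \<le> 256 * (24 * l * d * d) ^ 4 \<and> q ^ (d * k) \<in> vpow V k"
proof -
 have uA: "(\<sigma> * q ^ d) ^ k0 \<in> A" using k0(2) u_power_congruent by (rule A_I)
 then obtain N where N: "N > 0" "N \<le> 256 * (24 * l * d * d) ^ 4" "(\<sigma> * q ^ d) ^ N \<in> A"
  using torsion_exponent_bound[OF q k0(1) uA] unfolding u_def[OF q k0(1) uA] by auto
 have big: "2 * d\<^sup>2 \<le> 256 * (24 * l * d * d) ^ 4"
 proof -
  have "d\<^sup>2 \<le> 24 * l * d * d" using l_pos by (simp add: power2_eq_square)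
  also have "\<dots> \<le> (24 * l * d * d) ^ 4" using l_pos d0 by (intro self_le_power) auto
  finally show ?thesis by simp
 qed
 obtain m where m: "m > 0" "d\<^sup>2 \<le> m * N" "m * N \<le> 256 * (24 * l * d * d) ^ 4"
 proof (cases "d\<^sup>2 \<le> N")
  case True
  then show ?thesis using N(2) by (intro that[of 1]) auto
 next
  case False
  define m where "m = d\<^sup>2 div N + 1"
  have "d\<^sup>2 = d\<^sup>2 div N * N + d\<^sup>2 mod N" "m * N = d\<^sup>2 div N * N + N" by (simp_all add: m_def)
  then have "d\<^sup>2 \<le> m * N" using mod_less_divisor[OF N(1), of "d\<^sup>2"] by linarith
  moreover have "m * N \<le> d\<^sup>2 + N" by (simp add: m_def)
  then have "m * N \<le> 2 * d\<^sup>2" using False by simp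
  then have "m * N \<le> 256 * (24 * l * d * d) ^ 4" using big by linarith
  ultimately show ?thesis by (intro that[of m]) (simp_all add: m_def)
 qed
 have "(\<sigma> * q ^ d) ^ (m * N) \<in> A"
  using subalgD(9)[OF subalg_A N(3), of m] by (simp add: power_mult[symmetric] mult.commute)
 moreover have "degree (q ^ (d * (m * N))) \<le> d * (m * N)"
  using degree_power_le[of q "d * (m * N)"] q(2) by (metis le_trans mult.commute mult_le_mono2 nat_mult_1_right)
 ultimately have "q ^ (d * (m * N)) \<in> vpow V (m * N)"
  using member_vpow[OF m(2)] u_power_congruent by blast
 then show ?thesis using m(1,3) N(1) by (intro exI[of _ "m * N"]) auto
qed

end

section \<open>Binary forms and their affine charts\<close>

global_interpretation bfpv: vector_space_pair "bscale :: 'a::field => 'a poly poly => 'a poly poly"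
 "smult :: 'a => 'a poly => 'a poly" ..

text \<open>The affine chart of the projective line given by \<open>y = 1 + r * x\<close>; its point at
 infinity is \<open>(1 : r)\<close>. Varying \<open>r\<close> moves that point away from any finite
 set.\<close>

definition dehom :: "'a::comm_ring_1 => 'a poly poly => 'a poly" where
 "dehom r f = poly f [:1, r:]"

lemma dehom_hom:
 "dehom r (f + g) = dehom r f + dehom r g" "dehom r (f - g) = dehom r f - dehom r g"
 "dehom r (f * g) = dehom r f * dehom r g" "dehom r (bscale c f) = smult c (dehom r f)"
 "dehom r 0 = 0" "dehom r 1 = 1" "dehom r (f ^ k) = dehom r f ^ k"
 "dehom r xvar = [:0, 1:]" "dehom r yvar = [:1, r:]"
 by (simp_all add: dehom_def bscale_def xvar_def yvar_def)

lemma dehom_prod_list: "dehom r (prod_list fs) = prod_list (map (dehom r) fs)"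
 by (induction fs) (simp_all add: dehom_hom)

lemma dehom_sum: "dehom r (sum f S) = (\<Sum>i\<in>S. dehom r (f i))"
 by (induction S rule: infinite_finite_induct) (simp_all add: dehom_hom)

lemma linear_dehom: "Vector_Spaces.linear bscale smult (dehom (r::'a::field))"
 by (simp add: Vector_Spaces.linear_iff pv.vector_space_axioms bf.vector_space_axioms dehom_hom)

lemma poly_poly_eval: "poly (poly f g) z = poly (poly f [:poly g z:]) z"
 by (induction f) simp_all

lemma dehom_eval: "poly (dehom r f) z = beval f z (1 + r * z)"
 unfolding dehom_def beval_def by (subst poly_poly_eval) (simp add: mult.commute)

lemma bcoeff_hom:
 "bcoeff (f + g) i j = bcoeff f i j + bcoeff g i j" "bcoeff (bscale c f) i j = c * bcoeff f i j"
 "bcoeff 0 i j = 0"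
 by (simp_all add: bcoeff_def bscale_def)

lemma bcoeff_sum: "bcoeff (sum f S) i j = (\<Sum>x\<in>S. bcoeff (f x :: 'a::comm_ring_1 poly poly) i j)"
 by (induction S rule: infinite_finite_induct) (simp_all add: bcoeff_hom)

lemma bcoeff_eqI: "(\<And>i j. bcoeff f i j = bcoeff g i j) ==> f = g"
 unfolding bcoeff_def by (intro poly_eqI) blast

lemma xy_monom: "xvar ^ i * yvar ^ j = monom (monom 1 i) j"
proof -
 have "xvar ^ i = [:monom (1::'a) i:]"
  by (simp add: xvar_def poly_const_pow monom_altdef)
 moreover have "(yvar :: 'a poly poly) ^ j = monom 1 j" by (simp add: yvar_def monom_altdef)
 ultimately show ?thesis by (simp add: smult_monom)
qed

lemma bcoeff_xy: "bcoeff (xvar ^ i * yvar ^ j) i' j' = (if i' = i \<and> j' = j then 1 else 0)"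
 by (simp add: xy_monom bcoeff_def)

lemma binary_forms_subspace: "bf.subspace (binary_forms e :: 'a::field poly poly set)"
 by (rule bf.subspaceI) (auto simp: binary_forms_def bcoeff_hom, metis add.right_neutral)

lemma binary_forms_mult:
 assumes f: "f \<in> binary_forms e" and g: "g \<in> binary_forms e'"
 shows "f * g \<in> binary_forms (e + e')"
 unfolding binary_forms_def
proof (intro CollectI allI impI)
 fix i j assume ne: "bcoeff (f * g) i j ~= 0"
 have "bcoeff (f * g) i j = (\<Sum>j'\<le>j. \<Sum>i'\<le>i. bcoeff f i' j' * bcoeff g (i - i') (j - j'))"
  by (simp add: bcoeff_def coeff_mult coeff_sum)
 then obtain j' i' where ij: "j' \<le> j" "i' \<le> i" "bcoeff f i' j' * bcoeff g (i - i') (j - j') ~= 0"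
  using ne by (metis (no_types, lifting) atMost_iff sum.not_neutral_contains_not_neutral)
 then have "bcoeff f i' j' ~= 0" "bcoeff g (i - i') (j - j') ~= 0" by auto
 then have "i' + j' = e" "(i - i') + (j - j') = e'" using f g by (auto simp: binary_forms_def)
 then show "i + j = e + e'" using ij(1,2) by linarith
qed

lemma binary_forms_basic: "1 \<in> binary_forms 0" "xvar \<in> binary_forms 1" "yvar \<in> binary_forms 1"
 by (auto simp: binary_forms_def bcoeff_def xvar_def yvar_def coeff_pCons split: nat.splits if_splits)

lemma binary_forms_power: "f \<in> binary_forms e ==> f ^ k \<in> binary_forms (e * k)"
 by (induction k) (auto simp: binary_forms_basic dest: binary_forms_mult)

lemma binary_forms_prod_list: "set fs \<subseteq> binary_forms e ==> prod_list fs \<in> binary_forms (e * length fs)"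
 by (induction fs) (auto simp: binary_forms_basic dest: binary_forms_mult)

lemma form_expansion:
 assumes "f \<in> binary_forms e"
 shows "f = (\<Sum>j\<le>e. bscale (bcoeff f (e - j) j) (xvar ^ (e - j) * yvar ^ j))"
proof (rule bcoeff_eqI)
 fix i j
 have "bcoeff (\<Sum>j\<le>e. bscale (bcoeff f (e - j) j) (xvar ^ (e - j) * yvar ^ j)) i j
  = (\<Sum>j'\<le>e. if j' = j then (if i = e - j then bcoeff f i j else 0) else 0)"
  unfolding bcoeff_sum bcoeff_hom(2) bcoeff_xy by (intro sum.cong) auto
 also have "\<dots> = (if j \<le> e \<and> i = e - j then bcoeff f i j else 0)" by simp
 also have "\<dots> = bcoeff f i j"
 proof (cases "bcoeff f i j = 0")
  case False
  then have "i + j = e" using assms by (simp add: binary_forms_def)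
  then have "j \<le> e \<and> i = e - j" by linarith
  then show ?thesis by simp
 qed auto
 finally show "bcoeff f i j = bcoeff (\<Sum>j\<le>e. bscale (bcoeff f (e - j) j) (xvar ^ (e - j) * yvar ^ j)) i j" by (rule sym)
qed

lemma dehom_expansion:
 assumes "f \<in> binary_forms e"
 shows "dehom r f = (\<Sum>j\<le>e. smult (bcoeff f (e - j) j) ([:0, 1:] ^ (e - j) * [:1, r:] ^ j))"
 by (subst form_expansion[OF assms]) (simp add: dehom_sum dehom_hom)

lemma coeff_linear_power_top: "coeff ([:1, r:] ^ j) j = (r::'a::comm_ring_1) ^ j"
proof (induction j)
 case (Suc j)
 have "degree ([:1, r:] ^ j) \<le> j" using degree_power_le[of "[:1, r:]" j] by (simp split: if_splits)
 then have "coeff ([:1, r:] ^ j) (Suc j) = 0" by (intro coeff_eq_0) simp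
 then show ?case using Suc by simp
qed simp

lemma dehom_degree: "f \<in> binary_forms e ==> degree (dehom (r::'a::field) f) \<le> e"
 and dehom_top_coeff: "f \<in> binary_forms e ==> coeff (dehom r f) e = beval f 1 r"
proof -
 assume f: "f \<in> binary_forms e"
 have t: "degree ([:0, 1:] ^ (e - j) * [:1, r:] ^ j) \<le> e" if "j \<le> e" for j
 proof -
  have "degree ([:0, 1:] ^ (e - j) * [:1, r:] ^ j) \<le> degree ([:0, 1::'a:] ^ (e - j)) + degree ([:1, r:] ^ j)"
   by (rule degree_mult_le)
  also have "\<dots> \<le> (e - j) + j"
   using degree_power_le[of "[:0, 1::'a:]" "e - j"] degree_power_le[of "[:1, r:]" j]
   by (intro add_mono) (simp_all split: if_splits)
  finally show ?thesis using that by simp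
 qed
 show "degree (dehom r f) \<le> e" unfolding dehom_expansion[OF f]
  by (intro degree_sum_le) (auto intro!: le_trans[OF degree_smult_le] t)
 have c: "coeff ([:0, 1:] ^ (e - j) * [:1, r:] ^ j) e = r ^ j" if "j \<le> e" for j
 proof -
  have "[:0, 1::'a:] ^ (e - j) = monom 1 (e - j)" by (simp add: monom_altdef)
  then show ?thesis using that by (simp add: coeff_monom_mult coeff_linear_power_top)
 qed
 have "coeff (dehom r f) e = (\<Sum>j\<le>e. bcoeff f (e - j) j * r ^ j)"
  unfolding dehom_expansion[OF f] coeff_sum by (intro sum.cong) (simp_all add: c)
 also have "\<dots> = beval f 1 r"
  by (subst (2) form_expansion[OF f])
    (simp add: beval_def poly_sum bscale_def xvar_def yvar_def)
 finally show "coeff (dehom r f) e = beval f 1 r" .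
qed

text \<open>The substitution \<open>t = r + 1 / z\<close> turns \<open>f\<close> in the chart into a
 polynomial in \<open>t\<close> with the same coefficients and infinitely many zeros.\<close>

lemma dehom_inj:
 fixes f :: "'a::field_char_0 poly poly"
 assumes f: "f \<in> binary_forms e" and z: "dehom r f = 0"
 shows "f = 0"
proof -
 define h where "h = (\<Sum>j\<le>e. monom (bcoeff f (e - j) j) j)"
 have "poly h t = 0" if "t ~= r" for t
 proof -
  define z where "z = 1 / (t - r)"
  have z0: "z ~= 0" using that by (simp add: z_def)
  have "t * z - r * z = (t - r) * z" by (simp only: left_diff_distrib)
  then have tz: "1 + r * z = t * z" using that by (simp add: z_def diff_eq_eq)
  have "0 = poly (dehom r f) z" using assms(2) by simp
  also have "\<dots> = (\<Sum>j\<le>e. bcoeff f (e - j) j * (z ^ (e - j) * (t * z) ^ j))"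
   unfolding dehom_expansion[OF f] by (simp add: poly_sum tz[symmetric] mult.commute)
  also have "\<dots> = (\<Sum>j\<le>e. z ^ e * (bcoeff f (e - j) j * t ^ j))"
  proof (intro sum.cong refl)
   fix j assume "j \<in> {..e}"
   then have "z ^ (e - j) * z ^ j = z ^ e" by (simp flip: power_add)
   then show "bcoeff f (e - j) j * (z ^ (e - j) * (t * z) ^ j) = z ^ e * (bcoeff f (e - j) j * t ^ j)"
    by (simp add: power_mult_distrib mult_ac)
  qed
  also have "\<dots> = z ^ e * poly h t" by (simp add: h_def poly_sum poly_monom sum_distrib_left)
  finally show ?thesis using z0 by simp
 qed
 then have "UNIV \<subseteq> insert r {t. poly h t = 0}" by auto
 then have "infinite {t. poly h t = 0}"
  using infinite_UNIV_char_0[where ?'a = 'a] finite_subset finite.insertI by blast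
 then have h0: "h = 0" using poly_roots_finite by blast
 have "bcoeff f (e - j) j = 0" if "j \<le> e" for j
 proof -
  have "coeff h j = bcoeff f (e - j) j" using that by (simp add: h_def coeff_sum)
  then show ?thesis using h0 by simp
 qed
 then show ?thesis using form_expansion[OF f] by simp
qed

lemma dehom_inj_on: "inj_on (dehom (r::'a::field_char_0)) (binary_forms e)"
proof (rule inj_onI)
 fix f g assume fg: "f \<in> binary_forms e" "g \<in> binary_forms e" "dehom r f = dehom r g"
 have "f - g \<in> binary_forms e" by (rule bf.subspace_diff[OF binary_forms_subspace fg(1,2)])
 then have "f - g = 0" by (rule dehom_inj[where r = r]) (simp add: dehom_hom fg(3))
 then show "f = g" by simp
qed

definition homog :: "'a::field => nat => 'a poly => 'a poly poly" where
 "homog r e g = (\<Sum>i\<le>e. bscale (coeff g i) (xvar ^ i * (yvar - bscale r xvar) ^ (e - i)))"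

lemma homog_form: "homog r e g \<in> binary_forms e"
 unfolding homog_def
proof (intro bf.subspace_sum[OF binary_forms_subspace] bf.subspace_scale[OF binary_forms_subspace])
 fix i assume i: "i \<in> {..e}"
 have "yvar - bscale r xvar \<in> binary_forms 1"
  by (intro bf.subspace_diff[OF binary_forms_subspace] bf.subspace_scale[OF binary_forms_subspace] binary_forms_basic)
 then have "xvar ^ i * (yvar - bscale r xvar) ^ (e - i) \<in> binary_forms (1 * i + 1 * (e - i))"
  by (intro binary_forms_mult binary_forms_power binary_forms_basic)
 then show "xvar ^ i * (yvar - bscale r xvar) ^ (e - i) \<in> binary_forms e" using i by simp
qed

lemma dehom_homog:
 assumes "degree g \<le> e"
 shows "dehom r (homog r e g) = g"
proof -
 have "dehom r (homog r e g) = (\<Sum>i\<le>e. monom (coeff g i) i)"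
  by (simp add: homog_def dehom_sum dehom_hom monom_altdef one_pCons[symmetric])
 also have "\<dots> = g" by (rule poly_as_sum_of_monoms'[OF assms])
 finally show ?thesis .
qed

lemma bcoeff_homog_0: "bcoeff (homog 0 e g) i j = (if i + j = e then coeff g i else 0)"
proof -
 have "bcoeff (homog 0 e g) i j = (\<Sum>i'\<le>e. if i' = i then (if j = e - i then coeff g i else 0) else 0)"
  unfolding homog_def bcoeff_sum bf.scale_zero_left diff_zero bcoeff_hom(2) bcoeff_xy
  by (intro sum.cong) auto
 then show ?thesis by auto
qed

lemma coeffs_in_sum: "qalg S n ==> (\<And>i. i \<in> I ==> coeffs_in S (f i)) ==> coeffs_in S (sum f I)"
 by (induction I rule: infinite_finite_induct) (simp_all add: coeffs_in_0 qalgD coeffs_in_add)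

lemma coeffs_in_dehom:
 assumes S: "qalg S n" and f: "\<And>i j. bcoeff f i j \<in> S" and r: "r \<in> S"
 shows "coeffs_in S (dehom r f)"
proof -
 have "dehom r f = (\<Sum>j\<le>degree f. coeff f j * [:1, r:] ^ j)" by (simp add: dehom_def poly_altdef)
 also have "coeffs_in S \<dots>"
 proof (intro coeffs_in_sum[OF S] coeffs_in_mult[OF S] coeffs_in_power[OF S])
  show "coeffs_in S (coeff f j)" for j using f by (simp add: coeffs_in_def bcoeff_def)
  show "coeffs_in S [:1, r:]" using r qalgD(1,5)[OF S] by (simp add: coeffs_in_pCons coeffs_in_0)
 qed
 finally show ?thesis .
qed

lemma dehom_space_power: "dehom r ` space_power L k = vpow (dehom r ` L) k"
proof -
 have "dehom r ` {prod_list ls | ls. length ls = k \<and> set ls \<subseteq> L}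
  = {prod_list ls | ls. length ls = k \<and> set ls \<subseteq> dehom r ` L}"
 proof
  show "dehom r ` {prod_list ls | ls. length ls = k \<and> set ls \<subseteq> L}
   \<subseteq> {prod_list ls | ls. length ls = k \<and> set ls \<subseteq> dehom r ` L}"
  proof
   fix x assume "x \<in> dehom r ` {prod_list ls | ls. length ls = k \<and> set ls \<subseteq> L}"
   then obtain ls where "length ls = k" "set ls \<subseteq> L" "x = prod_list (map (dehom r) ls)"
    by (auto simp: dehom_prod_list)
   then show "x \<in> {prod_list ls | ls. length ls = k \<and> set ls \<subseteq> dehom r ` L}"
    by (intro CollectI exI[of _ "map (dehom r) ls"]) auto
  qed
  show "{prod_list ls | ls. length ls = k \<and> set ls \<subseteq> dehom r ` L}
   \<subseteq> dehom r ` {prod_list ls | ls. length ls = k \<and> set ls \<subseteq> L}"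
  proof
   fix x assume "x \<in> {prod_list ls | ls. length ls = k \<and> set ls \<subseteq> dehom r ` L}"
   then obtain ls where ls: "length ls = k" "set ls \<subseteq> dehom r ` L" "x = prod_list ls" by blast
   from ls(2) have "\<exists>ms. ls = map (dehom r) ms \<and> set ms \<subseteq> L"
   proof (induction ls)
    case (Cons x ls)
    then obtain ms y where "ls = map (dehom r) ms" "set ms \<subseteq> L" "x = dehom r y" "y \<in> L" by auto
    then show ?case by (intro exI[of _ "y # ms"]) simp
   qed simp
   then obtain ms where "ls = map (dehom r) ms" "set ms \<subseteq> L" by blast
   then show "x \<in> dehom r ` {prod_list ls | ls. length ls = k \<and> set ls \<subseteq> L}"
    using ls by (intro image_eqI[of _ _ "prod_list ms"]) (auto simp: dehom_prod_list)
  qed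
 qed
 then show ?thesis
  unfolding space_power_def vpow_def bfpv.linear_span_image[OF linear_dehom, symmetric] by (rule arg_cong)
qed

lemma space_power_subspace: "bf.subspace (space_power L k)" by (simp add: space_power_def)

lemma space_power_forms:
 assumes "L \<subseteq> binary_forms d"
 shows "space_power L k \<subseteq> binary_forms (d * k)"
 unfolding space_power_def
proof (rule bf.span_minimal[OF _ binary_forms_subspace])
 show "{prod_list ls | ls. length ls = k \<and> set ls \<subseteq> L} \<subseteq> binary_forms (d * k)"
  using assms binary_forms_prod_list by blast
qed

lemma dehom_mem_iff:
 fixes L :: "'a::field_char_0 poly poly set"
 assumes "L \<subseteq> binary_forms d" "f \<in> binary_forms (d * k)"
 shows "dehom r f \<in> vpow (dehom r ` L) k \<longleftrightarrow> f \<in> space_power L k"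
 using inj_on_image_mem_iff[OF dehom_inj_on assms(2) space_power_forms[OF assms(1)], of r]
 by (simp add: dehom_space_power)

lemma dim_vpow_dehom:
 fixes L :: "'a::field_char_0 poly poly set"
 assumes "L \<subseteq> binary_forms d"
 shows "pv.dim (vpow (dehom r ` L) k) = bf.dim (space_power L k)"
 unfolding dehom_space_power[symmetric]
 by (rule bfpv.dim_injective_image[OF linear_dehom space_power_subspace
    inj_on_subset[OF dehom_inj_on space_power_forms[OF assms]]])

lemma point_form_form: "point_form \<alpha> \<beta> \<in> binary_forms 1"
 unfolding point_form_def
 by (intro bf.subspace_diff[OF binary_forms_subspace] bf.subspace_scale[OF binary_forms_subspace] binary_forms_basic)

lemma dehom_point_form: "dehom r (point_form \<alpha> \<beta>) = [:- \<alpha>, \<beta> - \<alpha> * r:]"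
 by (simp add: point_form_def dehom_hom)

section \<open>Base point free systems of binary forms\<close>

locale form_system =
 fixes L :: "'a::{alg_closed_field, field_char_0} poly poly set" and d :: nat
 assumes L: "bf.subspace L" and Ld: "L \<subseteq> binary_forms d" and d0: "d > 0"
  and bpf: "\<And>x y. (x, y) ~= (0, 0) ==> \<exists>f\<in>L. beval f x y ~= 0"
begin

lemma chart: "base_point_free_system (dehom r ` L) d"
proof
 show "pv.subspace (dehom r ` L)" by (rule bfpv.linear_subspace_image[OF linear_dehom L])
 show "dehom r ` L \<subseteq> polys_le d" using Ld by (auto simp: polys_le_def intro: dehom_degree)
 show "d > 0" by (rule d0)
 show "\<exists>f\<in>dehom r ` L. poly f z ~= 0" for z
  using bpf[of z "1 + r * z"] by (auto simp: dehom_eval)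
 obtain f where f: "f \<in> L" "beval f 1 r ~= 0" using bpf[of 1 r] by auto
 then have "coeff (dehom r f) d ~= 0" using Ld dehom_top_coeff[of f d r] by auto
 then show "\<exists>f\<in>dehom r ` L. coeff f d ~= 0" using f(1) by blast
qed

end

locale genus_two_system = form_system +
 assumes codim: "\<exists>k0. \<forall>k\<ge>k0. bf.dim (space_power L k) + 2 = d * k + 1"
begin

lemma genus_two_chart: "linear_system (dehom r ` L) d"
 by (rule linear_system.intro[OF chart]) (unfold_locales, use codim dim_vpow_dehom[OF Ld] in simp)

text \<open>The conductor, found in one chart and over the field of definition, is a binary form and can be
 used in every chart.\<close>

lemma rational_conductor_form:
 assumes F: "qalg F l" and B: "\<And>b i j. b \<in> B ==> bcoeff b i j \<in> F" and LB: "L = bf.span B"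
 shows "\<exists>i0 j a. a ~= 0 \<and> a \<in> binary_forms (d * j) \<and> (\<forall>i k. bcoeff a i k \<in> F) \<and>
  (\<forall>i h. i \<ge> i0 --> h \<in> binary_forms (d * i) --> a * h \<in> space_power L (i + j))"
proof -
 let ?V = "dehom 0 ` L"
 interpret linear_system ?V d by (rule genus_two_chart)
 obtain j i0 a where a: "a ~= 0" "a \<in> vpow ?V j" "i0 \<ge> 1" "\<And>m. m \<le> d * i0 ==> monom 1 m * a \<in> vpow ?V (i0 + j)"
  using conductor_exists by metis
 define W where "W = {prod_list ls | ls. length ls = i0 + j \<and> set ls \<subseteq> dehom 0 ` B}"
 have VB: "?V = pv.span (dehom 0 ` B)" unfolding LB by (rule bfpv.linear_span_image[OF linear_dehom, symmetric])
 have Wsp: "pv.span W = vpow ?V (i0 + j)" unfolding W_def by (rule vpow_span[OF VB, symmetric])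
 have cB: "coeffs_in F b" if "b \<in> dehom 0 ` B" for b
  using that coeffs_in_dehom[OF F B qalgD(5)[OF F]] by blast
 have pl: "coeffs_in F (prod_list ls)" if "set ls \<subseteq> dehom 0 ` B" for ls
  using that by (induction ls) (auto intro: coeffs_in_1[OF F] coeffs_in_mult[OF F] cB)
 have "\<exists>a'. a' ~= 0 \<and> coeffs_in F a' \<and> degree a' = degree a \<and> (\<forall>m\<in>{..d * i0}. monom 1 m * a' \<in> pv.span W)"
  by (rule descend_span_multiples[OF F _ a(1)]) (use a(4) Wsp pl W_def in auto)
 then obtain a' where a': "a' ~= 0" "coeffs_in F a'" "degree a' = degree a"
  "\<And>m. m \<le> d * i0 ==> monom 1 m * a' \<in> vpow ?V (i0 + j)" by (auto simp: Wsp)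
 have da: "degree a' \<le> d * j" using a'(3) vpow_deg[OF a(2)] by simp
 define b where "b = homog 0 (d * j) a'"
 have db: "dehom 0 b = a'" unfolding b_def by (rule dehom_homog[OF da])
 have bf: "b \<in> binary_forms (d * j)" unfolding b_def by (rule homog_form)
 have "b * h \<in> space_power L (i + j)" if "i \<ge> i0" "h \<in> binary_forms (d * i)" for i h
 proof -
  have "b * h \<in> binary_forms (d * (i + j))" using binary_forms_mult[OF bf that(2)] by (simp add: distrib_left add.commute)
  moreover have "dehom 0 (b * h) \<in> vpow ?V (i + j)"
   unfolding dehom_hom db by (rule conductor_multiples[OF a(3) a'(4) that(1) dehom_degree[OF that(2)]])
  ultimately show ?thesis using dehom_mem_iff[OF Ld] by blast
 qed
 moreover have "b ~= 0" using db a'(1) by (auto simp: dehom_hom)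
 moreover have "bcoeff b i k \<in> F" for i k
  using a'(2) qalgD(5)[OF F] by (simp add: b_def bcoeff_homog_0 coeffs_in_def)
 ultimately show ?thesis using bf by blast
qed

text \<open>The chart has to be rational, and the conductor must keep its full degree in it; then the affine
 statement applies.\<close>

theorem bounded_power_form:
 assumes F: "qalg F l" and B: "\<And>b i j. b \<in> B ==> bcoeff b i j \<in> F" and LB: "L = bf.span B"
  and pt: "(\<alpha>, \<beta>) ~= (0, 0)" and k0: "k0 \<ge> 1" "point_form \<alpha> \<beta> ^ (d * k0) \<in> space_power L k0"
 shows "\<exists>k\<ge>1. k \<le> 256 * (24 * l * d * d) ^ 4 \<and> point_form \<alpha> \<beta> ^ (d * k) \<in> space_power L k"
proof -
 obtain i0 j a where a: "a ~= 0" "a \<in> binary_forms (d * j)" "\<And>i k. bcoeff a i k \<in> F"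
  "\<And>i h. i \<ge> i0 ==> h \<in> binary_forms (d * i) ==> a * h \<in> space_power L (i + j)"
  using rational_conductor_form[OF F B LB] by metis
 \<comment> \<open>A chart whose point at infinity is not a zero of the conductor.\<close>
 obtain n :: nat where n: "beval a 1 (of_nat n) ~= 0"
 proof -
  define h where "h = (\<Sum>k\<le>d * j. monom (bcoeff a (d * j - k) k) k)"
  have e: "beval a 1 t = poly h t" for t
   by (subst form_expansion[OF a(2)])
     (simp add: beval_def poly_sum bscale_def xvar_def yvar_def h_def poly_monom)
  have "h ~= 0"
  proof
   assume "h = 0"
   have "bcoeff a (d * j - k) k = coeff h k" if "k \<le> d * j" for k using that by (simp add: h_def coeff_sum)
   then have "a = 0" using form_expansion[OF a(2)] \<open>h = 0\<close> by simp
   then show False using a(1) by simp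
  qed
  then have "finite {t. poly h t = 0}" by (rule poly_roots_finite)
  then have "finite {n::nat. poly h (of_nat n) = 0}"
   using finite_imageD[of "of_nat :: nat => 'a" "{n. poly h (of_nat n) = 0}"]
   by (simp add: inj_on_def) (metis (mono_tags, lifting) finite_subset image_subsetI mem_Collect_eq)
  then obtain n :: nat where "n \<notin> {n. poly h (of_nat n) = 0}" using infinite_UNIV_nat by (metis ex_new_if_finite)
  then show thesis using e by (intro that[of n]) simp
 qed
 define r where "r = (of_nat n :: 'a)"
 have rF: "r \<in> F" using qalgD(4)[OF F, of "of_nat n"] by (simp add: r_def)
 define V where "V = dehom r ` L"
 define a' where "a' = dehom r a"
 have ca: "coeff a' (d * j) ~= 0" unfolding a'_def dehom_top_coeff[OF a(2)] using n by (simp add: r_def)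
 interpret linear_system V d unfolding V_def by (rule genus_two_chart)
 interpret rational_system V d F l "dehom r ` B" a' i0 j
 proof
  show "qalg F l" by (rule F)
  show "V = pv.span (dehom r ` B)" unfolding V_def LB by (rule bfpv.linear_span_image[OF linear_dehom, symmetric])
  show "coeffs_in F b" if "b \<in> dehom r ` B" for b using that coeffs_in_dehom[OF F B rF] by blast
  show "a' ~= 0" using ca by auto
  show "coeffs_in F a'" unfolding a'_def by (rule coeffs_in_dehom[OF F a(3) rF])
  show "degree a' = d * j" using dehom_degree[OF a(2)] le_degree[OF ca] by (simp add: a'_def le_antisym)
  show "a' * h \<in> vpow V (i + j)" if i: "i \<ge> i0" and h: "degree h \<le> d * i" for i h
  proof -
   have "dehom r (a * homog r (d * i) h) \<in> dehom r ` space_power L (i + j)"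
    by (intro imageI a(4)[OF i] homog_form)
   then show ?thesis by (simp add: dehom_hom dehom_homog[OF h] a'_def V_def dehom_space_power)
  qed
 qed
 obtain s where s: "good_section s" "coeffs_in F s" "\<And>z. poly a' z = 0 ==> poly s z ~= 0"
  using exists_good_section by blast
 have "s ~= 0" using s(1) by (auto simp: good_section_def)
 then obtain u h where "u * s + h * a' = 1" using no_common_root_bezout[of s a'] s(3) by metis
 then obtain \<sigma> where \<sigma>: "coeffs_in F \<sigma>" "a' dvd s * \<sigma> - 1" by (rule descend_bezout[OF F s(2) aF])
 interpret presented_curve V d F l "dehom r ` B" a' i0 j s \<sigma>
  by unfold_locales (use s \<sigma> in auto)
 define q where "q = dehom r (point_form \<alpha> \<beta>)"
 have q: "q ~= 0" "degree q \<le> 1" using pt by (auto simp: q_def dehom_point_form)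
 have pf: "point_form \<alpha> \<beta> ^ (d * k) \<in> binary_forms (d * k)" for k
  using binary_forms_power[OF point_form_form, of \<alpha> \<beta> "d * k"] by simp
 have iff: "q ^ (d * k) \<in> vpow V k \<longleftrightarrow> point_form \<alpha> \<beta> ^ (d * k) \<in> space_power L k" for k
  using dehom_mem_iff[OF Ld pf, of r k] by (simp add: dehom_hom q_def V_def)
 show ?thesis using bounded_power_membership[OF q, of k0] k0 by (simp add: iff)
qed

end

section \<open>The Hilbert function of a parametrized curve\<close>

global_interpretation mpbf: vector_space_pair "mscale :: 'a::field => 'a mpoly => 'a mpoly"
 "bscale :: 'a => 'a poly poly => 'a poly poly" ..

definition monomial_value :: "(nat => 'a::comm_ring_1 poly poly) => (nat \<Rightarrow>\<^sub>0 nat) => 'a poly poly" where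
 "monomial_value f m = (\<Prod>i\<in>keys m. f i ^ lookup m i)"

lemma monomial_value_superset:
 assumes "finite S" "keys m \<subseteq> S"
 shows "monomial_value f m = (\<Prod>i\<in>S. f i ^ lookup m i)"
 unfolding monomial_value_def
 by (rule prod.mono_neutral_left[OF assms]) (auto simp: in_keys_iff)

lemma monomial_value_add: "monomial_value f (m + m') = monomial_value f m * monomial_value f m'"
proof -
 let ?S = "keys m \<union> keys m'"
 have S: "finite ?S" by simp
 show ?thesis
  using monomial_value_superset[OF S, of "m + m'" f] monomial_value_superset[OF S, of m f]
   monomial_value_superset[OF S, of m' f] keys_add[of m m']
  by (simp add: Poly_Mapping.lookup_add power_add prod.distrib)
qed

lemma substitute_superset:
 assumes "finite S" "keys p \<subseteq> S"
 shows "substitute f p = (\<Sum>m\<in>S. bscale (lookup p m) (monomial_value f m))"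
 unfolding substitute_def monomial_value_def[symmetric]
 by (rule sum.mono_neutral_left[OF assms]) (auto simp: in_keys_iff bscale_def)

lemma substitute_add: "substitute f (p + q) = substitute f p + substitute f q"
proof -
 let ?S = "keys p \<union> keys q"
 have S: "finite ?S" by simp
 have b: "bscale (a + b) x = bscale a x + bscale b x" for a b :: 'a and x
  unfolding bscale_def by (metis add_pCons add.right_neutral smult_add_left)
 show ?thesis
  using substitute_superset[OF S, of "p + q" f] substitute_superset[OF S, of p f]
   substitute_superset[OF S, of q f] keys_add[of p q]
  by (simp add: Poly_Mapping.lookup_add b sum.distrib)
qed

lemma substitute_single: "substitute f (Poly_Mapping.single m c) = bscale c (monomial_value f m)"
 by (subst substitute_superset[of "{m}"]) auto

lemma substitute_zero: "substitute f 0 = 0"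
 by (simp add: substitute_def)

lemma substitute_sum: "substitute f (sum g S) = (\<Sum>i\<in>S. substitute f (g i))"
 by (induction S rule: infinite_finite_induct) (simp_all add: substitute_add substitute_zero)

lemma mpoly_expansion: "p = (\<Sum>m\<in>keys p. Poly_Mapping.single m (lookup p m))"
 by (rule poly_mapping_eqI) (simp add: lookup_sum lookup_single when_def in_keys_iff)

lemma substitute_mult: "substitute f (p * q) = substitute f p * substitute f q"
proof -
 have "p * q = (\<Sum>m\<in>keys p. Poly_Mapping.single m (lookup p m)) *
  (\<Sum>m\<in>keys q. Poly_Mapping.single m (lookup q m))"
  using mpoly_expansion[of p] mpoly_expansion[of q] by metis
 also have "substitute f \<dots> = (\<Sum>m\<in>keys p. bscale (lookup p m) (monomial_value f m)) *
  (\<Sum>m\<in>keys q. bscale (lookup q m) (monomial_value f m))"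
  unfolding sum_product substitute_sum mult_single substitute_single monomial_value_add
  by (intro sum.cong refl) (simp add: bscale_def)
 finally show ?thesis by (simp add: substitute_def monomial_value_def)
qed

lemma substitute_mscale: "substitute f (mscale c p) = bscale c (substitute f p)"
 by (simp add: mscale_def substitute_mult substitute_single monomial_value_def bscale_def)

lemma linear_substitute: "Vector_Spaces.linear mscale bscale (substitute (f :: nat => 'a::field poly poly))"
 by (simp add: Vector_Spaces.linear_iff mp.vector_space_axioms bf.vector_space_axioms
   substitute_add substitute_mscale)

lemma mon_deg_superset:
 assumes "finite S" "keys m \<subseteq> S"
 shows "mon_deg m = (\<Sum>i\<in>S. lookup m i)"
 unfolding mon_deg_def by (rule sum.mono_neutral_left[OF assms]) (auto simp: in_keys_iff)

lemma mon_deg_add: "mon_deg (m + m') = mon_deg m + mon_deg m'"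
proof -
 let ?S = "keys m \<union> keys m'"
 have S: "finite ?S" by simp
 show ?thesis
  using mon_deg_superset[OF S, of "m + m'"] mon_deg_superset[OF S, of m] mon_deg_superset[OF S, of m'] keys_add[of m m']
  by (simp add: Poly_Mapping.lookup_add sum.distrib)
qed

lemma hom_polys_iff:
 "p \<in> hom_polys n t \<longleftrightarrow> (\<forall>m\<in>keys p. keys m \<subseteq> {..n} \<and> mon_deg m = t)"
 by (auto simp: hom_polys_def polys_def)

lemma hom_polys_mult:
 assumes "p \<in> hom_polys n s" "q \<in> hom_polys n t"
 shows "p * q \<in> hom_polys n (s + t)"
 unfolding hom_polys_iff
proof
 fix m assume "m \<in> keys (p * q)"
 then obtain a b where ab: "a \<in> keys p" "b \<in> keys q" "m = a + b"
  using keys_mult[of p q] by blast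
 then have "keys a \<subseteq> {..n} \<and> mon_deg a = s" "keys b \<subseteq> {..n} \<and> mon_deg b = t"
  using assms unfolding hom_polys_iff by blast+
 then show "keys m \<subseteq> {..n} \<and> mon_deg m = s + t"
  unfolding ab(3) mon_deg_add using keys_add[of a b] by blast
qed

lemma keys_mscale: "keys (mscale c p) \<subseteq> keys p"
 unfolding mscale_def using keys_mult[of "Poly_Mapping.single 0 c" p] by (auto split: if_splits)

lemma hom_polys_subspace: "mp.subspace (hom_polys n t :: 'a::field mpoly set)"
proof (rule mp.subspaceI)
 show "x + y \<in> hom_polys n t" if "x \<in> hom_polys n t" "y \<in> hom_polys n t" for x y :: "'a mpoly"
  using that keys_add[of x y] unfolding hom_polys_iff by blast
 show "mscale c x \<in> hom_polys n t" if "x \<in> hom_polys n t" for c and x :: "'a mpoly"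
  using that keys_mscale[of c x] unfolding hom_polys_iff by blast
qed (simp add: hom_polys_iff)

lemma finite_monomials: "finite {m. keys m \<subseteq> {..n} \<and> mon_deg m = t}"
proof (rule finite_imageD)
 have "lookup ` {m. keys m \<subseteq> {..n} \<and> mon_deg m = t} \<subseteq>
  {g. \<forall>i. (i \<in> {..n} --> g i \<in> {..t}) \<and> (i \<notin> {..n} --> g i = 0)}"
 proof (intro image_subsetI CollectI allI conjI impI)
  fix m i assume m: "m \<in> {m. keys m \<subseteq> {..n} \<and> mon_deg m = t}"
  show "lookup m i = 0" if "i \<notin> {..n}"
   using m that by (auto simp: in_keys_iff)
  show "lookup m i \<in> {..t}" if "i \<in> {..n}"
  proof -
   have "t = (\<Sum>i\<in>{..n}. lookup m i)" using m mon_deg_superset[of "{..n}" m] by simp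
   then show ?thesis using member_le_sum[OF that, of "lookup m"] by simp
  qed
 qed
 then show "finite (lookup ` {m. keys m \<subseteq> {..n} \<and> mon_deg m = t})"
  by (rule finite_subset) (intro finite_set_of_finite_funs; simp)
 show "inj_on lookup {m. keys m \<subseteq> {..n} \<and> mon_deg m = t}"
  by (simp add: inj_on_def poly_mapping.lookup_inject)
qed

lemma hom_polys_span:
 "hom_polys n t \<subseteq> mp.span ((\<lambda>m. Poly_Mapping.single m (1::'a::field)) ` {m. keys m \<subseteq> {..n} \<and> mon_deg m = t})"
proof
 fix p :: "'a mpoly" assume p: "p \<in> hom_polys n t"
 have "p = (\<Sum>m\<in>keys p. mscale (lookup p m) (Poly_Mapping.single m 1))"
  by (subst mpoly_expansion) (simp add: mscale_def mult_single)
 also have "\<dots> \<in> mp.span ((\<lambda>m. Poly_Mapping.single m 1) ` {m. keys m \<subseteq> {..n} \<and> mon_deg m = t})"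
  using p unfolding hom_polys_iff by (intro mp.span_sum mp.span_scale mp.span_base) blast
 finally show "p \<in> mp.span ((\<lambda>m. Poly_Mapping.single m 1) ` {m. keys m \<subseteq> {..n} \<and> mon_deg m = t})" .
qed

lemma mvar_hom: "i \<le> n ==> mvar i \<in> hom_polys n 1"
 by (simp add: hom_polys_iff mvar_def mon_deg_def)

lemma substitute_mvar: "substitute f (mvar i) = f i"
 by (simp add: mvar_def substitute_single monomial_value_def bscale_def flip: one_pCons)

lemma prod_powers_list:
 assumes "finite S" "\<And>i. i \<in> S ==> f i \<in> L"
 shows "\<exists>ls. length ls = (\<Sum>i\<in>S. e i) \<and> set ls \<subseteq> L \<and> prod_list ls = (\<Prod>i\<in>S. f i ^ e i :: 'b::comm_monoid_mult)"
 using assms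
proof (induction S rule: finite_induct)
 case (insert x S)
 then obtain ls where "length ls = (\<Sum>i\<in>S. e i)" "set ls \<subseteq> L" "prod_list ls = (\<Prod>i\<in>S. f i ^ e i)" by auto
 then show ?case using insert.hyps insert.prems
  by (intro exI[of _ "replicate (e x) (f x) @ ls"]) (auto simp: prod_list_replicate)
qed simp

lemma substitute_hom_polys:
 fixes f :: "nat => 'a::field poly poly"
 shows "substitute f ` hom_polys n t = space_power (pullback_linear_forms n f) t"
proof
 let ?L = "pullback_linear_forms n f"
 show "substitute f ` hom_polys n t \<subseteq> space_power ?L t"
 proof
  fix x assume "x \<in> substitute f ` hom_polys n t"
  then obtain p where p: "p \<in> hom_polys n t" "x = substitute f p" by blast
  have fi: "f i \<in> ?L" if "i \<le> n" for i
   unfolding pullback_linear_forms_def using mvar_hom[OF that] substitute_mvar[of f i] by (metis imageI)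
  have "monomial_value f m \<in> space_power ?L t" if m: "m \<in> keys p" for m
  proof -
   have k: "keys m \<subseteq> {..n}" "mon_deg m = t" using p(1) m unfolding hom_polys_iff by blast+
   have fk: "f i \<in> ?L" if "i \<in> keys m" for i using fi k(1) that by blast
   obtain ls where ls: "length ls = (\<Sum>i\<in>keys m. lookup m i)" "set ls \<subseteq> ?L"
    "prod_list ls = (\<Prod>i\<in>keys m. f i ^ lookup m i)"
    using prod_powers_list[where f = f and e = "lookup m", OF finite_keys fk] by auto
   have "length ls = t" using ls(1) k(2) by (simp add: mon_deg_def)
   moreover have "monomial_value f m = prod_list ls" using ls(3) by (simp add: monomial_value_def)
   ultimately show ?thesis unfolding space_power_def using ls(2) by (intro bf.span_base) blast
  qed
  then show "x \<in> space_power ?L t"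
   unfolding p(2) substitute_def monomial_value_def[symmetric]
   by (intro bf.subspace_sum[OF space_power_subspace] bf.subspace_scale[OF space_power_subspace])
 qed
 have "\<exists>p\<in>hom_polys n (length ls). prod_list ls = substitute f p" if "set ls \<subseteq> ?L" for ls
  using that
 proof (induction ls)
  case Nil
  have "(1 :: 'a mpoly) \<in> hom_polys n 0" by (simp add: hom_polys_iff mon_deg_def flip: single_one)
  moreover have "substitute f 1 = 1"
   using substitute_single[of f 0 1] by (simp add: monomial_value_def bscale_def one_pCons)
  ultimately show ?case by (intro bexI[of _ 1]) simp_all
 next
  case (Cons l ls)
  then obtain p q where "p \<in> hom_polys n (length ls)" "prod_list ls = substitute f p"
   "q \<in> hom_polys n 1" "l = substitute f q" by (auto simp: pullback_linear_forms_def)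
  then show ?case using hom_polys_mult[of q n 1 p "length ls"]
   by (intro bexI[of _ "q * p"]) (simp_all add: substitute_mult)
 qed
 then have "{prod_list ls | ls. length ls = t \<and> set ls \<subseteq> ?L} \<subseteq> substitute f ` hom_polys n t" by blast
 then show "space_power ?L t \<subseteq> substitute f ` hom_polys n t"
  unfolding space_power_def
  by (rule bf.span_minimal[OF _ mpbf.linear_subspace_image[OF linear_substitute hom_polys_subspace]])
qed

lemma hilbert_function_eq:
 fixes f :: "nat => 'a::field poly poly"
 assumes "I = {p \<in> polys n. substitute f p = 0}"
 shows "hilbert_function n I t = int (bf.dim (space_power (pullback_linear_forms n f) t))"
proof -
 have "I \<inter> hom_polys n t = {p \<in> hom_polys n t. substitute f p = 0}"
  using assms by (auto simp: hom_polys_def)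
 moreover have "bf.dim (substitute f ` hom_polys n t) + mp.dim {p \<in> hom_polys n t. substitute f p = 0}
  = mp.dim (hom_polys n t :: 'a mpoly set)"
  by (rule mpbf.rank_nullity[OF linear_substitute hom_polys_subspace finite_imageI[OF finite_monomials] hom_polys_span])
 ultimately show ?thesis unfolding hilbert_function_def substitute_hom_polys by simp
qed

lemma poly_eventually_large:
 fixes p :: "'a::linordered_field poly"
 assumes "lead_coeff p > 0"
 shows "\<exists>n. \<forall>x\<ge>n. poly p x \<ge> lead_coeff p"
 using assms
proof (induction p)
 case (pCons a p)
 show ?case
 proof (cases "p = 0")
  case False
  define c where "c = lead_coeff p"
  have c: "c > 0" using pCons.prems False by (simp add: c_def)
  then obtain n where n: "\<And>x. x \<ge> n ==> c \<le> poly p x" using pCons.IH by (auto simp: c_def)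
  have "c \<le> poly (pCons a p) x" if x: "x \<ge> max n (1 + \<bar>a\<bar> / c)" for x
  proof -
   have "1 + \<bar>a\<bar> / c \<le> x" using x by simp
   then have "(1 + \<bar>a\<bar> / c) * c \<le> x * c" using c by (intro mult_right_mono) simp_all
   then have "c + \<bar>a\<bar> \<le> x * c" using c by (simp add: distrib_right)
   moreover have "0 \<le> x" using x c by (meson add_nonneg_nonneg divide_nonneg_pos abs_ge_zero le_max_iff_disj max.boundedE order_trans zero_le_one)
   then have "x * c \<le> x * poly p x" using n[of x] x by (intro mult_left_mono) simp_all
   ultimately have "c + \<bar>a\<bar> \<le> x * poly p x" by linarith
   then show ?thesis by (simp add: abs_if split: if_splits)
  qed
  moreover have "lead_coeff (pCons a p) = c" using False by (simp add: c_def)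
  ultimately show ?thesis by metis
 qed (auto intro: exI)
qed simp

lemma poly_agree_eventually:
 fixes p q :: "'a::field_char_0 poly"
 assumes "\<And>t::nat. t \<ge> t0 ==> poly p (of_nat t) = poly q (of_nat t)"
 shows "p = q"
proof (rule ccontr)
 assume "p ~= q"
 then have "finite {x. poly (p - q) x = 0}" by (intro poly_roots_finite) simp
 moreover have "of_nat ` {t0..} \<subseteq> {x. poly (p - q) x = 0}" using assms by auto
 ultimately have "finite (of_nat ` {t0..} :: 'a set)" by (rule finite_subset[rotated])
 then have "finite {t0..}" by (rule finite_imageD) (simp add: inj_on_def)
 then show False using infinite_Ici by blast
qed

context form_system
begin

lemma dim_space_power_le: "bf.dim (space_power L k) \<le> d * k + 1"
proof -
 interpret base_point_free_system "dehom 0 ` L" d by (rule chart)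
 have "pv.dim (vpow (dehom 0 ` L) k) \<le> card (monom (1::'a) ` {..d * k})"
  using vpow_le[OF Vd] by (intro pv.dim_le_card) (auto simp: polys_le_span)
 also have "\<dots> \<le> d * k + 1" using card_image_le[of "{..d * k}" "monom (1::'a)"] by simp
 finally show ?thesis using dim_vpow_dehom[OF Ld, of 0 k] by simp
qed

lemma dim_space_power_strict: "bf.dim (space_power L k) < bf.dim (space_power L (Suc k))"
proof -
 interpret base_point_free_system "dehom 0 ` L" d by (rule chart)
 show ?thesis using dim_vpow_strict[of k] by (simp add: dim_vpow_dehom[OF Ld])
qed

text \<open>A Hilbert polynomial of degree at least two grows too fast, and one of degree zero is excluded
 because the dimensions increase strictly. So it is linear, and the degree and the genus give its
 coefficients.\<close>

lemma dim_of_hilbert_polynomial: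
 fixes P :: "rat poly"
 assumes P: "\<And>t. t \<ge> t0 ==> of_nat (bf.dim (space_power L t)) = poly P (of_nat t)"
  and P0: "P ~= 0" and deg: "of_nat d = fact (degree P) * lead_coeff P"
  and gen: "2 = (-1) ^ degree P * (poly P 0 - 1)"
 shows "\<forall>k\<ge>t0. bf.dim (space_power L k) + 2 = d * k + 1"
proof -
 have "fact (degree P) * lead_coeff P > 0" using d0 by (simp flip: deg)
 then have lead: "lead_coeff P > 0" by (simp add: zero_less_mult_iff)
 have "degree P \<le> 1"
 proof (rule ccontr)
  assume "\<not> degree P \<le> 1"
  then have d2: "degree [:- 1, - of_nat d :: rat:] < degree P" by (auto simp: degree_pCons_eq_if)
  define Q where "Q = P + [:- 1, - of_nat d:]"
  have dQ: "degree Q = degree P" unfolding Q_def by (rule degree_add_eq_left[OF d2])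
  have "lead_coeff Q = lead_coeff P" unfolding dQ unfolding Q_def using coeff_eq_0[OF d2] by (simp only: coeff_add add_0_right)
  then have "lead_coeff Q > 0" using lead by simp
  then obtain x0 where x0: "\<And>x. x \<ge> x0 ==> poly Q x > 0" using poly_eventually_large[of Q] by (metis order_less_le_trans)
  obtain t1 :: nat where t1: "x0 \<le> of_nat t1" using real_arch_simple by blast
  define t where "t = max t0 t1"
  have "x0 \<le> of_nat t" using t1 by (simp add: t_def)
  then have "poly Q (of_nat t) > 0" by (rule x0)
  moreover have "poly Q (of_nat t) = of_nat (bf.dim (space_power L t)) - of_nat (d * t + 1)"
   using P[of t] by (simp add: Q_def t_def algebra_simps)
  moreover have "(of_nat (bf.dim (space_power L t)) :: rat) \<le> of_nat (d * t + 1)"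
   using dim_space_power_le[of t] by (simp only: of_nat_le_iff)
  ultimately show False by simp
 qed
 then consider "degree P = 0" | "degree P = 1" by linarith
 then show ?thesis
 proof cases
  case 1
  then obtain b where "P = [:b:]" by (rule degree_eq_zeroE)
  then have "of_nat (bf.dim (space_power L t0)) = (of_nat (bf.dim (space_power L (Suc t0))) :: rat)"
   using P[of t0] P[of "Suc t0"] by simp
  then show ?thesis using dim_space_power_strict[of t0] by simp
 next
  case 2
  then obtain b c where bc: "P = [:b, c:]" by (metis One_nat_def degree_eq_zeroE degree_pCons_eq pCons_cases degree_0 nat.inject zero_neq_one)
  have c: "c = of_nat d" using deg 2 by (simp add: bc)
  have b: "b = -1" using gen unfolding 2 by (simp add: bc)
  show ?thesis
  proof (intro allI impI)
   fix k assume "k \<ge> t0"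
   then have "of_nat (bf.dim (space_power L k)) = - 1 + of_nat k * (of_nat d :: rat)" using P[of k] by (simp add: bc b c)
   then have "(of_nat (bf.dim (space_power L k) + 2) :: rat) = of_nat (d * k + 1)" by (simp add: algebra_simps)
   then show "bf.dim (space_power L k) + 2 = d * k + 1" by (simp only: of_nat_eq_iff)
  qed
 qed
qed

end

lemma curve_genus_two_system:
 fixes I :: "'a::{alg_closed_field, field_char_0} mpoly set"
 assumes deg: "has_degree n I d" and gen: "has_arithmetic_genus n I 2"
  and norm: "normalization n I f" and Ldef: "L = pullback_linear_forms n f" and Ld: "L \<subseteq> binary_forms d"
 shows "genus_two_system L d"
proof -
 obtain P where P: "is_hilbert_polynomial n I P" "P ~= 0" "of_nat d = fact (degree P) * lead_coeff P"
  using deg by (auto simp: has_degree_def)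
 obtain P' where P': "is_hilbert_polynomial n I P'" "2 = (-1) ^ degree P' * (poly P' 0 - 1)"
  using gen by (auto simp: has_arithmetic_genus_def)
 obtain t0 t1 where t: "\<And>t. t \<ge> t0 ==> of_int (hilbert_function n I t) = poly P (of_nat t)"
  "\<And>t. t \<ge> t1 ==> of_int (hilbert_function n I t) = poly P' (of_nat t)"
  using P(1) P'(1) by (auto simp: is_hilbert_polynomial_def eventually_sequentially)
 have "P = P'" by (rule poly_agree_eventually[of "max t0 t1"]) (use t in \<open>simp flip: t\<close>)
 have I: "I = {p \<in> polys n. substitute f p = 0}" using norm by (simp add: normalization_def)
 have d0: "d > 0" using P(2,3) by (intro gr0I) simp
 have fs: "form_system L d"
 proof
  show "bf.subspace L" unfolding Ldef pullback_linear_forms_def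
   by (rule mpbf.linear_subspace_image[OF linear_substitute hom_polys_subspace])
  show "L \<subseteq> binary_forms d" "d > 0" by fact+
  fix x y :: 'a assume "(x, y) ~= (0, 0)"
  then obtain i where i: "i \<le> n" "beval (f i) x y ~= 0" using norm unfolding normalization_def by blast
  have "f i \<in> L" unfolding Ldef pullback_linear_forms_def
   using mvar_hom[OF i(1)] substitute_mvar[of f i] by (metis imageI)
  then show "\<exists>g\<in>L. beval g x y ~= 0" using i(2) by blast
 qed
 interpret form_system L d by (rule fs)
 have "\<forall>k\<ge>t0. bf.dim (space_power L k) + 2 = d * k + 1"
 proof (rule dim_of_hilbert_polynomial[OF _ P(2,3)])
  show "of_nat (bf.dim (space_power L t)) = poly P (of_nat t)" if "t \<ge> t0" for t
   using t(1)[OF that] unfolding hilbert_function_eq[OF I] Ldef by simp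
  show "2 = (-1) ^ degree P * (poly P 0 - 1)" using P'(2) \<open>P = P'\<close> by simp
 qed
 then show ?thesis by unfold_locales blast
qed

section \<open>The valuation at a point and its value semigroup\<close>

lemma space_power_mult: "f \<in> space_power L k ==> g \<in> space_power L m ==> f * g \<in> space_power L (k + m)"
 for f :: "'a::field poly poly"
proof -
 assume f: "f \<in> space_power L k" and g: "g \<in> space_power L m"
 have sc: "x * bscale c y = bscale c (x * y)" "bscale c y * x = bscale c (y * x)" for c and x y :: "'a poly poly"
  by (simp_all add: bscale_def)
 have 1: "prod_list ls * y \<in> space_power L (k + m)" if ls: "length ls = k" "set ls \<subseteq> L"
  and y: "y \<in> space_power L m" for ls y
  using y unfolding space_power_def[of L m]
 proof (induction rule: bf.span_induct_alt)
  case base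
  show ?case using bf.subspace_0[OF space_power_subspace] by simp
 next
  case (step c x y)
  then obtain ls' where ls': "x = prod_list ls'" "length ls' = m" "set ls' \<subseteq> L" by blast
  have "prod_list ls * x \<in> space_power L (k + m)" unfolding space_power_def
   using ls ls' by (intro bf.span_base CollectI exI[of _ "ls @ ls'"]) auto
  then show ?case using step(2) unfolding distrib_left sc
   by (intro bf.subspace_add[OF space_power_subspace] bf.subspace_scale[OF space_power_subspace])
 qed
 show "f * g \<in> space_power L (k + m)" using f unfolding space_power_def[of L k]
 proof (induction rule: bf.span_induct_alt)
  case base
  show ?case using bf.subspace_0[OF space_power_subspace] by simp
 next
  case (step c x y)
  then obtain ls where "x = prod_list ls" "length ls = k" "set ls \<subseteq> L" by blast
  then have "x * g \<in> space_power L (k + m)" using 1[OF _ _ g] by blast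
  then show ?case using step(2) unfolding distrib_right sc
   by (intro bf.subspace_add[OF space_power_subspace] bf.subspace_scale[OF space_power_subspace])
 qed
qed

lemma space_power_base: "f \<in> L ==> f \<in> space_power L 1"
 unfolding space_power_def by (rule bf.span_base) (auto intro!: exI[of _ "[f]"])

lemma space_power_0: "f \<in> space_power L 0 \<longleftrightarrow> (\<exists>c. f = [:[:c:]:])"
proof -
 have "{prod_list ls | ls. length ls = 0 \<and> set ls \<subseteq> L} = {1}" by auto
 then show ?thesis by (auto simp: space_power_def bf.span_singleton bscale_def one_pCons)
qed

text \<open>Dickson's lemma in two dimensions.\<close>

lemma minimal_pairs_finite:
 fixes T :: "(nat \<times> nat) set"
 shows "\<exists>F. finite F \<and> F \<subseteq> T \<and> (\<forall>(x, y)\<in>T. \<exists>(x', y')\<in>F. x' \<le> x \<and> y' \<le> y)"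
proof (cases "T = {}")
 case False
 then obtain a0 b0 where ab: "(a0, b0) \<in> T" by auto
 define f where "f = (\<lambda>a. (a, LEAST b. (a, b) \<in> T))"
 define g where "g = (\<lambda>b. (LEAST a. (a, b) \<in> T, b))"
 define F where "F = insert (a0, b0) (f ` {a. a < a0 \<and> (\<exists>b. (a, b) \<in> T)} \<union> g ` {b. b < b0 \<and> (\<exists>a. (a, b) \<in> T)})"
 have fT: "f a \<in> T" "(LEAST b'. (a, b') \<in> T) \<le> b" if "(a, b) \<in> T" for a b
  unfolding f_def using that by (auto intro: LeastI Least_le)
 have gT: "g b \<in> T" "(LEAST a'. (a', b) \<in> T) \<le> a" if "(a, b) \<in> T" for a b
  unfolding g_def using that by (auto intro: LeastI Least_le)
 have "F \<subseteq> T" unfolding F_def using ab fT gT by auto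
 moreover have "\<exists>(x', y')\<in>F. x' \<le> x \<and> y' \<le> y" if xy: "(x, y) \<in> T" for x y
 proof -
  consider "x < a0" | "y < b0" | "a0 \<le> x" "b0 \<le> y" by linarith
  then show ?thesis
  proof cases
   case 1
   then have "f x \<in> F" using xy by (auto simp: F_def)
   then show ?thesis using fT(2)[OF xy] by (auto simp: f_def)
  next
   case 2
   then have "g y \<in> F" using xy by (auto simp: F_def)
   then show ?thesis using gT(2)[OF xy] by (auto simp: g_def)
  next
   case 3
   then show ?thesis by (auto simp: F_def)
  qed
 qed
 moreover have "finite F" by (simp add: F_def)
 ultimately show ?thesis by blast
qed auto

text \<open>The minimal pairs in each pair of residue classes.\<close>

lemma minimal_pairs_mod_finite:
 fixes T :: "(nat \<times> nat) set" and M :: nat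
 assumes "M > 0"
 shows "\<exists>F. finite F \<and> F \<subseteq> T \<and> (\<forall>(x, y)\<in>T. \<exists>(x', y')\<in>F. (\<exists>i. x = x' + M * i) \<and> (\<exists>j. y = y' + M * j))"
proof -
 define C where "C = (\<lambda>(a, b). {(x, y). (x, y) \<in> T \<and> x mod M = a \<and> y mod M = b})"
 have "\<forall>c. \<exists>F. finite F \<and> F \<subseteq> C c \<and> (\<forall>(x, y)\<in>C c. \<exists>(x', y')\<in>F. x' \<le> x \<and> y' \<le> y)"
  using minimal_pairs_finite by blast
 then have "\<exists>G. \<forall>c. finite (G c) \<and> G c \<subseteq> C c \<and> (\<forall>(x, y)\<in>C c. \<exists>(x', y')\<in>G c. x' \<le> x \<and> y' \<le> y)"
  by (rule choice)
 then obtain G where G0: "\<forall>c. finite (G c) \<and> G c \<subseteq> C c \<and> (\<forall>(x, y)\<in>C c. \<exists>(x', y')\<in>G c. x' \<le> x \<and> y' \<le> y)"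
  by (rule exE)
 note G = G0[THEN spec, THEN conjunct1] G0[THEN spec, THEN conjunct2, THEN conjunct1]
  G0[THEN spec, THEN conjunct2, THEN conjunct2]
 define F where "F = (\<Union>c\<in>{..<M} \<times> {..<M}. G c)"
 have "\<exists>(x', y')\<in>F. (\<exists>i. x = x' + M * i) \<and> (\<exists>j. y = y' + M * j)" if "(x, y) \<in> T" for x y
 proof -
  have c: "(x, y) \<in> C (x mod M, y mod M)" using that by (simp add: C_def)
  have "case (x, y) of (x, y) => \<exists>(x', y')\<in>G (x mod M, y mod M). x' \<le> x \<and> y' \<le> y"
   using bspec[OF G(3) c] by simp
  then obtain x' y' where xy: "(x', y') \<in> G (x mod M, y mod M)" "x' \<le> x" "y' \<le> y" by auto
  then have "x' mod M = x mod M" "y' mod M = y mod M" using G(2) by (auto simp: C_def)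
  then have "M dvd x - x'" "M dvd y - y'"
   using mod_eq_dvd_iff_nat[OF xy(2), of M] mod_eq_dvd_iff_nat[OF xy(3), of M] by auto
  then obtain i j where "x - x' = M * i" "y - y' = M * j" by (auto elim!: dvdE)
  then have "x = x' + M * i" "y = y' + M * j" using xy(2,3) by linarith+
  moreover have "(x', y') \<in> F" unfolding F_def using xy(1) assms by (intro UN_I[of "(x mod M, y mod M)"]) auto
  ultimately show ?thesis by blast
 qed
 moreover have "C c \<subseteq> T" for c by (auto simp: C_def split: prod.splits)
 then have "F \<subseteq> T" unfolding F_def using G(2) by blast
 moreover have "finite F" using G(1) by (simp add: F_def)
 ultimately show ?thesis by blast
qed

locale pointed_system = genus_two_system L d for L :: "'a::{alg_closed_field, field_char_0} poly poly set" and d +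
 fixes \<alpha> \<beta> r :: 'a
 assumes chart_point: "\<beta> - \<alpha> * r ~= 0"
begin

abbreviation "pf \<equiv> point_form \<alpha> \<beta>"
abbreviation "pord \<equiv> point_ord \<alpha> \<beta>"
abbreviation "val \<equiv> point_valuation \<alpha> \<beta>"
abbreviation "R \<equiv> power_algebra L"

definition z0 :: 'a where "z0 = \<alpha> / (\<beta> - \<alpha> * r)"

lemma dehom_pf: "dehom r pf = smult (\<beta> - \<alpha> * r) [:- z0, 1:]"
 using chart_point by (simp add: dehom_point_form z0_def)

lemma dehom_pf_power: "dehom r (pf ^ m) = smult ((\<beta> - \<alpha> * r) ^ m) ([:- z0, 1:] ^ m)"
 by (simp only: dehom_hom dehom_pf smult_power)

lemma pf_power_form: "pf ^ m \<in> binary_forms m"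
 using binary_forms_power[OF point_form_form, of \<alpha> \<beta> m] by simp

lemma dehom_nonzero: "f \<in> binary_forms e ==> f ~= 0 ==> dehom r f ~= 0"
 using dehom_inj by blast

lemma pf_dvd_iff:
 assumes f: "f \<in> binary_forms e" "f ~= 0"
 shows "pf ^ m dvd f \<longleftrightarrow> m \<le> order z0 (dehom r f)"
proof
 note df = dehom_nonzero[OF f]
 assume "pf ^ m dvd f"
 then obtain g where "f = pf ^ m * g" by blast
 then have "dehom r f = [:- z0, 1:] ^ m * smult ((\<beta> - \<alpha> * r) ^ m) (dehom r g)"
  by (simp only: dehom_hom(3) dehom_pf_power mult_smult_left mult_smult_right)
 then have "[:- z0, 1:] ^ m dvd dehom r f" by (rule dvdI)
 then show "m \<le> order z0 (dehom r f)" using df by (simp add: order_divides)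
next
 note df = dehom_nonzero[OF f]
 assume "m \<le> order z0 (dehom r f)"
 then have "[:- z0, 1:] ^ m dvd dehom r f" by (simp add: order_divides)
 then obtain h where h: "dehom r f = [:- z0, 1:] ^ m * h" by blast
 define c where "c = (\<beta> - \<alpha> * r) ^ m"
 have c: "c ~= 0" using chart_point by (simp add: c_def)
 define g where "g = smult (inverse c) h"
 have "h ~= 0" using df h by auto
 have "degree (dehom r f) = m + degree h" unfolding h using \<open>h ~= 0\<close>
  by (subst degree_mult_eq) (auto simp: degree_power_eq)
 then have me: "m + degree h \<le> e" using dehom_degree[OF f(1), of r] by simp
 then have dg: "degree g \<le> e - m" unfolding g_def using degree_smult_le[of "inverse c" h] by linarith
 have hom: "pf ^ m * homog r (e - m) g \<in> binary_forms e"
  using binary_forms_mult[OF pf_power_form homog_form, of m r "e - m" g] me by simp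
 have "dehom r (pf ^ m * homog r (e - m) g) = smult c ([:- z0, 1:] ^ m) * g"
  by (simp only: dehom_hom(3) dehom_pf_power dehom_homog[OF dg] c_def)
 also have "\<dots> = smult (inverse c * c) ([:- z0, 1:] ^ m * h)"
  by (simp only: g_def mult_smult_left mult_smult_right smult_smult)
 also have "\<dots> = dehom r f" unfolding h left_inverse[OF c] smult_1_left ..
 finally have "f = pf ^ m * homog r (e - m) g"
  using inj_onD[OF dehom_inj_on _ hom f(1)] by metis
 then show "pf ^ m dvd f" by (rule dvdI)
qed

text \<open>In an affine chart containing the point, the order of a form is the order of a polynomial.\<close>

lemma pord_eq:
 assumes "f \<in> binary_forms e" "f ~= 0"
 shows "pord f = order z0 (dehom r f)"
proof -
 have "{m. pf ^ m dvd f} = {..order z0 (dehom r f)}" using pf_dvd_iff[OF assms] by auto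
 then show ?thesis unfolding point_ord_def by (auto intro!: Max_eqI)
qed

lemma pord_mult:
 assumes "f \<in> binary_forms e" "f ~= 0" "g \<in> binary_forms e'" "g ~= 0"
 shows "pord (f * g) = pord f + pord g"
proof -
 have "dehom r f * dehom r g ~= 0" using dehom_nonzero assms by simp
 then show ?thesis
  using pord_eq[OF assms(1,2)] pord_eq[OF assms(3,4)] pord_eq[OF binary_forms_mult[OF assms(1,3)]] assms(2,4)
  by (simp add: dehom_hom order_mult)
qed

lemma pord_add:
 assumes "f \<in> binary_forms e" "f ~= 0" "g \<in> binary_forms e" "g ~= 0" "f + g ~= 0"
 shows "min (pord f) (pord g) \<le> pord (f + g)"
proof -
 let ?m = "min (pord f) (pord g)"
 have "pf ^ ?m dvd f" "pf ^ ?m dvd g"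
  using pf_dvd_iff[OF assms(1,2)] pf_dvd_iff[OF assms(3,4)] pord_eq[OF assms(1,2)] pord_eq[OF assms(3,4)] by simp_all
 then have "pf ^ ?m dvd f + g" by simp
 moreover have fg: "f + g \<in> binary_forms e" using assms(1,3) by (rule bf.subspace_add[OF binary_forms_subspace])
 ultimately show ?thesis using pf_dvd_iff[OF fg assms(5)] pord_eq[OF fg assms(5)] by simp
qed

lemma pord_le: "f \<in> binary_forms e ==> f ~= 0 ==> pord f \<le> e"
 using pord_eq[of f e] dehom_degree[of f e r] order_degree[OF dehom_nonzero[of f e], of z0] by linarith

lemma pord_const:
 assumes "c ~= 0"
 shows "pord [:[:c:]:] = 0"
proof -
 have "bscale c 1 = [:[:c:]:]" by (simp add: bscale_def one_pCons)
 then have "[:[:c:]:] \<in> binary_forms 0" using bf.subspace_scale[OF binary_forms_subspace binary_forms_basic(1), of c] by simp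
 then show ?thesis using pord_le[of "[:[:c:]:]" 0] assms by simp
qed

lemma sp_form: "f \<in> space_power L k ==> f \<in> binary_forms (d * k)"
 using space_power_forms[OF Ld] by blast

lemma pord_top_iff: "(\<exists>f\<in>space_power L k. f ~= 0 \<and> pord f = d * k) \<longleftrightarrow> pf ^ (d * k) \<in> space_power L k"
proof
 assume "\<exists>f\<in>space_power L k. f ~= 0 \<and> pord f = d * k"
 then obtain f where f: "f \<in> space_power L k" "f ~= 0" "pord f = d * k" by blast
 note ff = sp_form[OF f(1)]
 have "[:- z0, 1:] ^ (d * k) dvd dehom r f" using pord_eq[OF ff f(2)] f(3) by (simp add: order_divides)
 then obtain h where h: "dehom r f = [:- z0, 1:] ^ (d * k) * h" by blast
 have "h ~= 0" using h dehom_nonzero[OF ff f(2)] by auto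
 then have "degree (dehom r f) = d * k + degree h" unfolding h
  by (subst degree_mult_eq) (auto simp: degree_power_eq)
 then have "degree h = 0" using dehom_degree[OF ff, of r] by simp
 then obtain c where c: "h = [:c:]" by (rule degree_eq_zeroE)
 define b where "b = (\<beta> - \<alpha> * r) ^ (d * k)"
 have "c ~= 0" using \<open>h ~= 0\<close> c by simp
 have "dehom r f = smult c ([:- z0, 1:] ^ (d * k))" by (simp add: h c)
 then have "dehom r (bscale (b / c) f) = dehom r (pf ^ (d * k))"
  unfolding dehom_hom(4) dehom_pf_power b_def[symmetric] using \<open>c ~= 0\<close> by simp
 moreover have "bscale (b / c) f \<in> binary_forms (d * k)" by (rule bf.subspace_scale[OF binary_forms_subspace ff])
 ultimately have "bscale (b / c) f = pf ^ (d * k)" using inj_onD[OF dehom_inj_on] pf_power_form by blast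
 then show "pf ^ (d * k) \<in> space_power L k" using bf.subspace_scale[OF space_power_subspace f(1), of "b / c"] by simp
next
 assume p: "pf ^ (d * k) \<in> space_power L k"
 have b: "(\<beta> - \<alpha> * r) ^ (d * k) ~= 0" using chart_point by simp
 then have "dehom r (pf ^ (d * k)) ~= 0" by (simp add: dehom_pf_power)
 then have ne: "pf ^ (d * k) ~= 0" by (metis dehom_hom(5))
 have "pord (pf ^ (d * k)) = d * k"
  unfolding pord_eq[OF pf_power_form ne] dehom_pf_power order_smult[OF b] by (rule order_power_n_n)
 then show "\<exists>f\<in>space_power L k. f ~= 0 \<and> pord f = d * k" using p ne by blast
qed

subsection \<open>The valuation\<close>

lemma finite_values: "finite {(int k, int (pord (coeff f k))) | k. coeff f k ~= 0}"
proof -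
 have "{(int k, int (pord (coeff f k))) | k. coeff f k ~= 0} \<subseteq> (\<lambda>k. (int k, int (pord (coeff f k)))) ` {..degree f}"
  using le_degree by auto
 then show ?thesis by (rule finite_subset) simp
qed

lemma val_le: "coeff f k ~= 0 ==> val f \<le> (int k, int (pord (coeff f k)))"
 unfolding point_valuation_def by (rule Min_le[OF finite_values]) blast

lemma val_low:
 assumes "f ~= 0"
 shows "\<exists>k. coeff f k ~= 0 \<and> val f = (int k, int (pord (coeff f k))) \<and> (\<forall>i<k. coeff f i = 0)"
proof -
 have "\<exists>k. coeff f k ~= 0" using assms by (metis leading_coeff_0_iff)
 then have ne: "{(int k, int (pord (coeff f k))) | k. coeff f k ~= 0} ~= {}" by blast
 have "val f \<in> {(int k, int (pord (coeff f k))) | k. coeff f k ~= 0}"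
  unfolding point_valuation_def by (rule Min_in[OF finite_values ne])
 then obtain k where k: "coeff f k ~= 0" "val f = (int k, int (pord (coeff f k)))" by blast
 have "coeff f i = 0" if "i < k" for i
 proof (rule ccontr)
  assume "coeff f i ~= 0"
  then have "val f \<le> (int i, int (pord (coeff f i)))" by (rule val_le)
  then show False using that k(2) by (simp add: less_eq_prod_def)
 qed
 then show ?thesis using k by blast
qed

lemma R_coeff: "f \<in> R ==> coeff f k \<in> space_power L k"
 by (simp add: power_algebra_def)

lemma R_form: "f \<in> R ==> coeff f k \<in> binary_forms (d * k)"
 using sp_form R_coeff by blast

lemma val_mult:
 assumes f: "f \<in> R" "f ~= 0" and g: "g \<in> R" "g ~= 0"
 shows "val (f * g) = val f + val g"
proof -
 obtain k where k: "coeff f k ~= 0" "val f = (int k, int (pord (coeff f k)))" "\<And>i. i < k ==> coeff f i = 0"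
  using val_low[OF f(2)] by blast
 obtain m where m: "coeff g m ~= 0" "val g = (int m, int (pord (coeff g m)))" "\<And>i. i < m ==> coeff g i = 0"
  using val_low[OF g(2)] by blast
 have "f * g ~= 0" using f(2) g(2) by simp
 then obtain s where s: "coeff (f * g) s ~= 0" "val (f * g) = (int s, int (pord (coeff (f * g) s)))"
  "\<And>i. i < s ==> coeff (f * g) i = 0" using val_low by blast
 have "coeff (f * g) (k + m) = (\<Sum>i\<le>k + m. if i = k then coeff f k * coeff g m else 0)"
  unfolding coeff_mult
 proof (intro sum.cong refl)
  fix i assume "i \<in> {..k + m}"
  consider "i < k" | "i = k" | "k < i" "k + m - i < m" using \<open>i \<in> {..k + m}\<close> by force
  then show "coeff f i * coeff g (k + m - i) = (if i = k then coeff f k * coeff g m else 0)"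
   by cases (auto simp: k(3) m(3))
 qed
 then have c: "coeff (f * g) (k + m) = coeff f k * coeff g m" by simp
 have z: "coeff (f * g) i = 0" if "i < k + m" for i
  unfolding coeff_mult
 proof (intro sum.neutral ballI)
  fix j assume "j \<in> {..i}"
  then have "j < k \<or> i - j < m" using that by force
  then show "coeff f j * coeff g (i - j) = 0" using k(3) m(3) by auto
 qed
 have "coeff (f * g) (k + m) ~= 0" using c k(1) m(1) by simp
 then have "s = k + m" using s(1,3) z by (meson linorder_neqE_nat)
 then show ?thesis
  using s(2) k(2) m(2) c pord_mult[OF R_form[OF f(1)] k(1) R_form[OF g(1)] m(1)] by simp
qed

lemma val_add:
 assumes f: "f \<in> R" and g: "g \<in> R" and fg: "f + g ~= 0"
 shows "min (val f) (val g) \<le> val (f + g)"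
proof -
 obtain m where m: "coeff (f + g) m ~= 0" "val (f + g) = (int m, int (pord (coeff (f + g) m)))"
  using val_low[OF fg] by blast
 consider "coeff f m = 0" | "coeff g m = 0" | "coeff f m ~= 0" "coeff g m ~= 0" by blast
 then show ?thesis
 proof cases
  case 1
  then have "val g \<le> val (f + g)" using m val_le[of g m] by simp
  then show ?thesis by (rule min.coboundedI2)
 next
  case 2
  then have "val f \<le> val (f + g)" using m val_le[of f m] by simp
  then show ?thesis by (rule min.coboundedI1)
 next
  case 3
  have "min (pord (coeff f m)) (pord (coeff g m)) \<le> pord (coeff (f + g) m)"
   using pord_add[OF R_form[OF f] 3(1) R_form[OF g] 3(2)] m(1) by simp
  then consider "pord (coeff f m) \<le> pord (coeff (f + g) m)" | "pord (coeff g m) \<le> pord (coeff (f + g) m)"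
   by linarith
  then show ?thesis
  proof cases
   case 1
   then have "val f \<le> val (f + g)" using val_le[OF 3(1)] m(2) by (auto simp: less_eq_prod_def)
   then show ?thesis by (rule min.coboundedI1)
  next
   case 2
   then have "val g \<le> val (f + g)" using val_le[OF 3(2)] m(2) by (auto simp: less_eq_prod_def)
   then show ?thesis by (rule min.coboundedI2)
  qed
 qed
qed

lemma val_monom: "g ~= 0 ==> val (monom g k) = (int k, int (pord g))"
 unfolding point_valuation_def by (subst Min_eqI[where x = "(int k, int (pord g))"]) (auto split: if_splits)

lemma valuation_on_R: "valuation_on R val"
 unfolding valuation_on_def
proof (intro conjI ballI allI impI)
 fix c :: 'a assume "c ~= 0"
 then show "val [:[:[:c:]:]:] = 0"
  using val_monom[of "[:[:c:]:]" 0] pord_const[of c] by (simp add: monom_0 zero_prod_def)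
qed (use val_mult val_add in blast)+

lemma homogeneous_R: "homogeneous_valuation R val"
 unfolding homogeneous_valuation_def
proof (intro ballI impI)
 fix f assume "f \<in> R" "f ~= 0"
 have "{val (graded_part k f) | k. coeff f k ~= 0} = {(int k, int (pord (coeff f k))) | k. coeff f k ~= 0}"
  unfolding graded_part_def using val_monom by (metis (no_types, lifting))
 then show "val f = Min {val (graded_part k f) | k. coeff f k ~= 0}" by (simp only: point_valuation_def)
qed

lemma value_set_R: "value_set R val = {(int k, int (pord f)) | k f. f \<in> space_power L k \<and> f ~= 0}"
proof
 show "value_set R val \<subseteq> {(int k, int (pord f)) | k f. f \<in> space_power L k \<and> f ~= 0}"
 proof
  fix x assume "x \<in> value_set R val"
  then obtain f where f: "f \<in> R" "f ~= 0" "x = val f" by (auto simp: value_set_def)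
  then obtain k where "coeff f k ~= 0" "val f = (int k, int (pord (coeff f k)))" using val_low by blast
  then show "x \<in> {(int k, int (pord f)) | k f. f \<in> space_power L k \<and> f ~= 0}" using f R_coeff by blast
 qed
 show "{(int k, int (pord f)) | k f. f \<in> space_power L k \<and> f ~= 0} \<subseteq> value_set R val"
 proof
  fix x assume "x \<in> {(int k, int (pord f)) | k f. f \<in> space_power L k \<and> f ~= 0}"
  then obtain k f where f: "x = (int k, int (pord f))" "f \<in> space_power L k" "f ~= 0" by blast
  have "monom f k \<in> R" using f(2) bf.subspace_0[OF space_power_subspace[of L]] by (simp add: power_algebra_def)
  then show "x \<in> value_set R val" unfolding value_set_def using f(1,3) val_monom[OF f(3), of k]
   by (intro image_eqI[of _ _ "monom f k"]) auto
 qed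
qed

definition S :: "(nat \<times> nat) set" where "S = {(k, pord f) | k f. f \<in> space_power L k \<and> f ~= 0}"

lemma value_set_S: "value_set R val = (\<lambda>(k, w). (int k, int w)) ` S"
proof -
 have "i ` {(k, pord f) | k f. f \<in> space_power L k \<and> f ~= 0} = {i (k, pord f) | k f. f \<in> space_power L k \<and> f ~= 0}" for i :: "nat \<times> nat => int \<times> int"
  by blast
 then show ?thesis unfolding value_set_R S_def by simp
qed

lemma S_D: "(k, x) \<in> S ==> \<exists>f\<in>space_power L k. f ~= 0 \<and> x = pord f"
 unfolding S_def by auto

lemma S_I: "f \<in> space_power L k ==> f ~= 0 ==> (k, pord f) \<in> S"
 unfolding S_def by blast

lemma S_add:
 assumes "(k, x) \<in> S" "(m, y) \<in> S"
 shows "(k + m, x + y) \<in> S"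
proof -
 obtain f where f: "f \<in> space_power L k" "f ~= 0" "x = pord f" using S_D[OF assms(1)] by blast
 obtain g where g: "g \<in> space_power L m" "g ~= 0" "y = pord g" using S_D[OF assms(2)] by blast
 have "f * g ~= 0" using f(2) g(2) by simp
 then have "(k + m, pord (f * g)) \<in> S" by (rule S_I[OF space_power_mult[OF f(1) g(1)]])
 then show ?thesis using pord_mult[OF sp_form[OF f(1)] f(2) sp_form[OF g(1)] g(2)] f(3) g(3) by simp
qed

lemma S_le: "(k, x) \<in> S ==> x \<le> d * k"
 using S_D pord_le[OF sp_form] by blast

lemma S_zero: "(0, 0) \<in> S"
proof -
 have "[:[:1::'a:]:] \<in> space_power L 0" using space_power_0 by blast
 then have "(0, pord [:[:1:]:]) \<in> S" by (rule S_I) simp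
 then show ?thesis by (simp add: pord_const)
qed

lemma S_base: "(1, 0) \<in> S"
proof -
 have "(z0, 1 + r * z0) ~= (0, 0)" by auto
 then obtain f where f: "f \<in> L" "beval f z0 (1 + r * z0) ~= 0" using bpf by blast
 then have z: "poly (dehom r f) z0 ~= 0" by (simp add: dehom_eval)
 then have "f ~= 0" by (auto simp: dehom_hom)
 moreover have "pord f = 0" using pord_eq[OF _ \<open>f ~= 0\<close>] Ld f(1) order_0I[OF z] by fastforce
 ultimately show ?thesis using S_I[OF space_power_base[OF f(1)]] by metis
qed

lemma S_positive: "\<exists>x>0. (1, x) \<in> S"
proof -
 interpret base_point_free_system "dehom r ` L" d by (rule chart)
 obtain s0 s1 where s: "s0 \<in> dehom r ` L" "s1 \<in> dehom r ` L" "coeff s0 d ~= 0" "\<forall>z. poly s0 z = 0 --> poly s1 z ~= 0"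
  using pencil by blast
 define g where "g = smult (poly s1 z0) s0 - smult (poly s0 z0) s1"
 have "g \<in> dehom r ` L" unfolding g_def using s(1,2) V by (intro pv.subspace_diff pv.subspace_scale)
 then obtain f where f: "f \<in> L" "g = dehom r f" by blast
 have ds0: "s0 ~= 0" "degree s0 > 0" using s(3) d0 le_degree[OF s(3)] by auto
 have "g ~= 0"
 proof
  assume "g = 0"
  then have e: "smult (poly s1 z0) s0 = smult (poly s0 z0) s1" by (simp add: g_def)
  obtain z where z: "poly s0 z = 0" using alg_closed_imp_poly_has_root[OF ds0(2)] by blast
  have "poly s0 z0 * poly s1 z = 0" using arg_cong[OF e, of "\<lambda>p. poly p z"] z by simp
  then have 1: "poly s0 z0 = 0" using s(4) z by simp
  then have "poly s1 z0 = 0" using e ds0(1) by simp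
  then show False using s(4) 1 by blast
 qed
 then have "f ~= 0" using f(2) by (auto simp: dehom_hom)
 have "poly g z0 = 0" by (simp add: g_def)
 then have "order z0 g ~= 0" using \<open>g ~= 0\<close> by (simp add: order_root)
 then have "pord f > 0" using pord_eq[OF _ \<open>f ~= 0\<close>] Ld f by fastforce
 then show ?thesis using S_I[OF space_power_base[OF f(1)] \<open>f ~= 0\<close>] by blast
qed

text \<open>Since the linear system has codimension two, it contains forms vanishing to almost the maximal
 order.\<close>

lemma S_high: "\<exists>k0. \<forall>k\<ge>k0. \<exists>x. (k, x) \<in> S \<and> d * k \<le> x + 2"
proof -
 let ?V = "dehom r ` L"
 interpret linear_system ?V d by (rule genus_two_chart)
 obtain k0 where k0: "\<forall>k\<ge>k0. \<exists>c1 c2. degree c1 \<le> d * k \<and> degree c2 \<le> d * k \<and>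
   (\<forall>f. degree f \<le> d * k --> (\<exists>x y. f - (smult x c1 + smult y c2) \<in> vpow ?V k)) \<and>
   (\<forall>x y. smult x c1 + smult y c2 \<in> vpow ?V k --> x = 0 \<and> y = 0)"
  using complement by (rule exE)
 have "\<exists>x. (k, x) \<in> S \<and> d * k \<le> x + 2" if k: "k \<ge> max k0 2" for k
 proof -
  have "d * k \<ge> 1 * 2" using d0 k by (intro mult_le_mono) auto
  then have dk: "d * k - 2 + 2 = d * k" by simp
  have "k0 \<le> k" using k by simp
  from k0[rule_format, OF this] obtain c1 c2 where
   c: "\<And>f. degree f \<le> d * k ==> \<exists>x y. f - (smult x c1 + smult y c2) \<in> vpow ?V k" by metis
  define P where "P = [:- z0, 1:] ^ (d * k - 2)"
  define v where "v = (\<lambda>i. P * monom 1 i)"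
  have P0: "P ~= 0" by (simp add: P_def)
  have "degree (v i) \<le> d * k" if "i < 3" for i
  proof -
   have "degree (v i) \<le> degree P + degree (monom (1::'a) i)" unfolding v_def by (rule degree_mult_le)
   also have "\<dots> = d * k - 2 + i" by (simp add: P_def degree_power_eq degree_monom_eq)
   finally show ?thesis using dk that by linarith
  qed
  then have "\<forall>i<3. \<exists>x y. v i - (smult x c1 + smult y c2) \<in> vpow ?V k" using c by blast
  then obtain x y where xy: "\<And>i. i < 3 ==> v i - (smult (x i) c1 + smult (y i) c2) \<in> vpow ?V k"
   by metis
  have "\<exists>e. (\<exists>i\<in>{..<3::nat}. e i ~= 0) \<and> (\<forall>j\<in>(UNIV::bool set). (\<Sum>i\<in>{..<3}. e i * (if j then x i else y i)) = 0)"
   by (rule underdetermined_system) simp_all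
  then obtain e where e: "\<exists>i\<in>{..<3::nat}. e i ~= 0" "\<forall>j. (\<Sum>i\<in>{..<3}. e i * (if j then x i else y i)) = 0" by auto
  have ex: "(\<Sum>i\<in>{..<3}. e i * x i) = 0" "(\<Sum>i\<in>{..<3}. e i * y i) = 0" using e(2)[rule_format, of True] e(2)[rule_format, of False] by simp_all
  define h where "h = (\<Sum>i\<in>{..<3}. monom (e i) i)"
  have "coeff h i = (if i < 3 then e i else 0)" for i by (simp add: h_def coeff_sum)
  then have h0: "h ~= 0" using e(1) by (metis coeff_0 lessThan_iff)
  have "(\<Sum>i\<in>{..<3}. smult (e i) (v i - (smult (x i) c1 + smult (y i) c2))) \<in> vpow ?V k"
   using xy by (intro pv.subspace_sum[OF vpow_subspace] pv.subspace_scale[OF vpow_subspace]) simp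
  also have "(\<Sum>i\<in>{..<3}. smult (e i) (v i - (smult (x i) c1 + smult (y i) c2)))
   = (\<Sum>i\<in>{..<3}. smult (e i) (v i)) - smult (\<Sum>i\<in>{..<3}. e i * x i) c1
    - smult (\<Sum>i\<in>{..<3}. e i * y i) c2"
   by (simp only: smult_diff_right smult_add_right sum_subtractf sum.distrib smult_sum diff_diff_eq smult_smult)
  also have "\<dots> = (\<Sum>i\<in>{..<3}. smult (e i) (v i))" by (simp add: ex)
  also have "\<dots> = P * h" unfolding h_def sum_distrib_left v_def
   by (intro sum.cong) (simp_all add: smult_monom flip: mult_smult_right)
  finally obtain f where f: "f \<in> space_power L k" "P * h = dehom r f" by (auto simp: dehom_space_power[symmetric])
  have "dehom r f ~= 0" using f(2) P0 h0 by (metis mult_eq_0_iff)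
  then have f0: "f ~= 0" by (auto simp: dehom_hom)
  have "[:- z0, 1:] ^ (d * k - 2) dvd dehom r f" unfolding f(2)[symmetric] P_def by simp
  then have "d * k - 2 \<le> pord f" using pord_eq[OF sp_form[OF f(1)] f0] \<open>dehom r f ~= 0\<close> by (simp add: order_divides)
  then have "d * k \<le> pord f + 2" by linarith
  then show ?thesis using S_I[OF f(1) f0] by blast
 qed
 then show ?thesis by blast
qed

subsection \<open>Finite generation of the value semigroup\<close>

lemma S_sum_list: "set as \<subseteq> (\<lambda>(k, w). (int k, int w)) ` S ==> sum_list as \<in> (\<lambda>(k, w). (int k, int w)) ` S"
proof (induction as)
 case Nil
 show ?case by (rule image_eqI[OF _ S_zero]) (simp add: zero_prod_def)
next
 case (Cons a as)
 then obtain k x m y where "a = (int k, int x)" "(k, x) \<in> S" "sum_list as = (int m, int y)" "(m, y) \<in> S" by auto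
 then show ?case by (intro image_eqI[OF _ S_add[of k x m y]]) simp_all
qed

text \<open>If no value has the maximal slope \<open>d\<close>, then the finitely many generators keep all
 slopes uniformly below \<open>d\<close>, but there are values \<open>(k, x)\<close> with \<open>x\<close>
 within 2 of \<open>d * k\<close> for all large \<open>k\<close>.\<close>

lemma fg_imp_top:
 assumes "fg_semigroup (value_set R val)"
 shows "\<exists>k\<ge>1. pf ^ (d * k) \<in> space_power L k"
proof (rule ccontr)
 assume no: "\<not> ?thesis"
 have not_top: "x < d * k" if "(k, x) \<in> S" "k \<ge> 1" for k x
 proof -
  have "pf ^ (d * k) \<notin> space_power L k" using no that(2) by blast
  then have "x ~= d * k" using S_D[OF that(1)] pord_top_iff[of k] by metis
  then show ?thesis using S_le[OF that(1)] by simp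
 qed
 obtain A where A: "finite A" "(\<lambda>(k, w). (int k, int w)) ` S = {sum_list as | as. as ~= [] \<and> set as \<subseteq> A}"
  using assms unfolding fg_semigroup_def value_set_S by blast
 define K where "K = Max (insert 1 (fst ` A))"
 have K: "fst a \<le> K" "1 \<le> K" if "a \<in> A" for a using A(1) that by (auto simp: K_def)
 have K1: "1 \<le> K" using A(1) by (simp add: K_def)
 \<comment> \<open>All generators, hence all values, stay away from the maximal slope.\<close>
 have bound: "fst a \<le> K * (int d * fst a - snd a)" if a: "a \<in> A" for a
 proof -
  have "a = sum_list [a]" by simp
  then have "a \<in> (\<lambda>(k, w). (int k, int w)) ` S" unfolding A(2) using a by fastforce
  then obtain k x where kx: "a = (int k, int x)" "(k, x) \<in> S" by auto
  show ?thesis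
  proof (cases "k = 0")
   case True
   then show ?thesis using kx S_le[OF kx(2)] by simp
  next
   case False
   then have "x < d * k" using not_top[OF kx(2)] by simp
   then have "int x < int d * int k" by (metis of_nat_less_iff of_nat_mult)
   then have "K * 1 \<le> K * (int d * int k - int x)" using K1 by (intro mult_left_mono) auto
   then show ?thesis using K(1)[OF a] kx(1) by simp
  qed
 qed
 have bound_sum: "fst (sum_list as) \<le> K * (int d * fst (sum_list as) - snd (sum_list as))" if "set as \<subseteq> A" for as
  using that
 proof (induction as)
  case (Cons a as)
  then have "fst a + fst (sum_list as) \<le> K * (int d * fst a - snd a) + K * (int d * fst (sum_list as) - snd (sum_list as))"
   using bound[of a] by (intro add_mono) auto
  then show ?case by (simp add: algebra_simps)
 qed simp
 obtain k0 where k0: "\<And>k. k \<ge> k0 ==> \<exists>x. (k, x) \<in> S \<and> d * k \<le> x + 2" using S_high by blast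
 define k where "k = k0 + nat (2 * K) + 1"
 obtain x where x: "(k, x) \<in> S" "d * k \<le> x + 2" using k0[of k] by (auto simp: k_def)
 have "(int k, int x) \<in> (\<lambda>(k, w). (int k, int w)) ` S" using x(1) by force
 then obtain as where as: "(int k, int x) = sum_list as" "set as \<subseteq> A" unfolding A(2) by blast
 have "int k \<le> K * (int d * int k - int x)" using bound_sum[OF as(2)] unfolding as(1)[symmetric] by simp
 moreover have "int d * int k - int x \<le> 2" using x(2) by (metis diff_le_eq add.commute of_nat_add of_nat_le_iff of_nat_mult of_nat_numeral)
 then have "K * (int d * int k - int x) \<le> K * 2" using K1 by (intro mult_left_mono) auto
 ultimately have "int k \<le> K * 2" by (rule order_trans)
 moreover have "int k > K * 2" using K1 by (simp add: k_def)
 ultimately show False by linarith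
qed

text \<open>In the coordinates \<open>x\<close> and \<open>d * k - x\<close> the semigroup lies in the
 quadrant and contains a nonzero multiple of each axis vector; finitely many elements then suffice in each
 residue class.\<close>

lemma top_imp_fg:
 assumes m: "m \<ge> 1" "pf ^ (d * m) \<in> space_power L m"
 shows "fg_semigroup (value_set R val)"
proof -
 let ?i = "\<lambda>(k, w). (int k, int w)"
 have top: "(m, d * m) \<in> S" using pord_top_iff[of m] m(2) S_I by metis
 have bot: "(k, 0) \<in> S" for k
  by (induction k) (use S_zero S_add[OF S_base] in auto)
 define T where "T = {(x, y). \<exists>k. (k, x) \<in> S \<and> x + y = d * k}"
 have "d * m > 0" using m(1) d0 by simp
 then obtain F where F: "finite F" "F \<subseteq> T" "\<forall>(x, y)\<in>T. \<exists>(x', y')\<in>F. (\<exists>i. x = x' + d * m * i) \<and> (\<exists>j. y = y' + d * m * j)"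
  using minimal_pairs_mod_finite[of "d * m" T] by blast
 define G where "G = (\<lambda>(x, y). ((x + y) div d, x)) ` F"
 define A where "A = ?i ` insert (m, d * m) (insert (m, 0) G)"
 have GS: "G \<subseteq> S"
 proof
  fix g assume "g \<in> G"
  then obtain x y where g: "(x, y) \<in> F" "g = ((x + y) div d, x)" by (auto simp: G_def)
  then obtain k where "(k, x) \<in> S" "x + y = d * k" using F(2) by (auto simp: T_def)
  then show "g \<in> S" using d0 g(2) by simp
 qed
 have "?i ` S = {sum_list as | as. as ~= [] \<and> set as \<subseteq> A}"
 proof
  have "A \<subseteq> ?i ` S" unfolding A_def using GS top bot by (intro image_mono) auto
  then show "{sum_list as | as. as ~= [] \<and> set as \<subseteq> A} \<subseteq> ?i ` S" using S_sum_list by blast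
  show "?i ` S \<subseteq> {sum_list as | as. as ~= [] \<and> set as \<subseteq> A}"
  proof
   fix a assume "a \<in> ?i ` S"
   then obtain k x where kx: "a = (int k, int x)" "(k, x) \<in> S" by auto
   then have "(x, d * k - x) \<in> T" using S_le by (auto simp: T_def)
   then obtain x' y' i j where xy: "(x', y') \<in> F" "x = x' + d * m * i" "d * k - x = y' + d * m * j" using F(3) by fast
   obtain k' where k': "(k', x') \<in> S" "x' + y' = d * k'" using xy(1) F(2) by (auto simp: T_def)
   have "d * k = x + (d * k - x)" using S_le[OF kx(2)] by simp
   also have "\<dots> = d * (k' + m * i + m * j)" using xy(2,3) k'(2) by (simp add: algebra_simps)
   finally have k: "k = k' + m * i + m * j" using d0 by simp
   have "(k', x') \<in> G" using xy(1) k'(2) d0 by (force simp: G_def)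
   then have gen: "(int k', int x') \<in> A" "(int m, int d * int m) \<in> A" "(int m, 0) \<in> A" unfolding A_def by force+
   have rep: "sum_list (replicate n (b, c)) = (int n * b, int n * c)" for n and b c :: int
    by (induction n) (auto simp: zero_prod_def algebra_simps)
   define as where "as = (int k', int x') # replicate i (int m, int d * int m) @ replicate j (int m, 0)"
   have "set as \<subseteq> A" "as ~= []" using gen by (auto simp: as_def)
   moreover have "a = sum_list as" unfolding kx(1) as_def using k xy(2) by (simp add: rep algebra_simps)
   ultimately show "a \<in> {sum_list as | as. as ~= [] \<and> set as \<subseteq> A}" by blast
  qed
 qed
 moreover have "finite A" using F(1) by (simp add: A_def G_def)
 ultimately show ?thesis unfolding fg_semigroup_def value_set_S by blast
qed

end

section \<open>Prime ideals of a ring of polynomials\<close>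

locale closed_subring =
 fixes S :: "'b::comm_ring_1 set"
 assumes one: "1 \<in> S" and minus: "\<And>x. x \<in> S ==> - x \<in> S"
  and add: "\<And>x y. x \<in> S ==> y \<in> S ==> x + y \<in> S" and mult: "\<And>x y. x \<in> S ==> y \<in> S ==> x * y \<in> S"
begin

abbreviation "as_ring \<equiv> (ring_of_type_algebra :: 'b ring)\<lparr>carrier := S\<rparr>"

lemma zero: "0 \<in> S" using add[OF one minus[OF one]] by simp

lemma sum: "(\<And>i. i \<in> A ==> f i \<in> S) ==> sum f A \<in> S"
 by (induction A rule: infinite_finite_induct) (auto intro: zero add)

lemma power: "x \<in> S ==> x ^ n \<in> S"
 by (induction n) (auto intro: one mult)

lemma cring: "cring as_ring"
proof (rule cringI)
 show "abelian_group as_ring"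
  by (rule abelian_groupI) (auto simp: ring_of_type_algebra_def add zero ac_simps intro!: bexI[OF _ minus])
 show "comm_monoid as_ring"
  by (rule comm_monoidI) (auto simp: ring_of_type_algebra_def mult one ac_simps)
qed (auto simp: ring_of_type_algebra_def algebra_simps)

lemma primeideal_facts:
 assumes "primeideal P as_ring"
 shows "P \<subseteq> S" "0 \<in> P" "1 \<notin> P" "\<And>x y. x \<in> P ==> y \<in> P ==> x + y \<in> P"
  "\<And>x y. x \<in> P ==> y \<in> S ==> x * y \<in> P" "\<And>x y. x \<in> S ==> y \<in> S ==> x * y \<in> P ==> x \<in> P \<or> y \<in> P"
proof -
 interpret P: primeideal P as_ring by fact
 show "P \<subseteq> S" using P.a_subset by simp
 show "0 \<in> P" using additive_subgroup.zero_closed[OF P.is_additive_subgroup] by (simp add: ring_of_type_algebra_def)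
 show "1 \<notin> P"
 proof
  assume "1 \<in> P"
  then have "P = carrier as_ring" by (intro P.one_imp_carrier) (simp add: ring_of_type_algebra_def)
  then show False using P.I_notcarr by simp
 qed
 show "x + y \<in> P" if "x \<in> P" "y \<in> P" for x y
  using additive_subgroup.a_closed[OF P.is_additive_subgroup that] by (simp add: ring_of_type_algebra_def)
 show "x * y \<in> P" if "x \<in> P" "y \<in> S" for x y
  using P.I_r_closed[of x y] that by (simp add: ring_of_type_algebra_def)
 show "x \<in> P \<or> y \<in> P" if "x \<in> S" "y \<in> S" "x * y \<in> P" for x y
  using P.I_prime[of x y] that by (simp add: ring_of_type_algebra_def)
qed

lemma primeideal_kernel:
 fixes \<phi> :: "'b => 'c::idom"
 assumes hom: "\<And>x y. \<phi> (x + y) = \<phi> x + \<phi> y" "\<And>x y. \<phi> (x * y) = \<phi> x * \<phi> y" "\<phi> 1 = 1"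
 shows "primeideal {x \<in> S. \<phi> x = 0} as_ring"
proof -
 note closed = zero one minus add mult and cr = cring
 interpret cring as_ring by (rule cr)
 have z: "\<phi> 0 = 0" using hom(1)[of 0 0] by (metis add.right_neutral add_left_cancel)
 have m: "\<phi> (- x) = - \<phi> x" for x using hom(1)[of x "- x"] z by (simp add: eq_neg_iff_add_eq_0 add.commute)
 have neg: "inv\<^bsub>add_monoid as_ring\<^esub> x = - x" if "x \<in> S" for x
 proof -
  have "\<ominus>\<^bsub>as_ring\<^esub> x = - x"
   by (rule minus_equality) (use that closed(3) in \<open>auto simp: ring_of_type_algebra_def\<close>)
  then show ?thesis by (simp add: a_inv_def)
 qed
 show ?thesis
 proof (rule primeidealI2)
  show "additive_subgroup {x \<in> S. \<phi> x = 0} as_ring"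
  proof (rule additive_subgroupI, rule group.subgroupI[OF a_group])
   show "inv\<^bsub>add_monoid as_ring\<^esub> x \<in> {x \<in> S. \<phi> x = 0}" if "x \<in> {x \<in> S. \<phi> x = 0}" for x
    using that neg closed(3) m by simp
  qed (use z closed in \<open>auto simp: ring_of_type_algebra_def hom(1)\<close>)
  show "carrier as_ring ~= {x \<in> S. \<phi> x = 0}"
  proof
   assume eq: "carrier as_ring = {x \<in> S. \<phi> x = 0}"
   have "1 \<in> carrier as_ring" using closed(2) by simp
   then have "1 \<in> {x \<in> S. \<phi> x = 0}" unfolding eq .
   then show False using hom(3) by simp
  qed
 qed (use cr closed in \<open>auto simp: ring_of_type_algebra_def hom(2)\<close>)
qed

text \<open>The lowest coefficient of an algebraic relation moves one step up a chain of prime ideals.\<close>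

lemma lowest_coefficient_in_prime:
 assumes P: "primeideal P as_ring" and Q: "primeideal Q as_ring" "P \<subseteq> Q"
  and g: "g \<in> S" "g \<notin> P" "g \<in> Q" and a: "\<And>j. a j \<in> S"
  and s: "(\<Sum>j<N. a j * g ^ j) \<in> P" and j0: "j0 < N" "\<And>j. j < j0 ==> a j = 0"
 shows "a j0 \<in> Q"
proof -
 note Pf = primeideal_facts[OF P] and Qf = primeideal_facts[OF Q(1)]
 have N: "N = j0 + Suc (N - Suc j0)" using j0(1) by simp
 define T where "T = (\<Sum>j<Suc (N - Suc j0). a (j0 + j) * g ^ j)"
 have "(\<Sum>j<N. a j * g ^ j) = (\<Sum>j\<in>{..<j0} \<union> (+) j0 ` {..<Suc (N - Suc j0)}. a j * g ^ j)"
 proof (rule sum.cong)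
  show "{..<N} = {..<j0} \<union> (+) j0 ` {..<Suc (N - Suc j0)}"
  proof
   show "{..<N} \<subseteq> {..<j0} \<union> (+) j0 ` {..<Suc (N - Suc j0)}"
   proof
    fix j assume j: "j \<in> {..<N}"
    show "j \<in> {..<j0} \<union> (+) j0 ` {..<Suc (N - Suc j0)}"
    proof (cases "j < j0")
     case False
     then have "j = j0 + (j - j0)" "j - j0 \<in> {..<Suc (N - Suc j0)}" using j j0(1) by auto
     then show ?thesis by blast
    qed simp
   qed
  qed (use N in auto)
 qed simp
 also have "\<dots> = (\<Sum>j\<in>(+) j0 ` {..<Suc (N - Suc j0)}. a j * g ^ j)"
  by (rule sum.mono_neutral_right) (auto simp: j0(2))
 also have "\<dots> = g ^ j0 * T"
  unfolding T_def by (subst sum.reindex) (simp_all add: sum_distrib_left power_add mult_ac del: sum.lessThan_Suc)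
 finally have "g ^ j0 * T \<in> P" using s by simp
 moreover have TS: "T \<in> S" unfolding T_def by (intro sum mult power a g(1))
 moreover have "g ^ n \<notin> P" for n
  by (induction n) (use Pf(3) Pf(6)[OF g(1) power[OF g(1)]] g(2) in auto)
 ultimately have "T \<in> P" using Pf(6)[OF power[OF g(1)] TS] by blast
 then have TQ: "T \<in> Q" using Q(2) by blast
 define U where "U = (\<Sum>j<N - Suc j0. a (j0 + Suc j) * g ^ j)"
 have "T = a j0 + g * U"
  unfolding T_def U_def sum.lessThan_Suc_shift by (simp add: sum_distrib_left mult_ac)
 then have "a j0 = T + g * (- U)" by simp
 moreover have "U \<in> S" unfolding U_def by (intro sum mult power a g(1))
 ultimately show ?thesis using Qf(4)[OF TQ Qf(5)[OF g(3) minus]] by simp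
qed

end

section \<open>The graded algebra of a linear system\<close>

lemma power_algebra_mult: "f \<in> power_algebra L ==> g \<in> power_algebra L ==> f * g \<in> power_algebra L"
 for f :: "'a::field poly poly poly"
proof -
 assume fg: "f \<in> power_algebra L" "g \<in> power_algebra L"
 have "coeff (f * g) k \<in> space_power L k" for k
  unfolding coeff_mult
 proof (rule bf.subspace_sum[OF space_power_subspace])
  fix i assume "i \<in> {..k}"
  then show "coeff f i * coeff g (k - i) \<in> space_power L k"
   using space_power_mult[of "coeff f i" L i "coeff g (k - i)" "k - i"] fg by (simp add: power_algebra_def)
 qed
 then show "f * g \<in> power_algebra L" by (simp add: power_algebra_def)
qed

lemma power_algebra_const: "[:[:[:c:]:]:] \<in> power_algebra (L :: 'a::field poly poly set)"
 unfolding power_algebra_def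
proof (intro CollectI allI)
 fix k show "coeff [:[:[:c:]:]:] k \<in> space_power L k"
  by (cases k) (use space_power_0 bf.subspace_0[OF space_power_subspace[of L]] in auto)
qed

lemma power_algebra_add: "f \<in> power_algebra L ==> g \<in> power_algebra L ==> f + g \<in> power_algebra L"
 for f :: "'a::field poly poly poly"
 by (simp add: power_algebra_def bf.subspace_add[OF space_power_subspace])

lemma power_algebra_monom: "g \<in> space_power L k ==> monom g k \<in> power_algebra L"
 for g :: "'a::field poly poly"
 using bf.subspace_0[OF space_power_subspace[of L]] by (simp add: power_algebra_def)

lemma closed_subring_power_algebra: "closed_subring (power_algebra (L :: 'a::field poly poly set))"
proof
 show "1 \<in> power_algebra L" using power_algebra_const[of 1 L] by (simp add: one_pCons)
 show "- f \<in> power_algebra L" if "f \<in> power_algebra L" for f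
  using that by (simp add: power_algebra_def bf.subspace_neg[OF space_power_subspace])
qed (simp_all add: power_algebra_add power_algebra_mult)

lemma power_algebra_fg:
 fixes L :: "'a::field poly poly set"
 assumes L: "bf.subspace L" and Ld: "L \<subseteq> binary_forms d"
 shows "fg_graded_domain (power_algebra L)"
 unfolding fg_graded_domain_def
proof (intro conjI ballI allI)
 show "subalgebra (power_algebra L)"
  unfolding subalgebra_def by (simp add: power_algebra_const power_algebra_add power_algebra_mult)
 show "graded_part k f \<in> power_algebra L" if "f \<in> power_algebra L" for f k
  using that unfolding graded_part_def by (intro power_algebra_monom) (simp add: power_algebra_def)
 obtain B where B: "B \<subseteq> L" "bf.independent B" "L \<subseteq> bf.span B" by (rule bf.basis_exists)
 define E where "E = (\<lambda>j. xvar ^ (d - j) * yvar ^ j :: 'a poly poly) ` {..d}"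
 have "B \<subseteq> bf.span E"
 proof
  fix f assume "f \<in> B"
  then have "f \<in> binary_forms d" using B(1) Ld by blast
  from form_expansion[OF this] show "f \<in> bf.span E"
   by (metis (no_types, lifting) E_def bf.span_base bf.span_scale bf.span_sum image_eqI)
 qed
 then have finB: "finite B" using bf.independent_span_bound[of E B] B(2) by (simp add: E_def)
 define G where "G = (\<lambda>b. monom b 1) ` B"
 have "power_algebra L \<subseteq> T" if T: "subalgebra T" "G \<subseteq> T" for T
 proof
  have Tc: "[:[:[:c:]:]:] \<in> T" and Ta: "f \<in> T ==> g \<in> T ==> f + g \<in> T" and Tm: "f \<in> T ==> g \<in> T ==> f * g \<in> T" for c f g
   using T(1) by (auto simp: subalgebra_def)
  have T0: "0 \<in> T" using Tc[of 0] by simp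
  have scale: "monom (bscale c x) k = [:[:[:c:]:]:] * monom x k" for c and x :: "'a poly poly" and k
   by (simp add: bscale_def smult_monom)
  have lin: "monom l 1 \<in> T" if "l \<in> L" for l
  proof -
   have "l \<in> bf.span B" using that B(3) by blast
   then show ?thesis
   proof (induction rule: bf.span_induct_alt)
    case (step c x y)
    have "monom x 1 \<in> T" using step(1) T(2) by (auto simp: G_def)
    then show ?case unfolding add_monom[symmetric] scale using step(2) Tc by (intro Ta Tm)
   qed (simp add: T0)
  qed
  have prd: "monom (prod_list ls) (length ls) \<in> T" if "set ls \<subseteq> L" for ls
   using that
  proof (induction ls)
   case Nil
   show ?case using Tc[of 1] by (simp add: one_pCons monom_0)
  next
   case (Cons l ls)
   have "monom (prod_list (l # ls)) (length (l # ls)) = monom l 1 * monom (prod_list ls) (length ls)"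
    by (simp add: mult_monom)
   then show ?case using Cons lin by (auto intro: Tm)
  qed
  have sp: "monom g k \<in> T" if "g \<in> space_power L k" for g k
   using that unfolding space_power_def
  proof (induction rule: bf.span_induct_alt)
   case (step c x y)
   then have "monom x k \<in> T" using prd by blast
   then show ?case unfolding add_monom[symmetric] scale using step(2) Tc by (intro Ta Tm)
  qed (simp add: T0)
  fix f assume f: "f \<in> power_algebra L"
  have "(\<Sum>i\<le>n. monom (coeff f i) i) \<in> T" for n
   using f sp by (induction n) (auto simp: power_algebra_def intro: Ta)
  then show "f \<in> T" using poly_as_sum_of_monoms[of f] by metis
 qed
 moreover have "finite G" using finB by (simp add: G_def)
 moreover have "G \<subseteq> power_algebra L" unfolding G_def
  using B(1) space_power_base power_algebra_monom by blast
 ultimately show "\<exists>G. finite G \<and> G \<subseteq> power_algebra L \<and> (\<forall>T. subalgebra T \<and> G \<subseteq> T --> power_algebra L \<subseteq> T)" by blast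
qed

section \<open>The Krull dimension and the rank of the value group\<close>

context form_system
begin

abbreviation "C c \<equiv> [:[:[:c:]:]:]"

text \<open>A count of monomials: there are \<open>N ^ 3\<close> products \<open>f ^ i * g ^ j * h ^
 k\<close>, but they lie in a space whose dimension is quadratic in \<open>N\<close>.\<close>

lemma power_algebra_dependent:
 assumes fgh: "f \<in> power_algebra L" "g \<in> power_algebra L" "h \<in> power_algebra L"
 shows "\<exists>N c. (\<exists>i<N. \<exists>j<N. \<exists>k<N. c i j k ~= 0) \<and>
  (\<Sum>i<N. (\<Sum>j<N. (\<Sum>k<N. C (c i j k) * h ^ k) * g ^ j) * f ^ i) = 0"
proof -
 interpret closed_subring "power_algebra L" by (rule closed_subring_power_algebra)
 define D where "D = max (degree f) (max (degree g) (degree h))"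
 define N where "N = (3 * D + 1) * (3 * D * d + 1) + 1"
 define I where "I = {..<N} \<times> {..<N} \<times> {..<N}"
 define J where "J = {..3 * N * D} \<times> {..d * (3 * N * D)}"
 define v where "v = (\<lambda>(i, j, k). f ^ i * g ^ j * h ^ k)"
 have "card J = (3 * N * D + 1) * (d * (3 * N * D) + 1)" by (simp add: J_def)
 also have "\<dots> \<le> (N * (3 * D + 1)) * (N * (3 * D * d + 1))"
  by (intro mult_le_mono) (simp_all add: N_def algebra_simps)
 also have "\<dots> = N * N * ((3 * D + 1) * (3 * D * d + 1))" by (simp only: mult_ac)
 also have "\<dots> < N * N * N" by (intro mult_strict_left_mono) (simp_all add: N_def)
 also have "\<dots> = card I" by (simp add: I_def)
 finally have cJ: "card J < card I" .
 have "\<exists>c. (\<exists>x\<in>I. c x ~= 0) \<and> (\<forall>y\<in>J. (\<Sum>x\<in>I. c x * (case y of (m, b) => bcoeff (coeff (v x) m) (d * m - b) b)) = 0)"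
  by (rule underdetermined_system) (use cJ in \<open>auto simp: I_def J_def\<close>)
 then obtain c where c: "\<exists>x\<in>I. c x ~= 0"
  "\<And>m b. (m, b) \<in> J ==> (\<Sum>x\<in>I. c x * bcoeff (coeff (v x) m) (d * m - b) b) = 0" by force
 have vR: "v x \<in> power_algebra L" for x unfolding v_def by (cases x) (auto intro!: mult power fgh)
 have vdeg: "degree (v x) \<le> 3 * N * D" if xI: "x \<in> I" for x
 proof -
  obtain i j k where x: "x = (i, j, k)" "i < N" "j < N" "k < N" using xI by (auto simp: I_def)
  have pw: "degree (p ^ n) \<le> N * D" if "degree p \<le> D" "n < N" for p :: "'a poly poly poly" and n
  proof -
   have "degree (p ^ n) \<le> degree p * n" by (rule degree_power_le)
   also have "\<dots> \<le> D * N" using that by (intro mult_le_mono) auto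
   finally show ?thesis by (simp add: mult.commute)
  qed
  have "degree (v x) \<le> degree (f ^ i) + degree (g ^ j) + degree (h ^ k)"
   unfolding v_def x(1) using degree_mult_le[of "f ^ i * g ^ j" "h ^ k"] degree_mult_le[of "f ^ i" "g ^ j"] by simp
  also have "\<dots> \<le> N * D + N * D + N * D" by (intro add_mono pw) (use x in \<open>auto simp: D_def\<close>)
  finally show ?thesis by simp
 qed
 have cC: "coeff (C a * p) m = bscale a (coeff p m)" for a :: 'a and p m by (simp add: bscale_def)
 have "(\<Sum>x\<in>I. C (c x) * v x) = 0"
 proof (rule poly_eqI, rule bcoeff_eqI)
  fix m i b
  have e: "bcoeff (coeff (\<Sum>x\<in>I. C (c x) * v x) m) i b = (\<Sum>x\<in>I. c x * bcoeff (coeff (v x) m) i b)"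
   unfolding coeff_sum cC bcoeff_sum bcoeff_hom ..
  show "bcoeff (coeff (\<Sum>x\<in>I. C (c x) * v x) m) i b = bcoeff (coeff 0 m) i b"
  proof (cases "m \<le> 3 * N * D \<and> i + b = d * m")
   case True
   then have "d * m \<le> d * (3 * N * D)" by (intro mult_le_mono2) simp
   then have "b \<le> d * (3 * N * D)" "i = d * m - b" using True by linarith+
   then have "(m, b) \<in> J" "i = d * m - b" using True unfolding J_def by (auto simp only: mem_Sigma_iff atMost_iff)
   then show ?thesis unfolding e using c(2) by (simp add: bcoeff_hom)
  next
   case False
   have "bcoeff (coeff (v x) m) i b = 0" if x: "x \<in> I" for x
   proof (cases "m \<le> 3 * N * D")
    case True
    have "coeff (v x) m \<in> binary_forms (d * m)"
     using vR[of x] space_power_forms[OF Ld, of m] by (auto simp: power_algebra_def)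
    then show ?thesis using False True by (auto simp: binary_forms_def)
   next
    case False
    then have "coeff (v x) m = 0" using vdeg[OF x] by (intro coeff_eq_0) simp
    then show ?thesis by (simp add: bcoeff_hom)
   qed
   then show ?thesis unfolding e by (simp add: bcoeff_hom)
  qed
 qed
 moreover have "(\<Sum>x\<in>I. C (c x) * v x) = (\<Sum>i<N. \<Sum>j<N. \<Sum>k<N. C (c (i, j, k)) * v (i, j, k))"
  unfolding I_def sum.cartesian_product[symmetric] by (simp add: sum.cartesian_product split_def)
 moreover have "\<dots> = (\<Sum>i<N. (\<Sum>j<N. (\<Sum>k<N. C (c (i, j, k)) * h ^ k) * g ^ j) * f ^ i)"
  unfolding sum_distrib_right by (intro sum.cong refl) (simp only: v_def prod.case mult_ac)
 ultimately have "(\<Sum>i<N. (\<Sum>j<N. (\<Sum>k<N. C (c (i, j, k)) * h ^ k) * g ^ j) * f ^ i) = 0" by simp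
 moreover have "\<exists>i<N. \<exists>j<N. \<exists>k<N. c (i, j, k) ~= 0" using c(1) by (auto simp: I_def)
 ultimately show ?thesis by (intro exI[of _ N] exI[of _ "\<lambda>i j k. c (i, j, k)"]) blast
qed

text \<open>Elements \<open>f\<close>, \<open>g\<close>, \<open>h\<close> that enter at the successive steps
 of the chain are algebraically dependent. The lexicographically lowest coefficient of a relation is a nonzero
 constant and ends up in the top prime ideal.\<close>

lemma no_long_prime_chain:
 assumes P: "\<And>i. i \<le> 3 ==> primeideal (P i) (ring_of_type_algebra\<lparr>carrier := power_algebra L\<rparr>)"
  and chain: "\<And>i. i < 3 ==> P i \<subset> P (Suc i)"
 shows False
proof -
 interpret closed_subring "power_algebra L" by (rule closed_subring_power_algebra)
 have p: "primeideal (P 0) as_ring" "primeideal (P 1) as_ring" "primeideal (P 2) as_ring" "primeideal (P 3) as_ring"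
  using P by simp_all
 have sub: "P 0 \<subset> P 1" "P 1 \<subset> P 2" "P 2 \<subset> P 3"
  using chain[of 0] chain[of 1] chain[of 2] by (simp_all add: numeral_2_eq_2 numeral_3_eq_3)
 obtain f g h where f: "f \<in> P 1" "f \<notin> P 0" and g: "g \<in> P 2" "g \<notin> P 1" and h: "h \<in> P 3" "h \<notin> P 2"
  using sub by blast
 have R: "f \<in> power_algebra L" "g \<in> power_algebra L" "h \<in> power_algebra L"
  using f(1) g(1) h(1) primeideal_facts(1)[OF p(2)] primeideal_facts(1)[OF p(3)] primeideal_facts(1)[OF p(4)] by blast+
 obtain N c where c: "\<exists>i<N. \<exists>j<N. \<exists>k<N. c i j k ~= 0"
  "(\<Sum>i<N. (\<Sum>j<N. (\<Sum>k<N. C (c i j k) * h ^ k) * g ^ j) * f ^ i) = 0"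
  using power_algebra_dependent[OF R] by blast
 have CR: "C a \<in> power_algebra L" for a by (rule power_algebra_const)
 define i0 where "i0 = (LEAST i. i < N \<and> (\<exists>j<N. \<exists>k<N. c i j k ~= 0))"
 have i0: "i0 < N" "\<exists>j<N. \<exists>k<N. c i0 j k ~= 0"
  using LeastI_ex[of "\<lambda>i. i < N \<and> (\<exists>j<N. \<exists>k<N. c i j k ~= 0)"] c(1) unfolding i0_def by blast+
 have i0z: "c i j k = 0" if "i < i0" "j < N" "k < N" for i j k
  using not_less_Least[of i "\<lambda>i. i < N \<and> (\<exists>j<N. \<exists>k<N. c i j k ~= 0)"] that i0(1) unfolding i0_def[symmetric] by force
 have "(\<Sum>j<N. (\<Sum>k<N. C (c i0 j k) * h ^ k) * g ^ j) \<in> P 1"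
 proof (rule lowest_coefficient_in_prime[OF p(1,2) _ R(1) f(2,1) _ _ i0(1),
    where a = "\<lambda>i. \<Sum>j<N. (\<Sum>k<N. C (c i j k) * h ^ k) * g ^ j"])
  show "(\<Sum>i<N. (\<Sum>j<N. (\<Sum>k<N. C (c i j k) * h ^ k) * g ^ j) * f ^ i) \<in> P 0"
   unfolding c(2) by (rule primeideal_facts(2)[OF p(1)])
  show "(\<Sum>j<N. (\<Sum>k<N. C (c i j k) * h ^ k) * g ^ j) \<in> power_algebra L" for i
   by (intro sum mult power R CR)
  show "(\<Sum>j<N. (\<Sum>k<N. C (c i j k) * h ^ k) * g ^ j) = 0" if "i < i0" for i
   by (intro sum.neutral ballI) (simp add: i0z[OF that])
 qed (use sub in blast)
 moreover define j0 where "j0 = (LEAST j. j < N \<and> (\<exists>k<N. c i0 j k ~= 0))"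
 have j0: "j0 < N" "\<exists>k<N. c i0 j0 k ~= 0"
  using LeastI_ex[of "\<lambda>j. j < N \<and> (\<exists>k<N. c i0 j k ~= 0)"] i0(2) unfolding j0_def by blast+
 have j0z: "c i0 j k = 0" if "j < j0" "k < N" for j k
  using not_less_Least[of j "\<lambda>j. j < N \<and> (\<exists>k<N. c i0 j k ~= 0)"] that j0(1) unfolding j0_def[symmetric] by force
 ultimately have "(\<Sum>k<N. C (c i0 j0 k) * h ^ k) \<in> P 2"
 proof (intro lowest_coefficient_in_prime[OF p(2,3) _ R(2) g(2,1) _ _ j0(1),
    where a = "\<lambda>j. \<Sum>k<N. C (c i0 j k) * h ^ k"])
  show "(\<Sum>k<N. C (c i0 j k) * h ^ k) \<in> power_algebra L" for j
   by (intro sum mult power R CR)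
  show "(\<Sum>k<N. C (c i0 j k) * h ^ k) = 0" if "j < j0" for j
   by (intro sum.neutral ballI) (simp add: j0z[OF that])
 qed (use sub in blast)+
 moreover define k0 where "k0 = (LEAST k. k < N \<and> c i0 j0 k ~= 0)"
 have k0: "k0 < N" "c i0 j0 k0 ~= 0"
  using LeastI_ex[of "\<lambda>k. k < N \<and> c i0 j0 k ~= 0"] j0(2) unfolding k0_def by blast+
 have k0z: "c i0 j0 k = 0" if "k < k0" for k
  using not_less_Least[of k "\<lambda>k. k < N \<and> c i0 j0 k ~= 0"] that k0(1) unfolding k0_def[symmetric] by force
 ultimately have "C (c i0 j0 k0) \<in> P 3"
  using sub k0z by (intro lowest_coefficient_in_prime[OF p(3,4) _ R(3) h(2,1) _ _ k0(1),
    where a = "\<lambda>k. C (c i0 j0 k)"] CR) auto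
 then have "C (c i0 j0 k0) * C (inverse (c i0 j0 k0)) \<in> P 3" using primeideal_facts(5)[OF p(4) _ CR] by blast
 then have "1 \<in> P 3" using k0(2) by (simp add: one_pCons)
 then show False using primeideal_facts(3)[OF p(4)] by blast
qed

end

context pointed_system
begin

text \<open>The zero ideal, the functions that vanish on the line over a point of the curve, and the
 irrelevant ideal.\<close>

lemma prime_chain:
 "\<exists>P. (\<forall>i\<le>2. primeideal (P i) (ring_of_type_algebra\<lparr>carrier := R\<rparr>)) \<and> (\<forall>i<2::nat. P i \<subset> P (Suc i))"
proof -
 interpret closed_subring R by (rule closed_subring_power_algebra)
 define ev :: "'a poly poly poly => 'a poly" where "ev = map_poly (\<lambda>g. beval g z0 (1 + r * z0))"
 have bh: "beval (f + g) x y = beval f x y + beval g x y" "beval (f * g) x y = beval f x y * beval g x y"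
  "beval 0 x y = 0" "beval 1 x y = 1" for f g and x y :: 'a
  by (simp_all add: beval_def)
 have bs: "beval (\<Sum>i\<in>A. f i) x y = (\<Sum>i\<in>A. beval (f i) x y)" for f A and x y :: 'a
  by (induction A rule: infinite_finite_induct) (simp_all add: bh)
 have evc: "coeff (ev f) k = beval (coeff f k) z0 (1 + r * z0)" for f k by (simp add: ev_def coeff_map_poly bh)
 have ev: "ev (x + y) = ev x + ev y" "ev (x * y) = ev x * ev y" "ev 1 = 1" for x y
  by (rule poly_eqI; simp add: evc bh coeff_mult bs)+
 define P where "P = (\<lambda>i::nat. if i = 0 then {x \<in> R. x = 0} else if i = 1 then {x \<in> R. ev x = 0} else {x \<in> R. coeff x 0 = 0})"
 have "primeideal {x \<in> R. id x = 0} as_ring" "primeideal {x \<in> R. ev x = 0} as_ring" "primeideal {x \<in> R. coeff x 0 = 0} as_ring"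
  by (rule primeideal_kernel; simp add: ev coeff_mult)+
 then have pr: "primeideal (P i) as_ring" if "i \<le> 2" for i using that by (auto simp: P_def)
 obtain x where x: "x > 0" "(1, x) \<in> S" using S_positive by blast
 obtain f where f: "f \<in> space_power L 1" "f ~= 0" "x = pord f" using S_D[OF x(2)] by blast
 have "order z0 (dehom r f) ~= 0" using pord_eq[OF sp_form[OF f(1)] f(2)] f(3) x(1) by simp
 then have fz: "beval f z0 (1 + r * z0) = 0" by (simp add: order_root dehom_eval[symmetric] split: if_splits)
 obtain g where g: "g \<in> L" "beval g z0 (1 + r * z0) ~= 0" using bpf[of z0 "1 + r * z0"] by auto
 have mR: "monom f 1 \<in> R" "monom g 1 \<in> R"
  using power_algebra_monom f(1) space_power_base[OF g(1)] by blast+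
 have evm: "ev (monom e 1) = monom (beval e z0 (1 + r * z0)) 1" for e
  by (rule poly_eqI) (simp add: evc bh)
 have "monom f 1 \<in> P 1 - P 0" using mR(1) f(2) by (simp add: P_def evm[unfolded One_nat_def] fz)
 moreover have "P 0 \<subseteq> P 1" using ev(1)[of 0 0] by (auto simp: P_def)
 moreover have "monom g 1 \<in> P 2 - P 1" using mR(2) g(2) by (simp add: P_def evm[unfolded One_nat_def])
 moreover have "P 1 \<subseteq> P 2"
 proof
  fix e assume "e \<in> P 1"
  then have e: "e \<in> R" "ev e = 0" by (auto simp: P_def)
  obtain c where c: "coeff e 0 = [:[:c:]:]" using R_coeff[OF e(1), of 0] space_power_0 by blast
  have "beval (coeff e 0) z0 (1 + r * z0) = 0" using evc[of e 0] e(2) by simp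
  then show "e \<in> P 2" using e(1) c by (simp add: P_def beval_def)
 qed
 ultimately have "P 0 \<subset> P 1" "P 1 \<subset> P 2" by blast+
 then have "P i \<subset> P (Suc i)" if "i < 2" for i
  using less_2_cases[OF that] by (auto simp only: numeral_2_eq_2 One_nat_def)
 then have "\<forall>i<2. P i \<subset> P (Suc i)" by blast
 then show ?thesis using pr by blast
qed

lemma krull_dim_R: "krull_dim (ring_of_type_algebra\<lparr>carrier := R\<rparr>) = 2"
proof -
 let ?M = "{enat m | m. \<exists>P. (\<forall>i\<le>m. primeideal (P i) (ring_of_type_algebra\<lparr>carrier := R\<rparr>)) \<and> (\<forall>i<m. P i \<subset> P (Suc i))}"
 have "enat 2 \<in> ?M" using prime_chain by blast
 then have "enat 2 \<le> Sup ?M" by (rule Sup_upper)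
 moreover have "Sup ?M \<le> enat 2"
 proof (rule Sup_least)
  fix e assume "e \<in> ?M"
  then obtain m P where m: "e = enat m" "\<And>i. i \<le> m ==> primeideal (P i) (ring_of_type_algebra\<lparr>carrier := R\<rparr>)"
   "\<And>i. i < m ==> P i \<subset> P (Suc i)" by blast
  have "\<not> 3 \<le> m"
  proof
   assume "3 \<le> m"
   then show False by (intro no_long_prime_chain[of P] m(2,3)) auto
  qed
  then show "e \<le> enat 2" using m(1) by simp
 qed
 ultimately show ?thesis by (simp add: krull_dim_def numeral_eq_enat)
qed

lemma zrank_values: "zrank (zm.span (value_set R val)) = 2"
proof -
 let ?G = "zm.span (value_set R val)"
 have upper: "card B \<le> 2" if B: "finite B" "zm.independent B" for B
 proof (rule ccontr)
  assume "\<not> card B \<le> 2"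
  then have "3 \<le> card B" by simp
  then obtain B' where "B' \<subseteq> B" "card B' = 3" by (meson obtain_subset_with_card_n)
  then obtain x y z where xyz: "x \<in> B" "y \<in> B" "z \<in> B" "x ~= y" "x ~= z" "y ~= z"
   unfolding card_3_iff by auto
  have nd: "\<forall>v\<in>t. u v = 0" if "finite t" "t \<subseteq> B" "(\<Sum>v\<in>t. zscale (u v) v) = 0" for t u
   using B(2) that unfolding zm.dependent_explicit by blast
  have rel: "a = 0 \<and> b = 0 \<and> c = 0" if "zscale a x + zscale b y + zscale c z = 0" for a b c
  proof -
   define u where "u = (\<lambda>v. if v = x then a else if v = y then b else c)"
   have "(\<Sum>v\<in>{x, y, z}. zscale (u v) v) = 0" using xyz that by (simp add: u_def add.assoc)
   then have "\<forall>v\<in>{x, y, z}. u v = 0" using xyz(1-3) by (intro nd) auto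
   then show ?thesis using xyz by (auto simp: u_def)
  qed
  define D where "D = (\<lambda>v w :: int \<times> int. fst v * snd w - snd v * fst w)"
  have "zscale (D y z) x + zscale (- D x z) y + zscale (D x y) z = 0"
   by (simp add: zscale_def D_def zero_prod_def algebra_simps)
  then have "D x y = 0" using rel by blast
  then have "zscale (fst y) x + zscale (- fst x) y + zscale 0 z = 0" "zscale (snd y) x + zscale (- snd x) y + zscale 0 z = 0"
   by (simp_all add: zscale_def D_def zero_prod_def algebra_simps)
  then have "fst x = 0" "snd x = 0" using rel by fastforce+
  then have "zscale 1 x + zscale 0 y + zscale 0 z = 0" by (simp add: zscale_def zero_prod_def)
  then show False using rel by fastforce
 qed
 obtain x where x: "x > 0" "(1, x) \<in> S" using S_positive by blast
 define B where "B = {(1 :: int, 0 :: int), (1, int x)}"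
 have "B \<subseteq> value_set R val" unfolding value_set_S B_def using x(2) S_base by force
 then have BG: "B \<subseteq> ?G" using zm.span_superset by blast
 have "zm.independent B"
  unfolding zm.dependent_explicit
 proof
  assume "\<exists>t u. finite t \<and> t \<subseteq> B \<and> (\<Sum>v\<in>t. zscale (u v) v) = 0 \<and> (\<exists>v\<in>t. u v ~= 0)"
  then obtain t u where t: "t \<subseteq> B" "(\<Sum>v\<in>t. zscale (u v) v) = 0" "\<exists>v\<in>t. u v ~= 0" by blast
  define w where "w = (\<lambda>v. if v \<in> t then u v else 0)"
  have "(\<Sum>v\<in>B. zscale (w v) v) = (\<Sum>v\<in>t. zscale (w v) v)"
   using t(1) by (intro sum.mono_neutral_right) (auto simp: B_def w_def zscale_def zero_prod_def)
  also have "\<dots> = 0" using t(2) by (simp add: w_def)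
  finally have "zscale (w (1, 0)) (1, 0) + zscale (w (1, int x)) (1, int x) = 0" using x(1) by (simp add: B_def)
  then have "w (1, int x) = 0" "w (1, 0) = 0" using x(1) by (auto simp: zscale_def zero_prod_def)
  then show False using t(1,3) by (auto simp: w_def B_def split: if_splits)
 qed
 moreover have "finite B" "card B = 2" using x(1) by (simp_all add: B_def)
 ultimately have "enat 2 \<in> {enat (card B) | B. finite B \<and> B \<subseteq> ?G \<and> zm.independent B}"
  using BG by (metis (mono_tags, lifting) mem_Collect_eq)
 then have "enat 2 \<le> zrank ?G" unfolding zrank_def by (rule Sup_upper)
 moreover have "zrank ?G \<le> enat 2" unfolding zrank_def by (rule Sup_least) (use upper in auto)
 ultimately show ?thesis by (simp add: numeral_eq_enat)
qed

text \<open>Algebra, valuation and rank conditions always hold, so only finite generation of the value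
 semigroup is at stake.\<close>

theorem khovanskii_finite_iff:
 "khovanskii_finite R val \<longleftrightarrow> (\<exists>k\<ge>1. pf ^ (d * k) \<in> space_power L k)"
proof -
 have "full_rank R val" unfolding full_rank_def by (simp add: krull_dim_R zrank_values)
 then have "khovanskii_finite R val \<longleftrightarrow> fg_semigroup (value_set R val)"
  using power_algebra_fg[OF L Ld] valuation_on_R homogeneous_R by (simp add: khovanskii_finite_def)
 then show ?thesis using fg_imp_top top_imp_fg by blast
qed

end

section \<open>The bounded criterion\<close>

theorem theorem3p10:
 fixes I :: "'a::{alg_closed_field, field_char_0} mpoly set"
  and f :: "nat \<Rightarrow> 'a poly poly"
  and L :: "'a poly poly set"
  and F :: "'a set"
  and \<alpha> \<beta> :: 'a
  and n d l :: nat
 assumes "projective_curve n I"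
  and "nondegenerate n I"
  and "has_degree n I d"
  and "has_arithmetic_genus n I 2"
  and "normalization n I f"
  and "L = pullback_linear_forms n f"
  and "L \<subseteq> binary_forms d"
  and "(\<alpha>, \<beta>) \<noteq> (0, 0)"
  and "number_field_of_degree F l"
  and "defined_over F L"
 shows "khovanskii_finite (power_algebra L) (point_valuation \<alpha> \<beta>) \<longleftrightarrow>
  (\<exists>k::nat. 1 \<le> k \<and>
    int k \<le> max (2 * (int d - int n - 1)) (((96 * int d ^ 3 * int l)\<^sup>2 + 2)\<^sup>2) \<and>
    point_form \<alpha> \<beta> ^ (d * k) \<in> space_power L k)"
proof -
 interpret genus_two_system L d by (rule curve_genus_two_system[OF assms(3-7)])
 have F: "qalg F l" by (rule number_field_qalg[OF assms(9)])
 obtain B where B: "\<And>b i j. b \<in> B \<Longrightarrow> bcoeff b i j \<in> F" "L = bf.span B"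
  using assms(10) unfolding defined_over_def by blast
 define r where "r = (if \<beta> = 0 then 1 else 0 :: 'a)"
 have "\<beta> - \<alpha> * r \<noteq> 0" using assms(8) by (auto simp: r_def)
 then interpret pointed_system L d \<alpha> \<beta> r by unfold_locales
 have b: "int k \<le> ((96 * int d ^ 3 * int l)\<^sup>2 + 2)\<^sup>2" if "k \<le> 256 * (24 * l * d * d) ^ 4" for k
 proof -
  have "int k \<le> int (256 * (24 * l * d * d) ^ 4)" using that by (simp only: of_nat_le_iff)
  also have "\<dots> = (96 ^ 4 * int l ^ 4) * int d ^ 8" by (simp add: power_mult_distrib power_add[symmetric] mult.assoc)
  also have "\<dots> \<le> (96 ^ 4 * int l ^ 4) * int d ^ 12" using d0 by (intro mult_left_mono power_increasing) auto
  also have "\<dots> = ((96 * int d ^ 3 * int l)\<^sup>2)\<^sup>2" by (simp add: power_mult_distrib power_mult[symmetric])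
  also have "\<dots> \<le> ((96 * int d ^ 3 * int l)\<^sup>2 + 2)\<^sup>2" by (intro power_mono) simp_all
  finally show ?thesis .
 qed
 show ?thesis
 proof
  assume "khovanskii_finite (power_algebra L) (point_valuation \<alpha> \<beta>)"
  then obtain k0 where "k0 \<ge> 1" "point_form \<alpha> \<beta> ^ (d * k0) \<in> space_power L k0"
   using khovanskii_finite_iff by blast
  then obtain k where "k \<ge> 1" "k \<le> 256 * (24 * l * d * d) ^ 4" "point_form \<alpha> \<beta> ^ (d * k) \<in> space_power L k"
   using bounded_power_form[OF F B assms(8)] by blast
  then show "\<exists>k::nat. 1 \<le> k \<and>
    int k \<le> max (2 * (int d - int n - 1)) (((96 * int d ^ 3 * int l)\<^sup>2 + 2)\<^sup>2) \<and>
    point_form \<alpha> \<beta> ^ (d * k) \<in> space_power L k"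
   using max.coboundedI2[OF b] by blast
 next
  assume "\<exists>k::nat. 1 \<le> k \<and>
    int k \<le> max (2 * (int d - int n - 1)) (((96 * int d ^ 3 * int l)\<^sup>2 + 2)\<^sup>2) \<and>
    point_form \<alpha> \<beta> ^ (d * k) \<in> space_power L k"
  then show "khovanskii_finite (power_algebra L) (point_valuation \<alpha> \<beta>)"
   using khovanskii_finite_iff by blast
 qed
qed

end
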